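(* Consider the degraded Gaussian diamond-wiretap channel with parameters $P_1,P_2>0$, $C_1,C_2\ge 0$, $g\in[0,1)$, in the first scenario (a common fictitious message of rate $R'$ is available at the source and at both relays), and let $C_S^{(1)}$ be its secrecy capacity. Then for every $\rho\in[-1,1]$ and every $R'\ge f_5(\rho)$, $$C_S^{(1)}\ge \max\bigl(R_{\mathrm{DF}}^{(1)}(\rho),\ R_{\mathrm{PDF-M}}^{(1)}(\rho)\bigr),$$ where \begin{align*} R_{\mathrm{DF}}^{(1)}(\rho)&=\min\bigl(C_1,C_2,f_4(\rho)-f_5(\rho)\bigr),\\ R_{\mathrm{PDF-M}}^{(1)}(\rho)&=\min\bigl(f_1(\rho),f_2(\rho),f_3(\rho),f_4(\rho)-f_5(\rho)\bigr). \end{align*}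
   Context: Channel. A source is connected to relays 1 and 2 by orthogonal noiseless links of capacities $C_1,C_2\ge 0$ (bits per channel use); there is no direct link from the source to the destination or eavesdropper. At each time the relays send real inputs $X_1,X_2$; the legitimate destination receives $Y=X_1+X_2+N_Y$ and the eavesdropper receives $Z=\sqrt{g}\,Y+N_Z$, where $g\in[0,1)$, $N_Y\sim\mathcal N(0,1)$ and $N_Z\sim\mathcal N(0,1-g)$ are independent of each other, of the inputs, and i.i.d. over time. The power constraint at relay $k=1,2$ over $n$ channel uses is $\frac1n\sum_{i=1}^n X_{k,i}^2\le P_k$. Notation: $[i:j]=\{i,i+1,\dots,j\}$; quantities such as $2^{nR}$ are rounded to integers. First scenario. A fictitious message $M\sim\mathrm{Unif}[1:2^{nR'}]$ is available at the source and at both relays (not at the destination or eavesdropper). A $(2^{nR},n)$ secrecy code consists of a message $W\sim\mathrm{Unif}[1:2^{nR}]$ independent of $M$; a (deterministic) encoding function at the source mapping $(W,M)$ to $(J_1,J_2)\in[1:2^{nC_1}]\times[1:2^{nC_2}]$; for $k=1,2$ a (deterministic) encoding function at relay $k$ mapping $(J_k,M)$ to $X_k^n$ satisfying the power constraint; and a decoding function mapping $Y^n$ to $\hat W\in[1:2^{nR}]$. A secrecy rate $R$ is achievable if there is a sequence of $(2^{nR},n)$ codes with $\lim_{n\to\infty}P(\hat W\ne W)=0$ and $\lim_{n\to\infty}\frac1n I(W;Z^n)=0$. $C_S^{(1)}$ is the supremum of all achievable secrecy rates. Functions (logarithms to base 2): $f_1(\rho)=C_1+\frac12\log(1+(1-\rho^2)P_2)$,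 $f_2(\rho)=C_2+\frac12\log(1+(1-\rho^2)P_1)$, $f_3(\rho)=C_1+C_2-\frac12\log\frac{1}{1-\rho^2}$ (equal to $-\infty$ when $|\rho|=1$), $f_4(\rho)=\frac12\log(1+P_1+P_2+2\rho\sqrt{P_1P_2})$, $f_5(\rho)=\frac12\log(1+g(P_1+P_2+2\rho\sqrt{P_1P_2}))$. *)

theory Defs
  imports "HOL-Probability.Probability"
begin

text \<open>All rates are in bits: logarithms and mutual information are to base 2.
  Cardinalities \<open>2^(nR)\<close> are rounded down, so a link of capacity \<open>C\<close> never carries more
  than \<open>nC\<close> bits in \<open>n\<close> channel uses.\<close>

definition index_set :: "nat \<Rightarrow> real \<Rightarrow> nat set" where
  "index_set n R = {1..nat \<lfloor>2 powr (real n * R)\<rfloor>}"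

text \<open>Sequences of length \<open>n\<close> are functions on \<open>{..<n}\<close>, as in the product measure \<^const>\<open>PiM\<close>.\<close>

abbreviation seq_space :: "nat \<Rightarrow> (nat \<Rightarrow> real) measure" where
  "seq_space n \<equiv> Pi\<^sub>M {..<n} (\<lambda>_. borel)"

text \<open>Here \<open>v\<close> is the variance of each component; \<^const>\<open>normal_density\<close> expects the
  standard deviation.\<close>

definition gaussian_noise :: "nat \<Rightarrow> real \<Rightarrow> (nat \<Rightarrow> real) measure" where
  "gaussian_noise n v = Pi\<^sub>M {..<n} (\<lambda>_. density lborel (\<lambda>x. ennreal (normal_density 0 (sqrt v) x)))"

text \<open>The fictitious message is an argument of the source encoder and of both relay encoders,
  but not of the decoder. The relay encoders map \<open>(J\<^sub>k, M)\<close> to a length-\<open>n\<close> input sequence.\<close>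

record secrecy_code =
  source_enc :: "nat \<Rightarrow> nat \<Rightarrow> nat \<times> nat"
  relay_enc1 :: "nat \<Rightarrow> nat \<Rightarrow> nat \<Rightarrow> real"
  relay_enc2 :: "nat \<Rightarrow> nat \<Rightarrow> nat \<Rightarrow> real"
  decoder :: "(nat \<Rightarrow> real) \<Rightarrow> nat"

definition power_constraint :: "nat \<Rightarrow> real \<Rightarrow> (nat \<Rightarrow> real) \<Rightarrow> bool" where
  "power_constraint n P x \<longleftrightarrow> (1 / real n) * (\<Sum>i<n. (x i)\<^sup>2) \<le> P"

definition is_secrecy_code ::
  "real \<Rightarrow> real \<Rightarrow> real \<Rightarrow> real \<Rightarrow> real \<Rightarrow> real \<Rightarrow> nat \<Rightarrow> secrecy_code \<Rightarrow> bool" where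
  "is_secrecy_code P1 P2 C1 C2 R' R n c \<longleftrightarrow>
     (\<forall>w\<in>index_set n R. \<forall>m\<in>index_set n R'.
        source_enc c w m \<in> index_set n C1 \<times> index_set n C2) \<and>
     (\<forall>j\<in>index_set n C1. \<forall>m\<in>index_set n R'. power_constraint n P1 (relay_enc1 c j m)) \<and>
     (\<forall>j\<in>index_set n C2. \<forall>m\<in>index_set n R'. power_constraint n P2 (relay_enc2 c j m)) \<and>
     decoder c \<in> seq_space n \<rightarrow>\<^sub>M count_space (index_set n R)"

text \<open>Outcomes are tuples \<open>(W, M, N\<^sub>Y, N\<^sub>Z)\<close> with independent components.\<close>

type_synonym outcome = "nat \<times> nat \<times> (nat \<Rightarrow> real) \<times> (nat \<Rightarrow> real)"

definition outcome_space :: "real \<Rightarrow> real \<Rightarrow> real \<Rightarrow> nat \<Rightarrow> outcome measure" where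
  "outcome_space g R' R n =
     uniform_count_measure (index_set n R) \<Otimes>\<^sub>M uniform_count_measure (index_set n R') \<Otimes>\<^sub>M
     gaussian_noise n 1 \<Otimes>\<^sub>M gaussian_noise n (1 - g)"

definition msg :: "outcome \<Rightarrow> nat" where
  "msg = (\<lambda>(w, m, ny, nz). w)"

definition dest_output :: "nat \<Rightarrow> secrecy_code \<Rightarrow> outcome \<Rightarrow> nat \<Rightarrow> real" where
  "dest_output n c = (\<lambda>(w, m, ny, nz). \<lambda>i\<in>{..<n}.
     relay_enc1 c (fst (source_enc c w m)) m i + relay_enc2 c (snd (source_enc c w m)) m i + ny i)"

definition eve_output :: "real \<Rightarrow> nat \<Rightarrow> secrecy_code \<Rightarrow> outcome \<Rightarrow> nat \<Rightarrow> real" where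
  "eve_output g n c = (\<lambda>(w, m, ny, nz). \<lambda>i\<in>{..<n}.
     sqrt g * dest_output n c (w, m, ny, nz) i + nz i)"

definition error_prob :: "real \<Rightarrow> real \<Rightarrow> real \<Rightarrow> nat \<Rightarrow> secrecy_code \<Rightarrow> real" where
  "error_prob g R' R n c =
     \<P>(\<omega> in outcome_space g R' R n. decoder c (dest_output n c \<omega>) \<noteq> msg \<omega>)"

text \<open>The mutual information \<open>I(W; Z\<^sup>n)\<close>.\<close>

definition leakage :: "real \<Rightarrow> real \<Rightarrow> real \<Rightarrow> nat \<Rightarrow> secrecy_code \<Rightarrow> real" where
  "leakage g R' R n c =
     prob_space.mutual_information (outcome_space g R' R n) 2
       (count_space (index_set n R)) (seq_space n) msg (eve_output g n c)"

definition achievable_secrecy_rate ::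
  "real \<Rightarrow> real \<Rightarrow> real \<Rightarrow> real \<Rightarrow> real \<Rightarrow> real \<Rightarrow> real \<Rightarrow> bool" where
  "achievable_secrecy_rate P1 P2 C1 C2 g R' R \<longleftrightarrow>
     R \<ge> 0 \<and>
     (\<exists>c :: nat \<Rightarrow> secrecy_code.
        (\<forall>n\<ge>1. is_secrecy_code P1 P2 C1 C2 R' R n (c n)) \<and>
        (\<lambda>n. error_prob g R' R n (c n)) \<longlonglongrightarrow> 0 \<and>
        (\<lambda>n. (1 / real n) * leakage g R' R n (c n)) \<longlonglongrightarrow> 0)"

definition secrecy_capacity ::
  "real \<Rightarrow> real \<Rightarrow> real \<Rightarrow> real \<Rightarrow> real \<Rightarrow> real \<Rightarrow> ereal" where
  "secrecy_capacity P1 P2 C1 C2 g R' =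
     Sup {ereal R | R. achievable_secrecy_rate P1 P2 C1 C2 g R' R}"

definition f1 :: "real \<Rightarrow> real \<Rightarrow> real \<Rightarrow> real" where
  "f1 P2 C1 \<rho> = C1 + 1/2 * log 2 (1 + (1 - \<rho>\<^sup>2) * P2)"

definition f2 :: "real \<Rightarrow> real \<Rightarrow> real \<Rightarrow> real" where
  "f2 P1 C2 \<rho> = C2 + 1/2 * log 2 (1 + (1 - \<rho>\<^sup>2) * P1)"

definition f3 :: "real \<Rightarrow> real \<Rightarrow> real \<Rightarrow> ereal" where
  "f3 C1 C2 \<rho> = (if \<bar>\<rho>\<bar> = 1 then -\<infinity> else ereal (C1 + C2 - 1/2 * log 2 (1 / (1 - \<rho>\<^sup>2))))"

definition f4 :: "real \<Rightarrow> real \<Rightarrow> real \<Rightarrow> real" where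
  "f4 P1 P2 \<rho> = 1/2 * log 2 (1 + P1 + P2 + 2 * \<rho> * sqrt (P1 * P2))"

definition f5 :: "real \<Rightarrow> real \<Rightarrow> real \<Rightarrow> real \<Rightarrow> real" where
  "f5 P1 P2 g \<rho> = 1/2 * log 2 (1 + g * (P1 + P2 + 2 * \<rho> * sqrt (P1 * P2)))"

definition R_DF :: "real \<Rightarrow> real \<Rightarrow> real \<Rightarrow> real \<Rightarrow> real \<Rightarrow> real \<Rightarrow> real" where
  "R_DF P1 P2 C1 C2 g \<rho> = Min {C1, C2, f4 P1 P2 \<rho> - f5 P1 P2 g \<rho>}"

definition R_PDF_M :: "real \<Rightarrow> real \<Rightarrow> real \<Rightarrow> real \<Rightarrow> real \<Rightarrow> real \<Rightarrow> ereal" where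
  "R_PDF_M P1 P2 C1 C2 g \<rho> =
     Min {ereal (f1 P2 C1 \<rho>), ereal (f2 P1 C2 \<rho>), f3 C1 C2 \<rho>,
          ereal (f4 P1 P2 \<rho> - f5 P1 P2 g \<rho>)}"

end

theory Submission
  imports Defs "HOL-Real_Asymp.Real_Asymp"
begin

text \<open>Relay 1 sends \<open>x1 (l, a)\<close> and relay 2 sends \<open>x2 (l, b, j)\<close>, all of them independent Gaussian
  codewords. The index \<open>l\<close>, of rate \<open>f5\<close>, is read off the fictitious message, \<open>(a, b)\<close> is the message \<open>W\<close>
  split over the two links, and \<open>j\<close> is chosen by Marton coding so that the two codewords look jointly
  Gaussian with covariance \<open>r\<close>; this costs \<open>1/2 * log 2 (1 / (1 - \<rho>\<^sup>2))\<close> bits on link 2.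
  A union bound over the ways in which a wrong pair can share codewords with the sent pair controls the
  error probability. Given \<open>W\<close>, the eavesdropper sees a Gaussian mixture over \<open>l\<close>,
  whose relative entropy to the Gaussian output law is \<open>o(n)\<close> on average by soft covering, because the rate
  of \<open>l\<close> is at least the capacity to the eavesdropper. A single codebook satisfies
  both requirements by Markov's inequality. In decode-and-forward both links carry all of \<open>W\<close>; the relays then
  send the same fresh Gaussian codeword for each \<open>(W, l)\<close>, in the proportion \<open>sqrt P1 : sqrt P2\<close>,
  which suffices for every correlation since only the total power matters. Scaling all powers down
  slightly leaves room for the power constraint.\<close>

section \<open>Gaussian sequences\<close>

text \<open>The Marton index is picked by looking at the codebook, so the selected pair has no
  tractable law. All expectations are therefore bounded for every candidate pair, masked by the
  indicator of \<open>good\<close>, and summed over all indices. This costs a factor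
  \<open>K\<close> of order exp(n * I0) per sum, repaid because on good pairs the product law of two
  codewords is at most about exp(-n * I0) times a joint Gaussian law. The same pointwise comparison,
  read backwards, yields covering. Exponential gains come from these density comparisons only; noise
  is controlled by Chebyshev's inequality at order 1/n, which suffices because it never meets a
  union bound. The one exception would be an atypical first-layer codeword, hence that layer is
  drawn from a Gaussian law conditioned on typical energy. Destination and eavesdropper are the same
  unit-noise channel with gains 1 and \<open>sqrt g\<close>, so one family of kernels serves both.
  Decode-and-forward uses the same random codebook: the label \<open>cl\<close> decides which
  messages share codewords. Rates inside the proof are in nats.\<close>

abbreviation lebesgue_seq :: "nat \<Rightarrow> (nat \<Rightarrow> real) measure" where
  "lebesgue_seq n \<equiv> Pi\<^sub>M {..<n} (\<lambda>_. lborel)"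

definition gauss :: "nat \<Rightarrow> real \<Rightarrow> (nat \<Rightarrow> real) \<Rightarrow> (nat \<Rightarrow> real) \<Rightarrow> real" where
  "gauss n v c x = (\<Prod>i<n. normal_density (c i) (sqrt v) (x i))"

definition sq_sum :: "nat \<Rightarrow> (nat \<Rightarrow> real) \<Rightarrow> real" where
  "sq_sum n x = (\<Sum>i<n. (x i)\<^sup>2)"

definition dot :: "nat \<Rightarrow> (nat \<Rightarrow> real) \<Rightarrow> (nat \<Rightarrow> real) \<Rightarrow> real" where
  "dot n x y = (\<Sum>i<n. x i * y i)"

interpretation lebesgue_seq: product_sigma_finite "\<lambda>_::nat. lborel :: real measure"
  by standard

interpretation lebesgue_seq_sigma_finite: sigma_finite_measure "lebesgue_seq n" for n
  by (rule lebesgue_seq.sigma_finite) simp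

lemma sets_lebesgue_seq [simp, measurable_cong]: "sets (lebesgue_seq n) = sets (seq_space n)"
  by (rule sets_PiM_cong) auto

lemma space_lebesgue_seq [simp]: "space (lebesgue_seq n) = space (seq_space n)"
  by (rule sets_eq_imp_space_eq) simp

lemma measurable_gauss [measurable]:
  assumes "\<And>i. i < n \<Longrightarrow> (\<lambda>w. c w i) \<in> borel_measurable M"
    and "\<And>i. i < n \<Longrightarrow> (\<lambda>w. x w i) \<in> borel_measurable M"
  shows "(\<lambda>w. gauss n v (c w) (x w)) \<in> borel_measurable M"
  unfolding gauss_def normal_density_def
  using assms
  by (intro borel_measurable_prod borel_measurable_times borel_measurable_exp borel_measurable_divide
      borel_measurable_uminus borel_measurable_power borel_measurable_diff borel_measurable_const) auto

lemma measurable_sq_sum [measurable]: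
  assumes "\<And>i. i < n \<Longrightarrow> (\<lambda>w. x w i) \<in> borel_measurable M"
  shows "(\<lambda>w. sq_sum n (x w)) \<in> borel_measurable M"
  unfolding sq_sum_def using assms by (intro borel_measurable_sum borel_measurable_power) auto

lemma measurable_dot [measurable]:
  assumes "\<And>i. i < n \<Longrightarrow> (\<lambda>w. x w i) \<in> borel_measurable M"
    and "\<And>i. i < n \<Longrightarrow> (\<lambda>w. y w i) \<in> borel_measurable M"
  shows "(\<lambda>w. dot n (x w) (y w)) \<in> borel_measurable M"
  unfolding dot_def using assms by (intro borel_measurable_sum borel_measurable_times) auto

lemma gauss_pos: "v > 0 \<Longrightarrow> 0 < gauss n v c x"
  unfolding gauss_def by (intro prod_pos ballI normal_density_pos) auto

lemma gauss_nonneg [simp]: "0 \<le> gauss n v c x"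
  unfolding gauss_def by (intro prod_nonneg) auto

lemma ln_gauss:
  assumes "v > 0"
  shows "ln (gauss n v c x) = - real n / 2 * ln (2 * pi * v) - (\<Sum>i<n. (x i - c i)\<^sup>2) / (2 * v)"
proof -
  have 1: "ln (normal_density a (sqrt v) b) = - (1/2) * ln (2 * pi * v) - (b - a)\<^sup>2 / (2 * v)" for a b
    using assms by (simp add: normal_density_def ln_mult ln_div ln_sqrt)
  have "ln (gauss n v c x) = (\<Sum>i<n. ln (normal_density (c i) (sqrt v) (x i)))"
    unfolding gauss_def by (rule ln_prod) (use assms normal_density_pos[of "sqrt v"] in \<open>auto simp: less_le\<close>)
  also have "\<dots> = (\<Sum>i<n. - (1/2) * ln (2 * pi * v) - (x i - c i)\<^sup>2 / (2 * v))"
    unfolding 1 ..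
  finally show ?thesis
    by (simp add: sum_subtractf sum_divide_distrib)
qed

lemma ln_gauss_zero: "v > 0 \<Longrightarrow> ln (gauss n v (\<lambda>_. 0) x) = - real n / 2 * ln (2 * pi * v) - sq_sum n x / (2 * v)"
  by (simp add: ln_gauss sq_sum_def)

text \<open>Bayes' rule for y = a + t * x + noise: the joint density of input and output is the
  output marginal times the posterior of x. Convolutions, conditional output laws and the exchange
  of the two codewords are all instances of this factorization.\<close>

lemma normal_density_bayes:
  fixes a t m u v x y :: real
  assumes vu: "v > 0" "u > 0"
  defines "z \<equiv> v + t\<^sup>2 * u"
  shows "normal_density (a + t * x) (sqrt v) y * normal_density m (sqrt u) x =
    normal_density (a + t * m) (sqrt z) y * normal_density ((m * v + t * u * (y - a)) / z) (sqrt (u * v / z)) x"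
proof -
  have z: "z > 0" using assms by (simp add: z_def add_pos_nonneg)
  have c: "sqrt (2 * pi * v) * sqrt (2 * pi * u) = sqrt (2 * pi * z) * sqrt (2 * pi * (u * v / z))"
    using z vu by (simp flip: real_sqrt_mult)
  \<comment> \<open>Completing the square in x; over the common denominator 2 * u * v * z it becomes
    the polynomial identity \<open>4\<close>.\<close>
  have e: "(y - (a + t * x))\<^sup>2 / (2 * v) + (x - m)\<^sup>2 / (2 * u)
     = (y - (a + t * m))\<^sup>2 / (2 * z) + (x - (m * v + t * u * (y - a)) / z)\<^sup>2 / (2 * (u * v / z))"
  proof -
    define b where "b = y - a"
    have b: "y - (a + t * x) = b - t * x" "y - (a + t * m) = b - t * m" by (auto simp: b_def)
    have 1: "(x - (m * v + t * u * b) / z)\<^sup>2 / (2 * (u * v / z)) = (x * z - (m * v + t * u * b))\<^sup>2 / (2 * u * v * z)"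
      using z vu by (simp add: field_simps power2_eq_square)
    have 2: "(b - t * x)\<^sup>2 / (2 * v) + (x - m)\<^sup>2 / (2 * u) = ((b - t * x)\<^sup>2 * u * z + (x - m)\<^sup>2 * v * z) / (2 * u * v * z)"
      using z vu by (simp add: field_simps)
    have 3: "(b - t * m)\<^sup>2 / (2 * z) = (b - t * m)\<^sup>2 * u * v / (2 * u * v * z)"
      using z vu by (simp add: field_simps)
    have 4: "(b - t * x)\<^sup>2 * u * z + (x - m)\<^sup>2 * v * z = (b - t * m)\<^sup>2 * u * v + (x * z - (m * v + t * u * b))\<^sup>2"
      unfolding z_def by algebra
    show ?thesis unfolding b b_def[symmetric] 1 2 3 4 by (simp add: add_divide_distrib)
  qed
  have nd: "normal_density c (sqrt w) b = exp (- ((b - c)\<^sup>2 / (2 * w))) / sqrt (2 * pi * w)"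
    if "w > 0" for b c w :: real
    using that by (simp add: normal_density_def)
  have mult: "exp (- A) / k * (exp (- B) / l) = exp (- (A + B)) / (k * l)" for A B k l :: real
    by (simp add: exp_add[symmetric])
  have w: "u * v / z > 0" using vu z by simp
  show ?thesis
    unfolding nd[OF vu(1)] nd[OF vu(2)] nd[OF z] nd[OF w] mult e c ..
qed

lemma nn_integral_normal_density [simp]: "s > 0 \<Longrightarrow> (\<integral>\<^sup>+x. ennreal (normal_density m s x) \<partial>lborel) = 1"
  by (subst nn_integral_eq_integral) auto

lemma gauss_bayes:
  fixes t :: real
  assumes "v > 0" "u > 0"
  defines "z \<equiv> v + t\<^sup>2 * u"
  shows "gauss n v (\<lambda>i. a i + t * x i) y * gauss n u m x =
    gauss n z (\<lambda>i. a i + t * m i) y * gauss n (u * v / z) (\<lambda>i. (m i * v + t * u * (y i - a i)) / z) x"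
  unfolding gauss_def z_def prod.distrib[symmetric] by (intro prod.cong refl normal_density_bayes assms)

lemma nn_integral_gauss [simp]: "v > 0 \<Longrightarrow> (\<integral>\<^sup>+x. ennreal (gauss n v c x) \<partial>lebesgue_seq n) = 1"
proof -
  assume "v > 0"
  have "(\<integral>\<^sup>+x. ennreal (gauss n v c x) \<partial>lebesgue_seq n)
    = (\<integral>\<^sup>+x. (\<Prod>i<n. ennreal (normal_density (c i) (sqrt v) (x i))) \<partial>lebesgue_seq n)"
    by (simp add: gauss_def prod_ennreal)
  also have "\<dots> = 1"
    using \<open>v > 0\<close> by (subst lebesgue_seq.product_nn_integral_prod) auto
  finally show ?thesis .
qed

text \<open>The posterior factor of \<open>gauss_bayes\<close> is a probability density in x, so
  only the output marginal survives the integration.\<close>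

lemma nn_integral_gauss_conv:
  assumes "v > 0" "u > 0"
  shows "(\<integral>\<^sup>+x. ennreal (gauss n v (\<lambda>i. a i + t * x i) y) * ennreal (gauss n u m x) \<partial>lebesgue_seq n)
    = ennreal (gauss n (v + t\<^sup>2 * u) (\<lambda>i. a i + t * m i) y)"
  unfolding ennreal_mult''[OF gauss_nonneg, symmetric] gauss_bayes[OF assms]
  using assms by (subst ennreal_mult') (auto simp: nn_integral_cmult add_pos_nonneg)

text \<open>The channel model gives noise as a product of densities, while likelihood computations
  want one density with respect to product Lebesgue measure; the two agree on rectangles.\<close>

lemma PiM_normal_eq_density:
  assumes "v > 0"
  shows "Pi\<^sub>M {..<n} (\<lambda>i. density lborel (\<lambda>x. ennreal (normal_density (c i) (sqrt v) x)))
    = density (lebesgue_seq n) (\<lambda>x. ennreal (gauss n v c x))" (is "?L = ?R")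
proof -
  interpret N: product_sigma_finite "\<lambda>i. density lborel (\<lambda>x. ennreal (normal_density (c i) (sqrt v) x))"
    using assms by (intro product_sigma_finite.intro prob_space_imp_sigma_finite prob_space_normal_density) auto
  have "?R = ?L"
  proof (rule N.PiM_eqI)
    show "sets ?R = sets ?L" by (simp, rule sets_PiM_cong) auto
    fix A :: "nat \<Rightarrow> real set"
    assume A: "\<And>i. i \<in> {..<n} \<Longrightarrow> A i \<in> sets (density lborel (\<lambda>x. ennreal (normal_density (c i) (sqrt v) x)))"
    then have [measurable]: "Pi\<^sub>E {..<n} A \<in> sets (seq_space n)"
      by (intro sets_PiM_I_finite) auto
    have "emeasure ?R (Pi\<^sub>E {..<n} A) = (\<integral>\<^sup>+x. ennreal (gauss n v c x) * indicator (Pi\<^sub>E {..<n} A) x \<partial>lebesgue_seq n)"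
      by (subst emeasure_density) auto
    also have "\<dots> = (\<integral>\<^sup>+x. (\<Prod>i<n. ennreal (normal_density (c i) (sqrt v) (x i)) * indicator (A i) (x i)) \<partial>lebesgue_seq n)"
    proof (rule nn_integral_cong)
      fix x assume x: "x \<in> space (lebesgue_seq n)"
      have "indicator (Pi\<^sub>E {..<n} A) x = (\<Prod>i<n. indicator (A i) (x i) :: ennreal)"
        using x by (auto simp: space_PiM PiE_iff indicator_def prod_eq_1_iff intro!: prod_zero[symmetric])
      then show "ennreal (gauss n v c x) * indicator (Pi\<^sub>E {..<n} A) x
        = (\<Prod>i<n. ennreal (normal_density (c i) (sqrt v) (x i)) * indicator (A i) (x i))"
        by (simp add: gauss_def prod.distrib prod_ennreal)
    qed
    also have "\<dots> = (\<Prod>i<n. \<integral>\<^sup>+x. ennreal (normal_density (c i) (sqrt v) x) * indicator (A i) x \<partial>lborel)"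
      using A by (subst lebesgue_seq.product_nn_integral_prod) auto
    also have "\<dots> = (\<Prod>i<n. emeasure (density lborel (\<lambda>x. ennreal (normal_density (c i) (sqrt v) x))) (A i))"
      using A by (intro prod.cong refl) (auto simp: emeasure_density)
    finally show "emeasure ?R (Pi\<^sub>E {..<n} A) = \<dots>" .
  qed simp
  then show ?thesis by simp
qed


section \<open>Second moments and typicality of Gaussian noise\<close>

abbreviation normal :: "real \<Rightarrow> real measure" where
  "normal v \<equiv> density lborel (\<lambda>x. ennreal (normal_density 0 (sqrt v) x))"

text \<open>Variance of a sum of independent centered variables, adding one coordinate at a time.
  Stating the left side as a nonnegative integral avoids carrying integrability on the product space
  through the induction.\<close>

lemma nn_integral_PiM_sum_squared:
  fixes f :: "'i \<Rightarrow> real \<Rightarrow> real"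
  assumes "finite I" "\<And>i. prob_space (M i)"
    and "\<And>i. i \<in> I \<Longrightarrow> integrable (M i) (f i)"
    and "\<And>i. i \<in> I \<Longrightarrow> integrable (M i) (\<lambda>x. (f i x)\<^sup>2)"
    and "\<And>i. i \<in> I \<Longrightarrow> integral\<^sup>L (M i) (f i) = 0"
  shows "(\<integral>\<^sup>+\<omega>. ennreal ((\<Sum>i\<in>I. f i (\<omega> i))\<^sup>2) \<partial>Pi\<^sub>M I M) = ennreal (\<Sum>i\<in>I. \<integral>x. (f i x)\<^sup>2 \<partial>M i)"
proof -
  interpret product_prob_space M
    by (intro product_prob_spaceI assms)
  show ?thesis
    using assms(1,3-)
  proof (induction I)
    case empty
    then show ?case by simp
  next
    case (insert i I)
    have [measurable]: "f j \<in> borel_measurable (M j)" if "j \<in> insert i I" for j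
      using insert.prems(1)[OF that] by auto
    note i = insert.prems[of i, simplified]
    \<comment> \<open>The earlier coordinates enter only as the constant \<open>a\<close>, so the
      cross term 2 * a * f integrates to zero.\<close>
    have inner: "(\<integral>\<^sup>+y. ennreal ((a + f i y)\<^sup>2) \<partial>M i) = ennreal (a\<^sup>2) + ennreal (\<integral>x. (f i x)\<^sup>2 \<partial>M i)" for a
    proof -
      have e: "(a + f i y)\<^sup>2 = a\<^sup>2 + 2 * a * f i y + (f i y)\<^sup>2" for y
        by (simp add: power2_sum)
      have "integrable (M i) (\<lambda>y. (a + f i y)\<^sup>2)"
        unfolding e using i by auto
      then have "(\<integral>\<^sup>+y. ennreal ((a + f i y)\<^sup>2) \<partial>M i) = ennreal (\<integral>y. (a + f i y)\<^sup>2 \<partial>M i)"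
        by (intro nn_integral_eq_integral) auto
      also have "(\<integral>y. (a + f i y)\<^sup>2 \<partial>M i) = a\<^sup>2 + (\<integral>x. (f i x)\<^sup>2 \<partial>M i)"
        unfolding e using i by (simp add: M.prob_space)
      finally show ?thesis by (simp add: ennreal_plus)
    qed
    have s: "(\<Sum>j\<in>I. f j (if j = i then y else \<omega> j)) = (\<Sum>j\<in>I. f j (\<omega> j))" for \<omega> y
      using insert.hyps by (intro sum.cong) auto
    have "(\<integral>\<^sup>+\<omega>. ennreal ((\<Sum>j\<in>insert i I. f j (\<omega> j))\<^sup>2) \<partial>Pi\<^sub>M (insert i I) M)
      = (\<integral>\<^sup>+\<omega>. \<integral>\<^sup>+y. ennreal (((\<Sum>j\<in>I. f j (\<omega> j)) + f i y)\<^sup>2) \<partial>M i \<partial>Pi\<^sub>M I M)"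
      using insert.hyps by (subst product_nn_integral_insert) (auto simp: s add.commute)
    also have "\<dots> = (\<integral>\<^sup>+\<omega>. ennreal ((\<Sum>j\<in>I. f j (\<omega> j))\<^sup>2) + ennreal (\<integral>x. (f i x)\<^sup>2 \<partial>M i) \<partial>Pi\<^sub>M I M)"
      unfolding inner ..
    also have "\<dots> = ennreal (\<Sum>j\<in>I. \<integral>x. (f j x)\<^sup>2 \<partial>M j) + ennreal (\<integral>x. (f i x)\<^sup>2 \<partial>M i)"
    proof (subst nn_integral_add)
      have "emeasure (Pi\<^sub>M I M) (space (Pi\<^sub>M I M)) = 1"
        using assms(2) by (intro prob_space.emeasure_space_1 prob_space_PiM)
      then show "(\<integral>\<^sup>+\<omega>. ennreal ((\<Sum>j\<in>I. f j (\<omega> j))\<^sup>2) \<partial>Pi\<^sub>M I M)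
          + (\<integral>\<^sup>+\<omega>. ennreal (\<integral>x. (f i x)\<^sup>2 \<partial>M i) \<partial>Pi\<^sub>M I M)
        = ennreal (\<Sum>j\<in>I. \<integral>x. (f j x)\<^sup>2 \<partial>M j) + ennreal (\<integral>x. (f i x)\<^sup>2 \<partial>M i)"
        using insert.IH insert.prems by simp
    qed auto
    also have "\<dots> = ennreal (\<Sum>j\<in>insert i I. \<integral>x. (f j x)\<^sup>2 \<partial>M j)"
      using insert.hyps
      by (subst ennreal_plus[symmetric]) (auto intro!: sum_nonneg arg_cong[where f=ennreal])
    finally show ?case .
  qed
qed

lemma gaussian_noise_eq: "v > 0 \<Longrightarrow> gaussian_noise n v = density (lebesgue_seq n) (\<lambda>x. ennreal (gauss n v (\<lambda>_. 0) x))"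
  unfolding gaussian_noise_def by (rule PiM_normal_eq_density)

lemma prob_space_gaussian_noise: "v > 0 \<Longrightarrow> prob_space (gaussian_noise n v)"
  unfolding gaussian_noise_def by (intro prob_space_PiM prob_space_normal_density) auto

lemma normal_moments:
  assumes "v > 0"
  shows "integrable (normal v) (\<lambda>x. x ^ k)"
    and "(\<integral>x. x \<partial>normal v) = 0" and "(\<integral>x. x\<^sup>2 \<partial>normal v) = v" and "(\<integral>x. x ^ 4 \<partial>normal v) = 3 * v\<^sup>2"
proof -
  have s: "sqrt v > 0" using assms by simp
  show "integrable (normal v) (\<lambda>x. x ^ k)"
    using integrable_normal_moment[OF s, of 0 k] by (subst integrable_density) auto
  show "(\<integral>x. x \<partial>normal v) = 0"
    using integral_normal_moment_nz_1[OF s, of 0] by (subst integral_density) auto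
  show "(\<integral>x. x\<^sup>2 \<partial>normal v) = v"
    using integral_normal_moment_even[OF s, of 0 1] assms by (subst integral_density) auto
  show "(\<integral>x. x ^ 4 \<partial>normal v) = 3 * v\<^sup>2"
    using integral_normal_moment_even[OF s, of 0 2] assms
    by (subst integral_density) (auto simp: fact_numeral field_simps power2_eq_square)
qed

lemma nn_integral_noise_sq_sum:
  assumes "v > 0"
  shows "(\<integral>\<^sup>+x. ennreal ((sq_sum n x - real n * v)\<^sup>2) \<partial>gaussian_noise n v) = ennreal (2 * real n * v\<^sup>2)"
proof -
  note m = normal_moments[OF assms]
  interpret N: prob_space "normal v"
    using assms by (intro prob_space_normal_density) auto
  note i[simp] = m(1)[of 2] m(1)[of 4]
  have "(\<integral>\<^sup>+x. ennreal ((sq_sum n x - real n * v)\<^sup>2) \<partial>gaussian_noise n v)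
    = (\<integral>\<^sup>+x. ennreal ((\<Sum>i<n. ((x i)\<^sup>2 - v))\<^sup>2) \<partial>gaussian_noise n v)"
    by (simp add: sq_sum_def sum_subtractf)
  also have "\<dots> = ennreal (\<Sum>i<n. \<integral>x. (x\<^sup>2 - v)\<^sup>2 \<partial>normal v)"
    unfolding gaussian_noise_def
  proof (rule nn_integral_PiM_sum_squared)
    show "integrable (normal v) (\<lambda>x. (x\<^sup>2 - v)\<^sup>2)"
      by (simp add: power2_diff power_mult[symmetric])
  qed (use m N.prob_space in \<open>auto intro: N.prob_space_axioms\<close>)
  \<comment> \<open>With fourth moment 3 * v^2, the variance of x^2 is 3 * v^2 - 2 * v^2 +
    v^2.\<close>
  also have "(\<integral>x. (x\<^sup>2 - v)\<^sup>2 \<partial>normal v) = (\<integral>x. x ^ 4 - 2 * v * x\<^sup>2 + v\<^sup>2 \<partial>normal v)"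
    by (intro arg_cong[where f="integral\<^sup>L (normal v)"] ext) (simp add: power2_diff power_mult[symmetric])
  also have "\<dots> = 2 * v\<^sup>2"
    using m(3,4) N.prob_space by (simp add: power2_eq_square[of v])
  finally show ?thesis by (simp add: mult_ac)
qed

lemma nn_integral_noise_dot:
  assumes "v > 0"
  shows "(\<integral>\<^sup>+y. ennreal ((dot n x y)\<^sup>2) \<partial>gaussian_noise n v) = ennreal (v * sq_sum n x)"
proof -
  note m = normal_moments[OF assms]
  interpret N: prob_space "normal v"
    using assms by (intro prob_space_normal_density) auto
  note i[simp] = m(1)[of 2] m(1)[of 1, simplified]
  have "(\<integral>\<^sup>+y. ennreal ((dot n x y)\<^sup>2) \<partial>gaussian_noise n v) = ennreal (\<Sum>i<n. \<integral>y. (x i * y)\<^sup>2 \<partial>normal v)"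
    unfolding dot_def gaussian_noise_def
    by (rule nn_integral_PiM_sum_squared[where f="\<lambda>i y. x i * y"])
      (use m in \<open>auto intro: N.prob_space_axioms simp: power_mult_distrib\<close>)
  also have "\<dots> = ennreal (v * sq_sum n x)"
    using m by (simp add: power_mult_distrib sq_sum_def sum_distrib_left mult.commute)
  finally show ?thesis .
qed

text \<open>Chebyshev's inequality, in a form that asks only for an upper bound on the second
  moment.\<close>

lemma emeasure_abs_gt_le:
  fixes f :: "'a \<Rightarrow> real"
  assumes [measurable]: "f \<in> borel_measurable M" and "c > 0" and "(\<integral>\<^sup>+x. ennreal ((f x)\<^sup>2) \<partial>M) \<le> ennreal B"
    and "B \<ge> 0"
  shows "emeasure M {x\<in>space M. \<bar>f x\<bar> > c} \<le> ennreal (B / c\<^sup>2)"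
proof -
  have "emeasure M {x\<in>space M. \<bar>f x\<bar> > c} = (\<integral>\<^sup>+x. indicator {x\<in>space M. \<bar>f x\<bar> > c} x \<partial>M)"
    by simp
  also have "\<dots> \<le> (\<integral>\<^sup>+x. ennreal (1 / c\<^sup>2) * ennreal ((f x)\<^sup>2) \<partial>M)"
  proof (rule nn_integral_mono)
    fix x
    have "1 \<le> (f x)\<^sup>2 / c\<^sup>2" if "\<bar>f x\<bar> > c"
      using that \<open>c > 0\<close> power_mono[of c "\<bar>f x\<bar>" 2] by (simp add: field_simps)
    then show "indicator {x\<in>space M. \<bar>f x\<bar> > c} x \<le> ennreal (1 / c\<^sup>2) * ennreal ((f x)\<^sup>2)"
      by (auto simp: indicator_def ennreal_mult'[symmetric])
  qed
  also have "\<dots> = ennreal (1 / c\<^sup>2) * (\<integral>\<^sup>+x. ennreal ((f x)\<^sup>2) \<partial>M)"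
    by (simp add: nn_integral_cmult)
  also have "\<dots> \<le> ennreal (1 / c\<^sup>2) * ennreal B"
    by (intro mult_left_mono assms) simp
  also have "\<dots> = ennreal (B / c\<^sup>2)"
    using \<open>B \<ge> 0\<close> by (simp add: ennreal_mult'[symmetric])
  finally show ?thesis .
qed

text \<open>The log-likelihood of a Gaussian output depends on the noise only through its energy and
  its correlation with the input, so these two statistics are all that typicality has to
  control.\<close>

definition typical_noise :: "nat \<Rightarrow> real \<Rightarrow> real \<Rightarrow> (nat \<Rightarrow> real) \<Rightarrow> (nat \<Rightarrow> real) \<Rightarrow> bool" where
  "typical_noise n v \<eta> x y \<longleftrightarrow> \<bar>sq_sum n y - real n * v\<bar> \<le> real n * \<eta> \<and> \<bar>dot n x y\<bar> \<le> real n * \<eta>"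

lemma measurable_typical_noise [measurable]:
  "Measurable.pred (seq_space n) (typical_noise n v \<eta> x)"
  unfolding typical_noise_def[abs_def] sq_sum_def dot_def by measurable

lemma sets_gaussian_noise [simp, measurable_cong]: "sets (gaussian_noise n v) = sets (seq_space n)"
  unfolding gaussian_noise_def by (rule sets_PiM_cong) auto

lemma space_gaussian_noise [simp]: "space (gaussian_noise n v) = space (seq_space n)"
  by (rule sets_eq_imp_space_eq) simp

text \<open>Chebyshev for the two statistics. The order 1/n is enough: the probability of atypical
  noise is averaged over codewords and never multiplied by their number.\<close>

lemma emeasure_not_typical_noise_le:
  assumes "v > 0" "\<eta> > 0" "n > 0" "sq_sum n x \<le> real n * P"
  shows "emeasure (gaussian_noise n v) {y\<in>space (seq_space n). \<not> typical_noise n v \<eta> x y}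
    \<le> ennreal ((2 * v\<^sup>2 + v * P) / (real n * \<eta>\<^sup>2))"
proof -
  let ?M = "gaussian_noise n v"
  let ?A = "{y\<in>space ?M. \<bar>sq_sum n y - real n * v\<bar> > real n * \<eta>}"
  let ?B = "{y\<in>space ?M. \<bar>dot n x y\<bar> > real n * \<eta>}"
  have [measurable]: "sq_sum n \<in> borel_measurable ?M" "dot n x \<in> borel_measurable ?M"
    unfolding sq_sum_def[abs_def] dot_def[abs_def] by measurable
  have P: "P \<ge> 0"
  proof (rule ccontr)
    assume "\<not> P \<ge> 0"
    then have "real n * P < 0" using assms by (simp add: mult_pos_neg)
    moreover have "0 \<le> sq_sum n x" by (simp add: sq_sum_def sum_nonneg)
    ultimately show False using assms by linarith
  qed
  have "emeasure ?M {y\<in>space (seq_space n). \<not> typical_noise n v \<eta> x y} \<le> emeasure ?M (?A \<union> ?B)"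
    by (intro emeasure_mono) (auto simp: typical_noise_def)
  also have "\<dots> \<le> emeasure ?M ?A + emeasure ?M ?B"
    by (intro emeasure_subadditive) auto
  also have "\<dots> \<le> ennreal (2 * real n * v\<^sup>2 / (real n * \<eta>)\<^sup>2) + ennreal ((v * (real n * P)) / (real n * \<eta>)\<^sup>2)"
    using assms P
    by (intro add_mono emeasure_abs_gt_le)
      (auto simp: nn_integral_noise_sq_sum nn_integral_noise_dot intro!: ennreal_leI)
  also have "\<dots> = ennreal ((2 * v\<^sup>2 + v * P) / (real n * \<eta>\<^sup>2))"
    using assms P
    by (subst ennreal_plus[symmetric]) (auto simp: field_simps power2_eq_square)
  finally show ?thesis .
qed


section \<open>Outputs of the additive noise channels\<close>

lemma distr_normal_shift:
  assumes "v > 0"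
  shows "distr (normal v) borel (\<lambda>y. a + y) = density lborel (\<lambda>x. ennreal (normal_density a (sqrt v) x))"
proof (rule measure_eqI)
  fix A assume "A \<in> sets (distr (normal v) borel (\<lambda>y. a + y))"
  then have [measurable]: "A \<in> sets borel" by simp
  have s: "normal_density a s (a + x) = normal_density 0 s x" for s x
    by (simp add: normal_density_def)
  have "emeasure (distr (normal v) borel (\<lambda>y. a + y)) A = (\<integral>\<^sup>+y. indicator A y \<partial>distr (normal v) borel (\<lambda>y. a + y))"
    by simp
  also have "\<dots> = (\<integral>\<^sup>+y. indicator A (a + y) \<partial>normal v)"
    by (subst nn_integral_distr) auto
  also have "\<dots> = (\<integral>\<^sup>+y. ennreal (normal_density a (sqrt v) (a + 1 * y)) * indicator A (a + 1 * y) \<partial>lborel)"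
    by (subst nn_integral_density) (auto simp: s)
  also have "\<dots> = (\<integral>\<^sup>+y. ennreal (normal_density a (sqrt v) y) * indicator A y \<partial>lborel)"
    by (subst (2) nn_integral_real_affine[where c=1 and t=a]) auto
  finally show "emeasure (distr (normal v) borel (\<lambda>y. a + y)) A
    = emeasure (density lborel (\<lambda>x. ennreal (normal_density a (sqrt v) x))) A"
    by (simp add: emeasure_density)
qed simp

text \<open>Translating each coordinate moves the center of the product Gaussian. Rectangles
  suffice, because their preimages under a translation are again rectangles.\<close>

lemma distr_add_noise:
  assumes "v > 0"
  shows "distr (gaussian_noise n v) (seq_space n) (\<lambda>y. \<lambda>i\<in>{..<n}. a i + y i)
    = density (lebesgue_seq n) (\<lambda>x. ennreal (gauss n v a x))" (is "?L = ?R")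
proof -
  interpret N: product_sigma_finite "\<lambda>i. density lborel (\<lambda>x. ennreal (normal_density (a i) (sqrt v) x))"
    using assms by (intro product_sigma_finite.intro prob_space_imp_sigma_finite prob_space_normal_density) auto
  interpret N0: product_sigma_finite "\<lambda>i. normal v"
    using assms by (intro product_sigma_finite.intro prob_space_imp_sigma_finite prob_space_normal_density) auto
  have "?L = Pi\<^sub>M {..<n} (\<lambda>i. density lborel (\<lambda>x. ennreal (normal_density (a i) (sqrt v) x)))"
  proof (rule N.PiM_eqI)
    show "sets ?L = sets (Pi\<^sub>M {..<n} (\<lambda>i. density lborel (\<lambda>x. ennreal (normal_density (a i) (sqrt v) x))))"
      by (simp, rule sets_PiM_cong) auto
    fix A :: "nat \<Rightarrow> real set"
    assume "\<And>i. i \<in> {..<n} \<Longrightarrow> A i \<in> sets (density lborel (\<lambda>x. ennreal (normal_density (a i) (sqrt v) x)))"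
    then have A[measurable]: "\<And>i. i \<in> {..<n} \<Longrightarrow> A i \<in> sets borel" by simp
    have [measurable]: "(\<lambda>y. \<lambda>i\<in>{..<n}. a i + y i) \<in> measurable (gaussian_noise n v) (seq_space n)"
      by measurable
    have "emeasure ?L (Pi\<^sub>E {..<n} A)
      = emeasure (gaussian_noise n v) ((\<lambda>y. \<lambda>i\<in>{..<n}. a i + y i) -` (Pi\<^sub>E {..<n} A) \<inter> space (gaussian_noise n v))"
      using A by (intro emeasure_distr sets_PiM_I_finite) auto
    also have "(\<lambda>y. \<lambda>i\<in>{..<n}. a i + y i) -` (Pi\<^sub>E {..<n} A) \<inter> space (gaussian_noise n v)
      = Pi\<^sub>E {..<n} (\<lambda>i. (\<lambda>y. a i + y) -` A i \<inter> space (normal v))"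
      by (auto simp: space_PiM PiE_iff)
    also have "emeasure (gaussian_noise n v) \<dots> = (\<Prod>i<n. emeasure (normal v) ((\<lambda>y. a i + y) -` A i \<inter> space (normal v)))"
      unfolding gaussian_noise_def
    proof (rule N0.emeasure_PiM)
      fix i assume i: "i \<in> {..<n}"
      have "(\<lambda>y. a i + y) \<in> measurable (normal v) borel" by simp
      from measurable_sets[OF this A[OF i]]
      show "(\<lambda>y. a i + y) -` A i \<inter> space (normal v) \<in> sets (normal v)" .
    qed simp
    also have "\<dots> = (\<Prod>i<n. emeasure (distr (normal v) borel (\<lambda>y. a i + y)) (A i))"
      by (intro prod.cong refl emeasure_distr[symmetric]) auto
    finally show "emeasure ?L (Pi\<^sub>E {..<n} A)
      = (\<Prod>i<n. emeasure (density lborel (\<lambda>x. ennreal (normal_density (a i) (sqrt v) x))) (A i))"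
      unfolding distr_normal_shift[OF assms] .
  qed simp
  then show ?thesis
    unfolding PiM_normal_eq_density[OF assms] .
qed

lemma nn_integral_add_noise:
  assumes "v > 0" and [measurable]: "f \<in> borel_measurable (seq_space n)"
  shows "(\<integral>\<^sup>+y. f (\<lambda>i\<in>{..<n}. a i + y i) \<partial>gaussian_noise n v)
    = (\<integral>\<^sup>+x. ennreal (gauss n v a x) * f x \<partial>lebesgue_seq n)"
proof -
  have "(\<integral>\<^sup>+y. f (\<lambda>i\<in>{..<n}. a i + y i) \<partial>gaussian_noise n v)
    = (\<integral>\<^sup>+x. f x \<partial>distr (gaussian_noise n v) (seq_space n) (\<lambda>y. \<lambda>i\<in>{..<n}. a i + y i))"
    by (rule nn_integral_distr[symmetric]) measurable
  also have "\<dots> = (\<integral>\<^sup>+x. ennreal (gauss n v a x) * f x \<partial>lebesgue_seq n)"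
    unfolding distr_add_noise[OF assms(1)] by (rule nn_integral_density) measurable
  finally show ?thesis .
qed

text \<open>The total noise \<open>sqrt g * ny + nz\<close> of the eavesdropper has variance g + (1
  - g) = 1, so her channel is the unit-noise channel with the input scaled by \<open>sqrt g\<close>.
  This lets one Gaussian kernel treat both receivers.\<close>

lemma nn_integral_degraded_noise:
  assumes "0 \<le> g" "g < 1" and [measurable]: "f \<in> borel_measurable (seq_space n)"
  shows "(\<integral>\<^sup>+ny. \<integral>\<^sup>+nz. f (\<lambda>i\<in>{..<n}. sqrt g * (a i + ny i) + nz i) \<partial>gaussian_noise n (1 - g) \<partial>gaussian_noise n 1)
    = (\<integral>\<^sup>+z. ennreal (gauss n 1 (\<lambda>i. sqrt g * a i) z) * f z \<partial>lebesgue_seq n)"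
proof -
  interpret pair_sigma_finite "lebesgue_seq n" "lebesgue_seq n" by standard
  let ?h = "\<lambda>ny. \<integral>\<^sup>+z. ennreal (gauss n (1 - g) (\<lambda>i. sqrt g * a i + sqrt g * ny i) z) * f z \<partial>lebesgue_seq n"
  have [measurable]: "?h \<in> borel_measurable (seq_space n)"
    by (rule lebesgue_seq_sigma_finite.borel_measurable_nn_integral)
      (simp add: case_prod_beta', measurable)
  have "(\<integral>\<^sup>+ny. \<integral>\<^sup>+nz. f (\<lambda>i\<in>{..<n}. sqrt g * (a i + ny i) + nz i) \<partial>gaussian_noise n (1 - g) \<partial>gaussian_noise n 1)
    = (\<integral>\<^sup>+ny. ?h ny \<partial>gaussian_noise n 1)"
  proof (rule nn_integral_cong)
    fix ny
    show "(\<integral>\<^sup>+nz. f (\<lambda>i\<in>{..<n}. sqrt g * (a i + ny i) + nz i) \<partial>gaussian_noise n (1 - g)) = ?h ny"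
      using assms nn_integral_add_noise[of "1 - g" f n "\<lambda>i. sqrt g * a i + sqrt g * ny i"]
      by (simp add: distrib_left)
  qed
  also have "\<dots> = (\<integral>\<^sup>+ny. ennreal (gauss n 1 (\<lambda>_. 0) ny) * ?h ny \<partial>lebesgue_seq n)"
    by (simp add: gaussian_noise_eq nn_integral_density)
  also have "\<dots> = (\<integral>\<^sup>+ny. \<integral>\<^sup>+z. ennreal (gauss n (1 - g) (\<lambda>i. sqrt g * a i + sqrt g * ny i) z)
      * ennreal (gauss n 1 (\<lambda>_. 0) ny) * f z \<partial>lebesgue_seq n \<partial>lebesgue_seq n)"
    by (subst nn_integral_cmult[symmetric]) (auto simp: mult_ac)
  \<comment> \<open>After the exchange the destination's noise is integrated out at fixed z, a
    Gaussian convolution with resulting variance (1 - g) + g * 1.\<close>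
  also have "\<dots> = (\<integral>\<^sup>+z. \<integral>\<^sup>+ny. ennreal (gauss n (1 - g) (\<lambda>i. sqrt g * a i + sqrt g * ny i) z)
      * ennreal (gauss n 1 (\<lambda>_. 0) ny) * f z \<partial>lebesgue_seq n \<partial>lebesgue_seq n)"
    by (rule Fubini') (simp add: case_prod_beta', measurable)
  also have "\<dots> = (\<integral>\<^sup>+z. ennreal (gauss n 1 (\<lambda>i. sqrt g * a i) z) * f z \<partial>lebesgue_seq n)"
  proof (rule nn_integral_cong)
    fix z assume z: "z \<in> space (lebesgue_seq n)"
    have [measurable]: "(\<lambda>ny. gauss n (1 - g) (\<lambda>i. sqrt g * a i + sqrt g * ny i) z) \<in> borel_measurable (seq_space n)"
      by (rule measurable_gauss) measurable
    have "(\<integral>\<^sup>+ny. ennreal (gauss n (1 - g) (\<lambda>i. sqrt g * a i + sqrt g * ny i) z)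
      * ennreal (gauss n 1 (\<lambda>_. 0) ny) * f z \<partial>lebesgue_seq n)
      = (\<integral>\<^sup>+ny. ennreal (gauss n (1 - g) (\<lambda>i. sqrt g * a i + sqrt g * ny i) z)
      * ennreal (gauss n 1 (\<lambda>_. 0) ny) \<partial>lebesgue_seq n) * f z"
      by (rule nn_integral_multc) measurable
    also have "\<dots> = ennreal (gauss n 1 (\<lambda>i. sqrt g * a i) z) * f z"
      using assms by (subst nn_integral_gauss_conv) auto
    finally show "(\<integral>\<^sup>+ny. ennreal (gauss n (1 - g) (\<lambda>i. sqrt g * a i + sqrt g * ny i) z)
      * ennreal (gauss n 1 (\<lambda>_. 0) ny) * f z \<partial>lebesgue_seq n)
      = ennreal (gauss n 1 (\<lambda>i. sqrt g * a i) z) * f z" .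
  qed
  finally show ?thesis .
qed

section \<open>Error probability and leakage of a code\<close>

lemma finite_index_set [simp]: "finite (index_set n R)"
  by (simp add: index_set_def)

lemma index_set_nonempty:
  assumes "R \<ge> 0"
  shows "1 \<in> index_set n R"
proof -
  have "1 \<le> 2 powr (real n * R)" using assms by (intro ge_one_powr_ge_zero) auto
  then have "1 \<le> nat \<lfloor>2 powr (real n * R)\<rfloor>" by (simp add: le_nat_iff)
  then show ?thesis by (simp add: index_set_def)
qed

lemma card_index_set_pos: "R \<ge> 0 \<Longrightarrow> 0 < card (index_set n R)"
  using index_set_nonempty[of R n] by (auto simp: card_gt_0_iff)

lemma prob_space_outcome_space:
  assumes "0 \<le> g" "g < 1" "R \<ge> 0" "R' \<ge> 0"
  shows "prob_space (outcome_space g R' R n)"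
proof -
  have pair: "prob_space (A \<Otimes>\<^sub>M B)" if "prob_space A" "prob_space B" for A :: "'a measure" and B :: "'b measure"
  proof -
    interpret A: prob_space A by fact
    interpret B: prob_space B by fact
    interpret pair_prob_space A B ..
    show ?thesis by (rule P.prob_space_axioms)
  qed
  have u: "prob_space (uniform_count_measure (index_set n r))" if "r \<ge> 0" for r
    using index_set_nonempty[OF that] by (intro prob_space_uniform_count_measure) auto
  show ?thesis unfolding outcome_space_def
    using assms by (intro pair u prob_space_gaussian_noise) auto
qed

text \<open>Messages are discrete, so it is enough to check measurability in the noise with both
  messages fixed.\<close>

lemma measurable_outcome:
  assumes "\<And>w m. w \<in> index_set n R \<Longrightarrow> m \<in> index_set n R' \<Longrightarrow>
    (\<lambda>x. f (w, m, fst x, snd x)) \<in> measurable (seq_space n \<Otimes>\<^sub>M seq_space n) K"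
  shows "f \<in> measurable (outcome_space g R' R n) K"
proof -
  have *: "sets (outcome_space g R' R n) = sets (count_space (index_set n R) \<Otimes>\<^sub>M count_space (index_set n R')
      \<Otimes>\<^sub>M seq_space n \<Otimes>\<^sub>M seq_space n)"
    unfolding outcome_space_def
    by (intro sets_pair_measure_cong) (auto simp: sets_uniform_count_measure)
  show ?thesis unfolding measurable_cong_sets[OF * refl]
    by (intro measurable_pair_measure_countable1) (use assms in \<open>auto intro: countable_finite\<close>)
qed

text \<open>The normalization is pulled out as a single factor, so that bounds on sums over
  codewords can be applied directly.\<close>

lemma nn_integral_outcome:
  assumes "0 \<le> g" "g < 1" and f: "f \<in> borel_measurable (outcome_space g R' R n)"
  shows "(\<integral>\<^sup>+\<omega>. f \<omega> \<partial>outcome_space g R' R n)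
    = (\<Sum>w\<in>index_set n R. \<Sum>m\<in>index_set n R'. \<integral>\<^sup>+ny. \<integral>\<^sup>+nz. f (w, m, ny, nz) \<partial>gaussian_noise n (1 - g) \<partial>gaussian_noise n 1)
      * ennreal (1 / (real (card (index_set n R)) * real (card (index_set n R'))))"
proof -
  interpret Y: prob_space "gaussian_noise n 1" by (rule prob_space_gaussian_noise) simp
  interpret Z: prob_space "gaussian_noise n (1 - g)" by (rule prob_space_gaussian_noise) (use assms in simp)
  interpret YZ: pair_prob_space "gaussian_noise n 1" "gaussian_noise n (1 - g)" ..
  let ?U = "\<lambda>R. uniform_count_measure (index_set n R)"
  let ?YZ = "gaussian_noise n 1 \<Otimes>\<^sub>M gaussian_noise n (1 - g)"
  interpret U: finite_measure "?U R'"
    by (standard, simp add: space_uniform_count_measure emeasure_uniform_count_measure)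
  interpret UYZ: pair_sigma_finite "?U R'" ?YZ ..
  have f[measurable]: "f \<in> borel_measurable (?U R \<Otimes>\<^sub>M ?U R' \<Otimes>\<^sub>M ?YZ)"
    using f unfolding outcome_space_def .
  have sec: "(\<lambda>x. f (w, m, x)) \<in> borel_measurable ?YZ" if "w \<in> index_set n R" "m \<in> index_set n R'" for w m
  proof -
    have "w \<in> space (?U R)" "m \<in> space (?U R')" using that by (auto simp: space_uniform_count_measure)
    then show ?thesis by measurable
  qed
  have sec': "(\<lambda>x. f (w, x)) \<in> borel_measurable (?U R' \<Otimes>\<^sub>M ?YZ)" if "w \<in> index_set n R" for w
  proof -
    have "w \<in> space (?U R)" using that by (auto simp: space_uniform_count_measure)
    then show ?thesis by measurable
  qed
  have "(\<integral>\<^sup>+\<omega>. f \<omega> \<partial>outcome_space g R' R n) = (\<integral>\<^sup>+w. \<integral>\<^sup>+x. f (w, x) \<partial>(?U R' \<Otimes>\<^sub>M ?YZ) \<partial>?U R)"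
    unfolding outcome_space_def by (rule UYZ.P.nn_integral_fst[symmetric]) measurable
  also have "\<dots> = (\<Sum>w\<in>index_set n R. (\<integral>\<^sup>+x. f (w, x) \<partial>(?U R' \<Otimes>\<^sub>M ?YZ)) * ennreal (1 / card (index_set n R)))"
    unfolding uniform_count_measure_def by (subst nn_integral_point_measure_finite) (auto simp: mult.commute)
  also have "\<dots> = (\<Sum>w\<in>index_set n R. (\<Sum>m\<in>index_set n R'. (\<integral>\<^sup>+ny. \<integral>\<^sup>+nz. f (w, m, ny, nz) \<partial>gaussian_noise n (1 - g) \<partial>gaussian_noise n 1)
      * ennreal (1 / card (index_set n R'))) * ennreal (1 / card (index_set n R)))"
  proof (intro sum.cong refl arg_cong2[where f="(*)"])
    fix w assume w: "w \<in> index_set n R"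
    have "(\<integral>\<^sup>+x. f (w, x) \<partial>(?U R' \<Otimes>\<^sub>M ?YZ)) = (\<integral>\<^sup>+m. \<integral>\<^sup>+x. f (w, m, x) \<partial>?YZ \<partial>?U R')"
      by (rule YZ.nn_integral_fst[symmetric, OF sec'[OF w]])
    also have "\<dots> = (\<Sum>m\<in>index_set n R'. (\<integral>\<^sup>+x. f (w, m, x) \<partial>?YZ) * ennreal (1 / card (index_set n R')))"
      unfolding uniform_count_measure_def by (subst nn_integral_point_measure_finite) (auto simp: mult.commute)
    also have "\<dots> = (\<Sum>m\<in>index_set n R'. (\<integral>\<^sup>+ny. \<integral>\<^sup>+nz. f (w, m, ny, nz) \<partial>gaussian_noise n (1 - g) \<partial>gaussian_noise n 1)
      * ennreal (1 / card (index_set n R')))"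
      by (intro sum.cong refl arg_cong2[where f="(*)"] Z.nn_integral_fst[symmetric] sec w)
    finally show "(\<integral>\<^sup>+x. f (w, x) \<partial>(?U R' \<Otimes>\<^sub>M ?YZ)) = \<dots>" .
  qed
  finally show ?thesis
    unfolding sum_distrib_right[symmetric] mult.assoc
    by (simp add: ennreal_mult'[symmetric] mult.commute)
qed


text \<open>Error probability and leakage depend on the encoders only through this sum, so a
  codebook has to prescribe nothing else.\<close>

definition channel_input :: "secrecy_code \<Rightarrow> nat \<Rightarrow> nat \<Rightarrow> nat \<Rightarrow> real" where
  "channel_input c w m i =
     relay_enc1 c (fst (source_enc c w m)) m i + relay_enc2 c (snd (source_enc c w m)) m i"

lemma dest_output_eq: "dest_output n c (w, m, ny, nz) = (\<lambda>i\<in>{..<n}. channel_input c w m i + ny i)"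
  by (simp add: dest_output_def channel_input_def)

lemma eve_output_eq:
  "eve_output g n c (w, m, ny, nz) = (\<lambda>i\<in>{..<n}. sqrt g * (channel_input c w m i + ny i) + nz i)"
  by (auto simp: eve_output_def dest_output_eq restrict_def)

lemma measurable_dest_output [measurable]:
  "dest_output n c \<in> measurable (outcome_space g R' R n) (seq_space n)"
  by (rule measurable_outcome) (unfold dest_output_eq, measurable)

lemma measurable_eve_output [measurable]:
  "eve_output g n c \<in> measurable (outcome_space g R' R n) (seq_space n)"
  by (rule measurable_outcome) (unfold eve_output_eq, measurable)

lemma measurable_msg [measurable]:
  "msg \<in> measurable (outcome_space g R' R n) (count_space (index_set n R))"
  by (rule measurable_outcome) (simp add: msg_def)

text \<open>Reduces the error probability to density integrals summed over messages; the
  eavesdropper's extra noise integrates to one.\<close>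

lemma error_prob_le:
  fixes \<epsilon> :: real
  assumes "0 \<le> g" "g < 1" "R \<ge> 0" "R' \<ge> 0" "\<epsilon> \<ge> 0"
    and [measurable]: "decoder c \<in> seq_space n \<rightarrow>\<^sub>M count_space (index_set n R)"
    and le: "(\<Sum>w\<in>index_set n R. \<Sum>m\<in>index_set n R'.
      \<integral>\<^sup>+y. ennreal (gauss n 1 (channel_input c w m) y) * indicator {y. decoder c y \<noteq> w} y \<partial>lebesgue_seq n)
      \<le> ennreal (\<epsilon> * (card (index_set n R) * card (index_set n R')))"
  shows "error_prob g R' R n c \<le> \<epsilon>" and "0 \<le> error_prob g R' R n c"
proof -
  interpret O: prob_space "outcome_space g R' R n"
    using assms by (intro prob_space_outcome_space)
  interpret Z: prob_space "gaussian_noise n (1 - g)"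
    using assms by (intro prob_space_gaussian_noise) auto
  let ?E = "{\<omega>\<in>space (outcome_space g R' R n). decoder c (dest_output n c \<omega>) \<noteq> msg \<omega>}"
  have [measurable]: "Measurable.pred (outcome_space g R' R n) (\<lambda>\<omega>. decoder c (dest_output n c \<omega>) \<noteq> msg \<omega>)"
    by (rule measurable_outcome) (unfold msg_def dest_output_eq prod.case, measurable)
  have [measurable]: "{y\<in>space (seq_space n). decoder c y \<noteq> w} \<in> sets (seq_space n)" for w
    by measurable
  have ind: "(\<lambda>\<omega>. indicator {\<omega>. decoder c (dest_output n c \<omega>) \<noteq> msg \<omega>} \<omega> :: ennreal)
      \<in> borel_measurable (outcome_space g R' R n)"
    by measurable
  have [measurable]: "(\<lambda>y. indicator {y. decoder c y \<noteq> w} y :: ennreal) \<in> borel_measurable (seq_space n)" for w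
    by measurable
  have "emeasure (outcome_space g R' R n) ?E
    = (\<integral>\<^sup>+\<omega>. indicator {\<omega>. decoder c (dest_output n c \<omega>) \<noteq> msg \<omega>} \<omega> \<partial>outcome_space g R' R n)"
    by (subst nn_integral_indicator[symmetric])
      (auto intro!: nn_integral_cong simp: indicator_def simp del: nn_integral_indicator)
  also have "\<dots> = (\<Sum>w\<in>index_set n R. \<Sum>m\<in>index_set n R'.
      \<integral>\<^sup>+y. ennreal (gauss n 1 (channel_input c w m) y) * indicator {y. decoder c y \<noteq> w} y \<partial>lebesgue_seq n)
    * ennreal (1 / (real (card (index_set n R)) * real (card (index_set n R'))))"
    using assms(1,2)
  proof (subst nn_integral_outcome[OF assms(1,2) ind], intro arg_cong2[where f="(*)"] sum.cong refl)
    fix w m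
    show "(\<integral>\<^sup>+ny. \<integral>\<^sup>+nz. indicator {\<omega>. decoder c (dest_output n c \<omega>) \<noteq> msg \<omega>} (w, m, ny, nz)
        \<partial>gaussian_noise n (1 - g) \<partial>gaussian_noise n 1)
      = (\<integral>\<^sup>+y. ennreal (gauss n 1 (channel_input c w m) y) * indicator {y. decoder c y \<noteq> w} y \<partial>lebesgue_seq n)"
      by (subst nn_integral_add_noise[symmetric])
        (auto simp: indicator_def dest_output_eq msg_def Z.emeasure_space_1[simplified] intro!: nn_integral_cong)
  qed
  also have "\<dots> \<le> ennreal (\<epsilon> * (card (index_set n R) * card (index_set n R')))
    * ennreal (1 / (real (card (index_set n R)) * real (card (index_set n R'))))"
    using le by (rule mult_right_mono) simp
  also have "\<dots> = ennreal \<epsilon>"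
    using card_index_set_pos[OF assms(3), of n] card_index_set_pos[OF assms(4), of n] assms(5)
    by (subst ennreal_mult'[symmetric]) auto
  finally have "ennreal (O.prob ?E) \<le> ennreal \<epsilon>"
    unfolding O.emeasure_eq_measure .
  then show "error_prob g R' R n c \<le> \<epsilon>" "0 \<le> error_prob g R' R n c"
    using assms(5) by (auto simp: error_prob_def)
qed

section \<open>Leakage bounded by relative entropies\<close>

lemma integral_le_nn_integral:
  assumes "(\<integral>\<^sup>+x. ennreal (f x) \<partial>M) \<le> ennreal B" "B \<ge> 0"
  shows "integral\<^sup>L M f \<le> B"
proof (cases "integrable M f")
  case True
  then have "integral\<^sup>L M f = enn2real (\<integral>\<^sup>+x. ennreal (f x) \<partial>M) - enn2real (\<integral>\<^sup>+x. ennreal (- f x) \<partial>M)"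
    by (rule real_lebesgue_integral_def)
  also have "\<dots> \<le> enn2real (\<integral>\<^sup>+x. ennreal (f x) \<partial>M)"
    by simp
  also have "\<dots> \<le> B"
    using enn2real_mono[OF assms(1)] assms(2) by simp
  finally show ?thesis .
\<comment> \<open>The Bochner integral of a non-integrable function is 0 by convention; in that case
  the bound rests on \<open>B \<ge> 0\<close>.\<close>
qed (use assms(2) in \<open>simp add: not_integrable_integral_eq\<close>)

text \<open>The law of the eavesdropper's output given W = w: a uniform mixture over the fictitious
  message of unit-variance Gaussians.\<close>

definition eve_density :: "real \<Rightarrow> real \<Rightarrow> nat \<Rightarrow> secrecy_code \<Rightarrow> nat \<Rightarrow> (nat \<Rightarrow> real) \<Rightarrow> real" where
  "eve_density g R' n c w z =
     (\<Sum>m\<in>index_set n R'. gauss n 1 (\<lambda>i. sqrt g * channel_input c w m i) z) / real (card (index_set n R'))"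

lemma measurable_eve_density [measurable]: "eve_density g R' n c w \<in> borel_measurable (seq_space n)"
  unfolding eve_density_def[abs_def] by measurable

lemma eve_density_pos: "R' \<ge> 0 \<Longrightarrow> 0 < eve_density g R' n c w z"
  using index_set_nonempty[of R' n]
  by (auto simp: eve_density_def card_gt_0_iff intro!: divide_pos_pos sum_pos gauss_pos)

lemma nn_integral_eve_density:
  assumes "R' \<ge> 0"
  shows "(\<integral>\<^sup>+z. ennreal (eve_density g R' n c w z) \<partial>lebesgue_seq n) = 1"
proof -
  have "(\<integral>\<^sup>+z. ennreal (eve_density g R' n c w z) \<partial>lebesgue_seq n)
    = (\<integral>\<^sup>+z. (\<Sum>m\<in>index_set n R'. ennreal (gauss n 1 (\<lambda>i. sqrt g * channel_input c w m i) z))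
        * ennreal (1 / real (card (index_set n R'))) \<partial>lebesgue_seq n)"
    unfolding eve_density_def
    by (intro nn_integral_cong) (subst sum_ennreal, auto simp: ennreal_mult''[symmetric] sum_nonneg)
  also have "\<dots> = ennreal (card (index_set n R')) * ennreal (1 / real (card (index_set n R')))"
    by (subst nn_integral_multc)
      (auto simp: nn_integral_sum ennreal_of_nat_eq_real_of_nat simp del: sum_ennreal)
  also have "\<dots> = 1"
    using card_index_set_pos[OF assms, of n] by (subst ennreal_mult'[symmetric]) auto
  finally show ?thesis .
qed

text \<open>The joint law and both marginals, given by densities, are the input of the density
  formula for mutual information.\<close>

lemma distributed_msg_eve:
  fixes n :: nat
  assumes "0 \<le> g" "g < 1" "R \<ge> 0" "R' \<ge> 0"
  defines "K \<equiv> real (card (index_set n R))"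
  shows "distributed (outcome_space g R' R n) (count_space (index_set n R) \<Otimes>\<^sub>M lebesgue_seq n)
      (\<lambda>\<omega>. (msg \<omega>, eve_output g n c \<omega>)) (\<lambda>(w, z). ennreal (eve_density g R' n c w z / K))" (is ?joint)
    and "distributed (outcome_space g R' R n) (count_space (index_set n R)) msg (\<lambda>w. ennreal (1 / K))" (is ?W)
    and "distributed (outcome_space g R' R n) (lebesgue_seq n) (eve_output g n c)
      (\<lambda>z. ennreal ((\<Sum>w\<in>index_set n R. eve_density g R' n c w z) / K))" (is ?Z)
proof -
  let ?I = "index_set n R"
  have K: "K > 0" unfolding K_def using card_index_set_pos[OF assms(3)] by simp
  have meas[measurable]: "(\<lambda>(w, z). ennreal (eve_density g R' n c w z / K)) \<in> borel_measurable (count_space ?I \<Otimes>\<^sub>M seq_space n)"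
    by (rule measurable_pair_measure_countable1) (auto intro: countable_finite)
  \<comment> \<open>One change of variables for functions of message and output; the three laws
    below are its instances for indicators.\<close>
  have law: "(\<integral>\<^sup>+\<omega>. f (msg \<omega>) (eve_output g n c \<omega>) \<partial>outcome_space g R' R n)
    = (\<Sum>w\<in>?I. \<integral>\<^sup>+z. ennreal (eve_density g R' n c w z / K) * f w z \<partial>lebesgue_seq n)"
    if f: "\<And>w. f w \<in> borel_measurable (seq_space n)" for f :: "nat \<Rightarrow> (nat \<Rightarrow> real) \<Rightarrow> ennreal"
  proof -
    note f[measurable]
    have fm: "(\<lambda>\<omega>. f (msg \<omega>) (eve_output g n c \<omega>)) \<in> borel_measurable (outcome_space g R' R n)"
      by (rule measurable_outcome) (unfold msg_def eve_output_eq prod.case, measurable)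
    have "(\<integral>\<^sup>+\<omega>. f (msg \<omega>) (eve_output g n c \<omega>) \<partial>outcome_space g R' R n)
      = (\<Sum>w\<in>?I. \<Sum>m\<in>index_set n R'. \<integral>\<^sup>+z. ennreal (gauss n 1 (\<lambda>i. sqrt g * channel_input c w m i) z) * f w z \<partial>lebesgue_seq n)
        * ennreal (1 / (K * real (card (index_set n R'))))"
      unfolding nn_integral_outcome[OF assms(1,2) fm] K_def
      by (simp add: msg_def eve_output_eq nn_integral_degraded_noise[OF assms(1,2) f])
    also have "\<dots> = (\<Sum>w\<in>?I. \<integral>\<^sup>+z. ennreal (eve_density g R' n c w z / K) * f w z \<partial>lebesgue_seq n)"
      unfolding sum_distrib_right
    proof (rule sum.cong[OF refl], unfold sum_distrib_right[symmetric])
      fix w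
      have "(\<Sum>m\<in>index_set n R'. \<integral>\<^sup>+z. ennreal (gauss n 1 (\<lambda>i. sqrt g * channel_input c w m i) z) * f w z \<partial>lebesgue_seq n)
        * ennreal (1 / (K * real (card (index_set n R'))))
        = (\<integral>\<^sup>+z. (\<Sum>m\<in>index_set n R'. ennreal (gauss n 1 (\<lambda>i. sqrt g * channel_input c w m i) z) * f w z)
        * ennreal (1 / (K * real (card (index_set n R')))) \<partial>lebesgue_seq n)"
        by (subst nn_integral_multc) (auto simp: nn_integral_sum)
      also have "\<dots> = (\<integral>\<^sup>+z. ennreal (eve_density g R' n c w z / K) * f w z \<partial>lebesgue_seq n)"
      proof (rule nn_integral_cong)
        fix z
        have e: "eve_density g R' n c w z / K
          = (\<Sum>m\<in>index_set n R'. gauss n 1 (\<lambda>i. sqrt g * channel_input c w m i) z) * (1 / (K * real (card (index_set n R'))))"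
          by (simp add: eve_density_def mult.commute)
        show "(\<Sum>m\<in>index_set n R'. ennreal (gauss n 1 (\<lambda>i. sqrt g * channel_input c w m i) z) * f w z)
          * ennreal (1 / (K * real (card (index_set n R')))) = ennreal (eve_density g R' n c w z / K) * f w z"
          unfolding e sum_distrib_right[symmetric]
          by (subst ennreal_mult'') (use K in \<open>auto simp: mult_ac\<close>)
      qed
      finally show "(\<Sum>m\<in>index_set n R'. \<integral>\<^sup>+z. ennreal (gauss n 1 (\<lambda>i. sqrt g * channel_input c w m i) z) * f w z \<partial>lebesgue_seq n)
        * ennreal (1 / (K * real (card (index_set n R')))) = \<dots>" .
    qed
    finally show ?thesis .
  qed
  have d: "eve_density g R' n c w z / K \<ge> 0" for w z
    using eve_density_pos[OF assms(4), of g n c w z] K by simp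
  show ?joint
    unfolding distributed_def
  proof (intro conjI measure_eqI)
    fix A assume "A \<in> sets (distr (outcome_space g R' R n) (count_space ?I \<Otimes>\<^sub>M lebesgue_seq n) (\<lambda>\<omega>. (msg \<omega>, eve_output g n c \<omega>)))"
    then have "A \<in> sets (count_space ?I \<Otimes>\<^sub>M lebesgue_seq n)" by simp
    also have "\<dots> = sets (count_space ?I \<Otimes>\<^sub>M seq_space n)"
      by (rule sets_pair_measure_cong) auto
    finally have A[measurable]: "A \<in> sets (count_space ?I \<Otimes>\<^sub>M seq_space n)" .
    have A': "Pair w -` A \<in> sets (seq_space n)" for w
      using A by (rule sets_Pair1)
    have "emeasure (distr (outcome_space g R' R n) (count_space ?I \<Otimes>\<^sub>M lebesgue_seq n) (\<lambda>\<omega>. (msg \<omega>, eve_output g n c \<omega>))) A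
      = (\<integral>\<^sup>+\<omega>. indicator (Pair (msg \<omega>) -` A) (eve_output g n c \<omega>) \<partial>outcome_space g R' R n)"
      by (subst emeasure_distr)
        (auto simp: nn_integral_indicator[symmetric] indicator_def simp del: nn_integral_indicator
          intro!: nn_integral_cong cong: sets_pair_measure_cong)
    also have "\<dots> = (\<Sum>w\<in>?I. \<integral>\<^sup>+z. ennreal (eve_density g R' n c w z / K) * indicator (Pair w -` A) z \<partial>lebesgue_seq n)"
      by (rule law) (rule borel_measurable_indicator[OF A'])
    also have "\<dots> = (\<integral>\<^sup>+w. \<integral>\<^sup>+z. (\<lambda>(w, z). ennreal (eve_density g R' n c w z / K) * indicator A (w, z)) (w, z) \<partial>lebesgue_seq n \<partial>count_space ?I)"
      by (subst nn_integral_count_space_finite) (auto simp: indicator_def intro!: sum.cong nn_integral_cong)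
    also have "\<dots> = (\<integral>\<^sup>+x. (\<lambda>(w, z). ennreal (eve_density g R' n c w z / K) * indicator A (w, z)) x \<partial>(count_space ?I \<Otimes>\<^sub>M lebesgue_seq n))"
    proof (rule lebesgue_seq_sigma_finite.nn_integral_fst)
      have "(\<lambda>x. (\<lambda>(w, z). ennreal (eve_density g R' n c w z / K)) x * indicator A x) \<in> borel_measurable (count_space ?I \<Otimes>\<^sub>M seq_space n)"
        by measurable
      then show "(\<lambda>(w, z). ennreal (eve_density g R' n c w z / K) * indicator A (w, z)) \<in> borel_measurable (count_space ?I \<Otimes>\<^sub>M lebesgue_seq n)"
        by (simp add: case_prod_beta' cong: measurable_cong_sets sets_pair_measure_cong)
    qed
    finally show "emeasure (distr (outcome_space g R' R n) (count_space ?I \<Otimes>\<^sub>M lebesgue_seq n) (\<lambda>\<omega>. (msg \<omega>, eve_output g n c \<omega>))) A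
      = emeasure (density (count_space ?I \<Otimes>\<^sub>M lebesgue_seq n) (\<lambda>(w, z). ennreal (eve_density g R' n c w z / K))) A"
      by (subst emeasure_density) (auto simp: case_prod_beta')
  qed (auto cong: sets_pair_measure_cong)
  show ?W
    unfolding distributed_def
  proof (intro conjI measure_eqI)
    fix A assume "A \<in> sets (distr (outcome_space g R' R n) (count_space ?I) msg)"
    then have A[measurable]: "A \<in> sets (count_space ?I)" by simp
    have "emeasure (distr (outcome_space g R' R n) (count_space ?I) msg) A = (\<integral>\<^sup>+\<omega>. indicator A (msg \<omega>) \<partial>outcome_space g R' R n)"
      by (subst emeasure_distr)
        (use A in \<open>auto simp: nn_integral_indicator[symmetric] indicator_def simp del: nn_integral_indicator intro!: nn_integral_cong\<close>)
    also have "\<dots> = (\<Sum>w\<in>?I. \<integral>\<^sup>+z. ennreal (eve_density g R' n c w z / K) * indicator A w \<partial>lebesgue_seq n)"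
      by (rule law[where f="\<lambda>w z. indicator A w"]) auto
    also have "\<dots> = (\<Sum>w\<in>?I. ennreal (1 / K) * indicator A w)"
    proof (intro sum.cong refl)
      fix w
      have "(\<integral>\<^sup>+z. ennreal (eve_density g R' n c w z / K) * indicator A w \<partial>lebesgue_seq n)
        = (\<integral>\<^sup>+z. ennreal (eve_density g R' n c w z) * (ennreal (1 / K) * indicator A w) \<partial>lebesgue_seq n)"
        using K eve_density_pos[OF assms(4), THEN less_imp_le]
        by (intro nn_integral_cong) (auto simp: ennreal_mult''[symmetric] mult.assoc[symmetric])
      also have "\<dots> = ennreal (1 / K) * indicator A w"
        by (subst nn_integral_multc) (auto simp: nn_integral_eve_density[OF assms(4)])
      finally show "(\<integral>\<^sup>+z. ennreal (eve_density g R' n c w z / K) * indicator A w \<partial>lebesgue_seq n) = \<dots>" .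
    qed
    finally show "emeasure (distr (outcome_space g R' R n) (count_space ?I) msg) A
      = emeasure (density (count_space ?I) (\<lambda>w. ennreal (1 / K))) A"
      using A by (subst emeasure_density) (auto simp: nn_integral_count_space_finite)
  qed auto
  show ?Z
    unfolding distributed_def
  proof (intro conjI measure_eqI)
    fix A assume "A \<in> sets (distr (outcome_space g R' R n) (lebesgue_seq n) (eve_output g n c))"
    then have A[measurable]: "A \<in> sets (seq_space n)" by simp
    have "emeasure (distr (outcome_space g R' R n) (lebesgue_seq n) (eve_output g n c)) A
      = (\<integral>\<^sup>+\<omega>. indicator A (eve_output g n c \<omega>) \<partial>outcome_space g R' R n)"
      by (subst emeasure_distr)
        (auto simp: nn_integral_indicator[symmetric] indicator_def simp del: nn_integral_indicator intro!: nn_integral_cong)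
    also have "\<dots> = (\<Sum>w\<in>?I. \<integral>\<^sup>+z. ennreal (eve_density g R' n c w z / K) * indicator A z \<partial>lebesgue_seq n)"
      by (rule law[where f="\<lambda>w. indicator A"]) auto
    also have "\<dots> = (\<integral>\<^sup>+z. ennreal ((\<Sum>w\<in>?I. eve_density g R' n c w z) / K) * indicator A z \<partial>lebesgue_seq n)"
      by (subst nn_integral_sum[symmetric])
        (auto intro!: nn_integral_cong simp: sum_divide_distrib sum_distrib_right[symmetric] sum_ennreal[OF d])
    finally show "emeasure (distr (outcome_space g R' R n) (lebesgue_seq n) (eve_output g n c)) A
      = emeasure (density (lebesgue_seq n) (\<lambda>z. ennreal ((\<Sum>w\<in>?I. eve_density g R' n c w z) / K))) A"
      by (subst emeasure_density) auto
  qed auto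
qed


text \<open>I(W;Z) is the average over w of D(p_w || s), where s is the mean of the p_w. Replacing s
  by another reference density q can only increase this average, up to the additive constant 1, so
  relative entropies to a fixed law suffice. The function \<open>u\<close> dominates the positive
  part of the integrand, which keeps the estimate within nonnegative integrals.\<close>

lemma leakage_le:
  fixes B :: real
  assumes "0 \<le> g" "g < 1" "R \<ge> 0" "R' \<ge> 0" "B \<ge> 0"
    and q: "\<And>z. q z > 0" "q \<in> borel_measurable (seq_space n)" "(\<integral>\<^sup>+z. ennreal (q z) \<partial>lebesgue_seq n) \<le> 1"
    and u[measurable]: "\<And>w. u w \<in> borel_measurable (seq_space n)"
    and le: "\<And>w z. w \<in> index_set n R \<Longrightarrow>
      ennreal (eve_density g R' n c w z * ln (eve_density g R' n c w z / q z)) \<le> u w z"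
    and B: "(\<Sum>w\<in>index_set n R. \<integral>\<^sup>+z. u w z \<partial>lebesgue_seq n) \<le> ennreal (B * card (index_set n R))"
  shows "leakage g R' R n c \<le> (B + 1) / ln 2" and "0 \<le> leakage g R' R n c"
proof -
  interpret O: prob_space "outcome_space g R' R n"
    using assms by (intro prob_space_outcome_space)
  interpret O: information_space "outcome_space g R' R n" 2
    by standard simp
  let ?I = "index_set n R"
  let ?L = "lebesgue_seq n"
  define K where "K = real (card ?I)"
  have K: "K > 0" unfolding K_def using card_index_set_pos[OF assms(3)] by simp
  define p where "p = eve_density g R' n c"
  have [measurable]: "p w \<in> borel_measurable (seq_space n)" for w unfolding p_def by measurable
  have p: "p w z > 0" for w z unfolding p_def using assms by (intro eve_density_pos)
  define s where "s z = (\<Sum>w\<in>?I. p w z) / K" for z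
  have [measurable]: "s \<in> borel_measurable (seq_space n)" unfolding s_def[abs_def] by measurable
  note q(2)[measurable]
  have s: "s z > 0" for z
    unfolding s_def using p K index_set_nonempty[OF assms(3), of n] by (auto intro!: divide_pos_pos sum_pos)
  define f where "f x = (case x of (w, z) \<Rightarrow> p w z / K) * log 2 ((case x of (w, z) \<Rightarrow> p w z / K) / (1 / K * s (snd x)))"
    for x :: "nat \<times> (nat \<Rightarrow> real)"
  note D = distributed_msg_eve(1)[OF assms(1-4), where c=c and n=n, folded K_def p_def]
    distributed_msg_eve(2)[OF assms(1-4), where n=n, folded K_def]
    distributed_msg_eve(3)[OF assms(1-4), where c=c and n=n, folded K_def p_def, folded s_def]
  \<comment> \<open>Mutual information sees the target spaces only through their sigma-algebras, so
    \<open>borel\<close> may be exchanged for Lebesgue measure, which carries the densities.\<close>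
  have "distr (outcome_space g R' R n) (seq_space n) (eve_output g n c)
      = distr (outcome_space g R' R n) ?L (eve_output g n c)"
    by (intro distr_cong) auto
  moreover have "distr (outcome_space g R' R n) (count_space ?I \<Otimes>\<^sub>M seq_space n) (\<lambda>x. (msg x, eve_output g n c x))
      = distr (outcome_space g R' R n) (count_space ?I \<Otimes>\<^sub>M ?L) (\<lambda>x. (msg x, eve_output g n c x))"
    by (intro distr_cong sets_pair_measure_cong) auto
  ultimately have "leakage g R' R n c = O.mutual_information 2 (count_space ?I) ?L msg (eve_output g n c)"
    unfolding leakage_def O.mutual_information_def by simp
  also have "\<dots> = integral\<^sup>L (count_space ?I \<Otimes>\<^sub>M ?L) f"
    unfolding f_def
  proof (rule O.mutual_information_distr)
    show "sigma_finite_measure (count_space ?I)" by (intro sigma_finite_measure_count_space_finite) simp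
    show "sigma_finite_measure ?L" by (rule lebesgue_seq_sigma_finite.sigma_finite_measure_axioms)
    show "distributed (outcome_space g R' R n) (count_space ?I) msg (\<lambda>x. ennreal (1 / K))" by (rule D)
    show "distributed (outcome_space g R' R n) ?L (eve_output g n c) (\<lambda>x. ennreal (s x))" by (rule D)
    show "distributed (outcome_space g R' R n) (count_space ?I \<Otimes>\<^sub>M ?L) (\<lambda>x. (msg x, eve_output g n c x))
      (\<lambda>x. ennreal (case x of (w, z) \<Rightarrow> p w z / K))"
      using D(1) by (simp add: case_prod_beta')
  qed (use K p s in \<open>auto simp: less_imp_le\<close>)
  finally have leak: "leakage g R' R n c = integral\<^sup>L (count_space ?I \<Otimes>\<^sub>M ?L) f" .

  have f_eq: "f (w, z) = p w z * ln (p w z / s z) / (K * ln 2)" for w z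
    using K p s by (simp add: f_def log_def)
  have fm: "(\<lambda>x. ennreal (f x)) \<in> borel_measurable (count_space ?I \<Otimes>\<^sub>M ?L)"
    by (rule measurable_pair_measure_countable1) (auto simp: f_eq intro: countable_finite)
  \<comment> \<open>Using ln x \<le> x rather than ln x \<le> x - 1 keeps the correction
    nonnegative; summed over w it becomes K * q, the source of the constant 1 in the bound.\<close>
  have gibbs: "p w z * ln (p w z / s z) \<le> p w z * ln (p w z / q z) + p w z * q z / s z" for w z
  proof -
    have "ln (q z / s z) \<le> q z / s z"
      using ln_le_minus_one[of "q z / s z"] q(1)[of z] s[of z] by simp
    then have "p w z * ln (q z / s z) \<le> p w z * (q z / s z)"
      using p[of w z] by (intro mult_left_mono) auto
    moreover have "ln (p w z / s z) = ln (p w z / q z) + ln (q z / s z)"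
      using p[of w z] q(1)[of z] s[of z] by (simp add: ln_div)
    ultimately show ?thesis by (simp add: distrib_left)
  qed
  have "(\<integral>\<^sup>+x. ennreal (f x) \<partial>(count_space ?I \<Otimes>\<^sub>M ?L)) = (\<Sum>w\<in>?I. \<integral>\<^sup>+z. ennreal (f (w, z)) \<partial>?L)"
    by (subst lebesgue_seq_sigma_finite.nn_integral_fst[OF fm, symmetric])
      (simp add: nn_integral_count_space_finite)
  also have "\<dots> \<le> (\<Sum>w\<in>?I. \<integral>\<^sup>+z. (u w z + ennreal (p w z * q z / s z)) * ennreal (1 / (K * ln 2)) \<partial>?L)"
  proof (intro sum_mono nn_integral_mono)
    fix w z assume w: "w \<in> ?I"
    have "ennreal (f (w, z)) \<le> ennreal ((p w z * ln (p w z / q z) + p w z * q z / s z) * (1 / (K * ln 2)))"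
      unfolding f_eq using gibbs[of w z] K by (intro ennreal_leI) (simp add: divide_right_mono)
    also have "\<dots> = ennreal (p w z * ln (p w z / q z) + p w z * q z / s z) * ennreal (1 / (K * ln 2))"
      using K by (intro ennreal_mult'') simp
    also have "\<dots> \<le> (ennreal (p w z * ln (p w z / q z)) + ennreal (p w z * q z / s z)) * ennreal (1 / (K * ln 2))"
    proof (intro mult_right_mono)
      have b: "0 \<le> p w z * q z / s z" using p[of w z] q(1)[of z] s[of z] by simp
      show "ennreal (p w z * ln (p w z / q z) + p w z * q z / s z)
        \<le> ennreal (p w z * ln (p w z / q z)) + ennreal (p w z * q z / s z)"
      proof (cases "0 \<le> p w z * ln (p w z / q z)")
        case True
        then show ?thesis using b by (simp add: ennreal_plus)
      next
        case False
        then have "ennreal (p w z * ln (p w z / q z) + p w z * q z / s z) \<le> ennreal (p w z * q z / s z)"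
          by (intro ennreal_leI) simp
        then show ?thesis by (simp add: add_increasing)
      qed
    qed simp
    also have "\<dots> \<le> (u w z + ennreal (p w z * q z / s z)) * ennreal (1 / (K * ln 2))"
      using le[OF w, of z] unfolding p_def[symmetric] by (intro mult_right_mono add_right_mono) simp_all
    finally show "ennreal (f (w, z)) \<le> \<dots>" .
  qed
  also have "\<dots> = ((\<Sum>w\<in>?I. \<integral>\<^sup>+z. u w z \<partial>?L) + (\<integral>\<^sup>+z. (\<Sum>w\<in>?I. ennreal (p w z * q z / s z)) \<partial>?L)) * ennreal (1 / (K * ln 2))"
    by (simp add: nn_integral_multc nn_integral_add sum_distrib_right[symmetric] sum.distrib nn_integral_sum
        del: sum_ennreal)
  \<comment> \<open>The p_w add up to K * s, so s cancels.\<close>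
  also have "(\<lambda>z. \<Sum>w\<in>?I. ennreal (p w z * q z / s z)) = (\<lambda>z. ennreal K * ennreal (q z))"
  proof
    fix z
    have "(\<Sum>w\<in>?I. ennreal (p w z * q z / s z)) = ennreal (\<Sum>w\<in>?I. p w z * (q z / s z))"
      using p s q(1) by (subst sum_ennreal) (auto simp: less_imp_le)
    also have "(\<Sum>w\<in>?I. p w z * (q z / s z)) = K * q z"
      unfolding sum_distrib_right[symmetric] using K s[of z] by (simp add: s_def field_simps)
    finally show "(\<Sum>w\<in>?I. ennreal (p w z * q z / s z)) = ennreal K * ennreal (q z)"
      using K q(1) by (simp add: ennreal_mult less_imp_le)
  qed
  also have "((\<Sum>w\<in>?I. \<integral>\<^sup>+z. u w z \<partial>?L) + (\<integral>\<^sup>+z. ennreal K * ennreal (q z) \<partial>?L)) * ennreal (1 / (K * ln 2))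
    \<le> (ennreal (B * K) + ennreal K * 1) * ennreal (1 / (K * ln 2))"
  proof (intro mult_right_mono add_mono)
    show "(\<Sum>w\<in>?I. \<integral>\<^sup>+z. u w z \<partial>?L) \<le> ennreal (B * K)"
      using B by (simp add: K_def)
    show "(\<integral>\<^sup>+z. ennreal K * ennreal (q z) \<partial>?L) \<le> ennreal K * 1"
      by (subst nn_integral_cmult) (measurable, intro mult_left_mono q, simp)
  qed simp
  also have "\<dots> = ennreal ((B + 1) / ln 2)"
    using K assms(5) by (simp add: ennreal_plus[symmetric] ennreal_mult''[symmetric] del: ennreal_plus)
      (simp add: field_simps)
  finally show "leakage g R' R n c \<le> (B + 1) / ln 2"
    unfolding leak using assms(5) by (intro integral_le_nn_integral) auto
  \<comment> \<open>Nonnegativity of relative entropy in the integrable case; otherwise the integral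
    is 0 by convention.\<close>
  show "0 \<le> leakage g R' R n c"
  proof (cases "integrable (count_space ?I \<Otimes>\<^sub>M ?L) f")
    case True
    have "0 \<le> O.mutual_information 2 (count_space ?I) ?L msg (eve_output g n c)"
    proof (rule O.mutual_information_nonneg)
      show "sigma_finite_measure (count_space ?I)" by (intro sigma_finite_measure_count_space_finite) simp
      show "sigma_finite_measure ?L" by (rule lebesgue_seq_sigma_finite.sigma_finite_measure_axioms)
      show "distributed (outcome_space g R' R n) (count_space ?I) msg (\<lambda>x. ennreal (1 / K))" by (rule D)
      show "distributed (outcome_space g R' R n) ?L (eve_output g n c) (\<lambda>x. ennreal (s x))" by (rule D)
      show "distributed (outcome_space g R' R n) (count_space ?I \<Otimes>\<^sub>M ?L) (\<lambda>x. (msg x, eve_output g n c x))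
        (\<lambda>x. ennreal (case x of (w, z) \<Rightarrow> p w z / K))"
        using D(1) by (simp add: case_prod_beta')
      show "integrable (count_space ?I \<Otimes>\<^sub>M ?L)
        (\<lambda>x. (case x of (w, z) \<Rightarrow> p w z / K) * log 2 ((case x of (w, z) \<Rightarrow> p w z / K) / (1 / K * s (snd x))))"
        using True by (simp add: f_def[abs_def])
    qed (use K p s in \<open>auto simp: less_imp_le\<close>)
    then show ?thesis
      using \<open>leakage g R' R n c = O.mutual_information 2 (count_space ?I) ?L msg (eve_output g n c)\<close> by simp
  qed (simp add: leak not_integrable_integral_eq)
qed


section \<open>Two-layer random codebooks\<close>

text \<open>Redrawing one coordinate does not change the law of the family. Expectations can thus be
  bounded one codeword at a time with the others frozen, without splitting the index set each
  time.\<close>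

lemma nn_integral_PiM_resample:
  assumes "finite J" "i \<in> J" "\<And>j. prob_space (M j)"
    and [measurable]: "F \<in> borel_measurable (Pi\<^sub>M J M)"
  shows "(\<integral>\<^sup>+\<omega>. F \<omega> \<partial>Pi\<^sub>M J M) = (\<integral>\<^sup>+\<omega>. \<integral>\<^sup>+x. F (fun_upd \<omega> i x) \<partial>M i \<partial>Pi\<^sub>M J M)"
proof -
  interpret product_prob_space M by (intro product_prob_spaceI assms)
  define I where "I = J - {i}"
  have J: "J = insert i I" "finite I" "i \<notin> I" using assms by (auto simp: I_def)
  have [measurable]: "(\<lambda>\<omega>. \<integral>\<^sup>+x. F (fun_upd \<omega> i x) \<partial>M i) \<in> borel_measurable (Pi\<^sub>M J M)"
  proof (rule M.borel_measurable_nn_integral)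
    have "(\<lambda>p. fun_upd (fst p) i (snd p)) \<in> measurable (Pi\<^sub>M J M \<Otimes>\<^sub>M M i) (Pi\<^sub>M J M)"
      by (rule measurable_fun_upd[where J=J]) (use assms(2) in auto)
    then show "(\<lambda>(\<omega>, x). F (fun_upd \<omega> i x)) \<in> borel_measurable (Pi\<^sub>M J M \<Otimes>\<^sub>M M i)"
      by (simp add: case_prod_beta') measurable
  qed
  \<comment> \<open>The redrawn value overwrites the old one, so the integral over the old value is
    that of a constant.\<close>
  have "(\<integral>\<^sup>+\<omega>. \<integral>\<^sup>+x. F (fun_upd \<omega> i x) \<partial>M i \<partial>Pi\<^sub>M J M)
    = (\<integral>\<^sup>+\<omega>. \<integral>\<^sup>+x'. \<integral>\<^sup>+x. F (fun_upd (fun_upd \<omega> i x') i x) \<partial>M i \<partial>M i \<partial>Pi\<^sub>M I M)"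
    unfolding J(1) using J by (subst product_nn_integral_insert) (auto simp flip: J(1))
  also have "\<dots> = (\<integral>\<^sup>+\<omega>. \<integral>\<^sup>+x. F (fun_upd \<omega> i x) \<partial>M i \<partial>Pi\<^sub>M I M)"
    by (simp add: M.emeasure_space_1)
  also have "\<dots> = (\<integral>\<^sup>+\<omega>. F \<omega> \<partial>Pi\<^sub>M J M)"
    unfolding J(1) using J by (subst product_nn_integral_insert) (auto simp flip: J(1))
  finally show ?thesis by simp
qed

lemma nn_integral_PiM_resample_le:
  assumes "finite J" "i \<in> J" "\<And>j. prob_space (M j)" "F \<in> borel_measurable (Pi\<^sub>M J M)"
    and "\<And>\<omega>. \<omega> \<in> space (Pi\<^sub>M J M) \<Longrightarrow> (\<integral>\<^sup>+x. F (fun_upd \<omega> i x) \<partial>M i) \<le> F' \<omega>"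
  shows "(\<integral>\<^sup>+\<omega>. F \<omega> \<partial>Pi\<^sub>M J M) \<le> (\<integral>\<^sup>+\<omega>. F' \<omega> \<partial>Pi\<^sub>M J M)"
  unfolding nn_integral_PiM_resample[OF assms(1-4)] by (intro nn_integral_mono assms(5))

text \<open>A two-layer random codebook: codewords of the first layer are drawn from \<open>\<nu>1\<close>, those of the second
  from \<open>\<nu>2\<close>, and only pairs satisfying \<open>G\<close> are ever used. The kernel \<open>\<phi>\<close> is the channel density,
  \<open>Q0\<close>, \<open>Q1\<close>, \<open>Q2\<close> are the output densities given nothing, the first and the second codeword.\<close>

locale codebook_kernel =
  fixes X :: "'x measure" and L :: "'y measure" and \<nu>1 \<nu>2 :: "'x measure"
    and G :: "'x \<Rightarrow> 'x \<Rightarrow> bool" and \<phi> :: "'x \<Rightarrow> 'x \<Rightarrow> 'y \<Rightarrow> real"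
    and Q0 :: "'y \<Rightarrow> real" and Q1 Q2 :: "'x \<Rightarrow> 'y \<Rightarrow> real" and c D :: real
  assumes sigma_finite_L: "sigma_finite_measure L"
    and prob1: "prob_space \<nu>1" and prob2: "prob_space \<nu>2"
    and sets1 [measurable_cong]: "sets \<nu>1 = sets X" and sets2 [measurable_cong]: "sets \<nu>2 = sets X"
    and G_meas: "Measurable.pred (X \<Otimes>\<^sub>M X) (\<lambda>x. G (fst x) (snd x))"
    and \<phi>_meas: "(\<lambda>x. \<phi> (fst x) (fst (snd x)) (snd (snd x))) \<in> borel_measurable (X \<Otimes>\<^sub>M X \<Otimes>\<^sub>M L)"
    and Q0_meas [measurable]: "Q0 \<in> borel_measurable L"
    and Q1_meas: "(\<lambda>x. Q1 (fst x) (snd x)) \<in> borel_measurable (X \<Otimes>\<^sub>M L)"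
    and Q2_meas: "(\<lambda>x. Q2 (fst x) (snd x)) \<in> borel_measurable (X \<Otimes>\<^sub>M L)"
    and nonneg: "\<And>x1 x2 y. 0 \<le> \<phi> x1 x2 y"
    and pos: "\<And>y. 0 < Q0 y" "\<And>x y. 0 < Q1 x y" "\<And>x y. 0 < Q2 x y" "0 < c" "0 < D"
    and kernel1: "\<And>x1 y. x1 \<in> space X \<Longrightarrow> y \<in> space L \<Longrightarrow>
      (\<integral>\<^sup>+x2. ennreal (of_bool (G x1 x2) * \<phi> x1 x2 y) \<partial>\<nu>2) \<le> ennreal (D * Q1 x1 y)"
    and kernel2: "\<And>x2 y. x2 \<in> space X \<Longrightarrow> y \<in> space L \<Longrightarrow>
      (\<integral>\<^sup>+x1. ennreal (of_bool (G x1 x2) * \<phi> x1 x2 y) \<partial>\<nu>1) \<le> ennreal (D * Q2 x2 y)"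
    and marginal1: "\<And>y. y \<in> space L \<Longrightarrow> (\<integral>\<^sup>+x. ennreal (Q1 x y) \<partial>\<nu>1) \<le> ennreal (c * Q0 y)"
    and marginal2: "\<And>y. y \<in> space L \<Longrightarrow> (\<integral>\<^sup>+x. ennreal (Q2 x y) \<partial>\<nu>2) \<le> ennreal (c * Q0 y)"
    and Q0_le: "(\<integral>\<^sup>+y. ennreal (Q0 y) \<partial>L) \<le> 1"
begin

lemma G_measurable [measurable (raw)]:
  "f \<in> measurable N X \<Longrightarrow> g \<in> measurable N X \<Longrightarrow> Measurable.pred N (\<lambda>x. G (f x) (g x))"
  using measurable_compose[OF measurable_Pair G_meas, of f N g] by simp

lemma \<phi>_measurable [measurable (raw)]:
  assumes "f \<in> measurable N X" "g \<in> measurable N X" "h \<in> measurable N L"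
  shows "(\<lambda>x. \<phi> (f x) (g x) (h x)) \<in> borel_measurable N"
  using measurable_compose[OF measurable_Pair[OF assms(1) measurable_Pair[OF assms(2,3)]] \<phi>_meas] by simp

lemma Q1_measurable [measurable (raw)]:
  "f \<in> measurable N X \<Longrightarrow> h \<in> measurable N L \<Longrightarrow> (\<lambda>x. Q1 (f x) (h x)) \<in> borel_measurable N"
  using measurable_compose[OF measurable_Pair Q1_meas, of f N h] by simp

lemma Q2_measurable [measurable (raw)]:
  "f \<in> measurable N X \<Longrightarrow> h \<in> measurable N L \<Longrightarrow> (\<lambda>x. Q2 (f x) (h x)) \<in> borel_measurable N"
  using measurable_compose[OF measurable_Pair Q2_meas, of f N h] by simp

text \<open>Masking the channel density by \<open>G\<close> is what makes the kernel bounds hold. In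
  the Gaussian instance \<open>D\<close> is of order exp(-n * I0), reflecting how rarely independent
  codewords form a good pair, and \<open>c\<close> pays for conditioning the first layer.\<close>

definition weight :: "'x \<Rightarrow> 'x \<Rightarrow> 'y \<Rightarrow> ennreal" where
  "weight x1 x2 y = ennreal (of_bool (G x1 x2) * \<phi> x1 x2 y)"

lemma weight_measurable [measurable (raw)]:
  assumes [measurable]: "f \<in> measurable N X" "g \<in> measurable N X" "h \<in> measurable N L"
  shows "(\<lambda>x. weight (f x) (g x) (h x)) \<in> borel_measurable N"
proof -
  have [measurable]: "(\<lambda>x. \<phi> (f x) (g x) (h x)) \<in> borel_measurable N"
    by (rule \<phi>_measurable) fact+
  show ?thesis unfolding weight_def of_bool_def by measurable
qed

lemma space12: "space \<nu>1 = space X" "space \<nu>2 = space X"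
  using sets1 sets2 by (auto dest: sets_eq_imp_space_eq)

definition layers :: "'i + 'j \<Rightarrow> 'x measure" where
  "layers = case_sum (\<lambda>_. \<nu>1) (\<lambda>_. \<nu>2)"

lemma layers_simps [simp]: "layers (Inl i) = \<nu>1" "layers (Inr j) = \<nu>2"
  by (auto simp: layers_def)

lemma prob_space_layers: "prob_space (layers j)"
  using prob1 prob2 by (cases j) auto

lemma measurable_layers_component [measurable (raw)]:
  "j \<in> J \<Longrightarrow> (\<lambda>\<omega>. \<omega> j) \<in> measurable (Pi\<^sub>M J layers) X"
  using measurable_component_singleton[of j J layers] sets1 sets2
  by (cases j) (auto cong: measurable_cong_sets)

lemma layers_component_in_space: "\<omega> \<in> space (Pi\<^sub>M J layers) \<Longrightarrow> j \<in> J \<Longrightarrow> \<omega> j \<in> space X"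
  by (cases j) (auto simp: space_PiM PiE_iff space12 split: sum.splits)

lemma resample:
  assumes "finite J" "i \<in> J" "F \<in> borel_measurable (Pi\<^sub>M J layers)"
    and "\<And>\<omega>. \<omega> \<in> space (Pi\<^sub>M J layers) \<Longrightarrow> (\<integral>\<^sup>+x. F (fun_upd \<omega> i x) \<partial>layers i) \<le> F' \<omega>"
  shows "(\<integral>\<^sup>+\<omega>. F \<omega> \<partial>Pi\<^sub>M J layers) \<le> (\<integral>\<^sup>+\<omega>. F' \<omega> \<partial>Pi\<^sub>M J layers)"
  using assms by (intro nn_integral_PiM_resample_le prob_space_layers)

lemma prob_space_codebook: "prob_space (Pi\<^sub>M J layers)"
  by (intro prob_space_PiM prob_space_layers)

lemma nn_integral_codebook_const: "(\<integral>\<^sup>+\<omega>. C \<partial>Pi\<^sub>M J layers) = C"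
  by (simp add: prob_space.emeasure_space_1[OF prob_space_codebook])

lemma weight_integral1:
  assumes "x1 \<in> space X" "y \<in> space L"
  shows "(\<integral>\<^sup>+x2. C * weight x1 x2 y \<partial>\<nu>2) \<le> C * ennreal (D * Q1 x1 y)"
proof -
  have [measurable]: "(\<lambda>x2. weight x1 x2 y) \<in> borel_measurable \<nu>2"
    using assms by measurable
  show ?thesis
    using kernel1[OF assms] by (simp add: nn_integral_cmult weight_def[symmetric] mult_left_mono)
qed

lemma weight_integral2:
  assumes "x2 \<in> space X" "y \<in> space L"
  shows "(\<integral>\<^sup>+x1. C * weight x1 x2 y \<partial>\<nu>1) \<le> C * ennreal (D * Q2 x2 y)"
proof -
  have [measurable]: "(\<lambda>x1. weight x1 x2 y) \<in> borel_measurable \<nu>1"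
    using assms by measurable
  show ?thesis
    using kernel2[OF assms] by (simp add: nn_integral_cmult weight_def[symmetric] mult_left_mono)
qed

lemma marginal_integral1:
  assumes "y \<in> space L"
  shows "(\<integral>\<^sup>+x. C * ennreal (D * Q1 x y) \<partial>\<nu>1) \<le> C * ennreal (c * D * Q0 y)"
proof -
  have "(\<integral>\<^sup>+x. C * ennreal (D * Q1 x y) \<partial>\<nu>1) = C * (ennreal D * (\<integral>\<^sup>+x. ennreal (Q1 x y) \<partial>\<nu>1))"
    using assms pos(5) by (simp add: nn_integral_cmult ennreal_mult')
  also have "\<dots> \<le> C * (ennreal D * ennreal (c * Q0 y))"
    by (intro mult_left_mono marginal1 assms) auto
  also have "\<dots> = C * ennreal (c * D * Q0 y)"
    using pos(5) by (simp add: ennreal_mult'[symmetric] mult_ac)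
  finally show ?thesis .
qed

lemma marginal_integral2:
  assumes "y \<in> space L"
  shows "(\<integral>\<^sup>+x. C * ennreal (D * Q2 x y) \<partial>\<nu>2) \<le> C * ennreal (c * D * Q0 y)"
proof -
  have "(\<integral>\<^sup>+x. C * ennreal (D * Q2 x y) \<partial>\<nu>2) = C * (ennreal D * (\<integral>\<^sup>+x. ennreal (Q2 x y) \<partial>\<nu>2))"
    using assms pos(5) by (simp add: nn_integral_cmult ennreal_mult')
  also have "\<dots> \<le> C * (ennreal D * ennreal (c * Q0 y))"
    by (intro mult_left_mono marginal2 assms) auto
  also have "\<dots> = C * ennreal (c * D * Q0 y)"
    using pos(5) by (simp add: ennreal_mult'[symmetric] mult_ac)
  finally show ?thesis .
qed

text \<open>Four distinct, hence independent codewords: they are integrated out in the order second,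
  first, second, first, and each pair contributes \<open>c * D * Q0 y\<close>.\<close>

lemma expected_weight_pair:
  assumes J: "finite J" "Inl i \<in> J" "Inr j \<in> J" "Inl i' \<in> J" "Inr j' \<in> J"
    and "i \<noteq> i'" "j \<noteq> j'" and y[measurable]: "y \<in> space L"
  shows "(\<integral>\<^sup>+\<omega>. weight (\<omega> (Inl i)) (\<omega> (Inr j)) y * weight (\<omega> (Inl i')) (\<omega> (Inr j')) y \<partial>Pi\<^sub>M J layers)
    \<le> ennreal ((c * D * Q0 y)\<^sup>2)"
proof -
  note [measurable] = J(2-)
  note sp = layers_component_in_space[OF _ J(2)] layers_component_in_space[OF _ J(3)]
    layers_component_in_space[OF _ J(4)] layers_component_in_space[OF _ J(5)]
  let ?\<Omega> = "Pi\<^sub>M J layers"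
  have "(\<integral>\<^sup>+\<omega>. weight (\<omega> (Inl i)) (\<omega> (Inr j)) y * weight (\<omega> (Inl i')) (\<omega> (Inr j')) y \<partial>?\<Omega>)
    \<le> (\<integral>\<^sup>+\<omega>. weight (\<omega> (Inl i)) (\<omega> (Inr j)) y * ennreal (D * Q1 (\<omega> (Inl i')) y) \<partial>?\<Omega>)"
    by (rule resample[OF J(1) J(5)]) (use assms weight_integral1 sp in auto)
  also have "\<dots> \<le> (\<integral>\<^sup>+\<omega>. weight (\<omega> (Inl i)) (\<omega> (Inr j)) y * ennreal (c * D * Q0 y) \<partial>?\<Omega>)"
    by (rule resample[OF J(1) J(4)]) (use assms marginal_integral1 sp in auto)
  also have "\<dots> = (\<integral>\<^sup>+\<omega>. ennreal (c * D * Q0 y) * weight (\<omega> (Inl i)) (\<omega> (Inr j)) y \<partial>?\<Omega>)"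
    by (simp add: mult.commute)
  also have "\<dots> \<le> (\<integral>\<^sup>+\<omega>. ennreal (c * D * Q0 y) * ennreal (D * Q1 (\<omega> (Inl i)) y) \<partial>?\<Omega>)"
    by (rule resample[OF J(1) J(3)]) (use assms weight_integral1 sp in auto)
  also have "\<dots> \<le> (\<integral>\<^sup>+\<omega>. ennreal (c * D * Q0 y) * ennreal (c * D * Q0 y) \<partial>?\<Omega>)"
    by (rule resample[OF J(1) J(2)]) (use assms marginal_integral1 sp in auto)
  also have "\<dots> = ennreal ((c * D * Q0 y)\<^sup>2)"
    unfolding nn_integral_codebook_const using pos less_imp_le[OF pos(1)]
    by (simp add: ennreal_mult'[symmetric] power2_eq_square)
  finally show ?thesis .
qed

text \<open>Given the shared first codeword x1, each weight integrates to at most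
  \<open>D * Q1 x1 y\<close>. The factor \<open>1 / Q1\<close> removes one of these two copies, so
  that the remaining average over x1 is a plain marginal.\<close>

lemma expected_weight_shared1:
  assumes J: "finite J" "Inl i \<in> J" "Inr j \<in> J" "Inr j' \<in> J" and "j \<noteq> j'" and y[measurable]: "y \<in> space L"
  shows "(\<integral>\<^sup>+\<omega>. weight (\<omega> (Inl i)) (\<omega> (Inr j)) y * weight (\<omega> (Inl i)) (\<omega> (Inr j')) y
      * ennreal (1 / Q1 (\<omega> (Inl i)) y) \<partial>Pi\<^sub>M J layers)
    \<le> ennreal (c * D\<^sup>2 * Q0 y)"
proof -
  note [measurable] = J(2-)
  note sp = layers_component_in_space[OF _ J(2)] layers_component_in_space[OF _ J(3)]
    layers_component_in_space[OF _ J(4)]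
  let ?\<Omega> = "Pi\<^sub>M J layers"
  have r: "ennreal (D * Q1 x y) * ennreal (1 / Q1 x y) = ennreal D" for x
    using pos(2)[of x y] pos(5) by (simp add: ennreal_mult''[symmetric])
  have r': "ennreal (D * Q1 x y) * (ennreal (1 / Q1 x y) * v) = ennreal D * v" for x v
    using r[of x] by (simp add: mult.assoc[symmetric])
  have "(\<integral>\<^sup>+\<omega>. weight (\<omega> (Inl i)) (\<omega> (Inr j)) y * weight (\<omega> (Inl i)) (\<omega> (Inr j')) y
      * ennreal (1 / Q1 (\<omega> (Inl i)) y) \<partial>?\<Omega>)
    = (\<integral>\<^sup>+\<omega>. (weight (\<omega> (Inl i)) (\<omega> (Inr j)) y * ennreal (1 / Q1 (\<omega> (Inl i)) y)) * weight (\<omega> (Inl i)) (\<omega> (Inr j')) y \<partial>?\<Omega>)"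
    by (simp add: mult_ac)
  also have "\<dots> \<le> (\<integral>\<^sup>+\<omega>. (weight (\<omega> (Inl i)) (\<omega> (Inr j)) y * ennreal (1 / Q1 (\<omega> (Inl i)) y)) * ennreal (D * Q1 (\<omega> (Inl i)) y) \<partial>?\<Omega>)"
    by (rule resample[OF J(1) J(4)]) (use assms weight_integral1 sp in auto)
  also have "\<dots> = (\<integral>\<^sup>+\<omega>. ennreal D * weight (\<omega> (Inl i)) (\<omega> (Inr j)) y \<partial>?\<Omega>)"
    by (simp add: r' mult_ac)
  also have "\<dots> \<le> (\<integral>\<^sup>+\<omega>. ennreal D * ennreal (D * Q1 (\<omega> (Inl i)) y) \<partial>?\<Omega>)"
    by (rule resample[OF J(1) J(3)]) (use assms weight_integral1 sp in auto)
  also have "\<dots> \<le> (\<integral>\<^sup>+\<omega>. ennreal D * ennreal (c * D * Q0 y) \<partial>?\<Omega>)"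
    by (rule resample[OF J(1) J(2)]) (use assms marginal_integral1 sp in auto)
  also have "\<dots> = ennreal (c * D\<^sup>2 * Q0 y)"
    unfolding nn_integral_codebook_const using pos(5)
    by (simp add: ennreal_mult'[symmetric] power2_eq_square mult_ac)
  finally show ?thesis .
qed

text \<open>The mirror image: the two first codewords are integrated out before the shared second
  one, through \<open>kernel2\<close>.\<close>

lemma expected_weight_shared2:
  assumes J: "finite J" "Inl i \<in> J" "Inr j \<in> J" "Inl i' \<in> J" and "i \<noteq> i'" and y[measurable]: "y \<in> space L"
  shows "(\<integral>\<^sup>+\<omega>. weight (\<omega> (Inl i)) (\<omega> (Inr j)) y * weight (\<omega> (Inl i')) (\<omega> (Inr j)) y
      * ennreal (1 / Q2 (\<omega> (Inr j)) y) \<partial>Pi\<^sub>M J layers)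
    \<le> ennreal (c * D\<^sup>2 * Q0 y)"
proof -
  note [measurable] = J(2-)
  note sp = layers_component_in_space[OF _ J(2)] layers_component_in_space[OF _ J(3)]
    layers_component_in_space[OF _ J(4)]
  let ?\<Omega> = "Pi\<^sub>M J layers"
  have r: "ennreal (D * Q2 x y) * ennreal (1 / Q2 x y) = ennreal D" for x
    using pos(3)[of x y] pos(5) by (simp add: ennreal_mult''[symmetric])
  have r': "ennreal (D * Q2 x y) * (ennreal (1 / Q2 x y) * v) = ennreal D * v" for x v
    using r[of x] by (simp add: mult.assoc[symmetric])
  have "(\<integral>\<^sup>+\<omega>. weight (\<omega> (Inl i)) (\<omega> (Inr j)) y * weight (\<omega> (Inl i')) (\<omega> (Inr j)) y
      * ennreal (1 / Q2 (\<omega> (Inr j)) y) \<partial>?\<Omega>)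
    = (\<integral>\<^sup>+\<omega>. (weight (\<omega> (Inl i)) (\<omega> (Inr j)) y * ennreal (1 / Q2 (\<omega> (Inr j)) y)) * weight (\<omega> (Inl i')) (\<omega> (Inr j)) y \<partial>?\<Omega>)"
    by (simp add: mult_ac)
  also have "\<dots> \<le> (\<integral>\<^sup>+\<omega>. (weight (\<omega> (Inl i)) (\<omega> (Inr j)) y * ennreal (1 / Q2 (\<omega> (Inr j)) y)) * ennreal (D * Q2 (\<omega> (Inr j)) y) \<partial>?\<Omega>)"
    by (rule resample[OF J(1) J(4)]) (use assms weight_integral2 sp in auto)
  also have "\<dots> = (\<integral>\<^sup>+\<omega>. ennreal D * weight (\<omega> (Inl i)) (\<omega> (Inr j)) y \<partial>?\<Omega>)"
    by (simp add: r' mult_ac)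
  also have "\<dots> \<le> (\<integral>\<^sup>+\<omega>. ennreal D * ennreal (D * Q2 (\<omega> (Inr j)) y) \<partial>?\<Omega>)"
    by (rule resample[OF J(1) J(2)]) (use assms weight_integral2 sp in auto)
  also have "\<dots> \<le> (\<integral>\<^sup>+\<omega>. ennreal D * ennreal (c * D * Q0 y) \<partial>?\<Omega>)"
    by (rule resample[OF J(1) J(3)]) (use assms marginal_integral2 sp in auto)
  also have "\<dots> = ennreal (c * D\<^sup>2 * Q0 y)"
    unfolding nn_integral_codebook_const using pos(5)
    by (simp add: ennreal_mult'[symmetric] power2_eq_square mult_ac)
  finally show ?thesis .
qed

end


section \<open>Confusion, collision and covering in a random codebook\<close>

lemma ennreal_inverse_mult:
  "t > 0 \<Longrightarrow> q > 0 \<Longrightarrow> ennreal (1 / (t * q)) = ennreal (1 / q) * ennreal (1 / t)"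
  by (subst ennreal_mult'[symmetric]) (auto simp: mult.commute)

context codebook_kernel
begin

lemma measurable_fst_layers_component [measurable (raw)]:
  assumes "j \<in> J"
  shows "(\<lambda>p. fst p j) \<in> measurable (Pi\<^sub>M J layers \<Otimes>\<^sub>M L) X"
  by (rule measurable_compose[OF measurable_fst measurable_layers_component[OF assms]])

text \<open>By Tonelli, a bound \<kappa> * Q0 y at each output integrates to \<kappa>, since
  \<open>Q0\<close> is a subprobability density.\<close>

lemma expected_nn_integral_le:
  assumes [measurable]: "(\<lambda>p. h (fst p) (snd p)) \<in> borel_measurable (Pi\<^sub>M J layers \<Otimes>\<^sub>M L)"
    and "\<And>y. y \<in> space L \<Longrightarrow> (\<integral>\<^sup>+\<omega>. h \<omega> y \<partial>Pi\<^sub>M J layers) \<le> ennreal (\<kappa> * Q0 y)" and "\<kappa> \<ge> 0"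
  shows "(\<integral>\<^sup>+\<omega>. \<integral>\<^sup>+y. h \<omega> y \<partial>L \<partial>Pi\<^sub>M J layers) \<le> ennreal \<kappa>"
proof -
  interpret L: sigma_finite_measure L by (rule sigma_finite_L)
  interpret \<Omega>: prob_space "Pi\<^sub>M J layers" by (rule prob_space_codebook)
  interpret pair_sigma_finite "Pi\<^sub>M J layers" L ..
  have "(\<integral>\<^sup>+\<omega>. \<integral>\<^sup>+y. h \<omega> y \<partial>L \<partial>Pi\<^sub>M J layers) = (\<integral>\<^sup>+y. \<integral>\<^sup>+\<omega>. h \<omega> y \<partial>Pi\<^sub>M J layers \<partial>L)"
    by (rule Fubini'[symmetric]) (simp add: case_prod_beta')
  also have "\<dots> \<le> (\<integral>\<^sup>+y. ennreal \<kappa> * ennreal (Q0 y) \<partial>L)"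
    using assms(2,3) by (intro nn_integral_mono) (simp add: ennreal_mult')
  also have "\<dots> = ennreal \<kappa> * (\<integral>\<^sup>+y. ennreal (Q0 y) \<partial>L)"
    by (rule nn_integral_cmult) measurable
  also have "\<dots> \<le> ennreal \<kappa> * 1"
    by (intro mult_left_mono Q0_le) simp
  finally show ?thesis by simp
qed

text \<open>The chi-square overlap of two masked output densities relative to \<open>Q0\<close>; its
  average controls how far a mixture of such densities is from \<open>Q0\<close>.\<close>

definition collision :: "'x \<Rightarrow> 'x \<Rightarrow> 'x \<Rightarrow> 'x \<Rightarrow> ennreal" where
  "collision x1 x2 x1' x2' = (\<integral>\<^sup>+y. weight x1 x2 y * weight x1' x2' y * ennreal (1 / Q0 y) \<partial>L)"

text \<open>A competing pair may share with the sent pair no codeword, the first or the second. Each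
  case has its own threshold, against the output density given just what is shared.\<close>

definition test :: "real \<Rightarrow> real \<Rightarrow> real \<Rightarrow> 'x \<Rightarrow> 'x \<Rightarrow> 'y \<Rightarrow> bool" where
  "test t0 t1 t2 x1 x2 y \<longleftrightarrow>
     t0 * Q0 y \<le> \<phi> x1 x2 y \<and> t1 * Q1 x1 y \<le> \<phi> x1 x2 y \<and> t2 * Q2 x2 y \<le> \<phi> x1 x2 y"

text \<open>Pairwise error probability: the output is produced by (x1, x2), yet (x1', x2') passes
  the test.\<close>

definition confusion :: "real \<Rightarrow> real \<Rightarrow> real \<Rightarrow> 'x \<Rightarrow> 'x \<Rightarrow> 'x \<Rightarrow> 'x \<Rightarrow> ennreal" where
  "confusion t0 t1 t2 x1 x2 x1' x2' =
     (\<integral>\<^sup>+y. weight x1 x2 y * of_bool (G x1' x2' \<and> test t0 t1 t2 x1' x2' y) \<partial>L)"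

lemma test_measurable [measurable (raw)]:
  assumes [measurable]: "f \<in> measurable N X" "g \<in> measurable N X" "h \<in> measurable N L"
  shows "Measurable.pred N (\<lambda>x. test t0 t1 t2 (f x) (g x) (h x))"
proof -
  have [measurable]: "(\<lambda>x. \<phi> (f x) (g x) (h x)) \<in> borel_measurable N"
    by (rule \<phi>_measurable) fact+
  show ?thesis unfolding test_def by measurable
qed

lemma collision_measurable [measurable (raw)]:
  assumes [measurable]: "f \<in> measurable N X" "g \<in> measurable N X" "f' \<in> measurable N X" "g' \<in> measurable N X"
  shows "(\<lambda>x. collision (f x) (g x) (f' x) (g' x)) \<in> borel_measurable N"
  unfolding collision_def
  by (rule sigma_finite_measure.borel_measurable_nn_integral[OF sigma_finite_L]) (simp add: case_prod_beta')

lemma confusion_measurable [measurable (raw)]: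
  assumes [measurable]: "f \<in> measurable N X" "g \<in> measurable N X" "f' \<in> measurable N X" "g' \<in> measurable N X"
  shows "(\<lambda>x. confusion t0 t1 t2 (f x) (g x) (f' x) (g' x)) \<in> borel_measurable N"
  unfolding confusion_def of_bool_def
  by (rule sigma_finite_measure.borel_measurable_nn_integral[OF sigma_finite_L]) (simp add: case_prod_beta')

text \<open>Markov's inequality for likelihood ratios: wherever the threshold is met, the masked
  density divided by it is at least 1.\<close>

lemma of_bool_le_weight:
  assumes "q > 0" "G x1 x2 \<Longrightarrow> b \<Longrightarrow> q \<le> \<phi> x1 x2 y"
  shows "of_bool (G x1 x2 \<and> b) \<le> weight x1 x2 y * ennreal (1 / q)"
  using assms nonneg[of x1 x2 y]
  by (auto simp: weight_def of_bool_def ennreal_mult'[symmetric] simp flip: ennreal_1 intro!: ennreal_leI)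

lemma weight_mult_le:
  assumes "b \<le> v * ennreal s * ennreal t"
  shows "u * b \<le> ennreal t * (u * v * ennreal s)"
  using mult_left_mono[OF assms, of u] by (simp add: mult_ac)

lemma expected_collision:
  assumes J: "finite J" "Inl i \<in> J" "Inr j \<in> J" "Inl i' \<in> J" "Inr j' \<in> J" and "i \<noteq> i'" "j \<noteq> j'"
  shows "(\<integral>\<^sup>+\<omega>. collision (\<omega> (Inl i)) (\<omega> (Inr j)) (\<omega> (Inl i')) (\<omega> (Inr j')) \<partial>Pi\<^sub>M J layers) \<le> ennreal ((c * D)\<^sup>2)"
  unfolding collision_def
proof (rule expected_nn_integral_le)
  note [measurable] = J(2-)
  show "(\<lambda>p. weight (fst p (Inl i)) (fst p (Inr j)) (snd p) * weight (fst p (Inl i')) (fst p (Inr j')) (snd p)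
    * ennreal (1 / Q0 (snd p))) \<in> borel_measurable (Pi\<^sub>M J layers \<Otimes>\<^sub>M L)" by measurable
  fix y assume y[measurable]: "y \<in> space L"
  have "(\<integral>\<^sup>+\<omega>. weight (\<omega> (Inl i)) (\<omega> (Inr j)) y * weight (\<omega> (Inl i')) (\<omega> (Inr j')) y * ennreal (1 / Q0 y) \<partial>Pi\<^sub>M J layers)
    \<le> ennreal ((c * D * Q0 y)\<^sup>2) * ennreal (1 / Q0 y)"
    by (subst nn_integral_multc) (measurable, intro mult_right_mono expected_weight_pair assms y, simp)
  also have "\<dots> = ennreal ((c * D)\<^sup>2 * Q0 y)"
    using pos(1)[of y] by (simp add: ennreal_mult'[symmetric] power2_eq_square mult_ac)
  finally show "(\<integral>\<^sup>+\<omega>. weight (\<omega> (Inl i)) (\<omega> (Inr j)) y * weight (\<omega> (Inl i')) (\<omega> (Inr j')) y * ennreal (1 / Q0 y)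
    \<partial>Pi\<^sub>M J layers) \<le> \<dots>" .
qed simp

text \<open>Replacing the test indicator by the likelihood ratio against \<open>Q0\<close> turns
  confusion into a collision divided by \<open>t0\<close>.\<close>

lemma expected_confusion_pair:
  assumes J: "finite J" "Inl i \<in> J" "Inr j \<in> J" "Inl i' \<in> J" "Inr j' \<in> J" and "i \<noteq> i'" "j \<noteq> j'" and t: "t0 > 0"
  shows "(\<integral>\<^sup>+\<omega>. confusion t0 t1 t2 (\<omega> (Inl i)) (\<omega> (Inr j)) (\<omega> (Inl i')) (\<omega> (Inr j')) \<partial>Pi\<^sub>M J layers)
    \<le> ennreal ((c * D)\<^sup>2 / t0)"
proof -
  note [measurable] = J(2-)
  have "confusion t0 t1 t2 x1 x2 x1' x2' \<le> ennreal (1 / t0) * collision x1 x2 x1' x2'"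
    if [measurable]: "x1 \<in> space X" "x2 \<in> space X" "x1' \<in> space X" "x2' \<in> space X" for x1 x2 x1' x2'
  proof -
    have "confusion t0 t1 t2 x1 x2 x1' x2' \<le> (\<integral>\<^sup>+y. ennreal (1 / t0) * (weight x1 x2 y * weight x1' x2' y * ennreal (1 / Q0 y)) \<partial>L)"
      unfolding confusion_def
    proof (rule nn_integral_mono)
      fix y
      have "of_bool (G x1' x2' \<and> test t0 t1 t2 x1' x2' y) \<le> weight x1' x2' y * ennreal (1 / (t0 * Q0 y))"
        using t pos(1)[of y] by (intro of_bool_le_weight) (auto simp: test_def)
      also have "\<dots> = weight x1' x2' y * ennreal (1 / Q0 y) * ennreal (1 / t0)"
        unfolding ennreal_inverse_mult[OF t pos(1)] by (simp add: mult.assoc)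
      finally show "weight x1 x2 y * of_bool (G x1' x2' \<and> test t0 t1 t2 x1' x2' y)
        \<le> ennreal (1 / t0) * (weight x1 x2 y * weight x1' x2' y * ennreal (1 / Q0 y))"
      by (rule weight_mult_le)
    qed
    also have "\<dots> = ennreal (1 / t0) * collision x1 x2 x1' x2'"
      unfolding collision_def by (rule nn_integral_cmult) measurable
    finally show ?thesis .
  qed
  then have "(\<integral>\<^sup>+\<omega>. confusion t0 t1 t2 (\<omega> (Inl i)) (\<omega> (Inr j)) (\<omega> (Inl i')) (\<omega> (Inr j')) \<partial>Pi\<^sub>M J layers)
    \<le> (\<integral>\<^sup>+\<omega>. ennreal (1 / t0) * collision (\<omega> (Inl i)) (\<omega> (Inr j)) (\<omega> (Inl i')) (\<omega> (Inr j')) \<partial>Pi\<^sub>M J layers)"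
    by (intro nn_integral_mono) (simp add: layers_component_in_space J)
  also have "\<dots> \<le> ennreal (1 / t0) * ennreal ((c * D)\<^sup>2)"
    by (subst nn_integral_cmult) (measurable, intro mult_left_mono expected_collision assms, simp)
  also have "\<dots> = ennreal ((c * D)\<^sup>2 / t0)"
    using t by (simp add: ennreal_mult'[symmetric])
  finally show ?thesis .
qed

text \<open>The competing pair is not independent of the output here, so the likelihood ratio is
  taken against \<open>Q1\<close>, the output law given the shared codeword.\<close>

lemma expected_confusion_shared1:
  fixes i :: 'i and j j' :: 'j
  assumes J: "finite J" "Inl i \<in> J" "Inr j \<in> J" "Inr j' \<in> J" and "j \<noteq> j'" and t: "t1 > 0"
  shows "(\<integral>\<^sup>+\<omega>. confusion t0 t1 t2 (\<omega> (Inl i)) (\<omega> (Inr j)) (\<omega> (Inl i)) (\<omega> (Inr j')) \<partial>Pi\<^sub>M J layers)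
    \<le> ennreal (c * D\<^sup>2 / t1)"
  unfolding confusion_def
proof (rule expected_nn_integral_le)
  note [measurable] = J(2-)
  show "(\<lambda>p. weight (fst p (Inl i)) (fst p (Inr j)) (snd p) * of_bool (G (fst p (Inl i)) (fst p (Inr j'))
      \<and> test t0 t1 t2 (fst p (Inl i)) (fst p (Inr j')) (snd p))) \<in> borel_measurable (Pi\<^sub>M J layers \<Otimes>\<^sub>M L)"
    unfolding of_bool_def by measurable
  fix y assume y[measurable]: "y \<in> space L"
  let ?h = "\<lambda>\<omega>. weight (\<omega> (Inl i)) (\<omega> (Inr j)) y * weight (\<omega> (Inl i)) (\<omega> (Inr j')) y * ennreal (1 / Q1 (\<omega> (Inl i)) y)"
  have "(\<integral>\<^sup>+\<omega>. weight (\<omega> (Inl i)) (\<omega> (Inr j)) y * of_bool (G (\<omega> (Inl i)) (\<omega> (Inr j'))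
      \<and> test t0 t1 t2 (\<omega> (Inl i)) (\<omega> (Inr j')) y) \<partial>Pi\<^sub>M J layers)
    \<le> (\<integral>\<^sup>+\<omega>. ennreal (1 / t1) * ?h \<omega> \<partial>Pi\<^sub>M J layers)"
  proof (rule nn_integral_mono)
    fix \<omega> :: "'i + 'j \<Rightarrow> 'x"
    let ?q = "Q1 (\<omega> (Inl i)) y"
    have "of_bool (G (\<omega> (Inl i)) (\<omega> (Inr j')) \<and> test t0 t1 t2 (\<omega> (Inl i)) (\<omega> (Inr j')) y)
      \<le> weight (\<omega> (Inl i)) (\<omega> (Inr j')) y * ennreal (1 / (t1 * ?q))"
      using t pos(2) by (intro of_bool_le_weight) (auto simp: test_def)
    also have "\<dots> = weight (\<omega> (Inl i)) (\<omega> (Inr j')) y * ennreal (1 / ?q) * ennreal (1 / t1)"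
      unfolding ennreal_inverse_mult[OF t pos(2)] by (simp add: mult.assoc)
    finally show "weight (\<omega> (Inl i)) (\<omega> (Inr j)) y * of_bool (G (\<omega> (Inl i)) (\<omega> (Inr j'))
      \<and> test t0 t1 t2 (\<omega> (Inl i)) (\<omega> (Inr j')) y) \<le> ennreal (1 / t1) * ?h \<omega>"
      by (rule weight_mult_le)
  qed
  also have "\<dots> = ennreal (1 / t1) * (\<integral>\<^sup>+\<omega>. ?h \<omega> \<partial>Pi\<^sub>M J layers)"
    by (rule nn_integral_cmult) measurable
  also have "\<dots> \<le> ennreal (1 / t1) * ennreal (c * D\<^sup>2 * Q0 y)"
    by (intro mult_left_mono expected_weight_shared1 assms y) simp
  also have "\<dots> = ennreal (c * D\<^sup>2 / t1 * Q0 y)"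
    using t by (simp add: ennreal_mult'[symmetric])
  finally show "(\<integral>\<^sup>+\<omega>. weight (\<omega> (Inl i)) (\<omega> (Inr j)) y * of_bool (G (\<omega> (Inl i)) (\<omega> (Inr j'))
      \<and> test t0 t1 t2 (\<omega> (Inl i)) (\<omega> (Inr j')) y) \<partial>Pi\<^sub>M J layers) \<le> \<dots>" .
qed (use t pos(4) in simp)

lemma expected_confusion_shared2:
  fixes i i' :: 'i and j :: 'j
  assumes J: "finite J" "Inl i \<in> J" "Inr j \<in> J" "Inl i' \<in> J" and "i \<noteq> i'" and t: "t2 > 0"
  shows "(\<integral>\<^sup>+\<omega>. confusion t0 t1 t2 (\<omega> (Inl i)) (\<omega> (Inr j)) (\<omega> (Inl i')) (\<omega> (Inr j)) \<partial>Pi\<^sub>M J layers)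
    \<le> ennreal (c * D\<^sup>2 / t2)"
  unfolding confusion_def
proof (rule expected_nn_integral_le)
  note [measurable] = J(2-)
  show "(\<lambda>p. weight (fst p (Inl i)) (fst p (Inr j)) (snd p) * of_bool (G (fst p (Inl i')) (fst p (Inr j))
      \<and> test t0 t1 t2 (fst p (Inl i')) (fst p (Inr j)) (snd p))) \<in> borel_measurable (Pi\<^sub>M J layers \<Otimes>\<^sub>M L)"
    unfolding of_bool_def by measurable
  fix y assume y[measurable]: "y \<in> space L"
  let ?h = "\<lambda>\<omega>. weight (\<omega> (Inl i)) (\<omega> (Inr j)) y * weight (\<omega> (Inl i')) (\<omega> (Inr j)) y * ennreal (1 / Q2 (\<omega> (Inr j)) y)"
  have "(\<integral>\<^sup>+\<omega>. weight (\<omega> (Inl i)) (\<omega> (Inr j)) y * of_bool (G (\<omega> (Inl i')) (\<omega> (Inr j))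
      \<and> test t0 t1 t2 (\<omega> (Inl i')) (\<omega> (Inr j)) y) \<partial>Pi\<^sub>M J layers)
    \<le> (\<integral>\<^sup>+\<omega>. ennreal (1 / t2) * ?h \<omega> \<partial>Pi\<^sub>M J layers)"
  proof (rule nn_integral_mono)
    fix \<omega> :: "'i + 'j \<Rightarrow> 'x"
    let ?q = "Q2 (\<omega> (Inr j)) y"
    have "of_bool (G (\<omega> (Inl i')) (\<omega> (Inr j)) \<and> test t0 t1 t2 (\<omega> (Inl i')) (\<omega> (Inr j)) y)
      \<le> weight (\<omega> (Inl i')) (\<omega> (Inr j)) y * ennreal (1 / (t2 * ?q))"
      using t pos(3) by (intro of_bool_le_weight) (auto simp: test_def)
    also have "\<dots> = weight (\<omega> (Inl i')) (\<omega> (Inr j)) y * ennreal (1 / ?q) * ennreal (1 / t2)"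
      unfolding ennreal_inverse_mult[OF t pos(3)] by (simp add: mult.assoc)
    finally show "weight (\<omega> (Inl i)) (\<omega> (Inr j)) y * of_bool (G (\<omega> (Inl i')) (\<omega> (Inr j))
      \<and> test t0 t1 t2 (\<omega> (Inl i')) (\<omega> (Inr j)) y) \<le> ennreal (1 / t2) * ?h \<omega>"
      by (rule weight_mult_le)
  qed
  also have "\<dots> = ennreal (1 / t2) * (\<integral>\<^sup>+\<omega>. ?h \<omega> \<partial>Pi\<^sub>M J layers)"
    by (rule nn_integral_cmult) measurable
  also have "\<dots> \<le> ennreal (1 / t2) * ennreal (c * D\<^sup>2 * Q0 y)"
    by (intro mult_left_mono expected_weight_shared2 assms y) simp
  also have "\<dots> = ennreal (c * D\<^sup>2 / t2 * Q0 y)"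
    using t by (simp add: ennreal_mult'[symmetric])
  finally show "(\<integral>\<^sup>+\<omega>. weight (\<omega> (Inl i)) (\<omega> (Inr j)) y * of_bool (G (\<omega> (Inl i')) (\<omega> (Inr j))
      \<and> test t0 t1 t2 (\<omega> (Inl i')) (\<omega> (Inr j)) y) \<partial>Pi\<^sub>M J layers) \<le> \<dots>" .
qed (use t pos(4) in simp)

text \<open>Given the first codeword the K candidates are independent, so failure probabilities
  multiply. The bound \<open>q\<close> is available only on \<open>T\<close>; as \<open>T\<close>
  has full measure under \<nu>1, no additive term spoils the doubly exponential decay.\<close>

lemma covering_failure:
  assumes J: "finite J" "Inl i \<in> J" "\<And>k. k < K \<Longrightarrow> Inr (j k) \<in> J" and inj: "inj_on j {..<K}"
    and T[measurable]: "T \<in> sets X" and AE: "AE x in \<nu>1. x \<in> T"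
    and q: "\<And>x1. x1 \<in> T \<Longrightarrow> emeasure \<nu>2 {x2 \<in> space X. \<not> G x1 x2} \<le> ennreal q" and "q \<ge> 0"
  shows "emeasure (Pi\<^sub>M J layers) {\<omega>\<in>space (Pi\<^sub>M J layers). \<forall>k<K. \<not> G (\<omega> (Inl i)) (\<omega> (Inr (j k)))} \<le> ennreal (q ^ K)"
proof -
  let ?\<Omega> = "Pi\<^sub>M J layers"
  note [measurable] = J(2)
  define F where "F k \<omega> = (of_bool (\<not> G (\<omega> (Inl i)) (\<omega> (Inr (j k)))) :: ennreal)" for k \<omega>
  have F[measurable]: "F k \<in> borel_measurable ?\<Omega>" if "k < K" for k
  proof -
    have [measurable]: "Inr (j k) \<in> J" using J(3)[OF that] .
    show ?thesis unfolding F_def[abs_def] of_bool_def by measurable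
  qed
  \<comment> \<open>The indicator of \<open>T\<close> stays inside the integral, so that
    \<open>q\<close> applies each time a candidate is redrawn.\<close>
  have le: "(\<integral>\<^sup>+\<omega>. indicator T (\<omega> (Inl i)) * (\<Prod>k<m. F k \<omega>) \<partial>?\<Omega>) \<le> ennreal (q ^ m)" if "m \<le> K" for m
    using that
  proof (induction m)
    case 0
    have "(\<integral>\<^sup>+\<omega>. indicator T (\<omega> (Inl i)) * (\<Prod>k<0. F k \<omega>) \<partial>?\<Omega>) \<le> (\<integral>\<^sup>+\<omega>. 1 \<partial>?\<Omega>)"
      by (intro nn_integral_mono) (auto simp: indicator_def)
    also have "\<dots> = 1" by (rule nn_integral_codebook_const)
    finally show ?case by simp
  next
    case (Suc m)
    have m: "m < K" using Suc by simp
    have [measurable]: "(\<lambda>\<omega>. \<Prod>k<m. F k \<omega>) \<in> borel_measurable ?\<Omega>"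
      using m by (intro borel_measurable_prod_ennreal F) auto
    have [measurable]: "(\<lambda>\<omega>. \<Prod>k<Suc m. F k \<omega>) \<in> borel_measurable ?\<Omega>"
      using m by (intro borel_measurable_prod_ennreal F) auto
    have "(\<integral>\<^sup>+\<omega>. indicator T (\<omega> (Inl i)) * (\<Prod>k<Suc m. F k \<omega>) \<partial>?\<Omega>)
      \<le> (\<integral>\<^sup>+\<omega>. indicator T (\<omega> (Inl i)) * (\<Prod>k<m. F k \<omega>) * ennreal q \<partial>?\<Omega>)"
    proof (rule resample[OF J(1) J(3)[OF m]])
      fix \<omega> assume \<omega>: "\<omega> \<in> space ?\<Omega>"
      then have [measurable]: "\<omega> (Inl i) \<in> space X" by (rule layers_component_in_space) (rule J)
      \<comment> \<open>The labels are distinct, so redrawing candidate m leaves the earlier factors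
        alone.\<close>
      have F': "F k (fun_upd \<omega> (Inr (j m)) x) = F k \<omega>" if "k < m" for k x
        using that m inj by (auto simp: F_def inj_on_def)
      have "(\<integral>\<^sup>+x. indicator T (fun_upd \<omega> (Inr (j m)) x (Inl i)) * (\<Prod>k<Suc m. F k (fun_upd \<omega> (Inr (j m)) x)) \<partial>layers (Inr (j m)))
        = (\<integral>\<^sup>+x. indicator T (\<omega> (Inl i)) * (\<Prod>k<m. F k \<omega>) * indicator {x \<in> space X. \<not> G (\<omega> (Inl i)) x} x \<partial>\<nu>2)"
        using F' by (simp, intro nn_integral_cong) (auto simp: F_def space12 indicator_def)
      also have "\<dots> = indicator T (\<omega> (Inl i)) * (\<Prod>k<m. F k \<omega>) * emeasure \<nu>2 {x \<in> space X. \<not> G (\<omega> (Inl i)) x}"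
        by (rule nn_integral_cmult_indicator) measurable
      also have "\<dots> \<le> indicator T (\<omega> (Inl i)) * (\<Prod>k<m. F k \<omega>) * ennreal q"
        using q[of "\<omega> (Inl i)"] by (cases "\<omega> (Inl i) \<in> T") (auto intro!: mult_left_mono)
      finally show "(\<integral>\<^sup>+x. indicator T (fun_upd \<omega> (Inr (j m)) x (Inl i)) * (\<Prod>k<Suc m. F k (fun_upd \<omega> (Inr (j m)) x)) \<partial>layers (Inr (j m)))
        \<le> \<dots>" .
    qed measurable
    also have "\<dots> = (\<integral>\<^sup>+\<omega>. indicator T (\<omega> (Inl i)) * (\<Prod>k<m. F k \<omega>) \<partial>?\<Omega>) * ennreal q"
      by (rule nn_integral_multc) measurable
    also have "\<dots> \<le> ennreal (q ^ m) * ennreal q"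
      using Suc by (intro mult_right_mono) auto
    also have "\<dots> = ennreal (q ^ Suc m)"
      using \<open>q \<ge> 0\<close> by (simp add: ennreal_mult'[symmetric] mult.commute)
    finally show ?case .
  qed
  have atyp: "(\<integral>\<^sup>+\<omega>. indicator (space X - T) (\<omega> (Inl i)) \<partial>?\<Omega>) \<le> (\<integral>\<^sup>+\<omega>. 0 \<partial>?\<Omega>)"
  proof (rule resample[OF J(1) J(2)])
    have "(\<integral>\<^sup>+x. indicator (space X - T) x \<partial>\<nu>1) = (\<integral>\<^sup>+x. 0 \<partial>\<nu>1)"
      by (rule nn_integral_cong_AE) (use AE in \<open>auto elim!: eventually_mono\<close>)
    then show "(\<integral>\<^sup>+x. indicator (space X - T) (fun_upd \<omega> (Inl i) x (Inl i)) \<partial>layers (Inl i)) \<le> 0" for \<omega>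
      by simp
  qed measurable
  have [measurable]: "(\<lambda>\<omega>. \<Prod>k<K. F k \<omega>) \<in> borel_measurable ?\<Omega>"
    by (intro borel_measurable_prod_ennreal F) auto
  have pred[measurable]: "Measurable.pred ?\<Omega> (\<lambda>\<omega>. \<forall>k\<in>{..<K}. \<not> G (\<omega> (Inl i)) (\<omega> (Inr (j k))))"
  proof (rule pred_intros_finite)
    fix k assume "k \<in> {..<K}"
    then have [measurable]: "Inr (j k) \<in> J" using J(3) by simp
    show "Measurable.pred ?\<Omega> (\<lambda>\<omega>. \<not> G (\<omega> (Inl i)) (\<omega> (Inr (j k))))" by measurable
  qed simp
  have "emeasure ?\<Omega> {\<omega>\<in>space ?\<Omega>. \<forall>k<K. \<not> G (\<omega> (Inl i)) (\<omega> (Inr (j k)))}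
    = (\<integral>\<^sup>+\<omega>. indicator {\<omega>\<in>space ?\<Omega>. \<forall>k\<in>{..<K}. \<not> G (\<omega> (Inl i)) (\<omega> (Inr (j k)))} \<omega> \<partial>?\<Omega>)"
    by (subst nn_integral_indicator) (measurable, auto simp: Ball_def)
  also have "\<dots> \<le> (\<integral>\<^sup>+\<omega>. indicator (space X - T) (\<omega> (Inl i)) + indicator T (\<omega> (Inl i)) * (\<Prod>k<K. F k \<omega>) \<partial>?\<Omega>)"
  proof (rule nn_integral_mono)
    fix \<omega> assume "\<omega> \<in> space ?\<Omega>"
    then have "\<omega> (Inl i) \<in> space X" by (rule layers_component_in_space) (rule J)
    then show "indicator {\<omega>\<in>space ?\<Omega>. \<forall>k\<in>{..<K}. \<not> G (\<omega> (Inl i)) (\<omega> (Inr (j k)))} \<omega>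
      \<le> indicator (space X - T) (\<omega> (Inl i)) + indicator T (\<omega> (Inl i)) * (\<Prod>k<K. F k \<omega>)"
      by (auto simp: indicator_def F_def)
  qed
  also have "\<dots> = (\<integral>\<^sup>+\<omega>. indicator (space X - T) (\<omega> (Inl i)) \<partial>?\<Omega>) + (\<integral>\<^sup>+\<omega>. indicator T (\<omega> (Inl i)) * (\<Prod>k<K. F k \<omega>) \<partial>?\<Omega>)"
    by (rule nn_integral_add) measurable
  also have "\<dots> \<le> 0 + ennreal (q ^ K)"
    using atyp by (intro add_mono le) auto
  finally show ?thesis by simp
qed

end


section \<open>Selecting one codebook for both requirements\<close>

definition expect_le :: "'a measure \<Rightarrow> ('a \<Rightarrow> ennreal) \<Rightarrow> real \<Rightarrow> bool" where
  "expect_le M f B \<longleftrightarrow> f \<in> borel_measurable M \<and> (\<integral>\<^sup>+x. f x \<partial>M) \<le> ennreal B \<and> 0 \<le> B"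

text \<open>With the companion rules for multiples and binary sums, the expectation of a nested sum
  is bounded by backward chaining along its syntax; measurability and nonnegativity travel inside
  \<open>expect_le\<close>.\<close>

lemma expect_le_sum:
  assumes "\<And>i. i \<in> I \<Longrightarrow> expect_le M (f i) (B i)"
  shows "expect_le M (\<lambda>x. \<Sum>i\<in>I. f i x) (\<Sum>i\<in>I. B i)"
proof -
  have "(\<integral>\<^sup>+x. (\<Sum>i\<in>I. f i x) \<partial>M) = (\<Sum>i\<in>I. \<integral>\<^sup>+x. f i x \<partial>M)"
    using assms by (intro nn_integral_sum) (auto simp: expect_le_def)
  also have "\<dots> \<le> (\<Sum>i\<in>I. ennreal (B i))"
    using assms by (intro sum_mono) (auto simp: expect_le_def)
  also have "\<dots> = ennreal (\<Sum>i\<in>I. B i)"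
    using assms by (intro sum_ennreal) (auto simp: expect_le_def)
  finally have "(\<integral>\<^sup>+x. (\<Sum>i\<in>I. f i x) \<partial>M) \<le> ennreal (\<Sum>i\<in>I. B i)" .
  moreover have "(\<lambda>x. \<Sum>i\<in>I. f i x) \<in> borel_measurable M"
    using assms by (intro borel_measurable_sum) (simp add: expect_le_def)
  moreover have "0 \<le> (\<Sum>i\<in>I. B i)"
    using assms by (intro sum_nonneg) (simp add: expect_le_def)
  ultimately show ?thesis by (simp add: expect_le_def)
qed

lemma expect_le_cmult:
  assumes "expect_le M f B" "C \<ge> 0"
  shows "expect_le M (\<lambda>x. ennreal C * f x) (C * B)"
  using assms by (auto simp: expect_le_def nn_integral_cmult ennreal_mult' intro!: mult_left_mono)

lemma expect_le_add:
  assumes "expect_le M f A" "expect_le M g B"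
  shows "expect_le M (\<lambda>x. f x + g x) (A + B)"
  using assms by (auto simp: expect_le_def nn_integral_add intro!: add_mono)

lemma expect_le_mono: "expect_le M f A \<Longrightarrow> A \<le> B \<Longrightarrow> expect_le M f B"
  by (auto simp: expect_le_def intro: order_trans ennreal_leI)

lemma ennreal_le_of_scaled_le:
  assumes "ennreal (1 / C) * h \<le> ennreal r" "C > 0"
  shows "h \<le> ennreal (r * C)"
proof -
  have "ennreal C * (ennreal (1 / C) * h) \<le> ennreal C * ennreal r"
    by (rule mult_left_mono[OF assms(1)]) simp
  moreover have "ennreal C * (ennreal (1 / C) * h) = h"
    using assms(2) by (simp add: mult.assoc[symmetric] ennreal_mult'[symmetric])
  ultimately show ?thesis
    using assms(2) by (simp add: ennreal_mult' ennreal_mult'' mult.commute)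
qed

text \<open>Scaled to mean at most 1 each, f and g have a sum of mean at most 2. If this sum
  exceeded 4 everywhere outside \<open>N\<close>, on an event of probability at least 3/4, its mean
  would be at least 3.\<close>

lemma (in prob_space) expect_le_ex:
  assumes f: "expect_le M f A" and g: "expect_le M g B" and "A > 0" "B > 0"
    and N[measurable]: "N \<in> sets M" and "emeasure M N \<le> ennreal (1/4)"
  obtains x where "x \<in> space M" "x \<notin> N" "f x \<le> ennreal (4 * A)" "g x \<le> ennreal (4 * B)"
proof -
  define \<Phi> where "\<Phi> x = ennreal (1 / A) * f x + ennreal (1 / B) * g x" for x
  have "expect_le M \<Phi> (1 / A * A + 1 / B * B)"
    unfolding \<Phi>_def using assms by (intro expect_le_add expect_le_cmult) auto
  then have \<Phi>: "(\<integral>\<^sup>+x. \<Phi> x \<partial>M) \<le> ennreal 2"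
    using assms by (simp add: expect_le_def)
  have "\<exists>x\<in>space M - N. \<Phi> x \<le> 4"
  proof (rule ccontr)
    assume *: "\<not> (\<exists>x\<in>space M - N. \<Phi> x \<le> 4)"
    have "ennreal 4 * emeasure M (space M - N) = (\<integral>\<^sup>+x. ennreal 4 * indicator (space M - N) x \<partial>M)"
      by (subst nn_integral_cmult_indicator) auto
    also have "\<dots> \<le> (\<integral>\<^sup>+x. \<Phi> x \<partial>M)"
      using * by (intro nn_integral_mono) (auto simp: indicator_def not_le less_imp_le)
    also note \<Phi>
    finally have "ennreal (4 * prob (space M - N)) \<le> ennreal 2"
      by (simp only: emeasure_eq_measure ennreal_mult')
    then have "4 * prob (space M - N) \<le> 2" by (subst (asm) ennreal_le_iff) auto
    moreover have "prob N \<le> 1/4"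
      using assms(6) by (simp add: emeasure_eq_measure)
    ultimately show False
      using prob_compl[OF N] by simp
  qed
  then obtain x where x: "x \<in> space M" "x \<notin> N" "\<Phi> x \<le> 4" by auto
  have "ennreal (1 / A) * f x \<le> \<Phi> x" "ennreal (1 / B) * g x \<le> \<Phi> x"
    by (simp_all add: \<Phi>_def)
  then have "ennreal (1 / A) * f x \<le> 4" "ennreal (1 / B) * g x \<le> 4"
    using x(3) by (auto intro: order_trans)
  then have "f x \<le> ennreal (4 * A)" "g x \<le> ennreal (4 * B)"
    using assms(3,4) by (auto intro!: ennreal_le_of_scaled_le)
  with x(1,2) show thesis by (rule that)
qed

text \<open>Destination and eavesdropper observe the same random codebook, masked by the same
  predicate, through different channels.\<close>

locale wiretap_kernel =
  Y: codebook_kernel X L \<nu>1 \<nu>2 G \<phi> Q0 Q1 Q2 c D + Z: codebook_kernel X L \<nu>1 \<nu>2 G \<psi> R0 R1 R2 c D'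
  for X :: "'x measure" and L :: "'y measure" and \<nu>1 \<nu>2 G \<phi> Q0 Q1 Q2 c D \<psi> R0 R1 R2 D'
begin

text \<open>A constant \<open>cl\<close> gives the layered code in \<open>a\<close> and
  \<open>b\<close>; an injective \<open>cl\<close> gives every message its own codewords. The
  weights \<open>p\<close> are the law of the index l. Sums run over all k and k' because the
  indices selected later depend on the codebook. In \<alpha>, competitors sharing the first codeword
  are counted by b and k', those sharing the second by a alone, since sharing it fixes the index as
  well.\<close>

lemma codebook_exists:
  fixes cl a b :: "'w \<Rightarrow> nat" and p :: "nat \<Rightarrow> real" and q :: real
  assumes W: "finite W" "W \<noteq> {}" and inj: "inj_on (\<lambda>w. (cl w, a w, b w)) W"
    and ab: "\<And>w. w \<in> W \<Longrightarrow> a w < NA" "\<And>w. w \<in> W \<Longrightarrow> b w < NB"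
    and p: "\<And>l. l < N \<Longrightarrow> 0 \<le> p l" "(\<Sum>l<N. p l) = 1"
    and t: "t0 > 0" "t1 > 0" "t2 > 0" and K: "K > 0"
    and T: "T \<in> sets X" "AE x in \<nu>1. x \<in> T"
    and q: "\<And>x1. x1 \<in> T \<Longrightarrow> emeasure \<nu>2 {x2 \<in> space X. \<not> G x1 x2} \<le> ennreal q" "q \<ge> 0"
    and fail: "card W * N * q ^ K \<le> 1/4"
  defines "\<alpha> \<equiv> real K * (real (card W) * N * K * ((c * D)\<^sup>2 / t0) + real NB * K * (c * D\<^sup>2 / t1) + real NA * (c * D\<^sup>2 / t2))"
  defines "\<gamma> \<equiv> (real K)\<^sup>2 * (c * D')\<^sup>2"
  shows "\<exists>x1 x2.
    (\<forall>w\<in>W. \<forall>l<N. x1 (cl w, l, a w) \<in> space X \<and> (\<forall>k<K. x2 (cl w, l, b w, k) \<in> space X) \<and>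
       (\<exists>k<K. G (x1 (cl w, l, a w)) (x2 (cl w, l, b w, k)))) \<and>
    (\<Sum>w\<in>W. \<Sum>l<N. ennreal (p l / card W) * (\<Sum>k<K. \<Sum>w'\<in>W-{w}. \<Sum>l'<N. \<Sum>k'<K.
       Y.confusion t0 t1 t2 (x1 (cl w, l, a w)) (x2 (cl w, l, b w, k)) (x1 (cl w', l', a w')) (x2 (cl w', l', b w', k'))))
      \<le> ennreal (4 * \<alpha>) \<and>
    (\<Sum>w\<in>W. \<Sum>l<N. ennreal (p l / card W) * (\<Sum>k<K. \<Sum>l'\<in>{..<N}-{l}. ennreal (p l') * (\<Sum>k'<K.
       Z.collision (x1 (cl w, l, a w)) (x2 (cl w, l, b w, k)) (x1 (cl w, l', a w)) (x2 (cl w, l', b w, k')))))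
      \<le> ennreal (4 * \<gamma>)"
proof -
  define J where "J = (\<lambda>(w, l). Inl (cl w, l, a w)) ` (W \<times> {..<N}) \<union>
    (\<lambda>(w, l, k). Inr (cl w, l, b w, k)) ` (W \<times> {..<N} \<times> {..<K})"
  let ?\<Omega> = "Pi\<^sub>M J Y.layers"
  have J: "finite J" using W by (auto simp: J_def)
  have J1: "Inl (cl w, l, a w) \<in> J" if "w \<in> W" "l < N" for w l
    unfolding J_def using that by (intro UnI1 image_eqI[of _ _ "(w, l)"]) auto
  have J2: "Inr (cl w, l, b w, k) \<in> J" if "w \<in> W" "l < N" "k < K" for w l k
    unfolding J_def using that by (intro UnI2 image_eqI[of _ _ "(w, l, k)"]) auto
  interpret \<Omega>: prob_space ?\<Omega> by (rule Y.prob_space_codebook)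
  have N: "N > 0" using p(2) by (cases N) auto
  have cW: "real (card W) > 0" using W by (simp add: card_gt_0_iff)
  have cD: "c > 0" "D > 0" "D' > 0" using Y.pos Z.pos by auto
  define \<beta>0 \<beta>1 \<beta>2 where "\<beta>0 = (c * D)\<^sup>2 / t0" and "\<beta>1 = c * D\<^sup>2 / t1" and "\<beta>2 = c * D\<^sup>2 / t2"
  have \<beta>: "\<beta>0 > 0" "\<beta>1 > 0" "\<beta>2 > 0" using t cD by (auto simp: \<beta>0_def \<beta>1_def \<beta>2_def)

  define F where "F \<omega> = (\<Sum>w\<in>W. \<Sum>l<N. ennreal (p l / card W) * (\<Sum>k<K. \<Sum>w'\<in>W-{w}. \<Sum>l'<N. \<Sum>k'<K.
    Y.confusion t0 t1 t2 (\<omega> (Inl (cl w, l, a w))) (\<omega> (Inr (cl w, l, b w, k)))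
      (\<omega> (Inl (cl w', l', a w'))) (\<omega> (Inr (cl w', l', b w', k')))))" for \<omega>
  define H where "H \<omega> = (\<Sum>w\<in>W. \<Sum>l<N. ennreal (p l / card W) * (\<Sum>k<K. \<Sum>l'\<in>{..<N}-{l}. ennreal (p l') * (\<Sum>k'<K.
    Z.collision (\<omega> (Inl (cl w, l, a w))) (\<omega> (Inr (cl w, l, b w, k)))
      (\<omega> (Inl (cl w, l', a w))) (\<omega> (Inr (cl w, l', b w, k'))))))" for \<omega>

  \<comment> \<open>The bounds of all applicable cases are added, so that the count below becomes a
    sum of separate indicators.\<close>
  define B where "B w l k w' l' k' = \<beta>0 + (if cl w' = cl w \<and> a w' = a w \<and> l' = l then \<beta>1 else 0)
    + (if (cl w' = cl w \<and> b w' = b w \<and> l' = l) \<and> k' = k then \<beta>2 else 0)" for w w' and l l' k k' :: nat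
  have conf: "expect_le ?\<Omega> (\<lambda>\<omega>. Y.confusion t0 t1 t2 (\<omega> (Inl (cl w, l, a w))) (\<omega> (Inr (cl w, l, b w, k)))
      (\<omega> (Inl (cl w', l', a w'))) (\<omega> (Inr (cl w', l', b w', k')))) (B w l k w' l' k')"
    if "w \<in> W" "l < N" "k < K" "w' \<in> W - {w}" "l' < N" "k' < K" for w l k w' l' k'
  proof -
    have w': "w' \<in> W" using that by simp
    note j = J1[OF that(1,2)] J2[OF that(1-3)] J1[OF w' that(5)] J2[OF w' that(5,6)]
    note [measurable] = j
    let ?i = "(cl w, l, a w)" and ?j = "(cl w, l, b w, k)" and ?i' = "(cl w', l', a w')" and ?j' = "(cl w', l', b w', k')"
    \<comment> \<open>A competitor belongs to another message, so by injectivity it shares at most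
      one codeword with the sent pair. A wrong l with the right message is no error and never
      appears.\<close>
    have "\<not> (?i = ?i' \<and> ?j = ?j')"
      using inj that by (auto simp: inj_on_def)
    then consider "?i \<noteq> ?i'" "?j \<noteq> ?j'" | "?i = ?i'" "?j \<noteq> ?j'" | "?i \<noteq> ?i'" "?j = ?j'" by blast
    then have "(\<integral>\<^sup>+\<omega>. Y.confusion t0 t1 t2 (\<omega> (Inl ?i)) (\<omega> (Inr ?j)) (\<omega> (Inl ?i')) (\<omega> (Inr ?j')) \<partial>?\<Omega>)
      \<le> ennreal (B w l k w' l' k')"
    proof cases
      case 1
      have "(\<integral>\<^sup>+\<omega>. Y.confusion t0 t1 t2 (\<omega> (Inl ?i)) (\<omega> (Inr ?j)) (\<omega> (Inl ?i')) (\<omega> (Inr ?j')) \<partial>?\<Omega>) \<le> ennreal \<beta>0"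
        unfolding \<beta>0_def using 1 by (intro Y.expected_confusion_pair J j t)
      also have "\<dots> \<le> ennreal (B w l k w' l' k')"
        using \<beta> by (intro ennreal_leI) (auto simp: B_def)
      finally show ?thesis .
    next
      case 2
      have "(\<integral>\<^sup>+\<omega>. Y.confusion t0 t1 t2 (\<omega> (Inl ?i)) (\<omega> (Inr ?j)) (\<omega> (Inl ?i)) (\<omega> (Inr ?j')) \<partial>?\<Omega>) \<le> ennreal \<beta>1"
        unfolding \<beta>1_def using 2 by (intro Y.expected_confusion_shared1 J j t)
      also have "\<dots> \<le> ennreal (B w l k w' l' k')"
        using \<beta> 2 by (intro ennreal_leI) (auto simp: B_def)
      finally show ?thesis using 2 by simp
    next
      case 3
      have "(\<integral>\<^sup>+\<omega>. Y.confusion t0 t1 t2 (\<omega> (Inl ?i)) (\<omega> (Inr ?j)) (\<omega> (Inl ?i')) (\<omega> (Inr ?j)) \<partial>?\<Omega>) \<le> ennreal \<beta>2"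
        unfolding \<beta>2_def using 3 by (intro Y.expected_confusion_shared2 J j t)
      also have "\<dots> \<le> ennreal (B w l k w' l' k')"
        using \<beta> 3 by (intro ennreal_leI) (auto simp: B_def)
      finally show ?thesis using 3 by simp
    qed
    moreover have "(\<lambda>\<omega>. Y.confusion t0 t1 t2 (\<omega> (Inl ?i)) (\<omega> (Inr ?j)) (\<omega> (Inl ?i')) (\<omega> (Inr ?j'))) \<in> borel_measurable ?\<Omega>"
      by measurable
    ultimately show ?thesis using \<beta> by (auto simp: expect_le_def B_def)
  qed
  have count: "(\<Sum>w'\<in>W-{w}. \<Sum>l'<N. \<Sum>k'<K. B w l k w' l' k')
      \<le> real (card W) * N * K * \<beta>0 + real NB * K * \<beta>1 + real NA * \<beta>2"
    if w: "w \<in> W" and "l < N" "k < K" for w l k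
  proof -
    define P1 P2 where "P1 w' \<longleftrightarrow> cl w' = cl w \<and> a w' = a w" and "P2 w' \<longleftrightarrow> cl w' = cl w \<and> b w' = b w" for w'
    have k': "(\<Sum>k'<K. if Q \<and> k' = k then r else 0) = (if Q then r else 0)" for Q and r :: real
      using \<open>k < K\<close> by (cases Q) auto
    have l': "(\<Sum>l'<N. if Q \<and> l' = l then r else 0) = (if Q then r else 0)" for Q and r :: real
      using \<open>l < N\<close> by (cases Q) auto
    have if_mult: "(real K * (if Q then r else 0)) = (if Q then real K * r else 0)" for Q r by simp
    have "(\<Sum>w'\<in>W-{w}. \<Sum>l'<N. \<Sum>k'<K. B w l k w' l' k')
      = (\<Sum>w'\<in>W-{w}. real N * (real K * \<beta>0) + (if P1 w' then real K * \<beta>1 else 0) + (if P2 w' then \<beta>2 else 0))"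
    proof (rule sum.cong[OF refl])
      fix w'
      have "(\<Sum>l'<N. \<Sum>k'<K. B w l k w' l' k')
        = (\<Sum>l'<N. real K * \<beta>0 + (if P1 w' \<and> l' = l then real K * \<beta>1 else 0) + (if P2 w' \<and> l' = l then \<beta>2 else 0))"
        unfolding B_def sum.distrib k' P1_def P2_def by (simp add: if_mult conj_assoc)
      then show "(\<Sum>l'<N. \<Sum>k'<K. B w l k w' l' k')
        = real N * (real K * \<beta>0) + (if P1 w' then real K * \<beta>1 else 0) + (if P2 w' then \<beta>2 else 0)"
        by (simp only: sum.distrib l') simp
    qed
    also have "\<dots> = real (card (W - {w})) * (real N * (real K * \<beta>0))
      + real (card {w'\<in>W-{w}. P1 w'}) * (real K * \<beta>1) + real (card {w'\<in>W-{w}. P2 w'}) * \<beta>2"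
      using W by (simp add: sum.distrib sum.If_cases Int_def)
    also have "\<dots> \<le> real (card W) * (real N * (real K * \<beta>0)) + real NB * (real K * \<beta>1) + real NA * \<beta>2"
    proof (intro add_mono mult_right_mono)
      show "real (card (W - {w})) \<le> real (card W)" using W by (simp add: card_mono)
      \<comment> \<open>With \<open>cl\<close> and \<open>a\<close> fixed, \<open>b\<close> alone
        identifies the message, so at most \<open>NB\<close> competitors share the first
        codeword.\<close>
      have "inj_on b {w'\<in>W-{w}. P1 w'}" "b ` {w'\<in>W-{w}. P1 w'} \<subseteq> {..<NB}"
        using inj ab by (auto simp: inj_on_def P1_def)
      from card_inj_on_le[OF this] show "real (card {w'\<in>W-{w}. P1 w'}) \<le> real NB" by simp
      have "inj_on a {w'\<in>W-{w}. P2 w'}" "a ` {w'\<in>W-{w}. P2 w'} \<subseteq> {..<NA}"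
        using inj ab by (auto simp: inj_on_def P2_def)
      from card_inj_on_le[OF this] show "real (card {w'\<in>W-{w}. P2 w'}) \<le> real NA" by simp
    qed (use \<beta> in auto)
    finally show ?thesis by (simp add: mult.assoc)
  qed
  have average: "(\<Sum>w\<in>W. \<Sum>l<N. p l / card W * C) = C" for C
  proof -
    have "(\<Sum>l<N. p l / card W * C) = (\<Sum>l<N. p l) * (C / card W)"
      by (simp add: sum_distrib_right sum_divide_distrib)
    then have "(\<Sum>w\<in>W. \<Sum>l<N. p l / card W * C) = real (card W) * (C / card W)"
      unfolding p(2) by simp
    then show ?thesis using cW by simp
  qed
  have "expect_le ?\<Omega> F (\<Sum>w\<in>W. \<Sum>l<N. p l / card W * (\<Sum>k<K. \<Sum>w'\<in>W-{w}. \<Sum>l'<N. \<Sum>k'<K. B w l k w' l' k'))"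
    unfolding F_def[abs_def] by (intro expect_le_sum expect_le_cmult conf) (use p in auto)
  moreover have "(\<Sum>w\<in>W. \<Sum>l<N. p l / card W * (\<Sum>k<K. \<Sum>w'\<in>W-{w}. \<Sum>l'<N. \<Sum>k'<K. B w l k w' l' k'))
    \<le> (\<Sum>w\<in>W. \<Sum>l<N. p l / card W * \<alpha>)"
  proof (intro sum_mono mult_left_mono)
    fix w l assume wl: "w \<in> W" "l \<in> {..<N}"
    have "(\<Sum>k<K. \<Sum>w'\<in>W-{w}. \<Sum>l'<N. \<Sum>k'<K. B w l k w' l' k')
      \<le> (\<Sum>k<K. real (card W) * N * K * \<beta>0 + real NB * K * \<beta>1 + real NA * \<beta>2)"
      using wl by (intro sum_mono count) auto
    also have "\<dots> = \<alpha>" by (simp add: \<alpha>_def \<beta>0_def \<beta>1_def \<beta>2_def)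
    finally show "(\<Sum>k<K. \<Sum>w'\<in>W-{w}. \<Sum>l'<N. \<Sum>k'<K. B w l k w' l' k') \<le> \<alpha>" .
  qed (use p in auto)
  ultimately have F: "expect_le ?\<Omega> F \<alpha>"
    unfolding average by (rule expect_le_mono)

  have coll: "expect_le ?\<Omega> (\<lambda>\<omega>. Z.collision (\<omega> (Inl (cl w, l, a w))) (\<omega> (Inr (cl w, l, b w, k)))
      (\<omega> (Inl (cl w, l', a w))) (\<omega> (Inr (cl w, l', b w, k')))) ((c * D')\<^sup>2)"
    if "w \<in> W" "l < N" "k < K" "l' \<in> {..<N} - {l}" "k' < K" for w l k l' k'
  proof -
    have l': "l' < N" using that by simp
    note j = J1[OF that(1,2)] J2[OF that(1-3)] J1[OF that(1) l'] J2[OF that(1) l' that(5)]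
    note [measurable] = j
    have "(\<lambda>\<omega>. Z.collision (\<omega> (Inl (cl w, l, a w))) (\<omega> (Inr (cl w, l, b w, k)))
      (\<omega> (Inl (cl w, l', a w))) (\<omega> (Inr (cl w, l', b w, k')))) \<in> borel_measurable ?\<Omega>"
      by measurable
    moreover have "(\<integral>\<^sup>+\<omega>. Z.collision (\<omega> (Inl (cl w, l, a w))) (\<omega> (Inr (cl w, l, b w, k)))
      (\<omega> (Inl (cl w, l', a w))) (\<omega> (Inr (cl w, l', b w, k'))) \<partial>?\<Omega>) \<le> ennreal ((c * D')\<^sup>2)"
      by (rule Z.expected_collision[OF J j]) (use that in auto)
    ultimately show ?thesis by (simp add: expect_le_def)
  qed
  have "expect_le ?\<Omega> H (\<Sum>w\<in>W. \<Sum>l<N. p l / card W * (\<Sum>k<K. \<Sum>l'\<in>{..<N}-{l}. p l' * (\<Sum>k'<K. (c * D')\<^sup>2)))"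
    unfolding H_def[abs_def] by (intro expect_le_sum expect_le_cmult coll) (use p in auto)
  moreover have "(\<Sum>w\<in>W. \<Sum>l<N. p l / card W * (\<Sum>k<K. \<Sum>l'\<in>{..<N}-{l}. p l' * (\<Sum>k'<K. (c * D')\<^sup>2)))
    \<le> (\<Sum>w\<in>W. \<Sum>l<N. p l / card W * \<gamma>)"
  proof (intro sum_mono mult_left_mono)
    fix l
    have "(\<Sum>l'\<in>{..<N}-{l}. p l') \<le> (\<Sum>l'<N. p l')"
      using p by (intro sum_mono2) auto
    then have "(\<Sum>l'\<in>{..<N}-{l}. p l' * (\<Sum>k'<K. (c * D')\<^sup>2)) \<le> 1 * (real K * (c * D')\<^sup>2)"
      using p unfolding sum_distrib_right[symmetric] by (intro mult_mono) auto
    then have "(\<Sum>k<K. \<Sum>l'\<in>{..<N}-{l}. p l' * (\<Sum>k'<K. (c * D')\<^sup>2)) \<le> (\<Sum>k<K. 1 * (real K * (c * D')\<^sup>2))"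
      by (intro sum_mono)
    then show "(\<Sum>k<K. \<Sum>l'\<in>{..<N}-{l}. p l' * (\<Sum>k'<K. (c * D')\<^sup>2)) \<le> \<gamma>"
      by (simp add: \<gamma>_def power2_eq_square mult_ac)
  qed (use p in auto)
  ultimately have H: "expect_le ?\<Omega> H \<gamma>"
    unfolding average by (rule expect_le_mono)

  define bad where "bad w l = {\<omega>\<in>space ?\<Omega>. \<forall>k<K. \<not> G (\<omega> (Inl (cl w, l, a w))) (\<omega> (Inr (cl w, l, b w, k)))}" for w l
  have bad_sets: "bad w l \<in> sets ?\<Omega>" if "w \<in> W" "l < N" for w l
  proof -
    have "Measurable.pred ?\<Omega> (\<lambda>\<omega>. \<forall>k\<in>{..<K}. \<not> G (\<omega> (Inl (cl w, l, a w))) (\<omega> (Inr (cl w, l, b w, k))))"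
    proof (rule pred_intros_finite)
      fix k assume "k \<in> {..<K}"
      then have [measurable]: "Inl (cl w, l, a w) \<in> J" "Inr (cl w, l, b w, k) \<in> J"
        using J1[OF that] J2[OF that] by auto
      show "Measurable.pred ?\<Omega> (\<lambda>\<omega>. \<not> G (\<omega> (Inl (cl w, l, a w))) (\<omega> (Inr (cl w, l, b w, k))))"
        by measurable
    qed simp
    then have "{\<omega>\<in>space ?\<Omega>. \<forall>k\<in>{..<K}. \<not> G (\<omega> (Inl (cl w, l, a w))) (\<omega> (Inr (cl w, l, b w, k)))} \<in> sets ?\<Omega>"
      by (rule predE)
    also have "{\<omega>\<in>space ?\<Omega>. \<forall>k\<in>{..<K}. \<not> G (\<omega> (Inl (cl w, l, a w))) (\<omega> (Inr (cl w, l, b w, k)))} = bad w l"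
      unfolding bad_def by (rule Collect_cong) blast
    finally show ?thesis .
  qed
  \<comment> \<open>Some message and some l have no good candidate; by \<open>fail\<close> the union
    bound stays within the 1/4 that \<open>expect_le_ex\<close> allows.\<close>
  define Bad where "Bad = (\<Union>(w, l)\<in>W \<times> {..<N}. bad w l)"
  have Bad_sets: "Bad \<in> sets ?\<Omega>"
    unfolding Bad_def using W by (intro sets.finite_UN) (auto intro: bad_sets)
  have "emeasure ?\<Omega> Bad \<le> (\<Sum>(w, l)\<in>W \<times> {..<N}. emeasure ?\<Omega> (bad w l))"
    unfolding Bad_def case_prod_beta' using W by (intro emeasure_subadditive_finite) (auto intro: bad_sets)
  also have "\<dots> \<le> (\<Sum>(w, l)\<in>W \<times> {..<N}. ennreal (q ^ K))"
  proof (rule sum_mono)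
    fix x assume "x \<in> W \<times> {..<N}"
    then obtain w l where x: "x = (w, l)" and wl: "w \<in> W" "l < N" by auto
    have "emeasure ?\<Omega> (bad w l) \<le> ennreal (q ^ K)"
      unfolding bad_def
    proof (rule Y.covering_failure[OF J _ _ _ T q])
      show "Inl (cl w, l, a w) \<in> J" using J1 wl by simp
      show "Inr (cl w, l, b w, k) \<in> J" if "k < K" for k using J2 wl that by simp
      show "inj_on (\<lambda>k. (cl w, l, b w, k)) {..<K}" by (simp add: inj_on_def)
    qed
    then show "(case x of (w, l) \<Rightarrow> emeasure ?\<Omega> (bad w l)) \<le> (case x of (w, l) \<Rightarrow> ennreal (q ^ K))"
      by (simp add: x)
  qed
  also have "\<dots> = ennreal (card W * N * q ^ K)"
  proof -
    have "(\<Sum>(w, l)\<in>W \<times> {..<N}. ennreal (q ^ K)) = of_nat (card W * N) * ennreal (q ^ K)"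
      by (simp add: card_cartesian_product case_prod_beta')
    also have "\<dots> = ennreal (real (card W * N)) * ennreal (q ^ K)"
      by (simp only: ennreal_of_nat_eq_real_of_nat)
    also have "\<dots> = ennreal (card W * N * q ^ K)"
      by (rule ennreal_mult'[symmetric]) simp
    finally show ?thesis .
  qed
  also have "\<dots> \<le> ennreal (1/4)"
    using fail by (intro ennreal_leI)
  finally have Bad: "emeasure ?\<Omega> Bad \<le> ennreal (1/4)" .

  have "0 < real (card W) * N * K * \<beta>0"
    using K cW N \<beta> by simp
  moreover have "0 \<le> real NB * K * \<beta>1" "0 \<le> real NA * \<beta>2"
    using \<beta> by simp_all
  ultimately have "0 < real (card W) * N * K * \<beta>0 + real NB * K * \<beta>1 + real NA * \<beta>2"
    by linarith
  then have "\<alpha> > 0"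
    unfolding \<alpha>_def \<beta>0_def[symmetric] \<beta>1_def[symmetric] \<beta>2_def[symmetric] using K by simp
  moreover have "\<gamma> > 0"
    unfolding \<gamma>_def using K cD by simp
  ultimately obtain \<omega> where \<omega>: "\<omega> \<in> space ?\<Omega>" "\<omega> \<notin> Bad" "F \<omega> \<le> ennreal (4 * \<alpha>)" "H \<omega> \<le> ennreal (4 * \<gamma>)"
    by (rule \<Omega>.expect_le_ex[OF F H _ _ Bad_sets Bad])
  show ?thesis
  proof (intro exI[of _ "\<lambda>i. \<omega> (Inl i)"] exI[of _ "\<lambda>j. \<omega> (Inr j)"] conjI)
    show "\<forall>w\<in>W. \<forall>l<N. \<omega> (Inl (cl w, l, a w)) \<in> space X \<and> (\<forall>k<K. \<omega> (Inr (cl w, l, b w, k)) \<in> space X) \<and>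
      (\<exists>k<K. G (\<omega> (Inl (cl w, l, a w))) (\<omega> (Inr (cl w, l, b w, k))))"
    proof (intro ballI allI impI conjI)
      fix w l assume wl: "w \<in> W" "l < N"
      show "\<omega> (Inl (cl w, l, a w)) \<in> space X"
        by (rule Y.layers_component_in_space[OF \<omega>(1) J1[OF wl]])
      show "\<omega> (Inr (cl w, l, b w, k)) \<in> space X" if "k < K" for k
        by (rule Y.layers_component_in_space[OF \<omega>(1) J2[OF wl that]])
      have "\<omega> \<notin> bad w l"
        using \<omega>(2) wl by (auto simp: Bad_def)
      then show "\<exists>k<K. G (\<omega> (Inl (cl w, l, a w))) (\<omega> (Inr (cl w, l, b w, k)))"
        using \<omega>(1) by (simp add: bad_def)
    qed
  qed (use \<omega>(3,4) in \<open>auto simp: F_def H_def\<close>)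
qed

end


section \<open>Jointly typical Gaussian codewords\<close>

lemma sq_sum_nonneg [simp]: "0 \<le> sq_sum n x"
  by (simp add: sq_sum_def sum_nonneg)

lemma dot_commute: "dot n x y = dot n y x"
  by (simp add: dot_def mult.commute)

lemma sq_sum_add: "sq_sum n (\<lambda>i. x i + y i) = sq_sum n x + sq_sum n y + 2 * dot n x y"
  by (simp add: sq_sum_def dot_def power2_sum sum.distrib sum_distrib_left mult.assoc)

lemma sq_sum_scale: "sq_sum n (\<lambda>i. b * x i) = b\<^sup>2 * sq_sum n x"
  by (simp add: sq_sum_def power_mult_distrib sum_distrib_left)

lemma dot_scale: "dot n (\<lambda>i. b * x i) y = b * dot n x y"
  by (simp add: dot_def sum_distrib_left mult.assoc)

lemma dot_add: "dot n (\<lambda>i. x i + y i) z = dot n x z + dot n y z"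
  by (simp add: dot_def sum.distrib distrib_right)

lemma sq_sum_diff_scale: "sq_sum n (\<lambda>i. y i - b * x i) = sq_sum n y - 2 * b * dot n x y + b\<^sup>2 * sq_sum n x"
  using sq_sum_add[of n y "\<lambda>i. (- b) * x i"] sq_sum_scale[of n "- b" x] dot_scale[of n "- b" x y]
  by (simp add: dot_commute[of n y])

lemma dot_diff_scale: "dot n (\<lambda>i. y i - b * x i) z = dot n y z - b * dot n x z"
  using dot_add[of n y "\<lambda>i. (- b) * x i" z] dot_scale[of n "- b" x z] by simp

lemma sq_sum_restrict [simp]: "sq_sum n (restrict x {..<n}) = sq_sum n x"
  by (simp add: sq_sum_def)

lemma dot_restrict [simp]: "dot n x (restrict y {..<n}) = dot n x y" "dot n (restrict x {..<n}) y = dot n x y"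
  by (simp_all add: dot_def)

text \<open>If the noise is typical, then the true input with component \<open>u\<close> beyond the center \<open>c\<close> is much
  likelier than the output distribution obtained by averaging over \<open>u\<close>.\<close>

lemma gauss_likelihood_ge:
  assumes "\<sigma> > 0" "\<epsilon>1 \<ge> 0" "\<epsilon>2 \<ge> 0" "\<eta> \<ge> 0"
    and u: "sq_sum n u \<ge> real n * (\<sigma> - \<epsilon>1)" and d: "\<bar>dot n u x\<bar> \<le> real n * \<epsilon>2"
    and x: "\<bar>sq_sum n x - real n\<bar> \<le> real n * \<eta>" and y: "\<And>i. i < n \<Longrightarrow> y i = c i + u i + x i"
  shows "exp (real n * (1/2 * ln (1 + \<sigma>) - (\<eta> + \<epsilon>1 / 2 + \<epsilon>2))) * gauss n (1 + \<sigma>) c y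
    \<le> gauss n 1 (\<lambda>i. c i + u i) y"
proof -
  define v where "v = 1 + \<sigma>"
  have v: "v \<ge> 1" using assms by (simp add: v_def)
  define q where "q = sq_sum n (\<lambda>i. u i + x i)"
  have s1: "(\<Sum>i<n. (y i - c i)\<^sup>2) = q"
    unfolding q_def sq_sum_def by (intro sum.cong) (auto simp: y)
  have s2: "(\<Sum>i<n. (y i - (c i + u i))\<^sup>2) = sq_sum n x"
    unfolding sq_sum_def by (intro sum.cong) (auto simp: y)
  have q: "q \<ge> real n * (v - (\<epsilon>1 + 2 * \<epsilon>2 + \<eta>))"
    unfolding q_def sq_sum_add v_def using u d x by (simp add: algebra_simps abs_le_iff)
  have e: "0 \<le> real n * (\<epsilon>1 + 2 * \<epsilon>2 + \<eta>)" using assms by simp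
  \<comment> \<open>Dividing the nonnegative slack by v \<ge> 1 only shrinks it.\<close>
  have "real n - real n * (\<epsilon>1 + 2 * \<epsilon>2 + \<eta>) \<le> real n - real n * (\<epsilon>1 + 2 * \<epsilon>2 + \<eta>) / v"
    using divide_left_mono[of 1 v "real n * (\<epsilon>1 + 2 * \<epsilon>2 + \<eta>)"] v e by simp
  also have "\<dots> = real n * (v - (\<epsilon>1 + 2 * \<epsilon>2 + \<eta>)) / v"
    using v by (simp add: field_simps)
  also have "\<dots> \<le> q / v"
    using q v by (simp add: divide_right_mono)
  finally have qv: "real n - real n * (\<epsilon>1 + 2 * \<epsilon>2 + \<eta>) \<le> q / v" .
  have "ln (exp (real n * (1/2 * ln v - (\<eta> + \<epsilon>1 / 2 + \<epsilon>2))) * gauss n v c y)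
    = real n * (1/2 * ln v - (\<eta> + \<epsilon>1 / 2 + \<epsilon>2)) - real n / 2 * ln (2 * pi * v) - q / (2 * v)"
    using v gauss_pos[of v n c y] by (simp add: ln_mult ln_gauss s1)
  also have "\<dots> \<le> - real n / 2 * ln (2 * pi) - sq_sum n x / 2"
  proof -
    have "q / (2 * v) = (q / v) / 2" by simp
    moreover have "ln (2 * pi * v) = ln (2 * pi) + ln v" using v by (simp add: ln_mult)
    moreover have "sq_sum n x \<le> real n + real n * \<eta>" using x by (simp add: abs_le_iff)
    ultimately show ?thesis using qv by (simp add: algebra_simps)
  qed
  also have "\<dots> = ln (gauss n 1 (\<lambda>i. c i + u i) y)"
    by (simp add: ln_gauss s2)
  finally show ?thesis
    unfolding v_def[symmetric] using v gauss_pos[of v n c y] gauss_pos[of 1 n _ y]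
    by (subst (asm) ln_le_cancel_iff) auto
qed

locale gaussian_pair =
  fixes n :: nat and s1 s2 r \<eta> :: real
  assumes n: "n > 0" and s: "s1 > 0" "s2 > 0" and r: "r\<^sup>2 < s1 * s2" and \<eta>: "\<eta> > 0"
begin

text \<open>For jointly Gaussian (X1, X2) with variances s1, s2 and covariance r: \<beta> and
  \<beta>' are the regression coefficients of X2 on X1 and of X1 on X2, \<tau> and \<tau>' the
  conditional variances, \<open>S\<close> is the variance of X1 + X2 and \<open>I0\<close> the
  mutual information of X1 and X2 in nats.\<close>

definition "\<beta> = r / s1"
definition "\<beta>' = r / s2"
definition "\<tau> = s2 - r\<^sup>2 / s1"
definition "\<tau>' = s1 - r\<^sup>2 / s2"
definition "S = s1 + s2 + 2 * r"
definition "I0 = 1/2 * ln (s2 / \<tau>)"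
text \<open>One constant for all typicality slacks. The terms with factor 5 serve the decoder
  thresholds, where for unrelated pairs the slacks add up to \<eta> + 4 * \<eta> / 2 + 2 * \<eta>;
  the other two serve the density ratio in \<open>good_ratio\<close>.\<close>

definition "\<kappa> = 5 * (1 + \<bar>\<beta>\<bar>)\<^sup>2 + 5 * (1 + \<bar>\<beta>'\<bar>)\<^sup>2 + (1 + \<bar>\<beta>\<bar>)\<^sup>2 / (2 * \<tau>) + 1 / (2 * s2)"

definition good :: "(nat \<Rightarrow> real) \<Rightarrow> (nat \<Rightarrow> real) \<Rightarrow> bool" where
  "good x1 x2 \<longleftrightarrow> \<bar>sq_sum n x1 - real n * s1\<bar> \<le> real n * \<eta> \<and> \<bar>sq_sum n x2 - real n * s2\<bar> \<le> real n * \<eta> \<and>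
     \<bar>dot n x1 x2 - real n * r\<bar> \<le> real n * \<eta>"

lemma \<tau>: "\<tau> > 0" "\<tau>' > 0"
  using s r by (simp_all add: \<tau>_def \<tau>'_def field_simps)

text \<open>\<open>S\<close> is the conditional variance \<tau> plus the variance of (1 + \<beta>) *
  X1, hence positive even for negative r.\<close>

lemma S: "S > 0"
proof -
  have "0 < \<tau> + (1 + \<beta>)\<^sup>2 * s1" using \<tau> s by (simp add: add_pos_nonneg)
  also have "\<dots> = S" using s by (simp add: \<tau>_def \<beta>_def S_def field_simps power2_eq_square)
  finally show ?thesis .
qed

lemma \<kappa>: "\<kappa> \<ge> 5 * (1 + \<bar>\<beta>\<bar>)\<^sup>2" "\<kappa> \<ge> 5 * (1 + \<bar>\<beta>'\<bar>)\<^sup>2" "\<kappa> \<ge> (1 + \<bar>\<beta>\<bar>)\<^sup>2 / (2 * \<tau>) + 1 / (2 * s2)" "\<kappa> \<ge> 5"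
proof -
  have "0 \<le> (1 + \<bar>\<beta>\<bar>)\<^sup>2 / (2 * \<tau>)" "0 \<le> 1 / (2 * s2)" "0 \<le> (1 + \<bar>\<beta>\<bar>)\<^sup>2" "1 \<le> (1 + \<bar>\<beta>'\<bar>)\<^sup>2"
    using \<tau> s by (auto intro: one_le_power)
  then show "\<kappa> \<ge> 5 * (1 + \<bar>\<beta>\<bar>)\<^sup>2" "\<kappa> \<ge> 5 * (1 + \<bar>\<beta>'\<bar>)\<^sup>2" "\<kappa> \<ge> (1 + \<bar>\<beta>\<bar>)\<^sup>2 / (2 * \<tau>) + 1 / (2 * s2)" "\<kappa> \<ge> 5"
    unfolding \<kappa>_def by linarith+
qed

lemma good_residual:
  assumes "good x1 x2"
  shows "\<bar>sq_sum n (\<lambda>i. x2 i - \<beta> * x1 i) - real n * \<tau>\<bar> \<le> real n * \<eta> * (1 + \<bar>\<beta>\<bar>)\<^sup>2"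
proof -
  have "sq_sum n (\<lambda>i. x2 i - \<beta> * x1 i) - real n * \<tau>
    = (sq_sum n x2 - real n * s2) - 2 * \<beta> * (dot n x1 x2 - real n * r) + \<beta>\<^sup>2 * (sq_sum n x1 - real n * s1)"
  proof -
    have "\<tau> = s2 - 2 * \<beta> * r + \<beta>\<^sup>2 * s1"
      using s by (simp add: \<tau>_def \<beta>_def field_simps power2_eq_square)
    then have "real n * \<tau> = real n * s2 - 2 * \<beta> * (real n * r) + \<beta>\<^sup>2 * (real n * s1)"
      by (simp only: distrib_left right_diff_distrib mult_ac)
    then show ?thesis unfolding sq_sum_diff_scale by (simp add: algebra_simps)
  qed
  also have "\<bar>\<dots>\<bar> \<le> \<bar>sq_sum n x2 - real n * s2\<bar> + 2 * \<bar>\<beta>\<bar> * \<bar>dot n x1 x2 - real n * r\<bar> + \<beta>\<^sup>2 * \<bar>sq_sum n x1 - real n * s1\<bar>"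
  proof -
    have "\<bar>a - b + d\<bar> \<le> \<bar>a\<bar> + \<bar>b\<bar> + \<bar>d\<bar>" for a b d :: real by linarith
    then show ?thesis by (rule order_trans) (simp add: abs_mult)
  qed
  also have "\<dots> \<le> real n * \<eta> + 2 * \<bar>\<beta>\<bar> * (real n * \<eta>) + \<beta>\<^sup>2 * (real n * \<eta>)"
    using assms by (intro add_mono mult_left_mono) (auto simp: good_def)
  also have "\<dots> = real n * \<eta> * (1 + \<bar>\<beta>\<bar>)\<^sup>2"
    by (simp add: power2_eq_square algebra_simps abs_mult_self_eq)
  finally show ?thesis .
qed

text \<open>Goodness is symmetric, so the locale with s1 and s2 exchanged delivers the mirrored
  bound.\<close>

lemma good_residual':
  assumes "good x1 x2"
  shows "\<bar>sq_sum n (\<lambda>i. x1 i - \<beta>' * x2 i) - real n * \<tau>'\<bar> \<le> real n * \<eta> * (1 + \<bar>\<beta>'\<bar>)\<^sup>2"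
proof -
  interpret swap: gaussian_pair n s2 s1 r \<eta>
    using n s r \<eta> by unfold_locales (auto simp: mult.commute)
  have "swap.good x2 x1"
    using assms by (simp add: good_def swap.good_def dot_commute)
  from swap.good_residual[OF this] show ?thesis
    by (simp add: swap.\<beta>_def swap.\<tau>_def \<beta>'_def \<tau>'_def)
qed

text \<open>The log ratio of the marginal to the conditional density of x2 depends only on the
  energies of x2 and of the residual x2 - \<beta> * x1, which goodness pins down. The upper bound
  makes good pairs rare among independent codewords, the lower bound makes them frequent enough to
  be found.\<close>

lemma good_ratio:
  assumes "good x1 x2"
  shows "gauss n s2 (\<lambda>_. 0) x2 \<le> exp (- real n * (I0 - \<kappa> * \<eta>)) * gauss n \<tau> (\<lambda>i. \<beta> * x1 i) x2"
    and "exp (- real n * (I0 + \<kappa> * \<eta>)) * gauss n \<tau> (\<lambda>i. \<beta> * x1 i) x2 \<le> gauss n s2 (\<lambda>_. 0) x2"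
proof -
  define d where "d = sq_sum n x2 / (2 * s2) - sq_sum n (\<lambda>i. x2 i - \<beta> * x1 i) / (2 * \<tau>)"
  have "d = (sq_sum n x2 - real n * s2) / (2 * s2) - (sq_sum n (\<lambda>i. x2 i - \<beta> * x1 i) - real n * \<tau>) / (2 * \<tau>)"
    using s \<tau> by (simp add: d_def field_simps)
  also have "\<bar>\<dots>\<bar> \<le> \<bar>sq_sum n x2 - real n * s2\<bar> / (2 * s2) + \<bar>sq_sum n (\<lambda>i. x2 i - \<beta> * x1 i) - real n * \<tau>\<bar> / (2 * \<tau>)"
    using s \<tau> by (intro order_trans[OF abs_triangle_ineq4]) (simp add: abs_divide abs_mult)
  also have "\<dots> \<le> real n * \<eta> / (2 * s2) + real n * \<eta> * (1 + \<bar>\<beta>\<bar>)\<^sup>2 / (2 * \<tau>)"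
    using assms s \<tau> good_residual[OF assms] by (intro add_mono divide_right_mono) (auto simp: good_def)
  also have "\<dots> = real n * \<eta> * ((1 + \<bar>\<beta>\<bar>)\<^sup>2 / (2 * \<tau>) + 1 / (2 * s2))"
    by (simp add: distrib_left)
  also have "\<dots> \<le> real n * \<eta> * \<kappa>"
    using \<eta> by (intro mult_left_mono \<kappa>) simp
  finally have d: "\<bar>d\<bar> \<le> real n * \<eta> * \<kappa>" .
  let ?a = "gauss n \<tau> (\<lambda>i. \<beta> * x1 i) x2" and ?b = "gauss n s2 (\<lambda>_. 0) x2"
  have a: "?a > 0" and b: "?b > 0" using s \<tau> by (auto intro: gauss_pos)
  have "ln ?a - ln ?b = real n * I0 + d"
    using s \<tau> by (simp add: ln_gauss ln_gauss_zero d_def I0_def ln_mult ln_div sq_sum_def algebra_simps)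
  moreover have "?a = exp (ln ?a - ln ?b) * ?b"
    using a b by (simp add: exp_diff)
  ultimately have ratio: "?a = exp (real n * I0 + d) * ?b"
    by simp
  show "?b \<le> exp (- real n * (I0 - \<kappa> * \<eta>)) * ?a"
  proof -
    have "1 \<le> exp (- real n * (I0 - \<kappa> * \<eta>) + (real n * I0 + d))"
      using d by (simp add: algebra_simps abs_le_iff)
    then show ?thesis
      unfolding ratio mult.assoc[symmetric] exp_add[symmetric] using b by simp
  qed
  show "exp (- real n * (I0 + \<kappa> * \<eta>)) * ?a \<le> ?b"
  proof -
    have "exp (- real n * (I0 + \<kappa> * \<eta>) + (real n * I0 + d)) \<le> 1"
      using d by (simp add: algebra_simps abs_le_iff)
    then show ?thesis
      unfolding ratio mult.assoc[symmetric] exp_add[symmetric] using b by simp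
  qed
qed

text \<open>Bayes' rule once more: the joint density of the two codewords factored in either
  order.\<close>

lemma gauss_pair_swap:
  "gauss n \<tau> (\<lambda>i. \<beta> * x1 i) x2 * gauss n s1 (\<lambda>_. 0) x1
    = gauss n s2 (\<lambda>_. 0) x2 * gauss n \<tau>' (\<lambda>i. \<beta>' * x2 i) x1"
proof -
  have "\<tau> + \<beta>\<^sup>2 * s1 = s2" "s1 * \<tau> / s2 = \<tau>'" "\<beta> * (s1 * x) / s2 = \<beta>' * x" for x
    using s by (simp_all add: \<tau>_def \<tau>'_def \<beta>_def \<beta>'_def field_simps power2_eq_square)
  then show ?thesis
    using gauss_bayes[OF \<tau>(1) s(1), of n "\<lambda>_. 0" \<beta> x1 x2 "\<lambda>_. 0"] by (simp add: mult.assoc)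
qed

text \<open>Writing the joint density in both orders and cancelling the conditional density of x2
  carries \<open>good_ratio\<close> over to x1.\<close>

lemma good_ratio':
  assumes "good x1 x2"
  shows "gauss n s1 (\<lambda>_. 0) x1 \<le> exp (- real n * (I0 - \<kappa> * \<eta>)) * gauss n \<tau>' (\<lambda>i. \<beta>' * x2 i) x1"
proof -
  let ?D = "exp (- real n * (I0 - \<kappa> * \<eta>))"
  let ?a = "gauss n \<tau> (\<lambda>i. \<beta> * x1 i) x2" and ?b = "gauss n s2 (\<lambda>_. 0) x2"
  have "?a * gauss n s1 (\<lambda>_. 0) x1 \<le> (?D * ?a) * gauss n \<tau>' (\<lambda>i. \<beta>' * x2 i) x1"
    unfolding gauss_pair_swap by (intro mult_right_mono good_ratio assms) simp
  then have "?a * gauss n s1 (\<lambda>_. 0) x1 \<le> ?a * (?D * gauss n \<tau>' (\<lambda>i. \<beta>' * x2 i) x1)"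
    by (simp add: mult_ac)
  then show ?thesis using gauss_pos[OF \<tau>(1)] by simp
qed

end


section \<open>Codeword laws, channel kernel and output densities\<close>

lemma measurable_gauss_affine [measurable (raw)]:
  assumes "f \<in> measurable N (seq_space n)" "g \<in> measurable N (seq_space n)" "h \<in> measurable N (seq_space n)"
  shows "(\<lambda>w. gauss n v (\<lambda>i. a * f w i + b * g w i) (h w)) \<in> borel_measurable N"
proof (rule measurable_gauss)
  fix i assume i: "i < n"
  have c: "(\<lambda>w. k w i) \<in> borel_measurable N" if "k \<in> measurable N (seq_space n)" for k
    using measurable_compose[OF that measurable_component_singleton[of i "{..<n}"]] i by simp
  show "(\<lambda>w. a * f w i + b * g w i) \<in> borel_measurable N"
    using c[OF assms(1)] c[OF assms(2)] by simp
  show "(\<lambda>w. h w i) \<in> borel_measurable N"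
    by (rule c[OF assms(3)])
qed

lemma measurable_dot_seq [measurable (raw)]:
  assumes "f \<in> measurable N (seq_space n)" "g \<in> measurable N (seq_space n)"
  shows "(\<lambda>w. dot n (f w) (g w)) \<in> borel_measurable N"
proof (rule measurable_dot)
  fix i assume i: "i < n"
  have c: "(\<lambda>w. k w i) \<in> borel_measurable N" if "k \<in> measurable N (seq_space n)" for k
    using measurable_compose[OF that measurable_component_singleton[of i "{..<n}"]] i by simp
  show "(\<lambda>w. f w i) \<in> borel_measurable N" "(\<lambda>w. g w i) \<in> borel_measurable N"
    using c assms by auto
qed

lemma sq_sum_eq_dot: "sq_sum n x = dot n x x"
  by (simp add: sq_sum_def dot_def power2_eq_square)

context gaussian_pair
begin

text \<open>Regression amplifies the errors of x1 and of the residual to at most (1 + |\<beta>|)^2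
  times their size, so this smaller slack for both yields goodness with slack \<eta>.\<close>

definition "\<eta>0 = \<eta> / (1 + \<bar>\<beta>\<bar>)\<^sup>2"

text \<open>Only the energy is constrained: against the zero sequence the correlation condition is
  void.\<close>

definition typical :: "(nat \<Rightarrow> real) set" where
  "typical = {x \<in> space (seq_space n). typical_noise n s1 \<eta>0 (\<lambda>_. 0) x}"

text \<open>Conditioning makes the covering bound hold for almost every first codeword. Chebyshev's
  O(1/n) for an atypical one could not survive a union over exponentially many codewords.\<close>

definition "\<nu>1 = uniform_measure (gaussian_noise n s1) typical"
definition "\<nu>2 = gaussian_noise n s2"

text \<open>Chosen so that the Chebyshev bounds for the energy of x1 and for the residual are both
  at most 1/2.\<close>

definition large :: bool where
  "large \<longleftrightarrow> (2 * s1\<^sup>2 + 2 * \<tau>\<^sup>2 + \<tau> * (s1 + \<eta>0)) / (real n * \<eta>0\<^sup>2) \<le> 1/2"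

definition channel :: "real \<Rightarrow> (nat \<Rightarrow> real) \<Rightarrow> (nat \<Rightarrow> real) \<Rightarrow> (nat \<Rightarrow> real) \<Rightarrow> real" where
  "channel t x1 x2 y = gauss n 1 (\<lambda>i. t * x1 i + t * x2 i) y"

definition output0 :: "real \<Rightarrow> (nat \<Rightarrow> real) \<Rightarrow> real" where
  "output0 t y = gauss n (1 + t\<^sup>2 * S) (\<lambda>_. 0) y"

text \<open>The output law given X1 = x1 when X2 has its conditional law. The summand with factor 0
  gives the center the two-term form that \<open>measurable_gauss_affine\<close> handles.\<close>

definition output1 :: "real \<Rightarrow> (nat \<Rightarrow> real) \<Rightarrow> (nat \<Rightarrow> real) \<Rightarrow> real" where
  "output1 t x1 y = gauss n (1 + t\<^sup>2 * \<tau>) (\<lambda>i. 0 * x1 i + t * (1 + \<beta>) * x1 i) y"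

definition output2 :: "real \<Rightarrow> (nat \<Rightarrow> real) \<Rightarrow> (nat \<Rightarrow> real) \<Rightarrow> real" where
  "output2 t x2 y = gauss n (1 + t\<^sup>2 * \<tau>') (\<lambda>i. 0 * x2 i + t * (1 + \<beta>') * x2 i) y"

text \<open>The factor 2 pays for conditioning the first layer on an event of probability at least
  1/2.\<close>

definition "D = 2 * exp (- real n * (I0 - \<kappa> * \<eta>))"

lemma \<eta>0: "\<eta>0 > 0" "\<eta>0 * (1 + \<bar>\<beta>\<bar>)\<^sup>2 = \<eta>" "\<eta>0 * (1 + \<bar>\<beta>\<bar>) \<le> \<eta>" "\<eta>0 \<le> \<eta>"
proof -
  show 1: "\<eta>0 > 0" using \<eta> by (simp add: \<eta>0_def add_pos_nonneg)
  have b: "1 + \<bar>\<beta>\<bar> \<noteq> 0" by linarith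
  show 2: "\<eta>0 * (1 + \<bar>\<beta>\<bar>)\<^sup>2 = \<eta>" using b by (simp add: \<eta>0_def)
  have "(1 + \<bar>\<beta>\<bar>) * 1 \<le> (1 + \<bar>\<beta>\<bar>) * (1 + \<bar>\<beta>\<bar>)"
    by (intro mult_left_mono) auto
  then have "\<eta>0 * (1 + \<bar>\<beta>\<bar>) \<le> \<eta>0 * (1 + \<bar>\<beta>\<bar>)\<^sup>2"
    using 1 unfolding power2_eq_square by (intro mult_left_mono) auto
  then show 3: "\<eta>0 * (1 + \<bar>\<beta>\<bar>) \<le> \<eta>"
    unfolding 2 .
  have "\<eta>0 * 1 \<le> \<eta>0 * (1 + \<bar>\<beta>\<bar>)" using 1 by (intro mult_left_mono) auto
  with 3 show "\<eta>0 \<le> \<eta>" by simp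
qed

lemma typical_sets [measurable]: "typical \<in> sets (seq_space n)"
  unfolding typical_def by measurable

lemma good_measurable [measurable]: "Measurable.pred (seq_space n \<Otimes>\<^sub>M seq_space n) (\<lambda>x. good (fst x) (snd x))"
  unfolding good_def by measurable

lemma good_measurable1 [measurable]:
  "x1 \<in> space (seq_space n) \<Longrightarrow> Measurable.pred (seq_space n) (good x1)"
  unfolding good_def[abs_def] by measurable

lemma good_measurable2 [measurable]:
  "x2 \<in> space (seq_space n) \<Longrightarrow> Measurable.pred (seq_space n) (\<lambda>x1. good x1 x2)"
  unfolding good_def[abs_def] by measurable

lemma prob_noise_typical:
  assumes "large"
  shows "emeasure (gaussian_noise n s1) typical \<ge> ennreal (1/2)"
    and "sq_sum n x1 \<le> real n * (s1 + \<eta>0) \<Longrightarrow>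
      emeasure (gaussian_noise n \<tau>) {v \<in> space (seq_space n). typical_noise n \<tau> \<eta>0 x1 v} \<ge> ennreal (1/2)"
proof -
  have compl: "emeasure M A \<ge> ennreal (1/2)"
    if "prob_space M" "A \<in> sets M" "emeasure M (space M - A) \<le> ennreal (1/2)" for M :: "(nat \<Rightarrow> real) measure" and A
  proof -
    interpret prob_space M by fact
    have "prob (space M - A) \<le> 1/2"
      using that(3) unfolding emeasure_eq_measure by (subst (asm) ennreal_le_iff) auto
    then show ?thesis using prob_compl[OF that(2)] by (simp add: emeasure_eq_measure ennreal_leI del: ennreal_half)
  qed
  have pos: "0 < real n * \<eta>0\<^sup>2" using n \<eta>0 by simp
  have le: "(2 * s1\<^sup>2 + s1 * 0) / (real n * \<eta>0\<^sup>2) \<le> 1/2"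
    "(2 * \<tau>\<^sup>2 + \<tau> * (s1 + \<eta>0)) / (real n * \<eta>0\<^sup>2) \<le> 1/2"
    using assms \<tau> s \<eta>0(1) unfolding large_def
    by (auto elim!: order_trans[rotated] intro!: divide_right_mono)
  show "emeasure (gaussian_noise n s1) typical \<ge> ennreal (1/2)"
  proof (rule compl[OF prob_space_gaussian_noise[OF s(1)]])
    have "emeasure (gaussian_noise n s1) {y\<in>space (seq_space n). \<not> typical_noise n s1 \<eta>0 (\<lambda>_. 0) y}
      \<le> ennreal ((2 * s1\<^sup>2 + s1 * 0) / (real n * \<eta>0\<^sup>2))"
      using n s \<eta>0 by (intro emeasure_not_typical_noise_le) (auto simp: sq_sum_def)
    also have "\<dots> \<le> ennreal (1/2)" by (intro ennreal_leI le)
    also have "{y\<in>space (seq_space n). \<not> typical_noise n s1 \<eta>0 (\<lambda>_. 0) y} = space (gaussian_noise n s1) - typical"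
      by (auto simp: typical_def)
    finally show "emeasure (gaussian_noise n s1) (space (gaussian_noise n s1) - typical) \<le> ennreal (1/2)" .
  qed simp
  show "emeasure (gaussian_noise n \<tau>) {v \<in> space (seq_space n). typical_noise n \<tau> \<eta>0 x1 v} \<ge> ennreal (1/2)"
    if "sq_sum n x1 \<le> real n * (s1 + \<eta>0)"
  proof (rule compl[OF prob_space_gaussian_noise[OF \<tau>(1)]])
    have "emeasure (gaussian_noise n \<tau>) {y\<in>space (seq_space n). \<not> typical_noise n \<tau> \<eta>0 x1 y}
      \<le> ennreal ((2 * \<tau>\<^sup>2 + \<tau> * (s1 + \<eta>0)) / (real n * \<eta>0\<^sup>2))"
      using n s \<eta>0 \<tau> that by (intro emeasure_not_typical_noise_le) auto
    also have "\<dots> \<le> ennreal (1/2)" by (intro ennreal_leI le)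
    also have "{y\<in>space (seq_space n). \<not> typical_noise n \<tau> \<eta>0 x1 y}
      = space (gaussian_noise n \<tau>) - {v \<in> space (seq_space n). typical_noise n \<tau> \<eta>0 x1 v}"
      by auto
    finally show "emeasure (gaussian_noise n \<tau>)
      (space (gaussian_noise n \<tau>) - {v \<in> space (seq_space n). typical_noise n \<tau> \<eta>0 x1 v}) \<le> ennreal (1/2)" .
  qed measurable
qed

lemma prob_space_\<nu>1: "large \<Longrightarrow> prob_space \<nu>1"
  unfolding \<nu>1_def using prob_noise_typical(1) prob_space.emeasure_le_1[OF prob_space_gaussian_noise[OF s(1)], of n typical]
  by (intro prob_space_uniform_measure) (auto simp: top_unique)

lemma prob_space_\<nu>2: "prob_space \<nu>2"
  unfolding \<nu>2_def by (rule prob_space_gaussian_noise[OF s(2)])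

lemma sets_\<nu> [simp, measurable_cong]: "sets \<nu>1 = sets (seq_space n)" "sets \<nu>2 = sets (seq_space n)"
  by (simp_all add: \<nu>1_def \<nu>2_def)

text \<open>Conditioning on an event of probability at least 1/2 at most doubles a nonnegative
  integral once its indicator is bounded by 1.\<close>

lemma nn_integral_\<nu>1_le:
  assumes "large" and [measurable]: "f \<in> borel_measurable (seq_space n)"
  shows "(\<integral>\<^sup>+x. f x \<partial>\<nu>1) \<le> 2 * (\<integral>\<^sup>+x. ennreal (gauss n s1 (\<lambda>_. 0) x) * f x \<partial>lebesgue_seq n)"
proof -
  let ?M = "gaussian_noise n s1"
  interpret M: prob_space ?M by (rule prob_space_gaussian_noise[OF s(1)])
  have "ennreal (1/2) \<le> ennreal (M.prob typical)"
    using prob_noise_typical(1)[OF assms(1)] unfolding M.emeasure_eq_measure .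
  then have p: "M.prob typical \<ge> 1/2"
    by (subst (asm) ennreal_le_iff) auto
  have "(\<integral>\<^sup>+x. f x \<partial>\<nu>1) = (\<integral>\<^sup>+x. f x * indicator typical x \<partial>?M) / emeasure ?M typical"
    unfolding \<nu>1_def by (subst nn_integral_uniform_measure) auto
  also have "\<dots> = (\<integral>\<^sup>+x. f x * indicator typical x \<partial>?M) * ennreal (inverse (M.prob typical))"
    using p by (simp add: M.emeasure_eq_measure divide_ennreal_def inverse_ennreal)
  also have "\<dots> \<le> (\<integral>\<^sup>+x. f x \<partial>?M) * ennreal 2"
    using p by (intro mult_mono nn_integral_mono ennreal_leI) (auto simp: indicator_def field_simps)
  also have "\<dots> = 2 * (\<integral>\<^sup>+x. f x \<partial>?M)"
    by (simp add: mult.commute)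
  also have "(\<integral>\<^sup>+x. f x \<partial>?M) = (\<integral>\<^sup>+x. ennreal (gauss n s1 (\<lambda>_. 0) x) * f x \<partial>lebesgue_seq n)"
    using s by (simp add: gaussian_noise_eq nn_integral_density)
  finally show ?thesis .
qed

lemma nn_integral_\<nu>2:
  assumes [measurable]: "f \<in> borel_measurable (seq_space n)"
  shows "(\<integral>\<^sup>+x. f x \<partial>\<nu>2) = (\<integral>\<^sup>+x. ennreal (gauss n s2 (\<lambda>_. 0) x) * f x \<partial>lebesgue_seq n)"
  unfolding \<nu>2_def using s by (simp add: gaussian_noise_eq nn_integral_density)

lemma channel_measurable [measurable (raw)]:
  assumes "f \<in> measurable N (seq_space n)" "g \<in> measurable N (seq_space n)" "h \<in> measurable N (seq_space n)"
  shows "(\<lambda>w. channel t (f w) (g w) (h w)) \<in> borel_measurable N"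
  unfolding channel_def by (rule measurable_gauss_affine[OF assms])

lemma output0_measurable [measurable]: "output0 t \<in> borel_measurable (seq_space n)"
  unfolding output0_def[abs_def] by measurable

lemma output1_measurable [measurable (raw)]:
  assumes "f \<in> measurable N (seq_space n)" "h \<in> measurable N (seq_space n)"
  shows "(\<lambda>w. output1 t (f w) (h w)) \<in> borel_measurable N"
  unfolding output1_def by (rule measurable_gauss_affine[OF assms(1,1,2)])

lemma output2_measurable [measurable (raw)]:
  assumes "f \<in> measurable N (seq_space n)" "h \<in> measurable N (seq_space n)"
  shows "(\<lambda>w. output2 t (f w) (h w)) \<in> borel_measurable N"
  unfolding output2_def by (rule measurable_gauss_affine[OF assms(1,1,2)])

lemma channel_pos: "channel t x1 x2 y > 0"
  unfolding channel_def by (rule gauss_pos) simp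

lemma output_pos: "output0 t y > 0" "output1 t x y > 0" "output2 t x y > 0"
  unfolding output0_def output1_def output2_def using S \<tau> by (auto intro!: gauss_pos add_pos_nonneg)

text \<open>Averaging over X2 given X1 = x1 moves the center by t * \<beta> * x1 and adds t^2 *
  \<tau> to the noise variance.\<close>

lemma gauss_channel1:
  "(\<integral>\<^sup>+x2. ennreal (channel t x1 x2 y) * ennreal (gauss n \<tau> (\<lambda>i. \<beta> * x1 i) x2) \<partial>lebesgue_seq n) = ennreal (output1 t x1 y)"
  unfolding channel_def output1_def using \<tau> by (subst nn_integral_gauss_conv) (auto simp: algebra_simps)

lemma gauss_channel2:
  "(\<integral>\<^sup>+x1. ennreal (channel t x1 x2 y) * ennreal (gauss n \<tau>' (\<lambda>i. \<beta>' * x2 i) x1) \<partial>lebesgue_seq n) = ennreal (output2 t x2 y)"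
proof -
  have "channel t x1 x2 y = gauss n 1 (\<lambda>i. t * x2 i + t * x1 i) y" for x1
    by (simp add: channel_def add.commute)
  then show ?thesis
    unfolding output2_def using \<tau> by (simp, subst nn_integral_gauss_conv) (auto simp: algebra_simps)
qed

lemma gauss_output1:
  "(\<integral>\<^sup>+x. ennreal (output1 t x y) * ennreal (gauss n s1 (\<lambda>_. 0) x) \<partial>lebesgue_seq n) = ennreal (output0 t y)"
proof -
  have S': "1 + t\<^sup>2 * S = 1 + t\<^sup>2 * \<tau> + (t * (1 + \<beta>))\<^sup>2 * s1"
    using s by (simp add: \<tau>_def \<beta>_def S_def field_simps power2_eq_square)
  show ?thesis
    unfolding output1_def output0_def S' using \<tau> s
    by (simp, subst nn_integral_gauss_conv[where a="\<lambda>_. 0", simplified]) (auto simp: add_pos_nonneg)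
qed

lemma gauss_output2:
  "(\<integral>\<^sup>+x. ennreal (output2 t x y) * ennreal (gauss n s2 (\<lambda>_. 0) x) \<partial>lebesgue_seq n) = ennreal (output0 t y)"
proof -
  have S': "1 + t\<^sup>2 * S = 1 + t\<^sup>2 * \<tau>' + (t * (1 + \<beta>'))\<^sup>2 * s2"
    using s by (simp add: \<tau>'_def \<beta>'_def S_def field_simps power2_eq_square)
  show ?thesis
    unfolding output2_def output0_def S' using \<tau> s
    by (simp, subst nn_integral_gauss_conv[where a="\<lambda>_. 0", simplified]) (auto simp: add_pos_nonneg)
qed

end


section \<open>Inequalities for soft covering\<close>

lemma ln_mult_add_le:
  fixes x A :: real
  assumes "0 \<le> x" "x \<le> 4 * exp A" "0 \<le> A"
  shows "ln (1 + x) \<le> ln 8 + A"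
proof -
  have "1 \<le> exp A" using assms by simp
  then have "1 + x \<le> 8 * exp A" using assms by linarith
  then have "ln (1 + x) \<le> ln (8 * exp A)" using assms by (subst ln_le_cancel_iff) auto
  then show ?thesis by (simp add: ln_mult)
qed

text \<open>An arithmetic-geometric mean bound. It trades a first absolute moment for a second
  moment, which is known exactly, at the cost of k.\<close>

lemma abs_le_add_square_divide:
  fixes a k :: real
  assumes "k > 0"
  shows "\<bar>a\<bar> \<le> k + a\<^sup>2 / k"
proof -
  have "0 \<le> (\<bar>a\<bar> - k)\<^sup>2 + k * \<bar>a\<bar>" using assms by simp
  then have "k * \<bar>a\<bar> \<le> k * k + a\<^sup>2" by (simp add: power2_diff power2_eq_square algebra_simps)
  then show ?thesis using assms by (simp add: field_simps)
qed

text \<open>The elementary inequality behind soft covering: separating the \<open>l\<close>-th term from the others makes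
  the remaining sum \<open>V\<close> independent of the \<open>l\<close>-th codeword, so that only its mean matters.\<close>

lemma mixture_log_ratio_le:
  fixes p f :: "'l \<Rightarrow> real"
  assumes I: "finite I" "I \<noteq> {}" and p: "\<And>l. l \<in> I \<Longrightarrow> 0 \<le> p l" "\<And>l. l \<in> I \<Longrightarrow> p l \<le> pm"
    and f: "\<And>l. l \<in> I \<Longrightarrow> 0 < f l" and q: "q > 0" and C: "C \<ge> 1"
    and P: "(\<Sum>l\<in>I. p l * f l) > 0"
  shows "(\<Sum>l\<in>I. p l * f l) * ln ((\<Sum>l\<in>I. p l * f l) / q)
    \<le> (\<Sum>l\<in>I. p l * f l * (ln (1 + pm * f l / q) + ln C + (\<Sum>l'\<in>I-{l}. p l' * f l' / q) / C))"
  unfolding sum_distrib_right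
proof (rule sum_mono)
  fix l assume l: "l \<in> I"
  define V where "V = (\<Sum>l'\<in>I-{l}. p l' * f l' / q)"
  have V: "V \<ge> 0"
    unfolding V_def using p(1) f q by (intro sum_nonneg) (auto simp: less_imp_le)
  have pm: "0 \<le> pm" using p[OF l] by linarith
  have u: "0 \<le> pm * f l / q" using pm f[OF l] q by simp
  have "(\<Sum>l\<in>I. p l * f l) / q = p l * f l / q + V"
    using I l unfolding V_def sum_divide_distrib by (subst sum.remove[of I l]) auto
  also have "\<dots> \<le> pm * f l / q + V"
    using p(2)[OF l] f[OF l] q by (intro add_right_mono divide_right_mono mult_right_mono) auto
  \<comment> \<open>The product form separates, inside the logarithm, the l-th term from the rest
    \<open>V\<close>.\<close>
  also have "\<dots> \<le> (1 + pm * f l / q) * (1 + V)"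
    using u V mult_nonneg_nonneg[OF u V] by (simp add: distrib_left distrib_right)
  finally have "ln ((\<Sum>l\<in>I. p l * f l) / q) \<le> ln ((1 + pm * f l / q) * (1 + V))"
    using P q u V by (subst ln_le_cancel_iff) (auto intro: mult_pos_pos)
  also have "\<dots> = ln (1 + pm * f l / q) + ln (1 + V)"
    using u V by (intro ln_mult_pos) auto
  \<comment> \<open>A tangent bound, linear in \<open>V\<close>, so that only the mean of
    \<open>V\<close> will matter; C is later taken just above the bound on the mean collision
    sum.\<close>
  also have "ln (1 + V) \<le> ln C + V / C"
  proof -
    have "ln (1 + V) = ln C + ln ((1 + V) / C)" using V C by (simp add: ln_div)
    also have "ln ((1 + V) / C) \<le> (1 + V) / C - 1" using V C by (intro ln_le_minus_one) simp
    also have "\<dots> \<le> V / C" using C by (simp add: field_simps)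
    finally show ?thesis by simp
  qed
  finally have "ln ((\<Sum>l\<in>I. p l * f l) / q) \<le> ln (1 + pm * f l / q) + ln C + V / C"
    by simp
  then show "p l * f l * ln ((\<Sum>l\<in>I. p l * f l) / q)
    \<le> p l * f l * (ln (1 + pm * f l / q) + ln C + (\<Sum>l'\<in>I-{l}. p l' * f l' / q) / C)"
    unfolding V_def using p(1)[OF l] f[OF l] by (intro mult_left_mono) auto
qed

context gaussian_pair
begin

text \<open>On good pairs the marginal density of the codeword being integrated is dominated by a
  multiple of its conditional density given the other codeword; dropping the mask then leaves an
  exact Gaussian convolution.\<close>

lemma codebook_kernel:
  assumes "large"
  shows "codebook_kernel (seq_space n) (lebesgue_seq n) \<nu>1 \<nu>2 good (channel t) (output0 t) (output1 t) (output2 t) 2 D"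
proof (intro codebook_kernel.intro)
  show "sigma_finite_measure (lebesgue_seq n)" by (rule lebesgue_seq_sigma_finite.sigma_finite_measure_axioms)
  show "prob_space \<nu>1" "prob_space \<nu>2" using assms prob_space_\<nu>1 prob_space_\<nu>2 by auto
  have eq: "sets (seq_space n \<Otimes>\<^sub>M lebesgue_seq n) = sets (seq_space n \<Otimes>\<^sub>M seq_space n)"
    "sets (seq_space n \<Otimes>\<^sub>M seq_space n \<Otimes>\<^sub>M lebesgue_seq n) = sets (seq_space n \<Otimes>\<^sub>M seq_space n \<Otimes>\<^sub>M seq_space n)"
    by (intro sets_pair_measure_cong; simp)+
  show "(\<lambda>x. channel t (fst x) (fst (snd x)) (snd (snd x))) \<in> borel_measurable (seq_space n \<Otimes>\<^sub>M seq_space n \<Otimes>\<^sub>M lebesgue_seq n)"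
    unfolding measurable_cong_sets[OF eq(2) refl] by measurable
  show "(\<lambda>x. output1 t (fst x) (snd x)) \<in> borel_measurable (seq_space n \<Otimes>\<^sub>M lebesgue_seq n)"
    "(\<lambda>x. output2 t (fst x) (snd x)) \<in> borel_measurable (seq_space n \<Otimes>\<^sub>M lebesgue_seq n)"
    unfolding measurable_cong_sets[OF eq(1) refl] by measurable
  show "output0 t \<in> borel_measurable (lebesgue_seq n)"
    by measurable
  have D: "D = 2 * exp (- real n * (I0 - \<kappa> * \<eta>))" by (rule D_def)
  let ?E = "exp (- real n * (I0 - \<kappa> * \<eta>))"
  show "(\<integral>\<^sup>+x2. ennreal (of_bool (good x1 x2) * channel t x1 x2 y) \<partial>\<nu>2) \<le> ennreal (D * output1 t x1 y)"
    if x1: "x1 \<in> space (seq_space n)" and "y \<in> space (lebesgue_seq n)" for x1 y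
  proof -
    note [measurable] = x1
    have y[measurable]: "y \<in> space (seq_space n)" using that by simp
    have "(\<integral>\<^sup>+x2. ennreal (of_bool (good x1 x2) * channel t x1 x2 y) \<partial>\<nu>2)
      = (\<integral>\<^sup>+x2. ennreal (gauss n s2 (\<lambda>_. 0) x2) * ennreal (of_bool (good x1 x2) * channel t x1 x2 y) \<partial>lebesgue_seq n)"
      by (rule nn_integral_\<nu>2) (unfold of_bool_def, measurable)
    also have "\<dots> \<le> (\<integral>\<^sup>+x2. ennreal ?E * (ennreal (channel t x1 x2 y) * ennreal (gauss n \<tau> (\<lambda>i. \<beta> * x1 i) x2)) \<partial>lebesgue_seq n)"
    proof (rule nn_integral_mono)
      fix x2
      show "ennreal (gauss n s2 (\<lambda>_. 0) x2) * ennreal (of_bool (good x1 x2) * channel t x1 x2 y)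
        \<le> ennreal ?E * (ennreal (channel t x1 x2 y) * ennreal (gauss n \<tau> (\<lambda>i. \<beta> * x1 i) x2))"
      proof (cases "good x1 x2")
        case True
        have "gauss n s2 (\<lambda>_. 0) x2 * channel t x1 x2 y \<le> (?E * gauss n \<tau> (\<lambda>i. \<beta> * x1 i) x2) * channel t x1 x2 y"
          using channel_pos by (intro mult_right_mono good_ratio(1) True) (simp add: less_imp_le)
        then show ?thesis
          using True by (simp add: ennreal_mult'[symmetric] ennreal_leI mult_ac channel_pos less_imp_le)
      qed simp
    qed
    also have "\<dots> = ennreal ?E * ennreal (output1 t x1 y)"
    proof -
      have "(\<lambda>x2. ennreal (gauss n \<tau> (\<lambda>i. \<beta> * x1 i) x2)) \<in> borel_measurable (seq_space n)" by measurable
      then show ?thesis by (subst nn_integral_cmult) (measurable, simp only: gauss_channel1)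
    qed
    also have "\<dots> \<le> ennreal (D * output1 t x1 y)"
      using output_pos(2)[of t x1 y] unfolding D by (simp add: ennreal_mult'[symmetric] ennreal_leI mult_right_mono)
    finally show ?thesis .
  qed
  show "(\<integral>\<^sup>+x1. ennreal (of_bool (good x1 x2) * channel t x1 x2 y) \<partial>\<nu>1) \<le> ennreal (D * output2 t x2 y)"
    if x2: "x2 \<in> space (seq_space n)" and "y \<in> space (lebesgue_seq n)" for x2 y
  proof -
    note [measurable] = x2
    have y[measurable]: "y \<in> space (seq_space n)" using that by simp
    have "(\<integral>\<^sup>+x1. ennreal (of_bool (good x1 x2) * channel t x1 x2 y) \<partial>\<nu>1)
      \<le> 2 * (\<integral>\<^sup>+x1. ennreal (gauss n s1 (\<lambda>_. 0) x1) * ennreal (of_bool (good x1 x2) * channel t x1 x2 y) \<partial>lebesgue_seq n)"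
      by (rule nn_integral_\<nu>1_le[OF assms]) (unfold of_bool_def, measurable)
    also have "(\<integral>\<^sup>+x1. ennreal (gauss n s1 (\<lambda>_. 0) x1) * ennreal (of_bool (good x1 x2) * channel t x1 x2 y) \<partial>lebesgue_seq n)
      \<le> (\<integral>\<^sup>+x1. ennreal ?E * (ennreal (channel t x1 x2 y) * ennreal (gauss n \<tau>' (\<lambda>i. \<beta>' * x2 i) x1)) \<partial>lebesgue_seq n)"
    proof (rule nn_integral_mono)
      fix x1
      show "ennreal (gauss n s1 (\<lambda>_. 0) x1) * ennreal (of_bool (good x1 x2) * channel t x1 x2 y)
        \<le> ennreal ?E * (ennreal (channel t x1 x2 y) * ennreal (gauss n \<tau>' (\<lambda>i. \<beta>' * x2 i) x1))"
      proof (cases "good x1 x2")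
        case True
        have "gauss n s1 (\<lambda>_. 0) x1 * channel t x1 x2 y \<le> (?E * gauss n \<tau>' (\<lambda>i. \<beta>' * x2 i) x1) * channel t x1 x2 y"
          using channel_pos by (intro mult_right_mono good_ratio' True) (simp add: less_imp_le)
        then show ?thesis
          using True by (simp add: ennreal_mult'[symmetric] ennreal_leI mult_ac channel_pos less_imp_le)
      qed simp
    qed
    also have "\<dots> = ennreal ?E * ennreal (output2 t x2 y)"
    proof -
      have "(\<lambda>x1. ennreal (gauss n \<tau>' (\<lambda>i. \<beta>' * x2 i) x1)) \<in> borel_measurable (seq_space n)" by measurable
      then show ?thesis by (subst nn_integral_cmult) (measurable, simp only: gauss_channel2)
    qed
    also have "2 * (ennreal ?E * ennreal (output2 t x2 y)) = ennreal (D * output2 t x2 y)"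
    proof -
      have "ennreal (D * output2 t x2 y) = ennreal 2 * (ennreal ?E * ennreal (output2 t x2 y))"
        using output_pos(3)[of t x2 y] unfolding D by (simp only: ennreal_mult' mult.assoc) (simp add: ennreal_mult')
      then show ?thesis by simp
    qed
    finally show ?thesis by (simp add: mult_left_mono)
  qed
  show "(\<integral>\<^sup>+x. ennreal (output1 t x y) \<partial>\<nu>1) \<le> ennreal (2 * output0 t y)" if "y \<in> space (lebesgue_seq n)" for y
  proof -
    have y[measurable]: "y \<in> space (seq_space n)" using that by simp
    have "(\<integral>\<^sup>+x. ennreal (output1 t x y) \<partial>\<nu>1)
      \<le> 2 * (\<integral>\<^sup>+x. ennreal (gauss n s1 (\<lambda>_. 0) x) * ennreal (output1 t x y) \<partial>lebesgue_seq n)"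
      by (rule nn_integral_\<nu>1_le[OF assms]) measurable
    also have "\<dots> = 2 * ennreal (output0 t y)"
      using gauss_output1[of t y] by (simp add: mult.commute)
    finally show ?thesis by (simp add: ennreal_mult')
  qed
  show "(\<integral>\<^sup>+x. ennreal (output2 t x y) \<partial>\<nu>2) \<le> ennreal (2 * output0 t y)" if "y \<in> space (lebesgue_seq n)" for y
  proof -
    have y[measurable]: "y \<in> space (seq_space n)" using that by simp
    have "(\<integral>\<^sup>+x. ennreal (output2 t x y) \<partial>\<nu>2) = (\<integral>\<^sup>+x. ennreal (gauss n s2 (\<lambda>_. 0) x) * ennreal (output2 t x y) \<partial>lebesgue_seq n)"
      by (rule nn_integral_\<nu>2) measurable
    also have "\<dots> = ennreal (output0 t y)"
      using gauss_output2[of t y] by (simp add: mult.commute)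
    also have "\<dots> \<le> ennreal (2 * output0 t y)"
      using output_pos(1)[of t y] by (intro ennreal_leI) simp
    finally show ?thesis .
  qed
  show "(\<integral>\<^sup>+y. ennreal (output0 t y) \<partial>lebesgue_seq n) \<le> 1"
    unfolding output0_def using S by (simp add: add_pos_nonneg)
qed (use channel_pos output_pos in \<open>auto simp: D_def less_imp_le\<close>)

lemma wiretap_kernel:
  assumes "large"
  shows "wiretap_kernel (seq_space n) (lebesgue_seq n) \<nu>1 \<nu>2 good (channel t) (output0 t) (output1 t) (output2 t) 2 D
    (channel t') (output0 t') (output1 t') (output2 t') D"
  by (intro wiretap_kernel.intro codebook_kernel assms)

lemma AE_typical:
  assumes "large"
  shows "AE x in \<nu>1. x \<in> typical"
proof -
  have "emeasure \<nu>1 {x \<in> space \<nu>1. x \<notin> typical} = emeasure \<nu>1 (space (seq_space n) - typical)"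
    by (intro arg_cong[where f="emeasure \<nu>1"]) (auto simp: \<nu>1_def)
  also have "\<dots> = (\<integral>\<^sup>+x. indicator (space (seq_space n) - typical) x \<partial>\<nu>1)"
    by simp
  also have "\<dots> = (\<integral>\<^sup>+x. indicator (space (seq_space n) - typical) x * indicator typical x \<partial>gaussian_noise n s1)
      / emeasure (gaussian_noise n s1) typical"
    unfolding \<nu>1_def by (rule nn_integral_uniform_measure) auto
  also have "(\<lambda>x. indicator (space (seq_space n) - typical) x * indicator typical x :: ennreal) = (\<lambda>_. 0)"
    by (auto simp: indicator_def)
  finally show ?thesis
    by (subst AE_iff_measurable[OF _ refl]) (auto simp: \<nu>1_def)
qed

text \<open>With x2 = \<beta> * x1 + v, joint typicality reduces to that of x1 and of v relative to
  x1; the amplified errors add up to at most \<eta>0 * (1 + |\<beta>|)^2 = \<eta>.\<close>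

lemma good_of_typical:
  assumes x1: "x1 \<in> typical" and v: "typical_noise n \<tau> \<eta>0 x1 v"
  shows "good x1 (\<lambda>i. \<beta> * x1 i + v i)"
proof -
  have x1': "\<bar>sq_sum n x1 - real n * s1\<bar> \<le> real n * \<eta>0"
    using x1 by (simp add: typical_def typical_noise_def)
  have v': "\<bar>sq_sum n v - real n * \<tau>\<bar> \<le> real n * \<eta>0" "\<bar>dot n x1 v\<bar> \<le> real n * \<eta>0"
    using v by (simp_all add: typical_noise_def)
  have "\<bar>sq_sum n x1 - real n * s1\<bar> \<le> real n * \<eta>"
    using x1' \<eta>0(4) by (elim order_trans) (simp add: mult_left_mono)
  moreover have "\<bar>sq_sum n (\<lambda>i. \<beta> * x1 i + v i) - real n * s2\<bar> \<le> real n * \<eta>"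
  proof -
    have "s2 = \<beta>\<^sup>2 * s1 + \<tau>" using s by (simp add: \<beta>_def \<tau>_def field_simps power2_eq_square)
    then have "real n * s2 = real n * (\<beta>\<^sup>2 * s1 + \<tau>)" by (rule arg_cong)
    then have "real n * s2 = \<beta>\<^sup>2 * (real n * s1) + real n * \<tau>" by (simp only: distrib_left mult_ac)
    then have "sq_sum n (\<lambda>i. \<beta> * x1 i + v i) - real n * s2
      = \<beta>\<^sup>2 * (sq_sum n x1 - real n * s1) + (sq_sum n v - real n * \<tau>) + 2 * \<beta> * dot n x1 v"
      unfolding sq_sum_add sq_sum_scale dot_scale by (simp add: algebra_simps)
    also have "\<bar>\<dots>\<bar> \<le> \<beta>\<^sup>2 * \<bar>sq_sum n x1 - real n * s1\<bar> + \<bar>sq_sum n v - real n * \<tau>\<bar> + 2 * \<bar>\<beta>\<bar> * \<bar>dot n x1 v\<bar>"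
    proof -
      have "\<bar>a + b + d\<bar> \<le> \<bar>a\<bar> + \<bar>b\<bar> + \<bar>d\<bar>" for a b d :: real by linarith
      then show ?thesis by (rule order_trans) (simp add: abs_mult)
    qed
    also have "\<dots> \<le> \<beta>\<^sup>2 * (real n * \<eta>0) + real n * \<eta>0 + 2 * \<bar>\<beta>\<bar> * (real n * \<eta>0)"
      using x1' v' by (intro add_mono mult_left_mono) auto
    also have "\<dots> = real n * (\<eta>0 * (1 + \<bar>\<beta>\<bar>)\<^sup>2)"
      by (simp add: power2_eq_square algebra_simps abs_mult_self_eq)
    finally show ?thesis unfolding \<eta>0(2) .
  qed
  moreover have "\<bar>dot n x1 (\<lambda>i. \<beta> * x1 i + v i) - real n * r\<bar> \<le> real n * \<eta>"
  proof -
    have "real n * r = \<beta> * (real n * s1)" using s by (simp add: \<beta>_def)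
    moreover have "dot n x1 (\<lambda>i. \<beta> * x1 i + v i) = \<beta> * sq_sum n x1 + dot n x1 v"
      by (simp add: dot_def sq_sum_def sum.distrib sum_distrib_left power2_eq_square algebra_simps)
    ultimately have "dot n x1 (\<lambda>i. \<beta> * x1 i + v i) - real n * r = \<beta> * (sq_sum n x1 - real n * s1) + dot n x1 v"
      unfolding right_diff_distrib by linarith
    also have "\<bar>\<dots>\<bar> \<le> \<bar>\<beta>\<bar> * \<bar>sq_sum n x1 - real n * s1\<bar> + \<bar>dot n x1 v\<bar>"
      by (rule order_trans[OF abs_triangle_ineq]) (simp add: abs_mult)
    also have "\<dots> \<le> \<bar>\<beta>\<bar> * (real n * \<eta>0) + real n * \<eta>0"
      using x1' v' by (intro add_mono mult_left_mono) auto
    also have "\<dots> = real n * (\<eta>0 * (1 + \<bar>\<beta>\<bar>))" by (simp add: algebra_simps)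
    also have "\<dots> \<le> real n * \<eta>" using \<eta>0(3) by (intro mult_left_mono) auto
    finally show ?thesis .
  qed
  ultimately show ?thesis by (simp add: good_def)
qed

lemma good_restrict [simp]: "good x1 (restrict x2 {..<n}) = good x1 x2"
  by (simp add: good_def)

lemma typical_space: "x1 \<in> typical \<Longrightarrow> x1 \<in> space (seq_space n)"
  by (simp add: typical_def)

text \<open>A good x2 has probability at least 1/2 under the conditional law given x1. The lower
  bound in \<open>good_ratio\<close> transfers this to the unconditional law at the price exp(-n *
  (I0 + \<kappa> * \<eta>)).\<close>

lemma covering:
  assumes "large" and x1: "x1 \<in> typical"
  shows "emeasure \<nu>2 {x2 \<in> space (seq_space n). \<not> good x1 x2} \<le> ennreal (1 - exp (- real n * (I0 + \<kappa> * \<eta>)) / 2)"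
proof -
  interpret \<nu>2: prob_space \<nu>2 by (rule prob_space_\<nu>2)
  note [measurable] = typical_space[OF x1]
  let ?E = "exp (- real n * (I0 + \<kappa> * \<eta>))"
  let ?A = "{x2 \<in> space (seq_space n). good x1 x2}"
  have [measurable]: "?A \<in> sets (seq_space n)" by measurable
  have sq: "sq_sum n x1 \<le> real n * (s1 + \<eta>0)"
    using x1 by (simp add: typical_def typical_noise_def abs_le_iff algebra_simps)
  have "emeasure (gaussian_noise n \<tau>) {v \<in> space (seq_space n). typical_noise n \<tau> \<eta>0 x1 v}
    = (\<integral>\<^sup>+v. indicator {v \<in> space (seq_space n). typical_noise n \<tau> \<eta>0 x1 v} v \<partial>gaussian_noise n \<tau>)"
    by (subst nn_integral_indicator) (simp, measurable)
  also have "\<dots> \<le> (\<integral>\<^sup>+v. indicator ?A (\<lambda>i\<in>{..<n}. \<beta> * x1 i + v i) \<partial>gaussian_noise n \<tau>)"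
    using good_of_typical[OF x1] by (intro nn_integral_mono) (auto simp: indicator_def space_PiM)
  also have "\<dots> = (\<integral>\<^sup>+x2. ennreal (gauss n \<tau> (\<lambda>i. \<beta> * x1 i) x2) * indicator ?A x2 \<partial>lebesgue_seq n)"
    using \<tau> by (intro nn_integral_add_noise) auto
  finally have noise: "emeasure (gaussian_noise n \<tau>) {v \<in> space (seq_space n). typical_noise n \<tau> \<eta>0 x1 v} \<le> \<dots>" .
  have "ennreal (?E / 2) = ennreal ?E * ennreal (1/2)" by (simp add: ennreal_mult'[symmetric] del: ennreal_half)
  also have "\<dots> \<le> ennreal ?E * (\<integral>\<^sup>+x2. ennreal (gauss n \<tau> (\<lambda>i. \<beta> * x1 i) x2) * indicator ?A x2 \<partial>lebesgue_seq n)"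
    by (intro mult_left_mono order_trans[OF prob_noise_typical(2)[OF assms(1) sq] noise]) simp
  also have "\<dots> = (\<integral>\<^sup>+x2. ennreal ?E * (ennreal (gauss n \<tau> (\<lambda>i. \<beta> * x1 i) x2) * indicator ?A x2) \<partial>lebesgue_seq n)"
    by (rule nn_integral_cmult[symmetric]) measurable
  also have "\<dots> \<le> (\<integral>\<^sup>+x2. ennreal (gauss n s2 (\<lambda>_. 0) x2) * indicator ?A x2 \<partial>lebesgue_seq n)"
    using good_ratio(2)[of x1]
    by (intro nn_integral_mono) (auto simp: indicator_def ennreal_mult'[symmetric] intro!: ennreal_leI)
  also have "\<dots> = (\<integral>\<^sup>+x2. indicator ?A x2 \<partial>\<nu>2)"
    by (rule nn_integral_\<nu>2[symmetric]) simp
  also have "\<dots> = emeasure \<nu>2 ?A"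
    by (rule nn_integral_indicator) simp
  finally have "?E / 2 \<le> \<nu>2.prob ?A"
    unfolding \<nu>2.emeasure_eq_measure by (subst (asm) ennreal_le_iff) auto
  moreover have "\<nu>2.prob (space \<nu>2 - ?A) = 1 - \<nu>2.prob ?A"
    by (rule \<nu>2.prob_compl) simp
  moreover have "space \<nu>2 - ?A = {x2 \<in> space (seq_space n). \<not> good x1 x2}"
    by (auto simp: \<nu>2_def)
  ultimately show ?thesis
    unfolding \<nu>2.emeasure_eq_measure by (intro ennreal_leI) simp
qed

end


section \<open>Decoder test and resolvability for the Gaussian channel\<close>

lemma pred_cmult_le:
  fixes f h :: "'a \<Rightarrow> real"
  assumes [measurable]: "f \<in> borel_measurable M" "h \<in> borel_measurable M"
  shows "Measurable.pred M (\<lambda>y. C * f y \<le> h y)"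
  by measurable

context gaussian_pair
begin

text \<open>The exponents are I(X1,X2;Y), I(X2;Y|X1) and I(X1;Y|X2) in nats, lowered by the
  typicality slack; this is the Gaussian instance of the decoder \<open>test\<close>.\<close>

definition accepts :: "(nat \<Rightarrow> real) \<Rightarrow> (nat \<Rightarrow> real) \<Rightarrow> (nat \<Rightarrow> real) \<Rightarrow> bool" where
  "accepts x1 x2 y \<longleftrightarrow>
     exp (real n * (1/2 * ln (1 + S) - \<kappa> * \<eta>)) * output0 1 y \<le> channel 1 x1 x2 y \<and>
     exp (real n * (1/2 * ln (1 + \<tau>) - \<kappa> * \<eta>)) * output1 1 x1 y \<le> channel 1 x1 x2 y \<and>
     exp (real n * (1/2 * ln (1 + \<tau>') - \<kappa> * \<eta>)) * output2 1 x2 y \<le> channel 1 x1 x2 y"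

lemma accepts_measurable [measurable]:
  assumes "x1 \<in> space (seq_space n)" "x2 \<in> space (seq_space n)"
  shows "Measurable.pred (seq_space n) (accepts x1 x2)"
proof -
  have c: "(\<lambda>_. x1) \<in> measurable (seq_space n) (seq_space n)" "(\<lambda>_. x2) \<in> measurable (seq_space n) (seq_space n)"
    using assms by auto
  have [measurable]: "channel 1 x1 x2 \<in> borel_measurable (seq_space n)"
    "output0 1 \<in> borel_measurable (seq_space n)"
    "output1 1 x1 \<in> borel_measurable (seq_space n)"
    "output2 1 x2 \<in> borel_measurable (seq_space n)"
    using channel_measurable[OF c measurable_ident] output0_measurable output1_measurable[OF c(1) measurable_ident]
      output2_measurable[OF c(2) measurable_ident] by simp_all
  show ?thesis unfolding accepts_def[abs_def]
    by (intro pred_intros_logic pred_cmult_le) fact+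
qed

lemma slack_le:
  fixes b :: real
  assumes "5 * (1 + \<bar>b\<bar>)\<^sup>2 \<le> \<kappa>"
  shows "\<eta> + \<eta> * (1 + \<bar>b\<bar>)\<^sup>2 / 2 + \<eta> * (1 + \<bar>b\<bar>) \<le> \<kappa> * \<eta>"
proof -
  define c where "c = 1 + \<bar>b\<bar>"
  have c: "1 \<le> c" by (simp add: c_def)
  then have "1 \<le> c\<^sup>2" "c \<le> c\<^sup>2" by (auto simp: power2_eq_square intro: order_trans[OF _ mult_left_mono[OF c]])
  then have "1 + c\<^sup>2 / 2 + c \<le> \<kappa>" using assms unfolding c_def[symmetric] by linarith
  then have "\<eta> * (1 + c\<^sup>2 / 2 + c) \<le> \<eta> * \<kappa>" using \<eta> by (intro mult_left_mono) auto
  then show ?thesis unfolding c_def[symmetric] by (simp add: algebra_simps)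
qed

lemma threshold_mono:
  assumes "e \<le> \<kappa> * \<eta>" "exp (real n * (L - e)) * q \<le> f" "0 \<le> q"
  shows "exp (real n * (L - \<kappa> * \<eta>)) * q \<le> f"
proof -
  have "exp (real n * (L - \<kappa> * \<eta>)) * q \<le> exp (real n * (L - e)) * q"
    using assms by (intro mult_right_mono) (auto intro: mult_left_mono)
  with assms(2) show ?thesis by linarith
qed

text \<open>Three uses of \<open>gauss_likelihood_ge\<close>, splitting the input as 0 + (x1 + x2),
  as (1 + \<beta>) * x1 plus the residual of x2, and as (1 + \<beta>') * x2 plus the residual of
  x1.\<close>

lemma accepts_typical:
  assumes g: "good x1 x2" and v1: "typical_noise n 1 \<eta> x1 v" and v2: "typical_noise n 1 \<eta> x2 v"
    and y: "\<And>i. i < n \<Longrightarrow> y i = x1 i + x2 i + v i"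
  shows "accepts x1 x2 y"
proof -
  have v: "\<bar>sq_sum n v - real n\<bar> \<le> real n * \<eta>" "\<bar>dot n x1 v\<bar> \<le> real n * \<eta>" "\<bar>dot n x2 v\<bar> \<le> real n * \<eta>"
    using v1 v2 by (simp_all add: typical_noise_def)
  have dot_le: "\<bar>dot n (\<lambda>i. a i - b * c i) v\<bar> \<le> real n * (\<eta> * (1 + \<bar>b\<bar>))"
    if "\<bar>dot n a v\<bar> \<le> real n * \<eta>" "\<bar>dot n c v\<bar> \<le> real n * \<eta>" for a b c
  proof -
    have "\<bar>dot n (\<lambda>i. a i - b * c i) v\<bar> \<le> \<bar>dot n a v\<bar> + \<bar>b\<bar> * \<bar>dot n c v\<bar>"
      unfolding dot_diff_scale by (rule order_trans[OF abs_triangle_ineq4]) (simp add: abs_mult)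
    also have "\<dots> \<le> real n * \<eta> + \<bar>b\<bar> * (real n * \<eta>)"
      using that by (intro add_mono mult_left_mono) auto
    finally show ?thesis by (simp add: algebra_simps)
  qed
  have "exp (real n * (1/2 * ln (1 + S) - \<kappa> * \<eta>)) * output0 1 y \<le> channel 1 x1 x2 y"
  proof (rule threshold_mono)
    show "\<eta> + (4 * \<eta>) / 2 + 2 * \<eta> \<le> \<kappa> * \<eta>"
      using mult_right_mono[OF \<kappa>(4), of \<eta>] \<eta> by simp
    have "exp (real n * (1/2 * ln (1 + S) - (\<eta> + (4 * \<eta>) / 2 + 2 * \<eta>))) * gauss n (1 + S) (\<lambda>_. 0) y
      \<le> gauss n 1 (\<lambda>i. 0 + (x1 i + x2 i)) y"
    proof (rule gauss_likelihood_ge[where x=v])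
      have "real n * S = real n * s1 + real n * s2 + 2 * (real n * r)" by (simp add: S_def algebra_simps)
      \<comment> \<open>4 * \<eta> collects the errors of both energies and twice that of the
        correlation.\<close>
      then show "real n * (S - 4 * \<eta>) \<le> sq_sum n (\<lambda>i. x1 i + x2 i)"
        using g unfolding sq_sum_add good_def abs_le_iff right_diff_distrib by linarith
      show "\<bar>dot n (\<lambda>i. x1 i + x2 i) v\<bar> \<le> real n * (2 * \<eta>)"
        using v unfolding dot_add by linarith
    qed (use S \<eta> v y in auto)
    then show "exp (real n * (1/2 * ln (1 + S) - (\<eta> + (4 * \<eta>) / 2 + 2 * \<eta>))) * output0 1 y \<le> channel 1 x1 x2 y"
      by (simp add: output0_def channel_def)
  qed (use output_pos in \<open>simp add: less_imp_le\<close>)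
  moreover have "exp (real n * (1/2 * ln (1 + \<tau>) - \<kappa> * \<eta>)) * output1 1 x1 y \<le> channel 1 x1 x2 y"
  proof (rule threshold_mono[OF slack_le[OF \<kappa>(1)]])
    have "exp (real n * (1/2 * ln (1 + \<tau>) - (\<eta> + (\<eta> * (1 + \<bar>\<beta>\<bar>)\<^sup>2) / 2 + \<eta> * (1 + \<bar>\<beta>\<bar>))))
      * gauss n (1 + \<tau>) (\<lambda>i. (1 + \<beta>) * x1 i) y \<le> gauss n 1 (\<lambda>i. (1 + \<beta>) * x1 i + (x2 i - \<beta> * x1 i)) y"
    proof (rule gauss_likelihood_ge[where x=v])
      show "real n * (\<tau> - \<eta> * (1 + \<bar>\<beta>\<bar>)\<^sup>2) \<le> sq_sum n (\<lambda>i. x2 i - \<beta> * x1 i)"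
        using good_residual[OF g] unfolding abs_le_iff right_diff_distrib mult.assoc by linarith
      show "\<bar>dot n (\<lambda>i. x2 i - \<beta> * x1 i) v\<bar> \<le> real n * (\<eta> * (1 + \<bar>\<beta>\<bar>))"
        using v by (intro dot_le)
      show "y i = (1 + \<beta>) * x1 i + (x2 i - \<beta> * x1 i) + v i" if "i < n" for i
        using y[OF that] by (simp add: algebra_simps)
    qed (use \<tau> \<eta> v in auto)
    moreover have "(\<lambda>i. (1 + \<beta>) * x1 i + (x2 i - \<beta> * x1 i)) = (\<lambda>i. 1 * x1 i + 1 * x2 i)"
      by (simp add: algebra_simps)
    ultimately show "exp (real n * (1/2 * ln (1 + \<tau>) - (\<eta> + \<eta> * (1 + \<bar>\<beta>\<bar>)\<^sup>2 / 2 + \<eta> * (1 + \<bar>\<beta>\<bar>))))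
      * output1 1 x1 y \<le> channel 1 x1 x2 y"
      by (simp add: output1_def channel_def)
  qed (use output_pos in \<open>simp add: less_imp_le\<close>)
  moreover have "exp (real n * (1/2 * ln (1 + \<tau>') - \<kappa> * \<eta>)) * output2 1 x2 y \<le> channel 1 x1 x2 y"
  proof (rule threshold_mono[OF slack_le[OF \<kappa>(2)]])
    have "exp (real n * (1/2 * ln (1 + \<tau>') - (\<eta> + (\<eta> * (1 + \<bar>\<beta>'\<bar>)\<^sup>2) / 2 + \<eta> * (1 + \<bar>\<beta>'\<bar>))))
      * gauss n (1 + \<tau>') (\<lambda>i. (1 + \<beta>') * x2 i) y \<le> gauss n 1 (\<lambda>i. (1 + \<beta>') * x2 i + (x1 i - \<beta>' * x2 i)) y"
    proof (rule gauss_likelihood_ge[where x=v])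
      show "real n * (\<tau>' - \<eta> * (1 + \<bar>\<beta>'\<bar>)\<^sup>2) \<le> sq_sum n (\<lambda>i. x1 i - \<beta>' * x2 i)"
        using good_residual'[OF g] unfolding abs_le_iff right_diff_distrib mult.assoc by linarith
      show "\<bar>dot n (\<lambda>i. x1 i - \<beta>' * x2 i) v\<bar> \<le> real n * (\<eta> * (1 + \<bar>\<beta>'\<bar>))"
        using v by (intro dot_le)
      show "y i = (1 + \<beta>') * x2 i + (x1 i - \<beta>' * x2 i) + v i" if "i < n" for i
        using y[OF that] by (simp add: algebra_simps)
    qed (use \<tau> \<eta> v in auto)
    moreover have "(\<lambda>i. (1 + \<beta>') * x2 i + (x1 i - \<beta>' * x2 i)) = (\<lambda>i. 1 * x1 i + 1 * x2 i)"
      by (simp add: algebra_simps)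
    ultimately show "exp (real n * (1/2 * ln (1 + \<tau>') - (\<eta> + \<eta> * (1 + \<bar>\<beta>'\<bar>)\<^sup>2 / 2 + \<eta> * (1 + \<bar>\<beta>'\<bar>))))
      * output2 1 x2 y \<le> channel 1 x1 x2 y"
      by (simp add: output2_def channel_def)
  qed (use output_pos in \<open>simp add: less_imp_le\<close>)
  ultimately show ?thesis by (simp add: accepts_def)
qed

text \<open>Rejection of the true pair forces noise that is atypical relative to x1 or to
  x2.\<close>

lemma prob_rejects_le:
  assumes g: "good x1 x2" and [measurable]: "x1 \<in> space (seq_space n)" "x2 \<in> space (seq_space n)"
  shows "(\<integral>\<^sup>+y. ennreal (channel 1 x1 x2 y) * indicator {y. \<not> accepts x1 x2 y} y \<partial>lebesgue_seq n)
    \<le> ennreal ((4 + s1 + s2 + 2 * \<eta>) / (real n * \<eta>\<^sup>2))"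
proof -
  let ?N = "gaussian_noise n 1"
  let ?A = "\<lambda>x. {v \<in> space (seq_space n). \<not> typical_noise n 1 \<eta> x v}"
  have [measurable]: "(\<lambda>y. indicator {y. \<not> accepts x1 x2 y} y :: ennreal) \<in> borel_measurable (seq_space n)"
  proof -
    have "(\<lambda>y. if accepts x1 x2 y then 0 else 1 :: ennreal) \<in> borel_measurable (seq_space n)" by measurable
    also have "(\<lambda>y. if accepts x1 x2 y then 0 else 1 :: ennreal) = (\<lambda>y. indicator {y. \<not> accepts x1 x2 y} y)"
      by (auto simp: indicator_def)
    finally show ?thesis .
  qed
  have "(\<integral>\<^sup>+y. ennreal (channel 1 x1 x2 y) * indicator {y. \<not> accepts x1 x2 y} y \<partial>lebesgue_seq n)
    = (\<integral>\<^sup>+v. indicator {y. \<not> accepts x1 x2 y} (\<lambda>i\<in>{..<n}. 1 * x1 i + 1 * x2 i + v i) \<partial>?N)"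
    unfolding channel_def by (rule nn_integral_add_noise[symmetric]) auto
  also have "\<dots> \<le> (\<integral>\<^sup>+v. indicator (?A x1) v + indicator (?A x2) v \<partial>?N)"
  proof (rule nn_integral_mono)
    fix v assume v: "v \<in> space ?N"
    show "indicator {y. \<not> accepts x1 x2 y} (\<lambda>i\<in>{..<n}. 1 * x1 i + 1 * x2 i + v i)
      \<le> (indicator (?A x1) v + indicator (?A x2) v :: ennreal)"
      using v accepts_typical[OF g, of v "\<lambda>i\<in>{..<n}. 1 * x1 i + 1 * x2 i + v i"]
      by (auto simp: indicator_def)
  qed
  also have "\<dots> = emeasure ?N (?A x1) + emeasure ?N (?A x2)"
  proof -
    have A: "?A x \<in> sets ?N" for x by measurable
    show ?thesis
      by (subst nn_integral_add) (auto simp: nn_integral_indicator[OF A] intro: borel_measurable_indicator[OF A])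
  qed
  also have "\<dots> \<le> ennreal ((2 * 1\<^sup>2 + 1 * (s1 + \<eta>)) / (real n * \<eta>\<^sup>2)) + ennreal ((2 * 1\<^sup>2 + 1 * (s2 + \<eta>)) / (real n * \<eta>\<^sup>2))"
    using g n \<eta> by (intro add_mono emeasure_not_typical_noise_le) (auto simp: good_def abs_le_iff algebra_simps)
  also have "\<dots> = ennreal ((4 + s1 + s2 + 2 * \<eta>) / (real n * \<eta>\<^sup>2))"
    using s \<eta> n by (subst ennreal_plus[symmetric]) (auto simp: add_divide_distrib[symmetric])
  finally show ?thesis .
qed

text \<open>As \<rho> is at least the information rate 1/2 * ln (1 + t^2 * S), the factor exp(-n *
  \<rho>) in \<open>pm\<close> cancels the mean of the log-likelihood ratio and only its fluctuation
  remains. Second moments bound the expected fluctuation, so no large-deviation estimate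
  enters.\<close>

lemma resolvability_term_le:
  assumes g: "good x1 x2" and [measurable]: "x1 \<in> space (seq_space n)" "x2 \<in> space (seq_space n)"
    and t: "0 \<le> t" "t \<le> 1" and pm: "0 \<le> pm" "pm \<le> 4 * exp (- real n * \<rho>)" and \<rho>: "1/2 * ln (1 + t\<^sup>2 * S) \<le> \<rho>"
  shows "(\<integral>\<^sup>+z. ennreal (channel t x1 x2 z) * ennreal (ln (1 + pm * channel t x1 x2 z / output0 t z)) \<partial>lebesgue_seq n)
    \<le> ennreal (ln 8 + 4 * real n * \<eta> + (1 + S) / \<eta> + 4)"
proof -
  let ?N = "gaussian_noise n 1"
  define x where "x i = t * x1 i + t * x2 i" for i
  define v where "v = 1 + t\<^sup>2 * S"
  define k where "k = real n * \<eta>"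
  have k: "k > 0" using n \<eta> by (simp add: k_def)
  have v: "v \<ge> 1" using S by (simp add: v_def)
  have t2: "0 \<le> t\<^sup>2" "t\<^sup>2 \<le> 1" using t by (auto simp: power_le_one)
  have sq12: "sq_sum n (\<lambda>i. x1 i + x2 i) \<le> real n * S + 4 * k"
  proof -
    have "real n * S = real n * s1 + real n * s2 + 2 * (real n * r)" by (simp add: S_def algebra_simps)
    then show ?thesis using g unfolding sq_sum_add good_def abs_le_iff k_def by linarith
  qed
  have sqx: "sq_sum n x = t\<^sup>2 * sq_sum n (\<lambda>i. x1 i + x2 i)"
    unfolding sq_sum_scale[symmetric] x_def by (simp add: distrib_left)
  have sq: "sq_sum n x \<le> real n * (v - 1) + 4 * k"
  proof -
    have "sq_sum n x \<le> t\<^sup>2 * (real n * S + 4 * k)"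
      unfolding sqx using sq12 t2 by (intro mult_left_mono) auto
    also have "\<dots> \<le> real n * (v - 1) + 4 * k"
      using t2 k by (simp add: v_def algebra_simps mult_left_le_one_le)
    finally show ?thesis .
  qed
  have sq': "sq_sum n x \<le> real n * S + 4 * k"
  proof -
    have "t\<^sup>2 * S \<le> 1 * S" using t2 S by (intro mult_right_mono) auto
    then have "real n * (v - 1) \<le> real n * S" by (intro mult_left_mono) (auto simp: v_def)
    with sq show ?thesis by linarith
  qed
  \<comment> \<open>The fluctuation is |n - sq_sum u| / 2 + 2 * k + |dot x u|. The inequality |a|
    \<le> k + a^2 / k makes it quadratic, and the terms in k add up to k / 2 + 2 * k + k.\<close>
  define A where "A u = ln 8 + 7 / 2 * k + 1 / (2 * k) * (sq_sum n u - real n * 1)\<^sup>2 + 1 / k * (dot n x u)\<^sup>2" for u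
  have pointwise: "ln (1 + pm * gauss n 1 x y / output0 t y) \<le> A u"
    if y: "\<And>i. i < n \<Longrightarrow> y i = x i + u i" for u y
  proof -
    let ?i = "ln (gauss n 1 x y) - ln (output0 t y)"
    have ysq: "(\<Sum>i<n. (y i - x i)\<^sup>2) = sq_sum n u" unfolding sq_sum_def by (intro sum.cong) (auto simp: y)
    have ysum: "sq_sum n y = sq_sum n x + sq_sum n u + 2 * dot n x u"
    proof -
      have "sq_sum n y = sq_sum n (\<lambda>i. x i + u i)"
        unfolding sq_sum_def by (intro sum.cong) (auto simp: y)
      then show ?thesis by (simp only: sq_sum_add)
    qed
    have "?i = real n / 2 * ln v + (sq_sum n x + sq_sum n u + 2 * dot n x u) / (2 * v) - sq_sum n u / 2"
    proof -
      have "ln (output0 t y) = - real n / 2 * ln (2 * pi * v) - sq_sum n y / (2 * v)"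
        using v unfolding output0_def v_def[symmetric] by (intro ln_gauss_zero) simp
      moreover have "ln (gauss n 1 x y) = - real n / 2 * ln (2 * pi * 1) - sq_sum n u / (2 * 1)"
        unfolding ysq[symmetric] by (rule ln_gauss) simp
      ultimately show ?thesis
        unfolding ysum[symmetric]
        using v by (simp add: ln_mult algebra_simps)
    qed
    also have "\<dots> \<le> real n / 2 * ln v + (real n * (v - 1) + 4 * k + sq_sum n u + 2 * dot n x u) / (2 * v) - sq_sum n u / 2"
      using sq v by (intro add_mono diff_right_mono divide_right_mono) auto
    \<comment> \<open>The second term vanishes at noise energy exactly n; the first is the
      information rate.\<close>
    also have "\<dots> = real n / 2 * ln v + (1 - 1 / v) / 2 * (real n - sq_sum n u) + 2 * k / v + dot n x u / v"
      using v by (simp add: field_simps)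
    also have "\<dots> \<le> real n * \<rho> + \<bar>real n - sq_sum n u\<bar> / 2 + 2 * k + \<bar>dot n x u\<bar>"
    proof -
      have "real n / 2 * ln v \<le> real n * \<rho>"
        using mult_left_mono[OF \<rho>, of "real n"] by (simp add: v_def)
      moreover have "(1 - 1 / v) / 2 * (real n - sq_sum n u) \<le> \<bar>real n - sq_sum n u\<bar> / 2"
      proof -
        have "(1 - 1 / v) * (real n - sq_sum n u) \<le> (1 - 1 / v) * \<bar>real n - sq_sum n u\<bar>"
          using v by (intro mult_left_mono) auto
        also have "\<dots> \<le> 1 * \<bar>real n - sq_sum n u\<bar>" using v by (intro mult_right_mono) auto
        finally show ?thesis by simp
      qed
      moreover have "2 * k / v \<le> 2 * k" using k v by (simp add: field_simps)
      moreover have "dot n x u / v \<le> \<bar>dot n x u\<bar>"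
      proof -
        have "dot n x u / v \<le> \<bar>dot n x u\<bar> / v" using v by (intro divide_right_mono) auto
        also have "\<dots> \<le> \<bar>dot n x u\<bar> / 1" using v by (intro divide_left_mono) auto
        finally show ?thesis by simp
      qed
      ultimately show ?thesis by linarith
    qed
    finally have i: "?i \<le> real n * \<rho> + (\<bar>real n - sq_sum n u\<bar> / 2 + 2 * k + \<bar>dot n x u\<bar>)" by simp
    have pos: "gauss n 1 x y > 0" "output0 t y > 0" by (auto intro: gauss_pos output_pos)
    have "gauss n 1 x y / output0 t y = exp ?i" using pos by (simp add: exp_diff)
    also have "\<dots> \<le> exp (real n * \<rho> + (\<bar>real n - sq_sum n u\<bar> / 2 + 2 * k + \<bar>dot n x u\<bar>))" using i by simp
    finally have "pm * (gauss n 1 x y / output0 t y)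
      \<le> (4 * exp (- real n * \<rho>)) * exp (real n * \<rho> + (\<bar>real n - sq_sum n u\<bar> / 2 + 2 * k + \<bar>dot n x u\<bar>))"
      using pm pos by (intro mult_mono) auto
    also have "\<dots> = 4 * exp (\<bar>real n - sq_sum n u\<bar> / 2 + 2 * k + \<bar>dot n x u\<bar>)"
      unfolding mult.assoc exp_add[symmetric] by simp
    finally have "ln (1 + pm * gauss n 1 x y / output0 t y) \<le> ln 8 + (\<bar>real n - sq_sum n u\<bar> / 2 + 2 * k + \<bar>dot n x u\<bar>)"
      using pm pos k by (intro ln_mult_add_le) auto
    also have "\<dots> \<le> A u"
    proof -
      have "\<bar>real n - sq_sum n u\<bar> \<le> k + (sq_sum n u - real n * 1)\<^sup>2 / k"
        using abs_le_add_square_divide[OF k, of "sq_sum n u - real n * 1"] by (simp add: abs_minus_commute)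
      moreover have "\<bar>dot n x u\<bar> \<le> k + (dot n x u)\<^sup>2 / k" by (rule abs_le_add_square_divide[OF k])
      ultimately show ?thesis unfolding A_def by (simp add: field_simps)
    qed
    finally show ?thesis .
  qed
  have [measurable]: "(\<lambda>z. ennreal (ln (1 + pm * gauss n 1 x z / output0 t z))) \<in> borel_measurable (seq_space n)"
    by measurable
  have "(\<integral>\<^sup>+z. ennreal (channel t x1 x2 z) * ennreal (ln (1 + pm * channel t x1 x2 z / output0 t z)) \<partial>lebesgue_seq n)
    = (\<integral>\<^sup>+u. ennreal (ln (1 + pm * gauss n 1 x (\<lambda>i\<in>{..<n}. x i + u i) / output0 t (\<lambda>i\<in>{..<n}. x i + u i))) \<partial>?N)"
    unfolding channel_def x_def[symmetric] by (rule nn_integral_add_noise[symmetric]) auto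
  also have "\<dots> \<le> (\<integral>\<^sup>+u. ennreal (ln 8 + 7 / 2 * k) + (ennreal (1 / (2 * k)) * ennreal ((sq_sum n u - real n * 1)\<^sup>2)
      + ennreal (1 / k) * ennreal ((dot n x u)\<^sup>2)) \<partial>?N)"
  proof (rule nn_integral_mono)
    fix u
    have "ennreal (ln (1 + pm * gauss n 1 x (\<lambda>i\<in>{..<n}. x i + u i) / output0 t (\<lambda>i\<in>{..<n}. x i + u i))) \<le> ennreal (A u)"
      by (intro ennreal_leI pointwise) simp
    also have "A u = (ln 8 + 7 / 2 * k) + (1 / (2 * k) * (sq_sum n u - real n * 1)\<^sup>2 + 1 / k * (dot n x u)\<^sup>2)"
      by (simp add: A_def)
    also have "ennreal \<dots> = ennreal (ln 8 + 7 / 2 * k) + (ennreal (1 / (2 * k)) * ennreal ((sq_sum n u - real n * 1)\<^sup>2)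
      + ennreal (1 / k) * ennreal ((dot n x u)\<^sup>2))"
      using k by (subst ennreal_plus, simp, simp, subst ennreal_plus, simp, simp, simp only: ennreal_mult' zero_le_power2)
        (simp add: ennreal_mult'[symmetric])
    finally show "ennreal (ln (1 + pm * gauss n 1 x (\<lambda>i\<in>{..<n}. x i + u i) / output0 t (\<lambda>i\<in>{..<n}. x i + u i))) \<le> \<dots>" .
  qed
  also have "\<dots> = ennreal (ln 8 + 7 / 2 * k) + (ennreal (1 / (2 * k)) * (\<integral>\<^sup>+u. ennreal ((sq_sum n u - real n * 1)\<^sup>2) \<partial>?N)
      + ennreal (1 / k) * (\<integral>\<^sup>+u. ennreal ((dot n x u)\<^sup>2) \<partial>?N))"
  proof -
    interpret N: prob_space ?N by (rule prob_space_gaussian_noise) simp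
    have [measurable]: "dot n x \<in> borel_measurable ?N" unfolding dot_def[abs_def] by measurable
    show ?thesis
      by (simp add: nn_integral_add nn_integral_cmult N.emeasure_space_1[simplified])
  qed
  also have "\<dots> = ennreal (ln 8 + 7 / 2 * k) + (ennreal (1 / (2 * k)) * ennreal (2 * real n * 1\<^sup>2)
      + ennreal (1 / k) * ennreal (1 * sq_sum n x))"
    by (subst nn_integral_noise_sq_sum, simp, subst nn_integral_noise_dot, simp, simp)
  also have "\<dots> = ennreal (ln 8 + 7 / 2 * k + (1 / (2 * k) * (2 * real n) + 1 / k * sq_sum n x))"
    using k by (simp add: ennreal_mult'[symmetric] ennreal_plus[symmetric] del: ennreal_plus)
  also have "\<dots> \<le> ennreal (ln 8 + 4 * real n * \<eta> + (1 + S) / \<eta> + 4)"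
  proof (rule ennreal_leI)
    have "1 / k * sq_sum n x \<le> 1 / k * (real n * S + 4 * k)" using sq' k by (intro mult_left_mono) auto
    also have "\<dots> = S / \<eta> + 4" using n \<eta> by (simp add: k_def field_simps)
    finally have "1 / k * sq_sum n x \<le> S / \<eta> + 4" .
    moreover have "1 / (2 * k) * (2 * real n) = 1 / \<eta>" using n \<eta> by (simp add: k_def)
    moreover have "7 / 2 * k \<le> 4 * real n * \<eta>" using k by (simp add: k_def mult.commute)
    ultimately show "ln 8 + 7 / 2 * k + (1 / (2 * k) * (2 * real n) + 1 / k * sq_sum n x)
      \<le> ln 8 + 4 * real n * \<eta> + (1 + S) / \<eta> + 4"
      by (simp add: add_divide_distrib)
  qed
  finally show ?thesis .
qed

end


section \<open>From the codebook to a code\<close>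

lemma gauss_cong:
  assumes "\<And>i. i < n \<Longrightarrow> c i = d i"
  shows "gauss n v c x = gauss n v d x"
  unfolding gauss_def using assms by (intro prod.cong) auto

lemma sum_mod_fibers:
  fixes f :: "nat \<Rightarrow> 'a :: semiring_1"
  assumes "finite M" "N > 0"
  shows "(\<Sum>m\<in>M. f (m mod N)) = (\<Sum>l<N. of_nat (card {m\<in>M. m mod N = l}) * f l)"
proof -
  have "(\<Sum>m\<in>M. f (m mod N)) = (\<Sum>l<N. \<Sum>m\<in>{m\<in>M. m mod N = l}. f (m mod N))"
    by (rule sum.group[symmetric]) (use assms in auto)
  also have "\<dots> = (\<Sum>l<N. of_nat (card {m\<in>M. m mod N = l}) * f l)"
    by (intro sum.cong) auto
  finally show ?thesis .
qed

text \<open>The residue m mod N is not uniform when N does not divide M, but no residue occurs more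
  than twice as often as on average.\<close>

lemma card_mod_fiber_le:
  fixes N M l :: nat
  assumes "N > 0" "N \<le> M"
  shows "real (card {m\<in>{1..M}. m mod N = l}) * N \<le> 2 * real M"
proof -
  have "inj_on (\<lambda>m. m div N) {m\<in>{1..M}. m mod N = l}"
  proof (rule inj_onI)
    fix x y assume "x \<in> {m\<in>{1..M}. m mod N = l}" "y \<in> {m\<in>{1..M}. m mod N = l}" "x div N = y div N"
    then show "x = y" using div_mult_mod_eq[of x N] div_mult_mod_eq[of y N] by simp
  qed
  moreover have "(\<lambda>m. m div N) ` {m\<in>{1..M}. m mod N = l} \<subseteq> {..M div N}"
    by (auto intro: div_le_mono)
  ultimately have "card {m\<in>{1..M}. m mod N = l} \<le> card {..M div N}"
    by (rule card_inj_on_le) simp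
  then have "card {m\<in>{1..M}. m mod N = l} \<le> M div N + 1" by simp
  then have "card {m\<in>{1..M}. m mod N = l} * N \<le> (M div N + 1) * N" by (rule mult_le_mono1)
  also have "\<dots> = M div N * N + N" by simp
  also have "\<dots> \<le> M + M" using assms(2) by (intro add_mono) (auto simp: div_times_less_eq_dividend)
  finally have "real (card {m\<in>{1..M}. m mod N = l} * N) \<le> real (2 * M)" by (intro of_nat_mono) simp
  then show ?thesis by simp
qed

context gaussian_pair
begin

text \<open>Only l = m mod N enters the codewords, because the full rate of the fictitious message
  might exceed what the destination tolerates besides W. The encoders stay abstract: every code with
  the prescribed channel input inherits the bounds, which leaves open how the message is distributed
  over the links.\<close>

theorem code_exists:
  fixes g R R' \<rho> :: real and cl a b :: "nat \<Rightarrow> nat" and N K NA NB :: nat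
  assumes "large" and g: "0 \<le> g" "g < 1" and R: "R \<ge> 0" "R' \<ge> 0"
    and inj: "inj_on (\<lambda>w. (cl w, a w, b w)) (index_set n R)"
    and ab: "\<forall>w\<in>index_set n R. a w < NA \<and> b w < NB"
    and N: "N > 0" "N \<le> card (index_set n R')" "exp (real n * \<rho>) \<le> 2 * real N"
    and \<rho>: "1/2 * ln (1 + g * S) \<le> \<rho>"
    and K: "K > 0" and fail: "card (index_set n R) * N * (1 - exp (- real n * (I0 + \<kappa> * \<eta>)) / 2) ^ K \<le> 1/4"
  defines "\<alpha> \<equiv> real K * (real (card (index_set n R)) * N * K * ((2 * D)\<^sup>2 / exp (real n * (1/2 * ln (1 + S) - \<kappa> * \<eta>)))
      + real NB * K * (2 * D\<^sup>2 / exp (real n * (1/2 * ln (1 + \<tau>) - \<kappa> * \<eta>)))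
      + real NA * (2 * D\<^sup>2 / exp (real n * (1/2 * ln (1 + \<tau>') - \<kappa> * \<eta>))))"
  defines "\<gamma> \<equiv> (real K)\<^sup>2 * (2 * D)\<^sup>2"
  shows "\<exists>x1 x2 sel dec.
    (\<forall>w\<in>index_set n R. \<forall>l<N. sel w l < K \<and> good (x1 (cl w, l, a w)) (x2 (cl w, l, b w, sel w l))) \<and>
    dec \<in> seq_space n \<rightarrow>\<^sub>M count_space (index_set n R) \<and>
    (\<forall>c. decoder c = dec \<and> (\<forall>w\<in>index_set n R. \<forall>m\<in>index_set n R'. \<forall>i<n.
        channel_input c w m i = x1 (cl w, m mod N, a w) i + x2 (cl w, m mod N, b w, sel w (m mod N)) i) \<longrightarrow>
      0 \<le> error_prob g R' R n c \<and> error_prob g R' R n c \<le> (4 + s1 + s2 + 2 * \<eta>) / (real n * \<eta>\<^sup>2) + 4 * \<alpha> \<and>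
      0 \<le> leakage g R' R n c \<and>
      leakage g R' R n c \<le> (ln 8 + 4 * real n * \<eta> + (1 + S) / \<eta> + 9 + ln (1 + \<gamma>)) / ln 2)"
proof -
  define I where "I = index_set n R"
  define M where "M = index_set n R'"
  define t where "t = sqrt g"
  have t: "0 \<le> t" "t \<le> 1" "t\<^sup>2 = g" using g by (auto simp: t_def)
  have cI: "card I > 0" and cM: "card M > 0"
    using card_index_set_pos R by (auto simp: I_def M_def)
  have fin: "finite I" "finite M" by (auto simp: I_def M_def)
  define p where "p l = real (card {m\<in>M. m mod N = l}) / card M" for l
  have p: "0 \<le> p l" for l by (simp add: p_def)
  have avg: "(\<Sum>m\<in>M. f (m mod N)) = (\<Sum>l<N. ennreal (p l) * f l) * ennreal (card M)" for f :: "nat \<Rightarrow> ennreal"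
  proof -
    have "ennreal (p l) * ennreal (card M) = of_nat (card {m\<in>M. m mod N = l})" for l
      using cM by (simp add: p_def ennreal_mult'[symmetric] ennreal_of_nat_eq_real_of_nat)
    then show ?thesis
      unfolding sum_mod_fibers[OF fin(2) N(1)] sum_distrib_right by (intro sum.cong) (auto simp: mult_ac)
  qed
  have avg_real: "(\<Sum>m\<in>M. f (m mod N)) / card M = (\<Sum>l<N. p l * f l)" for f :: "nat \<Rightarrow> real"
    unfolding sum_mod_fibers[OF fin(2) N(1)] p_def sum_divide_distrib by (intro sum.cong) auto
  have p1: "(\<Sum>l<N. p l) = 1"
    using avg_real[of "\<lambda>_. 1"] cM by simp
  \<comment> \<open>Each residue has weight at most 2 / N, and N \<ge> exp (n * \<rho>) / 2.\<close>
  have pm: "p l \<le> 4 * exp (- real n * \<rho>)" for l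
  proof -
    have M': "M = {1..card M}" unfolding M_def index_set_def by simp
    have "p l * N \<le> 2"
      using card_mod_fiber_le[OF N(1), of "card M" l] N(2) cM unfolding p_def
      by (subst (1) M') (simp add: field_simps M_def[symmetric])
    then have "p l * exp (real n * \<rho>) \<le> 4"
      using N(3) mult_left_mono[OF N(3) p[of l]] by linarith
    then show ?thesis by (simp add: exp_minus field_simps)
  qed

  interpret WK: wiretap_kernel "seq_space n" "lebesgue_seq n" \<nu>1 \<nu>2 good "channel 1" "output0 1" "output1 1" "output2 1" 2 D
    "channel t" "output0 t" "output1 t" "output2 t" D
    by (rule wiretap_kernel[OF \<open>large\<close>])
  let ?t0 = "exp (real n * (1/2 * ln (1 + S) - \<kappa> * \<eta>))" and ?t1 = "exp (real n * (1/2 * ln (1 + \<tau>) - \<kappa> * \<eta>))"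
    and ?t2 = "exp (real n * (1/2 * ln (1 + \<tau>') - \<kappa> * \<eta>))"
  have "0 < I0 + \<kappa> * \<eta>"
  proof -
    have "\<tau> \<le> s2" using s by (simp add: \<tau>_def)
    then have "0 \<le> I0" using \<tau> by (simp add: I0_def)
    then show ?thesis using \<kappa>(4) \<eta> by (simp add: add_nonneg_pos)
  qed
  then have "exp (- real n * (I0 + \<kappa> * \<eta>)) \<le> 1" by simp
  then have q: "0 \<le> 1 - exp (- real n * (I0 + \<kappa> * \<eta>)) / 2" by linarith
  obtain x1 x2 where
    x: "\<And>w l. w \<in> I \<Longrightarrow> l < N \<Longrightarrow> x1 (cl w, l, a w) \<in> space (seq_space n) \<and> (\<forall>k<K. x2 (cl w, l, b w, k) \<in> space (seq_space n)) \<and>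
       (\<exists>k<K. good (x1 (cl w, l, a w)) (x2 (cl w, l, b w, k)))" and
    conf: "(\<Sum>w\<in>I. \<Sum>l<N. ennreal (p l / card I) * (\<Sum>k<K. \<Sum>w'\<in>I-{w}. \<Sum>l'<N. \<Sum>k'<K.
       WK.Y.confusion ?t0 ?t1 ?t2 (x1 (cl w, l, a w)) (x2 (cl w, l, b w, k)) (x1 (cl w', l', a w')) (x2 (cl w', l', b w', k'))))
      \<le> ennreal (4 * \<alpha>)" and
    coll: "(\<Sum>w\<in>I. \<Sum>l<N. ennreal (p l / card I) * (\<Sum>k<K. \<Sum>l'\<in>{..<N}-{l}. ennreal (p l') * (\<Sum>k'<K.
       WK.Z.collision (x1 (cl w, l, a w)) (x2 (cl w, l, b w, k)) (x1 (cl w, l', a w)) (x2 (cl w, l', b w, k')))))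
      \<le> ennreal (4 * \<gamma>)"
  proof -
    have "\<exists>x1 x2.
    (\<forall>w\<in>I. \<forall>l<N. x1 (cl w, l, a w) \<in> space (seq_space n) \<and> (\<forall>k<K. x2 (cl w, l, b w, k) \<in> space (seq_space n)) \<and>
       (\<exists>k<K. good (x1 (cl w, l, a w)) (x2 (cl w, l, b w, k)))) \<and>
    (\<Sum>w\<in>I. \<Sum>l<N. ennreal (p l / card I) * (\<Sum>k<K. \<Sum>w'\<in>I-{w}. \<Sum>l'<N. \<Sum>k'<K.
       WK.Y.confusion ?t0 ?t1 ?t2 (x1 (cl w, l, a w)) (x2 (cl w, l, b w, k)) (x1 (cl w', l', a w')) (x2 (cl w', l', b w', k'))))
      \<le> ennreal (4 * \<alpha>) \<and>
    (\<Sum>w\<in>I. \<Sum>l<N. ennreal (p l / card I) * (\<Sum>k<K. \<Sum>l'\<in>{..<N}-{l}. ennreal (p l') * (\<Sum>k'<K.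
       WK.Z.collision (x1 (cl w, l, a w)) (x2 (cl w, l, b w, k)) (x1 (cl w, l', a w)) (x2 (cl w, l', b w, k')))))
      \<le> ennreal (4 * \<gamma>)"
      unfolding \<alpha>_def \<gamma>_def I_def[symmetric]
    proof (rule WK.codebook_exists[where T=typical and q="1 - exp (- real n * (I0 + \<kappa> * \<eta>)) / 2"])
      show "I \<noteq> {}" using cI by auto
      show "AE x in \<nu>1. x \<in> typical" by (rule AE_typical[OF \<open>large\<close>])
      show "emeasure \<nu>2 {x2 \<in> space (seq_space n). \<not> good x1 x2} \<le> ennreal (1 - exp (- real n * (I0 + \<kappa> * \<eta>)) / 2)"
        if "x1 \<in> typical" for x1 by (rule covering[OF \<open>large\<close> that])
    qed (use fin inj ab p p1 K q fail in \<open>auto simp: I_def\<close>)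
    then show thesis using that by blast
  qed
  \<comment> \<open>The choice among good candidates is arbitrary; bounds on the sums over all k
    cover every choice.\<close>
  define sel where "sel w l = (SOME k. k < K \<and> good (x1 (cl w, l, a w)) (x2 (cl w, l, b w, k)))" for w l
  have sel: "sel w l < K \<and> good (x1 (cl w, l, a w)) (x2 (cl w, l, b w, sel w l))" if "w \<in> I" "l < N" for w l
    unfolding sel_def by (rule someI_ex) (use x[OF that] in blast)
  define X1 where "X1 w l = x1 (cl w, l, a w)" for w l
  define X2 where "X2 w l = x2 (cl w, l, b w, sel w l)" for w l
  have X: "X1 w l \<in> space (seq_space n)" "X2 w l \<in> space (seq_space n)" "good (X1 w l) (X2 w l)"
    if "w \<in> I" "l < N" for w l
    using x[OF that] sel[OF that] by (auto simp: X1_def X2_def)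

  \<comment> \<open>All candidates k are tested, selected or not: the confusion bound sums over all
    of them.\<close>
  define hits where "hits w y \<longleftrightarrow> w \<in> I \<and> (\<exists>l\<in>{..<N}. \<exists>k\<in>{..<K}. good (x1 (cl w, l, a w)) (x2 (cl w, l, b w, k)) \<and>
    accepts (x1 (cl w, l, a w)) (x2 (cl w, l, b w, k)) y)" for w y
  \<comment> \<open>Message 1 belongs to the message set at every rate R \<ge> 0 and is the default
    when nothing matches.\<close>
  define dec where "dec y = (if \<exists>w\<in>I. hits w y then (LEAST w. hits w y) else 1)" for y
  have hits_meas [measurable]: "Measurable.pred (seq_space n) (hits w)" for w
  proof (cases "w \<in> I")
    case True
    then have "Measurable.pred (seq_space n) (\<lambda>y. \<exists>l\<in>{..<N}. \<exists>k\<in>{..<K}. good (x1 (cl w, l, a w)) (x2 (cl w, l, b w, k)) \<and>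
      accepts (x1 (cl w, l, a w)) (x2 (cl w, l, b w, k)) y)"
      using x by (intro pred_intros_finite pred_intros_logic accepts_measurable) auto
    then show ?thesis using True by (simp add: hits_def[abs_def])
  qed (simp add: hits_def[abs_def])
  have dec_range: "dec y \<in> I" for y
  proof (cases "\<exists>w\<in>I. hits w y")
    case True
    then have "hits (LEAST w. hits w y) y" by (metis LeastI)
    then show ?thesis using True by (simp add: dec_def hits_def)
  next
    case False
    then show ?thesis using index_set_nonempty[OF R(1), of n] by (simp add: dec_def I_def)
  qed
  have dec_meas: "dec \<in> seq_space n \<rightarrow>\<^sub>M count_space I"
  proof (rule measurable_count_space_eq2[THEN iffD2, OF fin(1)], intro conjI ballI)
    show "dec \<in> space (seq_space n) \<rightarrow> I" using dec_range by auto
    have "dec \<in> seq_space n \<rightarrow>\<^sub>M count_space UNIV"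
      unfolding dec_def[abs_def] using fin by measurable
    then show "dec -` {w} \<inter> space (seq_space n) \<in> sets (seq_space n)" for w
      by (rule measurable_sets) simp
  qed

  show ?thesis
  proof (intro exI[of _ x1] exI[of _ x2] exI[of _ sel] exI[of _ dec] conjI allI impI)
    show "\<forall>w\<in>index_set n R. \<forall>l<N. sel w l < K \<and> good (x1 (cl w, l, a w)) (x2 (cl w, l, b w, sel w l))"
      using sel by (simp add: I_def)
    show "dec \<in> seq_space n \<rightarrow>\<^sub>M count_space (index_set n R)"
      using dec_meas by (simp add: I_def)
    fix c assume "decoder c = dec \<and> (\<forall>w\<in>index_set n R. \<forall>m\<in>index_set n R'. \<forall>i<n.
        channel_input c w m i = x1 (cl w, m mod N, a w) i + x2 (cl w, m mod N, b w, sel w (m mod N)) i)"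
    then have c: "decoder c = dec"
      and inp: "\<And>w m i. w \<in> I \<Longrightarrow> m \<in> M \<Longrightarrow> i < n \<Longrightarrow> channel_input c w m i = X1 w (m mod N) i + X2 w (m mod N) i"
      by (auto simp: X1_def X2_def I_def M_def)
    have modN: "m mod N < N" for m using N by simp
    have chan: "gauss n 1 (\<lambda>i. u * channel_input c w m i) = channel u (X1 w (m mod N)) (X2 w (m mod N))"
      if "w \<in> I" "m \<in> M" for u w m
      unfolding channel_def by (intro ext gauss_cong) (simp add: inp that distrib_left)
    have chan1: "gauss n 1 (channel_input c w m) = channel 1 (X1 w (m mod N)) (X2 w (m mod N))"
      if "w \<in> I" "m \<in> M" for w m
      using chan[OF that, of 1] by simp

    define cheb where "cheb = (4 + s1 + s2 + 2 * \<eta>) / (real n * \<eta>\<^sup>2)"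
    have cheb: "cheb \<ge> 0" using s \<eta> by (simp add: cheb_def)
    define F where "F w l = (\<Sum>k<K. \<Sum>w'\<in>I-{w}. \<Sum>l'<N. \<Sum>k'<K.
       WK.Y.confusion ?t0 ?t1 ?t2 (x1 (cl w, l, a w)) (x2 (cl w, l, b w, k)) (x1 (cl w', l', a w')) (x2 (cl w', l', b w', k')))" for w l
    have test_eq: "WK.Y.test ?t0 ?t1 ?t2 = accepts"
      by (intro ext) (simp add: WK.Y.test_def accepts_def)
    \<comment> \<open>A wrong decision means that the sent pair is rejected or that some pair of
      another message is accepted.\<close>
    have err: "(\<integral>\<^sup>+y. ennreal (channel 1 (X1 w l) (X2 w l) y) * indicator {y. dec y \<noteq> w} y \<partial>lebesgue_seq n)
        \<le> ennreal cheb + F w l" if wl: "w \<in> I" "l < N" for w l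
    proof -
      define hit where "hit w' l' k' y = (of_bool (good (x1 (cl w', l', a w')) (x2 (cl w', l', b w', k')) \<and>
        accepts (x1 (cl w', l', a w')) (x2 (cl w', l', b w', k')) y) :: ennreal)" for w' l' k' y
      note [measurable] = X(1,2)[OF wl]
      have cm [measurable]: "(\<lambda>y. ennreal (channel 1 (X1 w l) (X2 w l) y)) \<in> borel_measurable (seq_space n)"
        by (intro measurable_compose[OF _ measurable_ennreal] channel_measurable) measurable
      have acc: "Measurable.pred (seq_space n) (accepts (X1 w l) (X2 w l))" by measurable
      have am: "(\<lambda>y. indicator {y. \<not> accepts (X1 w l) (X2 w l) y} y :: ennreal) \<in> borel_measurable (seq_space n)"
      proof -
        have "(\<lambda>y. if accepts (X1 w l) (X2 w l) y then 0 else 1 :: ennreal) \<in> borel_measurable (seq_space n)"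
          using acc by measurable
        then show ?thesis by (simp add: indicator_def if_distrib cong: if_cong)
      qed
      have hm: "hit w' l' k' \<in> borel_measurable (seq_space n)" if "w' \<in> I" "l' < N" "k' < K" for w' l' k'
      proof -
        have [measurable]: "x1 (cl w', l', a w') \<in> space (seq_space n)" "x2 (cl w', l', b w', k') \<in> space (seq_space n)"
          using x[OF that(1,2)] that(3) by auto
        have [measurable]: "Measurable.pred (seq_space n) (accepts (x1 (cl w', l', a w')) (x2 (cl w', l', b w', k')))"
          by measurable
        show ?thesis unfolding hit_def[abs_def] of_bool_def by measurable
      qed
      have sm: "(\<lambda>y. \<Sum>w'\<in>I-{w}. \<Sum>l'<N. \<Sum>k'<K. ennreal (channel 1 (X1 w l) (X2 w l) y) * hit w' l' k' y) \<in> borel_measurable (seq_space n)"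
        by (intro borel_measurable_sum borel_measurable_times_ennreal cm hm) auto
      have "(\<integral>\<^sup>+y. ennreal (channel 1 (X1 w l) (X2 w l) y) * indicator {y. dec y \<noteq> w} y \<partial>lebesgue_seq n)
        \<le> (\<integral>\<^sup>+y. ennreal (channel 1 (X1 w l) (X2 w l) y) * indicator {y. \<not> accepts (X1 w l) (X2 w l) y} y
          + (\<Sum>w'\<in>I-{w}. \<Sum>l'<N. \<Sum>k'<K. ennreal (channel 1 (X1 w l) (X2 w l) y) * hit w' l' k' y) \<partial>lebesgue_seq n)"
      proof (rule nn_integral_mono)
        fix y
        have "ennreal (channel 1 (X1 w l) (X2 w l) y)
          \<le> (\<Sum>w'\<in>I-{w}. \<Sum>l'<N. \<Sum>k'<K. ennreal (channel 1 (X1 w l) (X2 w l) y) * hit w' l' k' y)"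
          if "dec y \<noteq> w" "accepts (X1 w l) (X2 w l) y"
        proof -
          have "hits w y"
            unfolding hits_def using that(2) sel[OF wl] wl by (auto simp: X1_def X2_def)
          then have ex: "\<exists>w\<in>I. hits w y" using wl by auto
          then have "hits (dec y) y" by (simp add: dec_def) (metis LeastI)
          then obtain l' k' where lk: "l' < N" "k' < K" "hit (dec y) l' k' y = 1"
            by (auto simp: hits_def hit_def)
          have "ennreal (channel 1 (X1 w l) (X2 w l) y) = ennreal (channel 1 (X1 w l) (X2 w l) y) * hit (dec y) l' k' y"
            using lk by simp
          also have "\<dots> \<le> (\<Sum>k'<K. ennreal (channel 1 (X1 w l) (X2 w l) y) * hit (dec y) l' k' y)"
            using lk by (intro member_le_sum) auto
          also have "\<dots> \<le> (\<Sum>l'<N. \<Sum>k'<K. ennreal (channel 1 (X1 w l) (X2 w l) y) * hit (dec y) l' k' y)"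
            using lk by (intro member_le_sum[of l' "{..<N}" "\<lambda>l'. \<Sum>k'<K. ennreal (channel 1 (X1 w l) (X2 w l) y) * hit (dec y) l' k' y"]) auto
          also have "\<dots> \<le> (\<Sum>w'\<in>I-{w}. \<Sum>l'<N. \<Sum>k'<K. ennreal (channel 1 (X1 w l) (X2 w l) y) * hit w' l' k' y)"
            using dec_range[of y] that(1) fin
            by (intro member_le_sum[of "dec y" "I-{w}" "\<lambda>w'. \<Sum>l'<N. \<Sum>k'<K. ennreal (channel 1 (X1 w l) (X2 w l) y) * hit w' l' k' y"]) auto
          finally show ?thesis .
        qed
        then show "ennreal (channel 1 (X1 w l) (X2 w l) y) * indicator {y. dec y \<noteq> w} y
          \<le> ennreal (channel 1 (X1 w l) (X2 w l) y) * indicator {y. \<not> accepts (X1 w l) (X2 w l) y} y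
          + (\<Sum>w'\<in>I-{w}. \<Sum>l'<N. \<Sum>k'<K. ennreal (channel 1 (X1 w l) (X2 w l) y) * hit w' l' k' y)"
          by (auto simp: indicator_def)
      qed
      also have "\<dots> = (\<integral>\<^sup>+y. ennreal (channel 1 (X1 w l) (X2 w l) y) * indicator {y. \<not> accepts (X1 w l) (X2 w l) y} y \<partial>lebesgue_seq n)
        + (\<integral>\<^sup>+y. (\<Sum>w'\<in>I-{w}. \<Sum>l'<N. \<Sum>k'<K. ennreal (channel 1 (X1 w l) (X2 w l) y) * hit w' l' k' y) \<partial>lebesgue_seq n)"
        using sm am cm by (intro nn_integral_add) auto
      finally have first: "(\<integral>\<^sup>+y. ennreal (channel 1 (X1 w l) (X2 w l) y) * indicator {y. dec y \<noteq> w} y \<partial>lebesgue_seq n) \<le> \<dots>" .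
      have "(\<integral>\<^sup>+y. (\<Sum>w'\<in>I-{w}. \<Sum>l'<N. \<Sum>k'<K. ennreal (channel 1 (X1 w l) (X2 w l) y) * hit w' l' k' y) \<partial>lebesgue_seq n)
        = (\<Sum>w'\<in>I-{w}. \<Sum>l'<N. \<Sum>k'<K. \<integral>\<^sup>+y. ennreal (channel 1 (X1 w l) (X2 w l) y) * hit w' l' k' y \<partial>lebesgue_seq n)"
      proof -
        have h: "(\<lambda>y. ennreal (channel 1 (X1 w l) (X2 w l) y) * hit w' l' k' y) \<in> borel_measurable (lebesgue_seq n)"
          if "w' \<in> I - {w}" "l' \<in> {..<N}" "k' \<in> {..<K}" for w' l' k'
          using that cm hm by auto
        have "(\<integral>\<^sup>+y. (\<Sum>w'\<in>I-{w}. \<Sum>l'<N. \<Sum>k'<K. ennreal (channel 1 (X1 w l) (X2 w l) y) * hit w' l' k' y) \<partial>lebesgue_seq n)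
          = (\<Sum>w'\<in>I-{w}. \<integral>\<^sup>+y. (\<Sum>l'<N. \<Sum>k'<K. ennreal (channel 1 (X1 w l) (X2 w l) y) * hit w' l' k' y) \<partial>lebesgue_seq n)"
          by (intro nn_integral_sum borel_measurable_sum h)
        also have "\<dots> = (\<Sum>w'\<in>I-{w}. \<Sum>l'<N. \<integral>\<^sup>+y. (\<Sum>k'<K. ennreal (channel 1 (X1 w l) (X2 w l) y) * hit w' l' k' y) \<partial>lebesgue_seq n)"
          by (intro sum.cong refl nn_integral_sum borel_measurable_sum h)
        also have "\<dots> = (\<Sum>w'\<in>I-{w}. \<Sum>l'<N. \<Sum>k'<K. \<integral>\<^sup>+y. ennreal (channel 1 (X1 w l) (X2 w l) y) * hit w' l' k' y \<partial>lebesgue_seq n)"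
          by (intro sum.cong refl nn_integral_sum h)
        finally show ?thesis .
      qed
      also have "\<dots> = (\<Sum>w'\<in>I-{w}. \<Sum>l'<N. \<Sum>k'<K. WK.Y.confusion ?t0 ?t1 ?t2 (x1 (cl w, l, a w)) (x2 (cl w, l, b w, sel w l))
          (x1 (cl w', l', a w')) (x2 (cl w', l', b w', k')))"
        unfolding WK.Y.confusion_def test_eq hit_def WK.Y.weight_def using sel[OF wl] by (simp add: X1_def X2_def)
      also have "\<dots> \<le> F w l"
        unfolding F_def using sel[OF wl]
        by (intro member_le_sum[of "sel w l" "{..<K}" "\<lambda>k. \<Sum>w'\<in>I-{w}. \<Sum>l'<N. \<Sum>k'<K. WK.Y.confusion ?t0 ?t1 ?t2 (x1 (cl w, l, a w)) (x2 (cl w, l, b w, k))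
          (x1 (cl w', l', a w')) (x2 (cl w', l', b w', k'))"]) auto
      finally have second: "(\<integral>\<^sup>+y. (\<Sum>w'\<in>I-{w}. \<Sum>l'<N. \<Sum>k'<K. ennreal (channel 1 (X1 w l) (X2 w l) y) * hit w' l' k' y) \<partial>lebesgue_seq n)
        \<le> F w l" .
      show ?thesis
        using order_trans[OF first add_mono[OF prob_rejects_le[OF X(3)[OF wl] X(1,2)[OF wl]] second]]
        unfolding cheb_def .
    qed
    have total_F: "(\<Sum>w\<in>I. \<Sum>l<N. ennreal (p l) * F w l) \<le> ennreal (card I * (4 * \<alpha>))"
    proof -
      have "(\<Sum>w\<in>I. \<Sum>l<N. ennreal (p l) * F w l) = ennreal (card I) * (\<Sum>w\<in>I. \<Sum>l<N. ennreal (p l / card I) * F w l)"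
        unfolding sum_distrib_left mult.assoc[symmetric] using cI by (simp add: ennreal_mult'[symmetric])
      also have "\<dots> \<le> ennreal (card I) * ennreal (4 * \<alpha>)"
        using conf unfolding F_def by (intro mult_left_mono) auto
      finally show ?thesis by (simp add: ennreal_mult')
    qed
    have \<alpha>: "0 \<le> \<alpha>" unfolding \<alpha>_def by simp
    have "(\<Sum>w\<in>I. \<Sum>m\<in>M. \<integral>\<^sup>+y. ennreal (gauss n 1 (channel_input c w m) y) * indicator {y. decoder c y \<noteq> w} y \<partial>lebesgue_seq n)
      \<le> (\<Sum>w\<in>I. \<Sum>m\<in>M. ennreal cheb + F w (m mod N))"
      by (intro sum_mono) (simp add: chan1 c err modN)
    also have "\<dots> = (\<Sum>w\<in>I. (\<Sum>l<N. ennreal (p l) * (ennreal cheb + F w l))) * ennreal (card M)"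
      unfolding avg[where f="\<lambda>l. ennreal cheb + F _ l"] sum_distrib_right ..
    also have "(\<Sum>w\<in>I. (\<Sum>l<N. ennreal (p l) * (ennreal cheb + F w l)))
      = (\<Sum>w\<in>I. (\<Sum>l<N. ennreal (p l)) * ennreal cheb + (\<Sum>l<N. ennreal (p l) * F w l))"
      by (simp add: distrib_left sum.distrib sum_distrib_right del: sum_ennreal)
    also have "(\<Sum>l<N. ennreal (p l)) = 1" using p p1 by (simp add: sum_ennreal)
    also have "(\<Sum>w\<in>I. 1 * ennreal cheb + (\<Sum>l<N. ennreal (p l) * F w l))
      = ennreal (card I) * ennreal cheb + (\<Sum>w\<in>I. \<Sum>l<N. ennreal (p l) * F w l)"
      by (simp add: sum.distrib ennreal_of_nat_eq_real_of_nat)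
    also have "\<dots> * ennreal (card M) \<le> (ennreal (card I) * ennreal cheb + ennreal (card I * (4 * \<alpha>))) * ennreal (card M)"
      by (intro mult_right_mono add_left_mono total_F) simp
    also have "\<dots> = ennreal ((cheb + 4 * \<alpha>) * (card I * card M))"
      using cheb \<alpha> by (simp add: ennreal_mult'[symmetric] ennreal_plus[symmetric] algebra_simps del: ennreal_plus)
    finally have total: "(\<Sum>w\<in>I. \<Sum>m\<in>M. \<integral>\<^sup>+y. ennreal (gauss n 1 (channel_input c w m) y)
      * indicator {y. decoder c y \<noteq> w} y \<partial>lebesgue_seq n) \<le> \<dots>" .
    have ce: "0 \<le> cheb + 4 * \<alpha>" using cheb \<alpha> by simp
    have dm: "decoder c \<in> seq_space n \<rightarrow>\<^sub>M count_space (index_set n R)"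
      using dec_meas by (simp add: c I_def)
    show "0 \<le> error_prob g R' R n c" "error_prob g R' R n c \<le> (4 + s1 + s2 + 2 * \<eta>) / (real n * \<eta>\<^sup>2) + 4 * \<alpha>"
      using error_prob_le[OF g R ce dm total[unfolded I_def M_def]] by (auto simp: cheb_def)

    \<comment> \<open>The collision sums average to at most 4 * \<gamma>, so divided by this C they
      contribute a constant, and ln C is the only growing trace of them.\<close>
    define C where "C = 1 + \<gamma>"
    have \<gamma>: "0 \<le> \<gamma>" by (simp add: \<gamma>_def)
    then have C: "C \<ge> 1" by (simp add: C_def)
    define pmax where "pmax = 4 * exp (- real n * \<rho>)"
    define f where "f w l = channel t (X1 w l) (X2 w l)" for w l
    have fpos: "f w l z > 0" for w l z by (simp add: f_def channel_pos)
    have fm: "f w l \<in> borel_measurable (seq_space n)" if "w \<in> I" "l < N" for w l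
    proof -
      note [measurable] = X(1,2)[OF that]
      show ?thesis unfolding f_def by measurable
    qed
    have qpos: "output0 t z > 0" for z by (rule output_pos)
    define A where "A = ln 8 + 4 * real n * \<eta> + (1 + S) / \<eta> + 4"
    have A: "0 \<le> A" using S \<eta> by (simp add: A_def add_nonneg_nonneg)
    \<comment> \<open>Its terms integrate to collisions between the selected pairs of l and
      l'.\<close>
    define rest where "rest w l z = (\<Sum>l'\<in>{..<N}-{l}. ennreal (p l') * (ennreal (f w l z) * ennreal (f w l' z) * ennreal (1 / output0 t z)))" for w l z
    define u where "u w z = (if w \<in> I then \<Sum>l<N. ennreal (p l) * (ennreal (f w l z) * ennreal (ln (1 + pmax * f w l z / output0 t z))
      + ennreal (f w l z) * ennreal (ln C) + rest w l z * ennreal (1 / C)) else 0)" for w z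
    have rm: "rest w l \<in> borel_measurable (seq_space n)" if "w \<in> I" "l < N" for w l
      unfolding rest_def[abs_def]
    proof (intro borel_measurable_sum)
      fix l' assume "l' \<in> {..<N} - {l}"
      then have [measurable]: "f w l \<in> borel_measurable (seq_space n)" "f w l' \<in> borel_measurable (seq_space n)"
        using fm that by auto
      show "(\<lambda>z. ennreal (p l') * (ennreal (f w l z) * ennreal (f w l' z) * ennreal (1 / output0 t z))) \<in> borel_measurable (seq_space n)"
        by measurable
    qed
    have um: "u w \<in> borel_measurable (seq_space n)" for w
    proof (cases "w \<in> I")
      case True
      have "(\<lambda>z. \<Sum>l<N. ennreal (p l) * (ennreal (f w l z) * ennreal (ln (1 + pmax * f w l z / output0 t z))
        + ennreal (f w l z) * ennreal (ln C) + rest w l z * ennreal (1 / C))) \<in> borel_measurable (seq_space n)"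
      proof (intro borel_measurable_sum)
        fix l assume "l \<in> {..<N}"
        then have [measurable]: "f w l \<in> borel_measurable (seq_space n)" "rest w l \<in> borel_measurable (seq_space n)"
          using fm rm True by auto
        show "(\<lambda>z. ennreal (p l) * (ennreal (f w l z) * ennreal (ln (1 + pmax * f w l z / output0 t z))
          + ennreal (f w l z) * ennreal (ln C) + rest w l z * ennreal (1 / C))) \<in> borel_measurable (seq_space n)"
          by measurable
      qed
      then show ?thesis using True by (simp add: u_def[abs_def])
    qed (simp add: u_def[abs_def])
    have dens: "eve_density g R' n c w z = (\<Sum>l<N. p l * f w l z)" if "w \<in> I" for w z
    proof -
      have "eve_density g R' n c w z = (\<Sum>m\<in>M. f w (m mod N) z) / card M"
        unfolding eve_density_def M_def[symmetric] t_def[symmetric]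
        by (intro arg_cong2[where f="(/)"] sum.cong refl) (simp add: chan[OF that] f_def)
      then show ?thesis unfolding avg_real[where f="\<lambda>l. f w l z"] .
    qed
    have u_ge: "ennreal (eve_density g R' n c w z * ln (eve_density g R' n c w z / output0 t z)) \<le> u w z"
      if w: "w \<in> I" for w z
    proof -
      let ?V = "\<lambda>l. \<Sum>l'\<in>{..<N}-{l}. p l' * f w l' z / output0 t z"
      have a: "0 \<le> ln (1 + pmax * f w l z / output0 t z)" for l
        using fpos[of w l z] qpos[of z] by (simp add: pmax_def)
      have V: "0 \<le> ?V l" for l
        using p fpos qpos by (intro sum_nonneg) (auto simp: less_imp_le)
      have "0 < eve_density g R' n c w z" by (rule eve_density_pos[OF R(2)])
      then have "eve_density g R' n c w z * ln (eve_density g R' n c w z / output0 t z)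
        \<le> (\<Sum>l<N. p l * f w l z * (ln (1 + pmax * f w l z / output0 t z) + ln C + ?V l / C))"
        unfolding dens[OF w]
        by (intro mixture_log_ratio_le) (use N p pm fpos qpos C in \<open>auto simp: pmax_def\<close>)
      then have "ennreal (eve_density g R' n c w z * ln (eve_density g R' n c w z / output0 t z))
        \<le> ennreal (\<Sum>l<N. p l * f w l z * (ln (1 + pmax * f w l z / output0 t z) + ln C + ?V l / C))"
        by (rule ennreal_leI)
      also have "\<dots> = (\<Sum>l<N. ennreal (p l * f w l z * (ln (1 + pmax * f w l z / output0 t z) + ln C + ?V l / C)))"
        using p fpos a V C by (intro sum_ennreal[symmetric] mult_nonneg_nonneg add_nonneg_nonneg) (auto simp: less_imp_le)
      also have "\<dots> = u w z"
        unfolding u_def using w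
      proof (simp only: if_True, intro sum.cong refl)
        fix l
        have r: "rest w l z = ennreal (f w l z * ?V l)"
        proof -
          have "rest w l z = (\<Sum>l'\<in>{..<N}-{l}. ennreal (f w l z * (p l' * f w l' z / output0 t z)))"
            unfolding rest_def
          proof (intro sum.cong refl)
            fix l'
            have "f w l z * (p l' * f w l' z / output0 t z) = p l' * (f w l z * f w l' z * (1 / output0 t z))" by simp
            then show "ennreal (p l') * (ennreal (f w l z) * ennreal (f w l' z) * ennreal (1 / output0 t z))
              = ennreal (f w l z * (p l' * f w l' z / output0 t z))"
              using p fpos qpos by (simp only: ennreal_mult mult_nonneg_nonneg less_imp_le zero_le_divide_1_iff)
          qed
          also have "\<dots> = ennreal (\<Sum>l'\<in>{..<N}-{l}. f w l z * (p l' * f w l' z / output0 t z))"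
            using p fpos qpos by (intro sum_ennreal) (simp add: less_imp_le)
          finally show ?thesis by (simp add: sum_distrib_left)
        qed
        have "p l * f w l z * (ln (1 + pmax * f w l z / output0 t z) + ln C + ?V l / C)
          = p l * (f w l z * ln (1 + pmax * f w l z / output0 t z) + f w l z * ln C + f w l z * ?V l * (1 / C))"
          by (simp add: distrib_left mult.assoc)
        then show "ennreal (p l * f w l z * (ln (1 + pmax * f w l z / output0 t z) + ln C + ?V l / C))
          = ennreal (p l) * (ennreal (f w l z) * ennreal (ln (1 + pmax * f w l z / output0 t z))
            + ennreal (f w l z) * ennreal (ln C) + rest w l z * ennreal (1 / C))"
          using p[of l] fpos[of w l z] a[of l] V[of l] C unfolding r
          by (simp only: ennreal_mult ennreal_plus mult_nonneg_nonneg add_nonneg_nonneg less_imp_le ln_ge_zero zero_le_divide_1_iff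
              order_trans[OF zero_le_one])
      qed
      finally show ?thesis .
    qed
    have rest_int: "(\<integral>\<^sup>+z. rest w l z \<partial>lebesgue_seq n) \<le> (\<Sum>k<K. \<Sum>l'\<in>{..<N}-{l}. ennreal (p l') * (\<Sum>k'<K.
       WK.Z.collision (x1 (cl w, l, a w)) (x2 (cl w, l, b w, k)) (x1 (cl w, l', a w)) (x2 (cl w, l', b w, k'))))"
      (is "_ \<le> ?rhs") if wl: "w \<in> I" "l < N" for w l
    proof -
      have "(\<integral>\<^sup>+z. rest w l z \<partial>lebesgue_seq n) = (\<Sum>l'\<in>{..<N}-{l}. ennreal (p l') *
        (\<integral>\<^sup>+z. ennreal (f w l z) * ennreal (f w l' z) * ennreal (1 / output0 t z) \<partial>lebesgue_seq n))"
        unfolding rest_def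
      proof (subst nn_integral_sum)
        fix l' assume "l' \<in> {..<N} - {l}"
        then have [measurable]: "f w l \<in> borel_measurable (seq_space n)" "f w l' \<in> borel_measurable (seq_space n)"
          using fm wl by auto
        show "(\<lambda>z. ennreal (p l') * (ennreal (f w l z) * ennreal (f w l' z) * ennreal (1 / output0 t z))) \<in> borel_measurable (lebesgue_seq n)"
          by measurable
      next
        show "(\<Sum>l'\<in>{..<N}-{l}. \<integral>\<^sup>+z. ennreal (p l') * (ennreal (f w l z) * ennreal (f w l' z) * ennreal (1 / output0 t z)) \<partial>lebesgue_seq n)
          = (\<Sum>l'\<in>{..<N}-{l}. ennreal (p l') * (\<integral>\<^sup>+z. ennreal (f w l z) * ennreal (f w l' z) * ennreal (1 / output0 t z) \<partial>lebesgue_seq n))"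
        proof (intro sum.cong refl nn_integral_cmult)
          fix l' assume "l' \<in> {..<N} - {l}"
          then have [measurable]: "f w l \<in> borel_measurable (seq_space n)" "f w l' \<in> borel_measurable (seq_space n)"
            using fm wl by auto
          show "(\<lambda>z. ennreal (f w l z) * ennreal (f w l' z) * ennreal (1 / output0 t z)) \<in> borel_measurable (lebesgue_seq n)"
            by measurable
        qed
      qed
      \<comment> \<open>Selected pairs are good, so the mask equals 1 and \<open>weight\<close> is
        the channel density.\<close>
      also have "\<dots> = (\<Sum>l'\<in>{..<N}-{l}. ennreal (p l') * WK.Z.collision (x1 (cl w, l, a w)) (x2 (cl w, l, b w, sel w l))
          (x1 (cl w, l', a w)) (x2 (cl w, l', b w, sel w l')))"
        unfolding WK.Z.collision_def WK.Z.weight_def f_def X1_def X2_def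
        using sel wl by (intro sum.cong) auto
      also have "\<dots> \<le> (\<Sum>l'\<in>{..<N}-{l}. ennreal (p l') * (\<Sum>k'<K. WK.Z.collision (x1 (cl w, l, a w)) (x2 (cl w, l, b w, sel w l))
          (x1 (cl w, l', a w)) (x2 (cl w, l', b w, k'))))"
        using sel wl by (intro sum_mono mult_left_mono member_le_sum) auto
      also have "\<dots> \<le> ?rhs"
        using sel[OF wl] by (intro member_le_sum[of "sel w l" "{..<K}" "\<lambda>k. \<Sum>l'\<in>{..<N}-{l}. ennreal (p l') * (\<Sum>k'<K.
          WK.Z.collision (x1 (cl w, l, a w)) (x2 (cl w, l, b w, k)) (x1 (cl w, l', a w)) (x2 (cl w, l', b w, k')))"]) auto
      finally show ?thesis .
    qed
    define H where "H w l = (\<integral>\<^sup>+z. rest w l z \<partial>lebesgue_seq n)" for w l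
    have total_H: "(\<Sum>w\<in>I. \<Sum>l<N. ennreal (p l) * H w l) \<le> ennreal (card I * (4 * \<gamma>))"
    proof -
      have "(\<Sum>w\<in>I. \<Sum>l<N. ennreal (p l) * H w l) = ennreal (card I) * (\<Sum>w\<in>I. \<Sum>l<N. ennreal (p l / card I) * H w l)"
        unfolding sum_distrib_left mult.assoc[symmetric] using cI by (simp add: ennreal_mult'[symmetric])
      also have "\<dots> \<le> ennreal (card I) * (\<Sum>w\<in>I. \<Sum>l<N. ennreal (p l / card I) * (\<Sum>k<K. \<Sum>l'\<in>{..<N}-{l}. ennreal (p l') * (\<Sum>k'<K.
       WK.Z.collision (x1 (cl w, l, a w)) (x2 (cl w, l, b w, k)) (x1 (cl w, l', a w)) (x2 (cl w, l', b w, k')))))"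
        unfolding H_def using rest_int by (intro mult_left_mono sum_mono) auto
      also have "\<dots> \<le> ennreal (card I) * ennreal (4 * \<gamma>)"
        by (intro mult_left_mono coll) simp
      finally show ?thesis by (simp add: ennreal_mult')
    qed
    have term_int: "(\<integral>\<^sup>+z. ennreal (p l) * (ennreal (f w l z) * ennreal (ln (1 + pmax * f w l z / output0 t z))
      + ennreal (f w l z) * ennreal (ln C) + rest w l z * ennreal (1 / C)) \<partial>lebesgue_seq n)
      \<le> ennreal (p l) * (ennreal (A + ln C) + H w l * ennreal (1 / C))" if wl: "w \<in> I" "l < N" for w l
    proof -
      note [measurable] = fm[OF wl] rm[OF wl]
      have one: "(\<integral>\<^sup>+z. ennreal (f w l z) \<partial>lebesgue_seq n) = 1"
        unfolding f_def channel_def by simp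
      have rt: "(\<integral>\<^sup>+z. ennreal (f w l z) * ennreal (ln (1 + pmax * f w l z / output0 t z)) \<partial>lebesgue_seq n) \<le> ennreal A"
        unfolding f_def A_def
        by (rule resolvability_term_le[OF X(3)[OF wl] X(1,2)[OF wl] t(1,2)]) (use \<rho> t in \<open>auto simp: pmax_def\<close>)
      have "(\<integral>\<^sup>+z. ennreal (p l) * (ennreal (f w l z) * ennreal (ln (1 + pmax * f w l z / output0 t z))
        + ennreal (f w l z) * ennreal (ln C) + rest w l z * ennreal (1 / C)) \<partial>lebesgue_seq n)
        = ennreal (p l) * ((\<integral>\<^sup>+z. ennreal (f w l z) * ennreal (ln (1 + pmax * f w l z / output0 t z)) \<partial>lebesgue_seq n)
          + 1 * ennreal (ln C) + H w l * ennreal (1 / C))"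
        unfolding H_def one[symmetric]
        by (subst nn_integral_cmult, measurable, subst nn_integral_add, measurable, subst nn_integral_add, measurable)
          (simp add: nn_integral_multc)
      also have "\<dots> \<le> ennreal (p l) * (ennreal A + 1 * ennreal (ln C) + H w l * ennreal (1 / C))"
        by (intro mult_left_mono add_right_mono rt) simp
      also have "\<dots> = ennreal (p l) * (ennreal (A + ln C) + H w l * ennreal (1 / C))"
        using A C by (simp add: ennreal_plus)
      finally show ?thesis .
    qed
    have "(\<Sum>w\<in>I. \<integral>\<^sup>+z. u w z \<partial>lebesgue_seq n) \<le> (\<Sum>w\<in>I. \<Sum>l<N. ennreal (p l) * (ennreal (A + ln C) + H w l * ennreal (1 / C)))"
    proof (rule sum_mono)
      fix w assume w: "w \<in> I"
      have "(\<integral>\<^sup>+z. u w z \<partial>lebesgue_seq n) = (\<Sum>l<N. \<integral>\<^sup>+z. ennreal (p l) * (ennreal (f w l z) * ennreal (ln (1 + pmax * f w l z / output0 t z))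
        + ennreal (f w l z) * ennreal (ln C) + rest w l z * ennreal (1 / C)) \<partial>lebesgue_seq n)"
        unfolding u_def using w
      proof (simp only: if_True, subst nn_integral_sum)
        fix l assume "l \<in> {..<N}"
        then have [measurable]: "f w l \<in> borel_measurable (seq_space n)" "rest w l \<in> borel_measurable (seq_space n)"
          using fm rm w by auto
        show "(\<lambda>z. ennreal (p l) * (ennreal (f w l z) * ennreal (ln (1 + pmax * f w l z / output0 t z))
          + ennreal (f w l z) * ennreal (ln C) + rest w l z * ennreal (1 / C))) \<in> borel_measurable (lebesgue_seq n)"
          by measurable
      qed simp
      also have "\<dots> \<le> (\<Sum>l<N. ennreal (p l) * (ennreal (A + ln C) + H w l * ennreal (1 / C)))"
        using w by (intro sum_mono term_int) auto
      finally show "(\<integral>\<^sup>+z. u w z \<partial>lebesgue_seq n) \<le> \<dots>" .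
    qed
    also have "\<dots> = (\<Sum>w\<in>I. (\<Sum>l<N. ennreal (p l)) * ennreal (A + ln C) + (\<Sum>l<N. ennreal (p l) * H w l) * ennreal (1 / C))"
      by (simp add: distrib_left sum.distrib sum_distrib_right mult.assoc del: sum_ennreal)
    also have "(\<Sum>l<N. ennreal (p l)) = 1" using p p1 by (simp add: sum_ennreal)
    also have "(\<Sum>w\<in>I. 1 * ennreal (A + ln C) + (\<Sum>l<N. ennreal (p l) * H w l) * ennreal (1 / C))
      = ennreal (card I) * ennreal (A + ln C) + (\<Sum>w\<in>I. \<Sum>l<N. ennreal (p l) * H w l) * ennreal (1 / C)"
      by (simp add: sum.distrib ennreal_of_nat_eq_real_of_nat sum_distrib_right)
    also have "\<dots> \<le> ennreal (card I) * ennreal (A + ln C) + ennreal (card I * (4 * \<gamma>)) * ennreal (1 / C)"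
      by (intro add_left_mono mult_right_mono total_H) simp
    also have "\<dots> = ennreal (card I * (A + ln C) + card I * (4 * \<gamma>) * (1 / C))"
      using A C \<gamma> by (simp add: ennreal_mult'[symmetric] ennreal_plus[symmetric] del: ennreal_plus)
    also have "\<dots> \<le> ennreal ((A + ln C + 4) * card I)"
    proof (rule ennreal_leI)
      have "card I * (4 * \<gamma>) * (1 / C) = real (card I) * (4 * (\<gamma> / C))" by simp
      also have "\<dots> \<le> real (card I) * (4 * 1)"
        using \<gamma> by (intro mult_left_mono) (auto simp: C_def)
      finally show "card I * (A + ln C) + card I * (4 * \<gamma>) * (1 / C) \<le> (A + ln C + 4) * card I"
        by (simp add: algebra_simps)
    qed
    finally have uB: "(\<Sum>w\<in>I. \<integral>\<^sup>+z. u w z \<partial>lebesgue_seq n) \<le> ennreal ((A + ln C + 4) * card I)" .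
    have B: "0 \<le> A + ln C + 4" using A C by simp
    have Q: "(\<integral>\<^sup>+z. ennreal (output0 t z) \<partial>lebesgue_seq n) \<le> 1"
      by (rule WK.Z.Q0_le)
    note L = leakage_le[OF g R B qpos output0_measurable Q um u_ge[unfolded I_def] uB[unfolded I_def]]
    show "0 \<le> leakage g R' R n c" by (rule L(2))
    \<comment> \<open>The constant 9 consists of 4 from \<open>A\<close>, 4 from the collisions and
      1 from \<open>leakage_le\<close>.\<close>
    show "leakage g R' R n c \<le> (ln 8 + 4 * real n * \<eta> + (1 + S) / \<eta> + 9 + ln (1 + \<gamma>)) / ln 2"
      using L(1) by (simp add: A_def C_def algebra_simps)
  qed
qed

end


section \<open>Asymptotic rates\<close>

lemma two_powr_eq_exp: "2 powr (real n * x) = exp (real n * (x * ln 2))"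
  by (simp add: powr_def mult_ac)

lemma card_index_set_le: "real (card (index_set n R)) \<le> exp (real n * (R * ln 2))"
  unfolding index_set_def two_powr_eq_exp by simp

text \<open>Rounding down a number that is at least 1 loses less than a factor 2.\<close>

lemma card_index_set_ge:
  assumes "R \<ge> 0"
  shows "exp (real n * (R * ln 2)) \<le> 2 * real (card (index_set n R))"
proof -
  define y where "y = exp (real n * (R * ln 2))"
  have "1 \<le> y" using assms by (simp add: y_def)
  then have f: "1 \<le> \<lfloor>y\<rfloor>" by simp
  have "y < real_of_int \<lfloor>y\<rfloor> + 1" by linarith
  then have "y \<le> 2 * real_of_int \<lfloor>y\<rfloor>" using f by linarith
  then show ?thesis using f unfolding index_set_def two_powr_eq_exp y_def[symmetric] by simp
qed

lemma index_set_mono: "R \<le> R' \<Longrightarrow> index_set n R \<subseteq> index_set n R'"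
  unfolding index_set_def by (intro ivl_subset[THEN iffD2] disjI2 conjI nat_mono floor_mono powr_mono mult_left_mono atLeastatMost_subset_iff[THEN iffD2]) auto

text \<open>From 1 - p \<le> exp (- p). With p * K growing exponentially in n, covering failure
  becomes doubly exponentially small.\<close>

lemma failure_le:
  fixes p A B :: real
  assumes "0 \<le> p" "p \<le> 1" "B \<le> p * real K"
  shows "(1 - p) ^ K \<le> exp (- B)"
proof -
  have "(1 - p) ^ K \<le> exp (- p) ^ K"
    using assms exp_ge_add_one_self[of "- p"] by (intro power_mono) auto
  also have "\<dots> = exp (- (p * real K))" by (simp add: exp_of_nat_mult[symmetric] mult.commute)
  also have "\<dots> \<le> exp (- B)" using assms by simp
  finally show ?thesis .
qed

text \<open>The third bound exceeds I(X1;Y|X2) by \<open>I0\<close>: a competitor sharing the second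
  codeword shares its index k too, so being good with that codeword is an event of probability about
  exp(-n * I0) with no choice of k' to offset it. In the other two cases the sum over k' offsets
  this gain.\<close>

definition rate_gap :: "real \<Rightarrow> real \<Rightarrow> real \<Rightarrow> real \<Rightarrow> real \<Rightarrow> real \<Rightarrow> real \<Rightarrow> bool" where
  "rate_gap s1 s2 r R Ra Rb d \<longleftrightarrow>
     R * ln 2 + d \<le> 1/2 * ln (1 + gaussian_pair.S s1 s2 r) \<and>
     Rb * ln 2 + d \<le> 1/2 * ln (1 + gaussian_pair.\<tau> s1 s2 r) \<and>
     Ra * ln 2 + d \<le> 1/2 * ln (1 + gaussian_pair.\<tau>' s1 s2 r) + gaussian_pair.I0 s1 s2 r"

context gaussian_pair
begin

text \<open>K is about exp(n * I0) and \<open>D\<close> about exp(-n * I0), so a product K * D grows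
  only with the slack, and each union bound reduces to comparing a rate with its threshold.\<close>

lemma one_shot_bounds:
  fixes K N NA NB W :: nat and R Rl Ra Rb d :: real
  defines "\<alpha> \<equiv> real K * (real W * N * K * ((2 * D)\<^sup>2 / exp (real n * (1/2 * ln (1 + S) - \<kappa> * \<eta>)))
      + real NB * K * (2 * D\<^sup>2 / exp (real n * (1/2 * ln (1 + \<tau>) - \<kappa> * \<eta>)))
      + real NA * (2 * D\<^sup>2 / exp (real n * (1/2 * ln (1 + \<tau>') - \<kappa> * \<eta>))))"
  defines "\<gamma> \<equiv> (real K)\<^sup>2 * (2 * D)\<^sup>2"
  assumes K: "real K \<le> 2 * exp (real n * (I0 + \<kappa> * \<eta> + \<eta>))"
    and W: "real W * N \<le> exp (real n * (R * ln 2))"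
    and NA: "real NA \<le> exp (real n * (Ra * ln 2))" and NB: "real NB \<le> exp (real n * (Rb * ln 2))"
    and gap: "rate_gap s1 s2 r R Ra Rb d"
  shows "\<alpha> \<le> 448 * exp (real n * ((5 * \<kappa> + 2) * \<eta> - d))"
    and "ln (1 + \<gamma>) \<le> ln 65 + 2 * real n * ((2 * \<kappa> + 1) * \<eta>)"
proof -
  define k where "k = real n * \<kappa> * \<eta>"
  define e where "e = real n * \<eta>"
  define i where "i = real n * I0"
  have k: "0 \<le> k" using \<kappa>(4) \<eta> by (simp add: k_def)
  have e: "0 \<le> e" using \<eta> by (simp add: e_def)
  have K': "real K \<le> 2 * exp (i + k + e)" using K by (simp add: k_def e_def i_def algebra_simps)
  have D: "D = 2 * exp (k - i)" by (simp add: D_def k_def i_def algebra_simps)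
  have D0: "0 \<le> D" by (simp add: D)
  have KD: "real K * D \<le> 4 * exp (2 * k + e)"
  proof -
    have "real K * D \<le> (2 * exp (i + k + e)) * (2 * exp (k - i))"
      unfolding D using K' by (intro mult_right_mono) auto
    also have "\<dots> = 4 * exp ((i + k + e) + (k - i))" unfolding exp_add[of "i + k + e"] by simp
    finally show ?thesis by (simp add: algebra_simps)
  qed
  have KD2: "(real K * D)\<^sup>2 \<le> 16 * exp (4 * k + 2 * e)"
  proof -
    have "(real K * D)\<^sup>2 \<le> (4 * exp (2 * k + e))\<^sup>2" using KD D0 by (intro power_mono) auto
    also have "\<dots> = 16 * exp (4 * k + 2 * e)" by (simp add: power_mult_distrib exp_double[symmetric] algebra_simps)
    finally show ?thesis .
  qed
  \<comment> \<open>Here one factor \<open>D\<close> stays unmatched by a \<open>K\<close>; it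
    supplies the gain exp(-n * I0) for pairs sharing the second codeword.\<close>
  have KDD: "real K * D * D \<le> 8 * exp (3 * k + e - i)"
  proof -
    have "real K * D * D \<le> (4 * exp (2 * k + e)) * (2 * exp (k - i))"
      using KD D0 unfolding D[symmetric] by (intro mult_right_mono) auto
    also have "\<dots> = 8 * exp ((2 * k + e) + (k - i))" unfolding exp_add[of "2 * k + e"] by simp
    finally show ?thesis by (simp add: algebra_simps)
  qed
  have term_le: "X * Y / exp T \<le> c * exp (real n * ((5 * \<kappa> + 2) * \<eta> - d))"
    if "X \<le> c * exp x" "Y \<le> exp y" "0 \<le> Y" "0 \<le> c" "x + y - T \<le> 5 * k + 2 * e - real n * d" for X Y T c x y
  proof -
    have "X * Y / exp T \<le> (c * exp x) * exp y / exp T"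
      using that by (intro divide_right_mono mult_mono) auto
    also have "\<dots> = c * exp (x + y - T)" by (simp add: exp_add exp_diff)
    also have "\<dots> \<le> c * exp (5 * k + 2 * e - real n * d)" using that by (intro mult_left_mono) auto
    also have "5 * k + 2 * e - real n * d = real n * ((5 * \<kappa> + 2) * \<eta> - d)" by (simp add: k_def e_def algebra_simps)
    finally show ?thesis .
  qed
  have gaps: "real n * (R * ln 2) + real n * d \<le> real n * (1/2 * ln (1 + S))"
    "real n * (Rb * ln 2) + real n * d \<le> real n * (1/2 * ln (1 + \<tau>))"
    "real n * (Ra * ln 2) + real n * d \<le> real n * (1/2 * ln (1 + \<tau>')) + i"
  proof -
    have g: "R * ln 2 + d \<le> 1/2 * ln (1 + S)" "Rb * ln 2 + d \<le> 1/2 * ln (1 + \<tau>)"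
      "Ra * ln 2 + d \<le> 1/2 * ln (1 + \<tau>') + I0"
      using gap unfolding rate_gap_def by blast+
    show "real n * (R * ln 2) + real n * d \<le> real n * (1/2 * ln (1 + S))"
      "real n * (Rb * ln 2) + real n * d \<le> real n * (1/2 * ln (1 + \<tau>))"
      "real n * (Ra * ln 2) + real n * d \<le> real n * (1/2 * ln (1 + \<tau>')) + i"
      unfolding i_def distrib_left[symmetric] by (intro mult_left_mono g of_nat_0_le_iff)+
  qed
  have T: "real n * (L - \<kappa> * \<eta>) = real n * L - k" for L by (simp add: k_def algebra_simps)
  have "\<alpha> = 4 * ((real K * D)\<^sup>2 * (real W * N) / exp (real n * (1/2 * ln (1 + S)) - k))
      + 2 * ((real K * D)\<^sup>2 * real NB / exp (real n * (1/2 * ln (1 + \<tau>)) - k))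
      + 2 * (real K * D * D * real NA / exp (real n * (1/2 * ln (1 + \<tau>')) - k))"
    unfolding \<alpha>_def T by (simp add: power2_eq_square algebra_simps)
  also have "\<dots> \<le> 4 * (16 * exp (real n * ((5 * \<kappa> + 2) * \<eta> - d))) + 2 * (16 * exp (real n * ((5 * \<kappa> + 2) * \<eta> - d)))
      + 2 * (8 * exp (real n * ((5 * \<kappa> + 2) * \<eta> - d)))"
  proof (intro add_mono mult_left_mono)
    show "(real K * D)\<^sup>2 * (real W * N) / exp (real n * (1/2 * ln (1 + S)) - k) \<le> 16 * exp (real n * ((5 * \<kappa> + 2) * \<eta> - d))"
      by (rule term_le[OF KD2 W]) (use gaps(1) in \<open>auto simp: algebra_simps\<close>)
    show "(real K * D)\<^sup>2 * real NB / exp (real n * (1/2 * ln (1 + \<tau>)) - k) \<le> 16 * exp (real n * ((5 * \<kappa> + 2) * \<eta> - d))"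
      by (rule term_le[OF KD2 NB]) (use gaps(2) in \<open>auto simp: algebra_simps\<close>)
    show "real K * D * D * real NA / exp (real n * (1/2 * ln (1 + \<tau>')) - k) \<le> 8 * exp (real n * ((5 * \<kappa> + 2) * \<eta> - d))"
    proof (rule term_le[OF KDD NA])
      show "3 * k + e - i + real n * (Ra * ln 2) - (real n * (1/2 * ln (1 + \<tau>')) - k) \<le> 5 * k + 2 * e - real n * d"
        using gaps(3) k e by linarith
    qed auto
  qed auto
  also have "\<dots> \<le> 448 * exp (real n * ((5 * \<kappa> + 2) * \<eta> - d))" by simp
  finally show "\<alpha> \<le> 448 * exp (real n * ((5 * \<kappa> + 2) * \<eta> - d))" .
  have "\<gamma> = 4 * (real K * D)\<^sup>2" by (simp add: \<gamma>_def power_mult_distrib)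
  also have "\<dots> \<le> 64 * exp (4 * k + 2 * e)" using KD2 by simp
  finally have "1 + \<gamma> \<le> 1 + 64 * exp (4 * k + 2 * e)" by simp
  also have "\<dots> \<le> 65 * exp (4 * k + 2 * e)" using k e by simp
  finally have "ln (1 + \<gamma>) \<le> ln (65 * exp (4 * k + 2 * e))"
    by (subst ln_le_cancel_iff) (auto simp: \<gamma>_def add_pos_nonneg)
  also have "\<dots> = ln 65 + 2 * real n * ((2 * \<kappa> + 1) * \<eta>)"
    by (simp add: ln_mult k_def e_def algebra_simps)
  finally show "ln (1 + \<gamma>) \<le> ln 65 + 2 * real n * ((2 * \<kappa> + 1) * \<eta>)" .
qed

end


lemma eventually_le_of_tendsto_0:
  fixes f :: "nat \<Rightarrow> real"
  assumes "f \<longlonglongrightarrow> 0" "0 < c"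
  shows "\<forall>\<^sub>F n in sequentially. f n \<le> c"
  using order_tendstoD(2)[OF assms] by eventually_elim simp

text \<open>The slack \<eta> is fixed before n, whereas the message labels are quantified after it,
  so that they may depend on the blocklength. Both achievability schemes are instances with
  different labels.\<close>

theorem asymptotic_codes:
  fixes s1 s2 r g R R' Rl Ra Rb \<epsilon> d :: real
  assumes s: "s1 > 0" "s2 > 0" "r\<^sup>2 < s1 * s2" and g: "0 \<le> g" "g < 1"
    and R: "0 \<le> R" "0 \<le> Rl" "Rl \<le> R'"
    and leak: "1/2 * ln (1 + g * gaussian_pair.S s1 s2 r) \<le> Rl * ln 2"
    and gap: "rate_gap s1 s2 r (R + Rl) Ra Rb d" "d > 0" and \<epsilon>: "\<epsilon> > 0"
  obtains \<eta> where "0 < \<eta>" "\<eta> \<le> \<epsilon>"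
    "\<forall>\<^sub>F n in sequentially. \<forall>(cl :: nat \<Rightarrow> nat) a b NA NB. inj_on (\<lambda>w. (cl w, a w, b w)) (index_set n R) \<longrightarrow>
      (\<forall>w\<in>index_set n R. a w < NA \<and> b w < NB) \<longrightarrow>
      real NA \<le> exp (real n * (Ra * ln 2)) \<longrightarrow> real NB \<le> exp (real n * (Rb * ln 2)) \<longrightarrow>
      (\<exists>K x1 x2 sel dec. 0 < K \<and> real K \<le> exp (real n * (gaussian_pair.I0 s1 s2 r + \<epsilon>)) \<and>
        (\<forall>w\<in>index_set n R. \<forall>l<card (index_set n Rl). sel w l < K \<and>
          gaussian_pair.good n s1 s2 r \<eta> (x1 (cl w, l, a w)) (x2 (cl w, l, b w, sel w l))) \<and>
        dec \<in> seq_space n \<rightarrow>\<^sub>M count_space (index_set n R) \<and>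
        (\<forall>c. decoder c = dec \<and> (\<forall>w\<in>index_set n R. \<forall>m\<in>index_set n R'. \<forall>i<n.
            channel_input c w m i = x1 (cl w, m mod card (index_set n Rl), a w) i
              + x2 (cl w, m mod card (index_set n Rl), b w, sel w (m mod card (index_set n Rl))) i) \<longrightarrow>
          0 \<le> error_prob g R' R n c \<and> error_prob g R' R n c \<le> \<epsilon> \<and>
          0 \<le> leakage g R' R n c \<and> leakage g R' R n c \<le> \<epsilon> * real n))"
proof -
  define \<kappa> where "\<kappa> = gaussian_pair.\<kappa> s1 s2 r"
  define I0 where "I0 = gaussian_pair.I0 s1 s2 r"
  define S where "S = gaussian_pair.S s1 s2 r"
  define \<tau> where "\<tau> = gaussian_pair.\<tau> s1 s2 r"
  \<comment> \<open>Blocklength and slack 1 are placeholders; the facts taken from here concern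
    parameters that do not depend on them.\<close>
  interpret one: gaussian_pair 1 s1 s2 r 1
    using s by unfold_locales auto
  have \<kappa>: "\<kappa> \<ge> 5" using one.\<kappa>(4) by (simp add: \<kappa>_def)
  have \<tau>: "\<tau> > 0" using one.\<tau>(1) by (simp add: \<tau>_def)
  have I0: "I0 \<ge> 0"
  proof -
    have "\<tau> \<le> s2" using s by (simp add: \<tau>_def one.\<tau>_def)
    then show ?thesis using \<tau> by (simp add: I0_def one.I0_def \<tau>_def)
  qed
  have ln2: "(0::real) < ln 2" by simp
  \<comment> \<open>In turn the four terms give \<eta> \<le> \<epsilon>, a positive error exponent,
    leakage below \<epsilon> per channel use and K below exp (n * (I0 + \<epsilon>)); the factors 2
    leave a strict margin.\<close>
  define \<eta> where "\<eta> = min (min \<epsilon> (d / (2 * (5 * \<kappa> + 2)))) (min (\<epsilon> * ln 2 / (2 * (4 * \<kappa> + 6))) (\<epsilon> / (2 * (\<kappa> + 1))))"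
  have \<eta>: "0 < \<eta>" "\<eta> \<le> \<epsilon>"
    using \<epsilon> gap(2) \<kappa> ln2 by (auto simp: \<eta>_def)
  have e1: "(5 * \<kappa> + 2) * \<eta> < d"
  proof -
    have "(5 * \<kappa> + 2) * \<eta> \<le> (5 * \<kappa> + 2) * (d / (2 * (5 * \<kappa> + 2)))"
      using \<kappa> by (intro mult_left_mono) (auto simp: \<eta>_def)
    also have "\<dots> = d / 2" using \<kappa> by (simp add: field_simps)
    finally show ?thesis using gap(2) by linarith
  qed
  have e2: "(4 * \<kappa> + 6) * \<eta> < \<epsilon> * ln 2"
  proof -
    have "(4 * \<kappa> + 6) * \<eta> \<le> (4 * \<kappa> + 6) * (\<epsilon> * ln 2 / (2 * (4 * \<kappa> + 6)))"
      using \<kappa> by (intro mult_left_mono) (auto simp: \<eta>_def)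
    also have "\<dots> = \<epsilon> * ln 2 / 2" using \<kappa> by (simp add: field_simps)
    finally show ?thesis using mult_pos_pos[OF \<epsilon> ln2] by linarith
  qed
  have e3: "(\<kappa> + 1) * \<eta> < \<epsilon>"
  proof -
    have "(\<kappa> + 1) * \<eta> \<le> (\<kappa> + 1) * (\<epsilon> / (2 * (\<kappa> + 1)))"
      using \<kappa> by (intro mult_left_mono) (auto simp: \<eta>_def)
    also have "\<dots> = \<epsilon> / 2" using \<kappa> by (simp add: field_simps)
    finally show ?thesis using \<epsilon> by linarith
  qed
  define \<eta>0 where "\<eta>0 = gaussian_pair.\<eta>0 s1 r \<eta>"
  interpret one': gaussian_pair 1 s1 s2 r \<eta>
    using s \<eta> by unfold_locales auto
  have \<eta>0: "\<eta>0 > 0" using one'.\<eta>0(1) by (simp add: \<eta>0_def)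
  define x where "x = d - (5 * \<kappa> + 2) * \<eta>"
  define y where "y = \<epsilon> * ln 2 - (4 * \<kappa> + 6) * \<eta>"
  define z where "z = \<epsilon> - (\<kappa> + 1) * \<eta>"
  have pos: "x > 0" "y > 0" "z > 0" using e1 e2 e3 by (auto simp: x_def y_def z_def)
  have ev1: "\<forall>\<^sub>F n in sequentially. (2 * s1\<^sup>2 + 2 * \<tau>\<^sup>2 + \<tau> * (s1 + \<eta>0)) / (real n * \<eta>0\<^sup>2) \<le> 1/2"
  proof (rule eventually_le_of_tendsto_0)
    show "(\<lambda>n. (2 * s1\<^sup>2 + 2 * \<tau>\<^sup>2 + \<tau> * (s1 + \<eta>0)) / (real n * \<eta>0\<^sup>2)) \<longlonglongrightarrow> 0"
      using \<eta>0 by real_asymp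
  qed auto
  \<comment> \<open>The number of pairs (w, l) is exponential in n, the probability of a covering
    failure doubly exponentially small.\<close>
  have ev2: "\<forall>\<^sub>F n in sequentially. exp (real n * ((R + Rl) * ln 2) - exp (real n * \<eta>) / 2) \<le> 1/4"
  proof (rule eventually_le_of_tendsto_0)
    show "(\<lambda>n. exp (real n * ((R + Rl) * ln 2) - exp (real n * \<eta>) / 2)) \<longlonglongrightarrow> 0"
      using \<eta>(1) by real_asymp
  qed auto
  have ev3: "\<forall>\<^sub>F n in sequentially. (4 + s1 + s2 + 2 * \<eta>) / (real n * \<eta>\<^sup>2) + 4 * (448 * exp (real n * (- x))) \<le> \<epsilon>"
  proof (rule eventually_le_of_tendsto_0)
    show "(\<lambda>n. (4 + s1 + s2 + 2 * \<eta>) / (real n * \<eta>\<^sup>2) + 4 * (448 * exp (real n * (- x)))) \<longlonglongrightarrow> 0"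
      using \<eta>(1) pos(1) by real_asymp
  qed (use \<epsilon> in auto)
  have ev4: "\<forall>\<^sub>F n in sequentially. ln 8 + (1 + S) / \<eta> + 9 + ln 65 \<le> y * real n"
    using pos(2) by real_asymp
  have ev5: "\<forall>\<^sub>F n in sequentially. 2 \<le> exp (real n * z)"
    using pos(3) by real_asymp
  show thesis
  proof (rule that[OF \<eta>])
    show "\<forall>\<^sub>F n in sequentially. \<forall>(cl :: nat \<Rightarrow> nat) a b NA NB. inj_on (\<lambda>w. (cl w, a w, b w)) (index_set n R) \<longrightarrow>
      (\<forall>w\<in>index_set n R. a w < NA \<and> b w < NB) \<longrightarrow>
      real NA \<le> exp (real n * (Ra * ln 2)) \<longrightarrow> real NB \<le> exp (real n * (Rb * ln 2)) \<longrightarrow>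
      (\<exists>K x1 x2 sel dec. 0 < K \<and> real K \<le> exp (real n * (gaussian_pair.I0 s1 s2 r + \<epsilon>)) \<and>
        (\<forall>w\<in>index_set n R. \<forall>l<card (index_set n Rl). sel w l < K \<and>
          gaussian_pair.good n s1 s2 r \<eta> (x1 (cl w, l, a w)) (x2 (cl w, l, b w, sel w l))) \<and>
        dec \<in> seq_space n \<rightarrow>\<^sub>M count_space (index_set n R) \<and>
        (\<forall>c. decoder c = dec \<and> (\<forall>w\<in>index_set n R. \<forall>m\<in>index_set n R'. \<forall>i<n.
            channel_input c w m i = x1 (cl w, m mod card (index_set n Rl), a w) i
              + x2 (cl w, m mod card (index_set n Rl), b w, sel w (m mod card (index_set n Rl))) i) \<longrightarrow>
          0 \<le> error_prob g R' R n c \<and> error_prob g R' R n c \<le> \<epsilon> \<and>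
          0 \<le> leakage g R' R n c \<and> leakage g R' R n c \<le> \<epsilon> * real n))"
      using ev1 ev2 ev3 ev4 ev5 eventually_gt_at_top[of 0]
    proof eventually_elim
      case (elim n)
      note ev = elim
      interpret G: gaussian_pair n s1 s2 r \<eta>
        using s \<eta> ev(6) by unfold_locales auto
      show ?case
      proof (intro allI impI)
        fix cl a b :: "nat \<Rightarrow> nat" and NA NB :: nat
        assume inj: "inj_on (\<lambda>w. (cl w, a w, b w)) (index_set n R)"
          and ab: "\<forall>w\<in>index_set n R. a w < NA \<and> b w < NB"
          and NA: "real NA \<le> exp (real n * (Ra * ln 2))" and NB: "real NB \<le> exp (real n * (Rb * ln 2))"
        define N where "N = card (index_set n Rl)"
        define E where "E = exp (real n * (I0 + \<kappa> * \<eta> + \<eta>))"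
        \<comment> \<open>E exceeds the inverse success probability of one candidate by the factor
          exp (n * \<eta>), up to the constant 2; E \<ge> 1 keeps the ceiling below 2 * E.\<close>
        define K where "K = nat \<lceil>E\<rceil>"
        have "0 \<le> I0 + \<kappa> * \<eta> + \<eta>" using I0 \<kappa> \<eta> by simp
        then have E1: "1 \<le> E" by (simp add: E_def)
        have K: "0 < K" "E \<le> real K" "real K \<le> 2 * E"
          using E1 unfolding K_def by linarith+
        have N: "N > 0" "N \<le> card (index_set n R')" "exp (real n * (Rl * ln 2)) \<le> 2 * real N"
          using card_index_set_pos[OF R(2)] card_index_set_ge[OF R(2)] R(3)
          by (auto simp: N_def intro!: card_mono index_set_mono)
        have W: "real (card (index_set n R)) * real N \<le> exp (real n * ((R + Rl) * ln 2))"
        proof -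
          have "real (card (index_set n R)) * real N \<le> exp (real n * (R * ln 2)) * exp (real n * (Rl * ln 2))"
            unfolding N_def by (intro mult_mono card_index_set_le) auto
          then show ?thesis by (simp add: exp_add[symmetric] algebra_simps)
        qed
        define p where "p = exp (- real n * (I0 + \<kappa> * \<eta>)) / 2"
        have p: "0 \<le> p" "p \<le> 1"
        proof -
          have "0 \<le> real n * (I0 + \<kappa> * \<eta>)" using I0 \<kappa> \<eta> by simp
          then have "exp (- real n * (I0 + \<kappa> * \<eta>)) \<le> 1" by simp
          then show "p \<le> 1" unfolding p_def by linarith
        qed (simp add: p_def)
        have "exp (real n * \<eta>) / 2 = p * E"
          unfolding p_def E_def by (simp add: exp_add[symmetric] algebra_simps)
        also have "\<dots> \<le> p * real K" using p K by (intro mult_left_mono)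
        finally have "(1 - p) ^ K \<le> exp (- (exp (real n * \<eta>) / 2))" by (rule failure_le[OF p])
        then have "card (index_set n R) * N * (1 - p) ^ K \<le> exp (real n * ((R + Rl) * ln 2)) * exp (- (exp (real n * \<eta>) / 2))"
          using W p by (intro mult_mono) auto
        also have "\<dots> \<le> 1/4" using ev(2) by (simp add: exp_add[symmetric])
        finally have fail: "card (index_set n R) * N * (1 - p) ^ K \<le> 1/4" .
        have large: "G.large"
          unfolding G.large_def using ev(1) by (simp add: \<tau>_def \<eta>0_def)
        have R': "0 \<le> R'" using R by simp
        have K': "real K \<le> 2 * exp (real n * (gaussian_pair.I0 s1 s2 r + gaussian_pair.\<kappa> s1 s2 r * \<eta> + \<eta>))"
          using K(3) by (simp add: E_def I0_def \<kappa>_def)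
        note bounds = G.one_shot_bounds[OF K' W NA NB gap(1)]
        obtain x1 x2 sel dec where code:
          "\<forall>w\<in>index_set n R. \<forall>l<N. sel w l < K \<and> G.good (x1 (cl w, l, a w)) (x2 (cl w, l, b w, sel w l))"
          "dec \<in> seq_space n \<rightarrow>\<^sub>M count_space (index_set n R)"
          "\<And>c. decoder c = dec \<and> (\<forall>w\<in>index_set n R. \<forall>m\<in>index_set n R'. \<forall>i<n.
            channel_input c w m i = x1 (cl w, m mod N, a w) i + x2 (cl w, m mod N, b w, sel w (m mod N)) i) \<Longrightarrow>
          0 \<le> error_prob g R' R n c \<and> error_prob g R' R n c \<le> (4 + s1 + s2 + 2 * \<eta>) / (real n * \<eta>\<^sup>2) + 4 * (448 * exp (real n * (- x))) \<and>
          0 \<le> leakage g R' R n c \<and>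
          leakage g R' R n c \<le> (ln 8 + 4 * real n * \<eta> + (1 + S) / \<eta> + 9 + (ln 65 + 2 * real n * ((2 * \<kappa> + 1) * \<eta>))) / ln 2"
        proof -
          have leak': "1/2 * ln (1 + g * gaussian_pair.S s1 s2 r) \<le> Rl * ln 2" by (rule leak)
          have fail': "card (index_set n R) * N * (1 - exp (- real n * (G.I0 + G.\<kappa> * \<eta>)) / 2) ^ K \<le> 1/4"
            using fail unfolding p_def I0_def \<kappa>_def .
          note CE = G.code_exists[OF large g R(1) R' inj ab N leak' K(1) fail']
          from CE show thesis
          proof (elim exE conjE, goal_cases)
            case (1 x1 x2 sel dec)
            show thesis
            proof (rule that[OF 1(1,2)])
              fix c assume c: "decoder c = dec \<and> (\<forall>w\<in>index_set n R. \<forall>m\<in>index_set n R'. \<forall>i<n.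
                channel_input c w m i = x1 (cl w, m mod N, a w) i + x2 (cl w, m mod N, b w, sel w (m mod N)) i)"
              note e = 1(3)[rule_format, OF c]
              have "error_prob g R' R n c \<le> (4 + s1 + s2 + 2 * \<eta>) / (real n * \<eta>\<^sup>2) + 4 * (448 * exp (real n * (- x)))"
                using e bounds(1) unfolding x_def \<kappa>_def by simp
              moreover have "leakage g R' R n c \<le> (ln 8 + 4 * real n * \<eta> + (1 + S) / \<eta> + 9
                + (ln 65 + 2 * real n * ((2 * \<kappa> + 1) * \<eta>))) / ln 2"
              proof -
                have "leakage g R' R n c \<le> (ln 8 + 4 * real n * \<eta> + (1 + G.S) / \<eta> + 9 + ln (1 + (real K)\<^sup>2 * (2 * G.D)\<^sup>2)) / ln 2"
                  using e by blast
                also have "\<dots> \<le> (ln 8 + 4 * real n * \<eta> + (1 + S) / \<eta> + 9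
                  + (ln 65 + 2 * real n * ((2 * \<kappa> + 1) * \<eta>))) / ln 2"
                  unfolding S_def \<kappa>_def by (intro divide_right_mono add_left_mono bounds(2)) simp
                finally show ?thesis .
              qed
              ultimately show "0 \<le> error_prob g R' R n c \<and> error_prob g R' R n c \<le> (4 + s1 + s2 + 2 * \<eta>) / (real n * \<eta>\<^sup>2) + 4 * (448 * exp (real n * (- x))) \<and>
                0 \<le> leakage g R' R n c \<and>
                leakage g R' R n c \<le> (ln 8 + 4 * real n * \<eta> + (1 + S) / \<eta> + 9 + (ln 65 + 2 * real n * ((2 * \<kappa> + 1) * \<eta>))) / ln 2"
                using e by blast
            qed
          qed
        qed
        have "real K \<le> exp (real n * z) * E" using K(3) ev(5) E1 by (elim order_trans) (intro mult_right_mono, auto)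
        also have "\<dots> = exp (real n * (I0 + \<epsilon>))"
          unfolding E_def z_def by (simp add: exp_add[symmetric] algebra_simps)
        finally have Kle: "real K \<le> exp (real n * (gaussian_pair.I0 s1 s2 r + \<epsilon>))" by (simp add: I0_def)
        have lk: "(ln 8 + 4 * real n * \<eta> + (1 + S) / \<eta> + 9 + (ln 65 + 2 * real n * ((2 * \<kappa> + 1) * \<eta>))) / ln 2 \<le> \<epsilon> * real n"
        proof -
          have "ln 8 + 4 * real n * \<eta> + (1 + S) / \<eta> + 9 + (ln 65 + 2 * real n * ((2 * \<kappa> + 1) * \<eta>))
            = (ln 8 + (1 + S) / \<eta> + 9 + ln 65) + real n * ((4 * \<kappa> + 6) * \<eta>)" by (simp add: algebra_simps)
          also have "\<dots> \<le> y * real n + real n * ((4 * \<kappa> + 6) * \<eta>)" using ev(4) by simp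
          also have "\<dots> = (\<epsilon> * real n) * ln 2" by (simp add: y_def algebra_simps)
          finally show ?thesis using ln2 by (simp add: pos_divide_le_eq)
        qed
        show "\<exists>K x1 x2 sel dec. 0 < K \<and> real K \<le> exp (real n * (gaussian_pair.I0 s1 s2 r + \<epsilon>)) \<and>
        (\<forall>w\<in>index_set n R. \<forall>l<card (index_set n Rl). sel w l < K \<and>
          G.good (x1 (cl w, l, a w)) (x2 (cl w, l, b w, sel w l))) \<and>
        dec \<in> seq_space n \<rightarrow>\<^sub>M count_space (index_set n R) \<and>
        (\<forall>c. decoder c = dec \<and> (\<forall>w\<in>index_set n R. \<forall>m\<in>index_set n R'. \<forall>i<n.
            channel_input c w m i = x1 (cl w, m mod card (index_set n Rl), a w) i
              + x2 (cl w, m mod card (index_set n Rl), b w, sel w (m mod card (index_set n Rl))) i) \<longrightarrow>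
          0 \<le> error_prob g R' R n c \<and> error_prob g R' R n c \<le> \<epsilon> \<and>
          0 \<le> leakage g R' R n c \<and> leakage g R' R n c \<le> \<epsilon> * real n)"
          unfolding N_def[symmetric]
        proof (rule exI[of _ K], rule exI[of _ x1], rule exI[of _ x2], rule exI[of _ sel], rule exI[of _ dec], safe)
          show "0 < K" by (rule K(1))
          show "real K \<le> exp (real n * (gaussian_pair.I0 s1 s2 r + \<epsilon>))" by (rule Kle)
          show "sel w l < K" "G.good (x1 (cl w, l, a w)) (x2 (cl w, l, b w, sel w l))"
            if "w \<in> index_set n R" "l < N" for w l using code(1) that by auto
          show "dec \<in> seq_space n \<rightarrow>\<^sub>M count_space (index_set n R)" by (rule code(2))
          fix c assume "\<forall>w\<in>index_set n R. \<forall>m\<in>index_set n R'. \<forall>i<n.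
              channel_input c w m i = x1 (cl w, m mod N, a w) i + x2 (cl w, m mod N, b w, sel w (m mod N)) i"
            and "dec = decoder c"
          then have *: "0 \<le> error_prob g R' R n c \<and> error_prob g R' R n c \<le> \<epsilon> \<and> 0 \<le> leakage g R' R n c \<and> leakage g R' R n c \<le> \<epsilon> * real n"
            using code(3)[of c] ev(3) lk by auto
          show "0 \<le> error_prob g R' R n c" "error_prob g R' R n c \<le> \<epsilon>"
            "0 \<le> leakage g R' R n c" "leakage g R' R n c \<le> \<epsilon> * real n"
            using * by auto
        qed
      qed
    qed
  qed
qed


section \<open>Achievable secrecy rates\<close>

definition code_within :: "real \<Rightarrow> real \<Rightarrow> real \<Rightarrow> real \<Rightarrow> real \<Rightarrow> real \<Rightarrow> real \<Rightarrow> nat \<Rightarrow> real \<Rightarrow> secrecy_code \<Rightarrow> bool" where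
  "code_within P1 P2 C1 C2 g R' R n \<epsilon> c \<longleftrightarrow> is_secrecy_code P1 P2 C1 C2 R' R n c \<and>
     0 \<le> error_prob g R' R n c \<and> error_prob g R' R n c \<le> \<epsilon> \<and>
     0 \<le> leakage g R' R n c \<and> leakage g R' R n c \<le> \<epsilon> * real n"

lemma code_within_mono:
  "code_within P1 P2 C1 C2 g R' R n \<epsilon> c \<Longrightarrow> \<epsilon> \<le> \<epsilon>' \<Longrightarrow> code_within P1 P2 C1 C2 g R' R n \<epsilon>' c"
  unfolding code_within_def using mult_right_mono[of \<epsilon> \<epsilon>' "real n"] by auto

text \<open>Fills the blocklengths at which no good code is known, since a valid code is demanded
  for every n \<ge> 1.\<close>

definition silent_code :: secrecy_code where
  "silent_code = \<lparr>source_enc = \<lambda>_ _. (1, 1), relay_enc1 = \<lambda>_ _ _. 0, relay_enc2 = \<lambda>_ _ _. 0, decoder = \<lambda>_. 1\<rparr>"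

lemma power_constraint_zero: "0 \<le> P \<Longrightarrow> power_constraint n P (\<lambda>_. 0)"
  by (simp add: power_constraint_def)

lemma silent_code_valid:
  assumes "0 \<le> P1" "0 \<le> P2" "0 \<le> C1" "0 \<le> C2" "0 \<le> R"
  shows "is_secrecy_code P1 P2 C1 C2 R' R n silent_code"
  using assms index_set_nonempty power_constraint_zero
  by (auto simp: is_secrecy_code_def silent_code_def)

text \<open>Diagonal argument: \<open>k n\<close> is the best precision \<open>1/k\<close> that blocklength \<open>n\<close> certifies among \<open>k \<le> n\<close>.\<close>

lemma achievable_of_eventually:
  assumes nonneg: "0 \<le> P1" "0 \<le> P2" "0 \<le> C1" "0 \<le> C2" "0 \<le> R"
    and ev: "\<And>\<epsilon>. \<epsilon> > 0 \<Longrightarrow> \<forall>\<^sub>F n in sequentially. \<exists>c. code_within P1 P2 C1 C2 g R' R n \<epsilon> c"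
  shows "achievable_secrecy_rate P1 P2 C1 C2 g R' R"
proof -
  let ?ok = "\<lambda>n \<epsilon> c. code_within P1 P2 C1 C2 g R' R n \<epsilon> c"
  define good where "good n = {j. j \<le> n \<and> (\<exists>c. ?ok n (1 / real (Suc j)) c)}" for n
  define c where "c n = (if good n = {} then silent_code else SOME c. ?ok n (1 / real (Suc (Max (good n)))) c)" for n
  have fin: "finite (good n)" for n by (rule finite_subset[of _ "{..n}"]) (auto simp: good_def)
  have c: "?ok n (1 / real (Suc (Max (good n)))) (c n)" if "good n \<noteq> {}" for n
  proof -
    have "Max (good n) \<in> good n" using fin that by (rule Max_in)
    then have "\<exists>c. ?ok n (1 / real (Suc (Max (good n)))) c" by (simp add: good_def)
    then have "?ok n (1 / real (Suc (Max (good n)))) (SOME c. ?ok n (1 / real (Suc (Max (good n)))) c)" by (rule someI_ex)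
    then show ?thesis using that by (simp add: c_def)
  qed
  have valid: "is_secrecy_code P1 P2 C1 C2 R' R n (c n)" for n
    using c[of n] silent_code_valid[OF nonneg] by (cases "good n = {}") (auto simp: code_within_def c_def)
  \<comment> \<open>Once n \<ge> j and blocklength n admits precision 1 / (j + 1), the maximum of
    \<open>good n\<close> is at least j.\<close>
  have close: "\<forall>\<^sub>F n in sequentially. ?ok n \<epsilon> (c n)" if \<epsilon>: "\<epsilon> > 0" for \<epsilon>
  proof -
    obtain j where j: "1 / real (Suc j) < \<epsilon>" using nat_approx_posE[OF \<epsilon>] by blast
    have "\<forall>\<^sub>F n in sequentially. \<exists>c. ?ok n (1 / real (Suc j)) c" by (rule ev) simp
    then show ?thesis using eventually_ge_at_top[of j]
    proof eventually_elim
      case (elim n)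
      then have jg: "j \<in> good n" by (simp add: good_def)
      then have "j \<le> Max (good n)" using fin by (intro Max_ge)
      then have "1 / real (Suc (Max (good n))) \<le> 1 / real (Suc j)" by (intro divide_left_mono) auto
      with j have "1 / real (Suc (Max (good n))) \<le> \<epsilon>" by linarith
      with c[of n] jg show ?case by (auto intro: code_within_mono)
    qed
  qed
  have err: "(\<lambda>n. error_prob g R' R n (c n)) \<longlonglongrightarrow> 0"
  proof (rule LIMSEQ_I)
    fix \<epsilon> :: real assume "0 < \<epsilon>"
    then have "\<forall>\<^sub>F n in sequentially. ?ok n (\<epsilon> / 2) (c n)" by (intro close) simp
    then have "\<forall>\<^sub>F n in sequentially. norm (error_prob g R' R n (c n) - 0) < \<epsilon>"
      by eventually_elim (use \<open>0 < \<epsilon>\<close> in \<open>auto simp: code_within_def\<close>)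
    then show "\<exists>no. \<forall>n\<ge>no. norm (error_prob g R' R n (c n) - 0) < \<epsilon>"
      by (simp add: eventually_sequentially)
  qed
  have leak: "(\<lambda>n. (1 / real n) * leakage g R' R n (c n)) \<longlonglongrightarrow> 0"
  proof (rule LIMSEQ_I)
    fix \<epsilon> :: real assume "0 < \<epsilon>"
    then have "\<forall>\<^sub>F n in sequentially. ?ok n (\<epsilon> / 2) (c n)" by (intro close) simp
    then have "\<forall>\<^sub>F n in sequentially. norm ((1 / real n) * leakage g R' R n (c n) - 0) < \<epsilon>"
      using eventually_gt_at_top[of 0]
    proof eventually_elim
      case (elim n)
      then have "(1 / real n) * leakage g R' R n (c n) \<le> (1 / real n) * (\<epsilon> / 2 * real n)"
        by (intro mult_left_mono) (auto simp: code_within_def)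
      also have "\<dots> = \<epsilon> / 2" using elim by simp
      also have "\<dots> < \<epsilon>" using \<open>0 < \<epsilon>\<close> by simp
      finally show ?case using elim by (simp add: code_within_def)
    qed
    then show "\<exists>no. \<forall>n\<ge>no. norm ((1 / real n) * leakage g R' R n (c n) - 0) < \<epsilon>"
      by (simp add: eventually_sequentially)
  qed
  show ?thesis
    unfolding achievable_secrecy_rate_def using nonneg(5) valid err leak by blast
qed

text \<open>At rate 0 there is a single message, so silence never errs. This makes the capacity
  nonnegative and settles rate bounds that are not positive.\<close>

lemma achievable_zero:
  assumes "0 \<le> P1" "0 \<le> P2" "0 \<le> C1" "0 \<le> C2" "0 \<le> g" "g < 1" "0 \<le> R'"
  shows "achievable_secrecy_rate P1 P2 C1 C2 g R' 0"
proof (rule achievable_of_eventually)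
  have I: "index_set n 0 = {1}" for n by (simp add: index_set_def)
  fix \<epsilon> :: real assume "\<epsilon> > 0"
  then have "\<forall>\<^sub>F n in sequentially. 1 / ln 2 \<le> \<epsilon> * real n" by real_asymp
  then show "\<forall>\<^sub>F n in sequentially. \<exists>c. code_within P1 P2 C1 C2 g R' 0 n \<epsilon> c"
  proof eventually_elim
    case (elim n)
    have valid: "is_secrecy_code P1 P2 C1 C2 R' 0 n silent_code"
      using assms by (intro silent_code_valid) auto
    then have dec: "decoder silent_code \<in> seq_space n \<rightarrow>\<^sub>M count_space (index_set n 0)"
      by (simp add: is_secrecy_code_def)
    have "(\<Sum>w\<in>index_set n 0. \<Sum>m\<in>index_set n R'. \<integral>\<^sup>+y. ennreal (gauss n 1 (channel_input silent_code w m) y)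
      * indicator {y. decoder silent_code y \<noteq> w} y \<partial>lebesgue_seq n)
      \<le> ennreal ((0::real) * (card (index_set n 0) * card (index_set n R')))"
      by (simp add: I silent_code_def)
    from error_prob_le[OF assms(5,6) order_refl assms(7) order_refl dec this]
    have err: "error_prob g R' 0 n silent_code \<le> 0" "0 \<le> error_prob g R' 0 n silent_code" by auto
    have inp: "channel_input silent_code w m = (\<lambda>_. 0)" for w m
      by (auto simp: channel_input_def silent_code_def)
    have dens: "eve_density g R' n silent_code w = gauss n 1 (\<lambda>_. 0)" for w
      using index_set_nonempty[OF assms(7), of n] by (intro ext) (auto simp: eve_density_def inp)
    \<comment> \<open>The conditional output law is the reference density itself, so the log ratio
      vanishes and only the constant of \<open>leakage_le\<close> remains.\<close>
    have leak: "leakage g R' 0 n silent_code \<le> (0 + 1) / ln 2" "0 \<le> leakage g R' 0 n silent_code"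
      by (rule leakage_le[where q="gauss n 1 (\<lambda>_. 0)" and u="\<lambda>_ _. 0"]; (use assms in \<open>simp add: dens gauss_pos less_imp_neq[OF gauss_pos, symmetric]\<close>)?)+
    show ?case
      using valid err leak elim \<open>\<epsilon> > 0\<close> by (intro exI[of _ silent_code]) (auto simp: code_within_def)
  qed
qed (use assms in auto)

definition swap_code :: "secrecy_code \<Rightarrow> secrecy_code" where
  "swap_code c = \<lparr>source_enc = \<lambda>w m. prod.swap (source_enc c w m), relay_enc1 = relay_enc2 c,
     relay_enc2 = relay_enc1 c, decoder = decoder c\<rparr>"

lemma swap_code_valid:
  "is_secrecy_code P1 P2 C1 C2 R' R n c \<Longrightarrow> is_secrecy_code P2 P1 C2 C1 R' R n (swap_code c)"
  by (auto simp: is_secrecy_code_def swap_code_def mem_Times_iff)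

lemma dest_output_swap: "dest_output n (swap_code c) = dest_output n c"
  by (auto simp: dest_output_def swap_code_def add.commute)

lemma eve_output_swap: "eve_output g n (swap_code c) = eve_output g n c"
  by (auto simp: eve_output_def dest_output_swap)

text \<open>Exchanging the relays changes neither output. This allows the Marton index to travel on
  whichever link has room for it.\<close>

lemma achievable_swap:
  assumes "achievable_secrecy_rate P1 P2 C1 C2 g R' R"
  shows "achievable_secrecy_rate P2 P1 C2 C1 g R' R"
proof -
  obtain c where c: "0 \<le> R" "\<And>n. n \<ge> 1 \<Longrightarrow> is_secrecy_code P1 P2 C1 C2 R' R n (c n)"
    "(\<lambda>n. error_prob g R' R n (c n)) \<longlonglongrightarrow> 0" "(\<lambda>n. (1 / real n) * leakage g R' R n (c n)) \<longlonglongrightarrow> 0"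
    using assms unfolding achievable_secrecy_rate_def by blast
  have "error_prob g R' R n (swap_code c) = error_prob g R' R n c" "leakage g R' R n (swap_code c) = leakage g R' R n c" for n c
    by (simp_all add: error_prob_def leakage_def dest_output_swap eve_output_swap) (simp add: swap_code_def)
  then show ?thesis
    unfolding achievable_secrecy_rate_def using c swap_code_valid
    by (intro conjI exI[of _ "\<lambda>n. swap_code (c n)"]) auto
qed

text \<open>Codewords that the encoders never select may violate the power constraint; they are replaced by zero.\<close>

definition truncate :: "nat \<Rightarrow> real \<Rightarrow> (nat \<Rightarrow> real) \<Rightarrow> nat \<Rightarrow> real" where
  "truncate n P x = (if power_constraint n P x then x else (\<lambda>_. 0))"

lemma power_constraint_truncate: "0 \<le> P \<Longrightarrow> power_constraint n P (truncate n P x)"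
  by (simp add: truncate_def power_constraint_zero)

lemma truncate_id: "n > 0 \<Longrightarrow> sq_sum n x \<le> real n * P \<Longrightarrow> truncate n P x = x"
  by (simp add: truncate_def power_constraint_def sq_sum_def field_simps)

text \<open>Each relay receives all of W and knows M, hence computes the whole sum codeword and
  sends its share. With \<open>cl\<close> the identity no two messages share a codeword, so the
  label rates are 0. The two layers of the general codebook are taken independent, with power S / 2
  each, and only their sum is transmitted.\<close>

lemma achievable_coherent:
  assumes P: "0 < P1" "0 < P2" and g: "0 \<le> g" "g < 1"
    and S: "0 < S" "S < (sqrt P1 + sqrt P2)\<^sup>2"
    and R: "0 \<le> R" "R \<le> C1" "R \<le> C2" and Rl: "0 \<le> Rl" "Rl \<le> R'"
    and leak: "1/2 * ln (1 + g * S) \<le> Rl * ln 2" and rate: "(R + Rl) * ln 2 < 1/2 * ln (1 + S)"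
  shows "achievable_secrecy_rate P1 P2 C1 C2 g R' R"
proof (rule achievable_of_eventually)
  define s where "s = S / 2"
  have s: "s > 0" "0\<^sup>2 < s * s" using S by (auto simp: s_def)
  interpret one: gaussian_pair 1 s s 0 1
    using s by unfold_locales auto
  have par: "one.S = S" "one.\<tau> = s" "one.\<tau>' = s" "one.I0 = 0"
    unfolding one.S_def one.\<tau>_def one.\<tau>'_def one.I0_def using s by (simp_all add: s_def)
  define d where "d = min (1/2 * ln (1 + S) - (R + Rl) * ln 2) (1/2 * ln (1 + s))"
  have d: "d > 0" using rate s by (simp add: d_def)
  have gap: "rate_gap s s 0 (R + Rl) 0 0 d"
  proof -
    have "d \<le> 1/2 * ln (1 + S) - (R + Rl) * ln 2" "d \<le> 1/2 * ln (1 + s)"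
      unfolding d_def by (rule min.cobounded1, rule min.cobounded2)
    then show ?thesis unfolding rate_gap_def par by simp
  qed
  \<comment> \<open>The amplitude share of relay 1: a sum codeword of power (sqrt P1 + sqrt P2)^2 is
    split into powers P1 and P2 exactly.\<close>
  define \<alpha> where "\<alpha> = sqrt P1 / (sqrt P1 + sqrt P2)"
  have sum_pos: "sqrt P1 + sqrt P2 > 0" using P by (simp add: add_pos_pos)
  have \<alpha>: "\<alpha>\<^sup>2 * (sqrt P1 + sqrt P2)\<^sup>2 = P1" "(1 - \<alpha>)\<^sup>2 * (sqrt P1 + sqrt P2)\<^sup>2 = P2"
  proof -
    have "\<alpha> * (sqrt P1 + sqrt P2) = sqrt P1" "(1 - \<alpha>) * (sqrt P1 + sqrt P2) = sqrt P2"
      using sum_pos by (simp_all add: \<alpha>_def field_simps)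
    then show "\<alpha>\<^sup>2 * (sqrt P1 + sqrt P2)\<^sup>2 = P1" "(1 - \<alpha>)\<^sup>2 * (sqrt P1 + sqrt P2)\<^sup>2 = P2"
      using P by (simp_all flip: power_mult_distrib)
  qed
  fix \<epsilon> :: real assume "\<epsilon> > 0"
  \<comment> \<open>The sum of a good pair has energy at most n * (S + 4 * \<eta>), and \<eta> will
    be at most \<epsilon>'.\<close>
  define \<epsilon>' where "\<epsilon>' = min \<epsilon> (((sqrt P1 + sqrt P2)\<^sup>2 - S) / 4)"
  have \<epsilon>': "\<epsilon>' > 0" "\<epsilon>' \<le> \<epsilon>" using \<open>\<epsilon> > 0\<close> S by (auto simp: \<epsilon>'_def)
  from asymptotic_codes[OF s(1) s(1) s(2) g R(1) Rl _ gap d \<epsilon>'(1), unfolded par, OF leak]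
  obtain \<eta> where \<eta>: "0 < \<eta>" "\<eta> \<le> \<epsilon>'" and
    ev: "\<forall>\<^sub>F n in sequentially. \<forall>(cl :: nat \<Rightarrow> nat) a b NA NB. inj_on (\<lambda>w. (cl w, a w, b w)) (index_set n R) \<longrightarrow>
      (\<forall>w\<in>index_set n R. a w < NA \<and> b w < NB) \<longrightarrow>
      real NA \<le> exp (real n * (0 * ln 2)) \<longrightarrow> real NB \<le> exp (real n * (0 * ln 2)) \<longrightarrow>
      (\<exists>K x1 x2 sel dec. 0 < K \<and> real K \<le> exp (real n * (0 + \<epsilon>')) \<and>
        (\<forall>w\<in>index_set n R. \<forall>l<card (index_set n Rl). sel w l < K \<and>
          gaussian_pair.good n s s 0 \<eta> (x1 (cl w, l, a w)) (x2 (cl w, l, b w, sel w l))) \<and>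
        dec \<in> seq_space n \<rightarrow>\<^sub>M count_space (index_set n R) \<and>
        (\<forall>c. decoder c = dec \<and> (\<forall>w\<in>index_set n R. \<forall>m\<in>index_set n R'. \<forall>i<n.
            channel_input c w m i = x1 (cl w, m mod card (index_set n Rl), a w) i
              + x2 (cl w, m mod card (index_set n Rl), b w, sel w (m mod card (index_set n Rl))) i) \<longrightarrow>
          0 \<le> error_prob g R' R n c \<and> error_prob g R' R n c \<le> \<epsilon>' \<and>
          0 \<le> leakage g R' R n c \<and> leakage g R' R n c \<le> \<epsilon>' * real n))" by blast
  show "\<forall>\<^sub>F n in sequentially. \<exists>c. code_within P1 P2 C1 C2 g R' R n \<epsilon> c"
    using ev eventually_gt_at_top[of 0]
  proof eventually_elim
    case (elim n)
    interpret G: gaussian_pair n s s 0 \<eta>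
      using s \<eta> elim(2) by unfold_locales auto
    define N where "N = card (index_set n Rl)"
    have N: "N > 0" unfolding N_def using Rl by (intro card_index_set_pos)
    obtain x1 x2 sel dec where
      good: "\<And>w l. w \<in> index_set n R \<Longrightarrow> l < N \<Longrightarrow> G.good (x1 (w, l, 0::nat)) (x2 (w, l, 0::nat, sel w l :: nat))"
      and dec: "dec \<in> seq_space n \<rightarrow>\<^sub>M count_space (index_set n R)"
      and code: "\<And>c. decoder c = dec \<Longrightarrow> (\<And>w m i. w \<in> index_set n R \<Longrightarrow> m \<in> index_set n R' \<Longrightarrow> i < n \<Longrightarrow>
            channel_input c w m i = x1 (w, m mod N, 0) i + x2 (w, m mod N, 0, sel w (m mod N)) i) \<Longrightarrow>
          0 \<le> error_prob g R' R n c \<and> error_prob g R' R n c \<le> \<epsilon>' \<and>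
          0 \<le> leakage g R' R n c \<and> leakage g R' R n c \<le> \<epsilon>' * real n"
    proof -
      have inj: "inj_on (\<lambda>w. (w, 0::nat, 0::nat)) (index_set n R)"
        and ab: "\<forall>w\<in>index_set n R. (0::nat) < 1 \<and> (0::nat) < 1"
        and one: "real 1 \<le> exp (real n * (0 * ln 2))"
        by (auto simp: inj_on_def)
      from elim(1)[THEN spec[of _ "\<lambda>w. w"], THEN spec[of _ "\<lambda>_. 0"], THEN spec[of _ "\<lambda>_. 0"], THEN spec[of _ 1], THEN spec[of _ 1],
          THEN mp, OF inj, THEN mp, OF ab, THEN mp, OF one, THEN mp, OF one, folded N_def]
      show thesis
      proof (elim exE conjE, goal_cases)
        case (1 K x1 x2 sel dec)
        show thesis
        proof (rule that[where ?x1.0 = x1 and ?x2.0 = x2 and sel = sel and dec = dec, OF _ 1(4)])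
          show "G.good (x1 (w, l, 0)) (x2 (w, l, 0, sel w l))" if "w \<in> index_set n R" "l < N" for w l
            using 1(3) that by blast
          fix c assume "decoder c = dec" and "\<And>w m i. w \<in> index_set n R \<Longrightarrow> m \<in> index_set n R' \<Longrightarrow> i < n \<Longrightarrow>
            channel_input c w m i = x1 (w, m mod N, 0) i + x2 (w, m mod N, 0, sel w (m mod N)) i"
          then show "0 \<le> error_prob g R' R n c \<and> error_prob g R' R n c \<le> \<epsilon>' \<and>
            0 \<le> leakage g R' R n c \<and> leakage g R' R n c \<le> \<epsilon>' * real n"
            using 1(5)[THEN spec[of _ c], THEN mp] by blast
        qed
      qed
    qed
    define x where "x w m i = x1 (w, m mod N, 0) i + x2 (w, m mod N, 0, sel w (m mod N)) i" for w m i
    have sq: "sq_sum n (x w m) \<le> real n * (sqrt P1 + sqrt P2)\<^sup>2" if "w \<in> index_set n R" for w m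
    proof -
      have "G.good (x1 (w, m mod N, 0)) (x2 (w, m mod N, 0, sel w (m mod N)))"
        using N by (intro good that) simp
      moreover have "real n * S = 2 * (real n * s)" by (simp add: s_def)
      ultimately have "sq_sum n (x w m) \<le> real n * S + 4 * (real n * \<eta>)"
        unfolding G.good_def x_def[abs_def] sq_sum_add abs_le_iff \<open>real n * S = 2 * (real n * s)\<close> by linarith
      also have "\<dots> = real n * (S + 4 * \<eta>)" by (simp add: algebra_simps)
      also have "\<dots> \<le> real n * (sqrt P1 + sqrt P2)\<^sup>2"
        using \<eta>(2) by (intro mult_left_mono) (auto simp: \<epsilon>'_def)
      finally show ?thesis .
    qed
    \<comment> \<open>The index \<open>sel\<close> is not transmitted: it is a function of (w, m),
      which both relays know.\<close>
    define c where "c = \<lparr>source_enc = \<lambda>w m. (w, w),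
      relay_enc1 = \<lambda>w m. truncate n P1 (\<lambda>i. \<alpha> * x w m i),
      relay_enc2 = \<lambda>w m. truncate n P2 (\<lambda>i. (1 - \<alpha>) * x w m i), decoder = dec\<rparr>"
    have tr: "truncate n P1 (\<lambda>i. \<alpha> * x w m i) = (\<lambda>i. \<alpha> * x w m i)"
      "truncate n P2 (\<lambda>i. (1 - \<alpha>) * x w m i) = (\<lambda>i. (1 - \<alpha>) * x w m i)" if "w \<in> index_set n R" for w m
    proof -
      have "b\<^sup>2 * sq_sum n (x w m) \<le> real n * (b\<^sup>2 * (sqrt P1 + sqrt P2)\<^sup>2)" for b
        using mult_left_mono[OF sq[OF that, of m], of "b\<^sup>2"] by (simp add: mult_ac)
      from this[of \<alpha>] this[of "1 - \<alpha>"]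
      show "truncate n P1 (\<lambda>i. \<alpha> * x w m i) = (\<lambda>i. \<alpha> * x w m i)"
        "truncate n P2 (\<lambda>i. (1 - \<alpha>) * x w m i) = (\<lambda>i. (1 - \<alpha>) * x w m i)"
        unfolding \<alpha> using elim(2) by (auto intro!: truncate_id simp: sq_sum_scale)
    qed
    have "is_secrecy_code P1 P2 C1 C2 R' R n c"
      unfolding is_secrecy_code_def
      using P R index_set_mono[of R C1 n] index_set_mono[of R C2 n] dec
      by (auto simp: c_def power_constraint_truncate)
    moreover have "channel_input c w m i = x1 (w, m mod N, 0) i + x2 (w, m mod N, 0, sel w (m mod N)) i"
      if "w \<in> index_set n R" for w m i
    proof -
      have "channel_input c w m i = \<alpha> * x w m i + (1 - \<alpha>) * x w m i"
        by (simp add: channel_input_def c_def tr[OF that])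
      then show ?thesis by (simp add: x_def algebra_simps)
    qed
    ultimately have "code_within P1 P2 C1 C2 g R' R n \<epsilon>' c"
      using code[of c] unfolding code_within_def by (simp add: c_def)
    then show ?case using \<epsilon>'(2) code_within_mono by blast
  qed
qed (use P R in auto)


section \<open>Partial decode-and-forward with Marton coding\<close>

lemma rate_split_exists:
  fixes R C1 U T :: real
  assumes "0 \<le> C1" "0 < U" "0 < T" "R < C1 + U" "R < T + U"
  obtains Ra Rb where "0 \<le> Ra" "Ra \<le> C1" "Ra < T" "0 < Rb" "Rb < U" "R < Ra + Rb"
proof -
  obtain Ra where Ra: "0 \<le> Ra" "Ra \<le> C1" "Ra < T" "R - U < Ra"
  proof (cases "R < U")
    case True
    then show thesis using that[of 0] assms by simp
  next
    case False
    \<comment> \<open>The midpoint of the interval of candidates for Ra, from R - U up to min C1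
      T.\<close>
    then have "0 \<le> (R - U + min C1 T) / 2" "(R - U + min C1 T) / 2 \<le> C1" "(R - U + min C1 T) / 2 < T"
      "R - U < (R - U + min C1 T) / 2"
      using assms by (auto simp: min_def)
    then show thesis using that by blast
  qed
  define Rb where "Rb = (max 0 (R - Ra) + U) / 2"
  have "0 < Rb" "Rb < U" "R < Ra + Rb"
    using Ra assms(2) unfolding Rb_def max_def by (auto simp: field_simps)
  with Ra show thesis using that by blast
qed

text \<open>Link 1 carries \<open>a\<close> at rate Ra, link 2 carries \<open>b\<close> at rate Rb
  together with the Marton index at rate \<open>I0\<close>. The conditions on R are what remains
  when Ra and Rb are eliminated from the link and decoding constraints.\<close>

lemma achievable_partial:
  fixes s1 s2 r :: real
  defines "S \<equiv> gaussian_pair.S s1 s2 r" and "\<tau> \<equiv> gaussian_pair.\<tau> s1 s2 r"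
    and "\<tau>' \<equiv> gaussian_pair.\<tau>' s1 s2 r" and "I0 \<equiv> gaussian_pair.I0 s1 s2 r"
  assumes s: "0 < s1" "0 < s2" "r\<^sup>2 < s1 * s2" and P: "s1 < P1" "s2 < P2" and g: "0 \<le> g" "g < 1"
    and C: "0 \<le> C1" "0 \<le> C2" and R: "0 \<le> R" and Rl: "0 \<le> Rl" "Rl \<le> R'"
    and leak: "1/2 * ln (1 + g * S) \<le> Rl * ln 2" and rate: "(R + Rl) * ln 2 < 1/2 * ln (1 + S)"
    and I0: "I0 < C2 * ln 2"
    and R1: "R * ln 2 < C1 * ln 2 + 1/2 * ln (1 + \<tau>)" and R2: "R * ln 2 < C2 * ln 2 + 1/2 * ln (1 + \<tau>')"
    and R3: "R * ln 2 < (C1 + C2) * ln 2 - I0"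
  shows "achievable_secrecy_rate P1 P2 C1 C2 g R' R"
proof (rule achievable_of_eventually)
  interpret one: gaussian_pair 1 s1 s2 r 1
    using s by unfold_locales auto
  have pos: "0 < \<tau>" "0 < \<tau>'" "0 < S" "0 \<le> I0"
  proof -
    show "0 < \<tau>" "0 < \<tau>'" "0 < S" using one.\<tau> one.S by (simp_all add: \<tau>_def \<tau>'_def S_def)
    have "one.\<tau> \<le> s2" using s by (simp add: one.\<tau>_def)
    then show "0 \<le> I0" using one.\<tau>(1) by (simp add: I0_def one.I0_def)
  qed
  \<comment> \<open>I(X1,X2;Y) \<le> I(X2;Y|X1) + I(X1;Y|X2) + I(X1;X2), through an algebraic
    identity whose right side is a square over s1. Hence the decoding constraints on Ra and Rb do
    not restrict R beyond the sum-rate condition.\<close>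
  have sum_rate: "1/2 * ln (1 + S) \<le> 1/2 * ln (1 + \<tau>) + 1/2 * ln (1 + \<tau>') + I0"
  proof -
    have "(1 + \<tau>) * (1 + \<tau>') * s2 - \<tau> * (1 + S) = (r - \<tau> * s1)\<^sup>2 / s1"
      unfolding \<tau>_def \<tau>'_def S_def one.\<tau>_def one.\<tau>'_def one.S_def using s
      by (simp add: field_simps power2_eq_square)
    also have "\<dots> \<ge> 0" using s by simp
    finally have "1 + S \<le> (1 + \<tau>) * (1 + \<tau>') * (s2 / \<tau>)"
      using pos by (simp add: field_simps)
    then have "ln (1 + S) \<le> ln ((1 + \<tau>) * (1 + \<tau>') * (s2 / \<tau>))"
      using pos s by (subst ln_le_cancel_iff) auto
    also have "\<dots> = ln (1 + \<tau>) + ln (1 + \<tau>') + ln (s2 / \<tau>)"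
      using pos s by (simp add: ln_mult_pos ln_div)
    finally show ?thesis by (simp add: I0_def one.I0_def \<tau>_def)
  qed
  \<comment> \<open>\<open>U\<close> is the room for Rb: what the Marton index leaves on link 2, and
    the decoding bound. \<open>T\<close> below is the decoding bound for Ra.\<close>
  define U where "U = min (C2 - I0 / ln 2) (1/2 * ln (1 + \<tau>) / ln 2)"
  define T where "T = (1/2 * ln (1 + \<tau>') + I0) / ln 2"
  have ln2: "(0::real) < ln 2" by simp
  have bits: "x < y" if "x * ln 2 < y * ln 2" for x y :: real using that ln2 by simp
  have U_cases: "x < C + U" if "x * ln 2 < C * ln 2 + C2 * ln 2 - I0" "x * ln 2 < C * ln 2 + 1/2 * ln (1 + \<tau>)" for x C
  proof -
    have "x < C + (C2 - I0 / ln 2)" by (rule bits) (use that(1) in \<open>simp add: algebra_simps\<close>)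
    moreover have "x < C + 1/2 * ln (1 + \<tau>) / ln 2" by (rule bits) (use that(2) in \<open>simp add: algebra_simps\<close>)
    ultimately show ?thesis by (simp add: U_def min_def)
  qed
  have U: "0 < U" using U_cases[of 0 0] I0 pos by simp
  have T: "0 < T" using pos by (simp add: T_def add_pos_nonneg)
  have Tln: "T * ln 2 = 1/2 * ln (1 + \<tau>') + I0" using ln2 by (simp add: T_def)
  have "0 \<le> Rl * ln 2" using Rl by simp
  then have rate': "R * ln 2 < 1/2 * ln (1 + S)" using rate by (simp add: algebra_simps)
  have RU: "R < C1 + U" "R < T + U"
    using R1 R2 R3 rate' sum_rate by (auto intro!: U_cases simp: Tln algebra_simps)
  obtain Ra Rb where Rab: "0 \<le> Ra" "Ra \<le> C1" "Ra < T" "0 < Rb" "Rb < U" "R < Ra + Rb"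
    using rate_split_exists[OF C(1) U T RU] by blast
  have Rb: "Rb * ln 2 < C2 * ln 2 - I0" "Rb * ln 2 < 1/2 * ln (1 + \<tau>)"
  proof -
    have "Rb < C2 - I0 / ln 2" "Rb < 1/2 * ln (1 + \<tau>) / ln 2" using Rab(5) by (auto simp: U_def)
    then show "Rb * ln 2 < C2 * ln 2 - I0" "Rb * ln 2 < 1/2 * ln (1 + \<tau>)"
      using ln2 by (auto simp: field_simps)
  qed
  have Ra: "Ra * ln 2 < 1/2 * ln (1 + \<tau>') + I0"
    unfolding Tln[symmetric] using Rab(3) ln2 by simp
  define d where "d = Min {1/2 * ln (1 + S) - (R + Rl) * ln 2, 1/2 * ln (1 + \<tau>) - Rb * ln 2, 1/2 * ln (1 + \<tau>') + I0 - Ra * ln 2}"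
  have d: "d > 0" using rate Ra Rb by (simp add: d_def)
  have dle: "d \<le> 1/2 * ln (1 + S) - (R + Rl) * ln 2" "d \<le> 1/2 * ln (1 + \<tau>) - Rb * ln 2" "d \<le> 1/2 * ln (1 + \<tau>') + I0 - Ra * ln 2"
    unfolding d_def by (intro Min_le; simp)+
  have gap: "rate_gap s1 s2 r (R + Rl) Ra Rb d"
    unfolding rate_gap_def S_def[symmetric] \<tau>_def[symmetric] \<tau>'_def[symmetric] I0_def[symmetric]
    using dle by linarith
  fix \<epsilon> :: real assume "\<epsilon> > 0"
  \<comment> \<open>In turn: the target precision, the room in both power constraints, and the room
    on link 2 for up to exp (n * (I0 + \<epsilon>')) candidates.\<close>
  define \<epsilon>' where "\<epsilon>' = Min {\<epsilon>, P1 - s1, P2 - s2, C2 * ln 2 - I0 - Rb * ln 2}"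
  have \<epsilon>': "\<epsilon>' > 0" using \<open>\<epsilon> > 0\<close> P Rb by (simp add: \<epsilon>'_def)
  have \<epsilon>'_le: "\<epsilon>' \<le> \<epsilon>" "\<epsilon>' \<le> P1 - s1" "\<epsilon>' \<le> P2 - s2" "\<epsilon>' \<le> C2 * ln 2 - I0 - Rb * ln 2"
    unfolding \<epsilon>'_def by (intro Min_le; simp)+
  from asymptotic_codes[OF s g R Rl leak[unfolded S_def] gap d \<epsilon>']
  obtain \<eta> where \<eta>: "0 < \<eta>" "\<eta> \<le> \<epsilon>'" and
    ev: "\<forall>\<^sub>F n in sequentially. \<forall>(cl :: nat \<Rightarrow> nat) a b NA NB. inj_on (\<lambda>w. (cl w, a w, b w)) (index_set n R) \<longrightarrow>
      (\<forall>w\<in>index_set n R. a w < NA \<and> b w < NB) \<longrightarrow>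
      real NA \<le> exp (real n * (Ra * ln 2)) \<longrightarrow> real NB \<le> exp (real n * (Rb * ln 2)) \<longrightarrow>
      (\<exists>K x1 x2 sel dec. 0 < K \<and> real K \<le> exp (real n * (gaussian_pair.I0 s1 s2 r + \<epsilon>')) \<and>
        (\<forall>w\<in>index_set n R. \<forall>l<card (index_set n Rl). sel w l < K \<and>
          gaussian_pair.good n s1 s2 r \<eta> (x1 (cl w, l, a w)) (x2 (cl w, l, b w, sel w l))) \<and>
        dec \<in> seq_space n \<rightarrow>\<^sub>M count_space (index_set n R) \<and>
        (\<forall>c. decoder c = dec \<and> (\<forall>w\<in>index_set n R. \<forall>m\<in>index_set n R'. \<forall>i<n.
            channel_input c w m i = x1 (cl w, m mod card (index_set n Rl), a w) i
              + x2 (cl w, m mod card (index_set n Rl), b w, sel w (m mod card (index_set n Rl))) i) \<longrightarrow>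
          0 \<le> error_prob g R' R n c \<and> error_prob g R' R n c \<le> \<epsilon>' \<and>
          0 \<le> leakage g R' R n c \<and> leakage g R' R n c \<le> \<epsilon>' * real n))" by blast
  \<comment> \<open>The strict surplus of Ra + Rb over R pays for rounding the number of values of
    \<open>a\<close> and the quotients w div A.\<close>
  define y where "y = (Ra + Rb - R) * ln 2"
  have "y > 0" using Rab(6) ln2 by (simp add: y_def)
  then have ev2: "\<forall>\<^sub>F n in sequentially. 4 \<le> exp (real n * y)" by real_asymp
  have ev3: "\<forall>\<^sub>F n in sequentially. 2 \<le> exp (real n * (Rb * ln 2))"
  proof -
    have "0 < Rb * ln 2" using Rab(4) ln2 by simp
    moreover have "\<forall>\<^sub>F n in sequentially. 2 \<le> exp (real n * c)" if "0 < c" for c using that by real_asymp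
    ultimately show ?thesis by blast
  qed
  show "\<forall>\<^sub>F n in sequentially. \<exists>c. code_within P1 P2 C1 C2 g R' R n \<epsilon> c"
    using ev ev2 ev3 eventually_gt_at_top[of 0]
  proof eventually_elim
    case (elim n)
    interpret G: gaussian_pair n s1 s2 r \<eta>
      using s \<eta> elim(4) by unfold_locales auto
    define N where "N = card (index_set n Rl)"
    have N: "N > 0" unfolding N_def using Rl by (intro card_index_set_pos)
    define A where "A = card (index_set n Ra)"
    have A: "A > 0" "exp (real n * (Ra * ln 2)) \<le> 2 * real A" "real A \<le> exp (real n * (Ra * ln 2))"
      unfolding A_def using Rab card_index_set_pos card_index_set_ge card_index_set_le by auto
    define W where "W = card (index_set n R)"
    have W: "real W \<le> exp (real n * (R * ln 2))" unfolding W_def by (rule card_index_set_le)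
    have wW: "w \<le> W" if "w \<in> index_set n R" for w using that by (simp add: W_def index_set_def)
    \<comment> \<open>The quotients w div A range from 0 to W div A.\<close>
    define B where "B = W div A + 1"
    have B: "real B \<le> exp (real n * (Rb * ln 2))"
    proof -
      have "real (W div A) \<le> real W / real A" by (rule of_nat_div_le_of_nat)
      also have "\<dots> \<le> exp (real n * (R * ln 2)) / (exp (real n * (Ra * ln 2)) / 2)"
        using W A by (intro frac_le) auto
      also have "\<dots> = 2 * exp (real n * (R * ln 2) - real n * (Ra * ln 2))"
        by (simp add: exp_diff)
      also have "\<dots> = 2 * (exp (real n * (Rb * ln 2)) / exp (real n * y))"
        by (simp add: exp_diff[symmetric] y_def algebra_simps)
      also have "\<dots> \<le> 2 * (exp (real n * (Rb * ln 2)) / 4)"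
        using elim(2) by (intro mult_left_mono divide_left_mono) auto
      finally show ?thesis using elim(3) by (simp add: B_def)
    qed
    have inj: "inj_on (\<lambda>w. (0::nat, w mod A, w div A)) (index_set n R)"
    proof (rule inj_onI)
      fix w w' :: nat assume "(0::nat, w mod A, w div A) = (0, w' mod A, w' div A)"
      then have "w mod A = w' mod A" "w div A = w' div A" by auto
      then show "w = w'" by (metis div_mult_mod_eq)
    qed
    have ab: "\<forall>w\<in>index_set n R. w mod A < A \<and> w div A < B"
      using A(1) wW by (auto simp: B_def less_Suc_eq_le intro: div_le_mono)
    obtain K x1 x2 sel dec where K: "0 < K" "real K \<le> exp (real n * (I0 + \<epsilon>'))" and
      sel: "\<And>w l. w \<in> index_set n R \<Longrightarrow> l < N \<Longrightarrow> sel w l < K" and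
      good: "\<And>w l. w \<in> index_set n R \<Longrightarrow> l < N \<Longrightarrow> G.good (x1 (0::nat, l, w mod A)) (x2 (0::nat, l, w div A, sel w l :: nat))"
      and dec: "dec \<in> seq_space n \<rightarrow>\<^sub>M count_space (index_set n R)"
      and code: "\<And>c. decoder c = dec \<Longrightarrow> (\<And>w m i. w \<in> index_set n R \<Longrightarrow> m \<in> index_set n R' \<Longrightarrow> i < n \<Longrightarrow>
            channel_input c w m i = x1 (0, m mod N, w mod A) i + x2 (0, m mod N, w div A, sel w (m mod N)) i) \<Longrightarrow>
          0 \<le> error_prob g R' R n c \<and> error_prob g R' R n c \<le> \<epsilon>' \<and>
          0 \<le> leakage g R' R n c \<and> leakage g R' R n c \<le> \<epsilon>' * real n"
    proof -
      from elim(1)[THEN spec[of _ "\<lambda>_. 0"], THEN spec[of _ "\<lambda>w. w mod A"], THEN spec[of _ "\<lambda>w. w div A"], THEN spec[of _ A], THEN spec[of _ B],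
          THEN mp, OF inj, THEN mp, OF ab, THEN mp, OF A(3), THEN mp, OF B, folded N_def I0_def]
      show thesis
      proof (elim exE conjE, goal_cases)
        case (1 K x1 x2 sel dec)
        show thesis
        proof (rule that[where K = K and ?x1.0 = x1 and ?x2.0 = x2 and sel = sel and dec = dec, OF 1(1,2) _ _ 1(4)])
          show "sel w l < K" "G.good (x1 (0, l, w mod A)) (x2 (0, l, w div A, sel w l))" if "w \<in> index_set n R" "l < N" for w l
            using 1(3) that by blast+
          fix c assume "decoder c = dec" and "\<And>w m i. w \<in> index_set n R \<Longrightarrow> m \<in> index_set n R' \<Longrightarrow> i < n \<Longrightarrow>
            channel_input c w m i = x1 (0, m mod N, w mod A) i + x2 (0, m mod N, w div A, sel w (m mod N)) i"
          then show "0 \<le> error_prob g R' R n c \<and> error_prob g R' R n c \<le> \<epsilon>' \<and>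
            0 \<le> leakage g R' R n c \<and> leakage g R' R n c \<le> \<epsilon>' * real n"
            using 1(5)[THEN spec[of _ c], THEN mp] by blast
        qed
      qed
    qed
    have modN: "m mod N < N" for m using N by simp
    \<comment> \<open>Link 2 carries the pair (w div A, k) as one number in base K, read back with
      div and mod; the offset 1 matches index sets that start at 1. The relays obtain l from the
      fictitious message.\<close>
    define c where "c = \<lparr>source_enc = \<lambda>w m. (w mod A + 1, (w div A) * K + sel w (m mod N) + 1),
      relay_enc1 = \<lambda>j m. truncate n P1 (x1 (0, m mod N, j - 1)),
      relay_enc2 = \<lambda>j m. truncate n P2 (x2 (0, m mod N, (j - 1) div K, (j - 1) mod K)), decoder = dec\<rparr>"
    have tr: "truncate n P1 (x1 (0, m mod N, w mod A)) = x1 (0, m mod N, w mod A)"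
      "truncate n P2 (x2 (0, m mod N, w div A, sel w (m mod N))) = x2 (0, m mod N, w div A, sel w (m mod N))"
      if "w \<in> index_set n R" for w m
    proof -
      note gd = good[OF that modN[of m], unfolded G.good_def abs_le_iff]
      have le: "real n * s1 + real n * \<eta> \<le> real n * P1" "real n * s2 + real n * \<eta> \<le> real n * P2"
        unfolding distrib_left[symmetric] using \<eta>(2) \<epsilon>'_le by (auto intro!: mult_left_mono)
      show "truncate n P1 (x1 (0, m mod N, w mod A)) = x1 (0, m mod N, w mod A)"
        using elim(4) gd le by (intro truncate_id) linarith+
      show "truncate n P2 (x2 (0, m mod N, w div A, sel w (m mod N))) = x2 (0, m mod N, w div A, sel w (m mod N))"
        using elim(4) gd le by (intro truncate_id) linarith+
    qed
    have link1: "w mod A + 1 \<in> index_set n C1" for w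
    proof -
      have "w mod A + 1 \<le> A" using A(1) by (simp add: Suc_le_eq)
      then have "w mod A + 1 \<in> index_set n Ra" by (simp add: A_def index_set_def)
      then show ?thesis using index_set_mono[OF Rab(2)] by blast
    qed
    have link2: "(w div A) * K + sel w (m mod N) + 1 \<in> index_set n C2" if "w \<in> index_set n R" for w m
    proof -
      have "(w div A) * K + sel w (m mod N) + 1 \<le> (w div A) * K + K"
        using sel[OF that modN[of m]] by simp
      also have "\<dots> = (w div A + 1) * K" by simp
      also have "\<dots> \<le> B * K" using ab that by (intro mult_le_mono1) (simp add: Suc_le_eq)
      finally have "real ((w div A) * K + sel w (m mod N) + 1) \<le> real (B * K)" by (rule of_nat_mono)
      also have "\<dots> \<le> exp (real n * (Rb * ln 2)) * exp (real n * (I0 + \<epsilon>'))"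
        using B K by (simp add: mult_mono)
      also have "\<dots> = exp (real n * (Rb * ln 2 + (I0 + \<epsilon>')))" by (simp add: exp_add[symmetric] distrib_left)
      also have "\<dots> \<le> exp (real n * (C2 * ln 2))" using \<epsilon>'_le(4) by (simp add: mult_left_mono)
      finally have "real ((w div A) * K + sel w (m mod N) + 1) \<le> exp (real n * (C2 * ln 2))" .
      then have "(w div A) * K + sel w (m mod N) + 1 \<le> nat \<lfloor>exp (real n * (C2 * ln 2))\<rfloor>"
        by (intro le_nat_floor)
      then show ?thesis unfolding index_set_def two_powr_eq_exp by simp
    qed
    have "is_secrecy_code P1 P2 C1 C2 R' R n c"
      unfolding is_secrecy_code_def
    proof (intro conjI ballI)
      show "source_enc c w m \<in> index_set n C1 \<times> index_set n C2" if "w \<in> index_set n R" for w m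
        using link1 link2[OF that] by (simp add: c_def)
    qed (use s P dec in \<open>auto simp: c_def intro!: power_constraint_truncate\<close>)
    moreover have "channel_input c w m i = x1 (0, m mod N, w mod A) i + x2 (0, m mod N, w div A, sel w (m mod N)) i"
      if "w \<in> index_set n R" for w m i
      using sel[OF that modN[of m]] by (simp add: channel_input_def c_def tr[OF that])
    ultimately have "code_within P1 P2 C1 C2 g R' R n \<epsilon>' c"
      using code[of c] unfolding code_within_def by (simp add: c_def)
    then show ?case using \<epsilon>'_le(1) code_within_mono by blast
  qed
qed (use s P C R in auto)


section \<open>From Gaussian codes to the rate bounds\<close>

lemma eventually_less_half_ln_shrink:
  fixes S a :: real
  assumes "0 \<le> S" "a < 1/2 * ln (1 + S)"
  shows "\<forall>\<^sub>F \<theta> in at_right 0. a < 1/2 * ln (1 + (1 - \<theta>) * S)"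
proof -
  have "((\<lambda>\<theta>. 1/2 * ln (1 + (1 - \<theta>) * S)) \<longlongrightarrow> 1/2 * ln (1 + (1 - 0) * S)) (at_right 0)"
    by (intro tendsto_intros) (use assms(1) in simp)
  with assms(2) show ?thesis by (intro order_tendstoD(1)) auto
qed

text \<open>The power of X1 + X2 at full relay powers and correlation \<rho>; f4 and f5 depend on
  \<rho> only through it.\<close>

definition sum_power :: "real \<Rightarrow> real \<Rightarrow> real \<Rightarrow> real" where
  "sum_power P1 P2 \<rho> = P1 + P2 + 2 * \<rho> * sqrt (P1 * P2)"

text \<open>Affine in \<rho>, so the extremes are at \<rho> = -1 and \<rho> = 1, where the value is
  a square.\<close>

lemma sum_power_bounds:
  assumes "0 < P1" "0 < P2" "-1 \<le> \<rho>" "\<rho> \<le> 1"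
  shows "0 \<le> sum_power P1 P2 \<rho>" "sum_power P1 P2 \<rho> \<le> (sqrt P1 + sqrt P2)\<^sup>2"
proof -
  define q where "q = sqrt (P1 * P2)"
  have q: "0 \<le> q" "(sqrt P1 - sqrt P2)\<^sup>2 = P1 + P2 - 2 * q" "(sqrt P1 + sqrt P2)\<^sup>2 = P1 + P2 + 2 * q"
    using assms by (simp_all add: q_def power2_eq_square algebra_simps real_sqrt_mult)
  have "- q \<le> \<rho> * q" "\<rho> * q \<le> q"
    using mult_right_mono[OF assms(3) q(1)] mult_right_mono[OF assms(4) q(1)] by auto
  moreover have "0 \<le> P1 + P2 - 2 * q" using q(2) zero_le_power2[of "sqrt P1 - sqrt P2"] by simp
  ultimately show "0 \<le> sum_power P1 P2 \<rho>" "sum_power P1 P2 \<rho> \<le> (sqrt P1 + sqrt P2)\<^sup>2"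
    using q by (auto simp: sum_power_def q_def[symmetric])
qed

lemma f4_ln: "f4 P1 P2 \<rho> * ln 2 = 1/2 * ln (1 + sum_power P1 P2 \<rho>)"
  by (simp add: f4_def sum_power_def log_def add.assoc)

lemma f5_ln: "f5 P1 P2 g \<rho> * ln 2 = 1/2 * ln (1 + g * sum_power P1 P2 \<rho>)"
  by (simp add: f5_def sum_power_def log_def)

lemma f5_commute: "f5 P1 P2 g \<rho> = f5 P2 P1 g \<rho>"
  by (simp add: f5_def ac_simps)

lemma f4_commute: "f4 P1 P2 \<rho> = f4 P2 P1 \<rho>"
  by (simp add: f4_def ac_simps)

lemma f5_nonneg:
  assumes "0 < P1" "0 < P2" "-1 \<le> \<rho>" "\<rho> \<le> 1" "0 \<le> g"
  shows "0 \<le> f5 P1 P2 g \<rho>"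
proof -
  have "0 \<le> g * sum_power P1 P2 \<rho>" using sum_power_bounds(1)[OF assms(1-4)] assms(5) by simp
  then show ?thesis unfolding f5_def sum_power_def[symmetric] by (simp add: zero_le_log_cancel_iff)
qed

lemma leak_shrink:
  assumes "0 \<le> S" "0 \<le> g" "0 < \<theta>" "\<theta> < (1::real)"
  shows "1/2 * ln (1 + g * ((1 - \<theta>) * S)) \<le> 1/2 * ln (1 + g * S)"
proof -
  have "(1 - \<theta>) * S \<le> S" using assms by (simp add: mult_left_le_one_le)
  then have "g * ((1 - \<theta>) * S) \<le> g * S" "0 \<le> g * ((1 - \<theta>) * S)"
    using assms by (auto intro: mult_left_mono)
  then show ?thesis by simp
qed

text \<open>Coherent transmission reaches every total power below (sqrt P1 + sqrt P2)^2. Shrinking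
  the power by 1 - \<theta> makes this strict even at \<rho> = 1; the rate inequality survives by
  continuity, and less power only lowers the rate needed for l.\<close>

lemma achievable_DF:
  assumes P: "0 < P1" "0 < P2" and g: "0 \<le> g" "g < 1" and \<rho>: "-1 \<le> \<rho>" "\<rho> \<le> 1"
    and R': "f5 P1 P2 g \<rho> \<le> R'" and R: "0 < R" "R \<le> C1" "R \<le> C2"
    and rate: "R < f4 P1 P2 \<rho> - f5 P1 P2 g \<rho>"
  shows "achievable_secrecy_rate P1 P2 C1 C2 g R' R"
proof -
  let ?S = "sum_power P1 P2 \<rho>"
  note S = sum_power_bounds[OF P \<rho>]
  have f5: "0 \<le> f5 P1 P2 g \<rho>" using f5_nonneg P \<rho> g by blast
  have "(R + f5 P1 P2 g \<rho>) * ln 2 < f4 P1 P2 \<rho> * ln 2"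
    using rate by (intro mult_strict_right_mono) auto
  then have *: "(R + f5 P1 P2 g \<rho>) * ln 2 < 1/2 * ln (1 + ?S)" by (simp add: f4_ln)
  moreover have "0 < (R + f5 P1 P2 g \<rho>) * ln 2" using R f5 by simp
  \<comment> \<open>Zero total power would make f4 vanish, against R > 0.\<close>
  ultimately have Spos: "0 < ?S" using S(1) by (cases "?S = 0") auto
  have "\<forall>\<^sub>F \<theta> in at_right 0. (R + f5 P1 P2 g \<rho>) * ln 2 < 1/2 * ln (1 + (1 - \<theta>) * ?S) \<and> \<theta> \<in> {0<..<1::real}"
    using eventually_less_half_ln_shrink[OF S(1) *] eventually_at_right_real[of 0 1]
    by (simp add: eventually_conj)
  then obtain \<theta> where \<theta>: "(R + f5 P1 P2 g \<rho>) * ln 2 < 1/2 * ln (1 + (1 - \<theta>) * ?S)" "0 < \<theta>" "\<theta> < 1"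
    using eventually_happens'[OF trivial_limit_at_right_real] by (metis (no_types, lifting) greaterThanLessThan_iff)
  show ?thesis
  proof (rule achievable_coherent[OF P g _ _ _ R(2,3) f5 R' _ \<theta>(1)])
    show "0 < (1 - \<theta>) * ?S" using \<theta> Spos by simp
    have "(1 - \<theta>) * ?S < ?S" using \<theta> Spos by simp
    then show "(1 - \<theta>) * ?S < (sqrt P1 + sqrt P2)\<^sup>2" using S(2) by simp
    show "1/2 * ln (1 + g * ((1 - \<theta>) * ?S)) \<le> f5 P1 P2 g \<rho> * ln 2"
      unfolding f5_ln by (rule leak_shrink) (use S g \<theta> in auto)
  qed (use R in simp)
qed

text \<open>Powers and covariance are scaled by the same factor 1 - \<theta>, which preserves the
  correlation \<rho>, and hence \<open>I0\<close>, while leaving room below P1 and P2.\<close>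

lemma achievable_PDF_large_C2:
  assumes P: "0 < P1" "0 < P2" and C: "0 \<le> C1" "0 \<le> C2" and g: "0 \<le> g" "g < 1" and \<rho>: "\<bar>\<rho>\<bar> < 1"
    and R': "f5 P1 P2 g \<rho> \<le> R'" and R: "0 < R"
    and rate: "R < f4 P1 P2 \<rho> - f5 P1 P2 g \<rho>" and R1: "R < f1 P2 C1 \<rho>" and R2: "R < f2 P1 C2 \<rho>"
    and R3: "R < C1 + C2 - 1/2 * log 2 (1 / (1 - \<rho>\<^sup>2))"
    and C2: "1/2 * log 2 (1 / (1 - \<rho>\<^sup>2)) < C2"
  shows "achievable_secrecy_rate P1 P2 C1 C2 g R' R"
proof -
  let ?S = "sum_power P1 P2 \<rho>"
  have \<rho>1: "-1 \<le> \<rho>" "\<rho> \<le> 1" using \<rho> by auto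
  note S = sum_power_bounds[OF P \<rho>1]
  have \<rho>2: "0 < 1 - \<rho>\<^sup>2" using \<rho> by (simp add: abs_square_less_1)
  have f5: "0 \<le> f5 P1 P2 g \<rho>" using f5_nonneg P \<rho>1 g by blast
  have scale: "x < y \<Longrightarrow> x * ln 2 < y * ln 2" for x y :: real by simp
  have 1: "(R + f5 P1 P2 g \<rho>) * ln 2 < 1/2 * ln (1 + ?S)"
    using scale[of "R + f5 P1 P2 g \<rho>" "f4 P1 P2 \<rho>"] rate by (simp add: f4_ln)
  have 2: "R * ln 2 - C1 * ln 2 < 1/2 * ln (1 + (1 - \<rho>\<^sup>2) * P2)"
    using scale[OF R1] by (simp add: f1_def log_def algebra_simps)
  have 3: "R * ln 2 - C2 * ln 2 < 1/2 * ln (1 + (1 - \<rho>\<^sup>2) * P1)"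
    using scale[OF R2] by (simp add: f2_def log_def algebra_simps)
  have "\<forall>\<^sub>F \<theta> in at_right 0. ((R + f5 P1 P2 g \<rho>) * ln 2 < 1/2 * ln (1 + (1 - \<theta>) * ?S) \<and>
      R * ln 2 - C1 * ln 2 < 1/2 * ln (1 + (1 - \<theta>) * ((1 - \<rho>\<^sup>2) * P2))) \<and>
      R * ln 2 - C2 * ln 2 < 1/2 * ln (1 + (1 - \<theta>) * ((1 - \<rho>\<^sup>2) * P1)) \<and> \<theta> \<in> {0<..<1::real}"
    by (intro eventually_conj eventually_less_half_ln_shrink eventually_at_right_real 1 2 3 S(1))
      (use P \<rho>2 in auto)
  then obtain \<theta> where \<theta>: "(R + f5 P1 P2 g \<rho>) * ln 2 < 1/2 * ln (1 + (1 - \<theta>) * ?S)"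
      "R * ln 2 - C1 * ln 2 < 1/2 * ln (1 + (1 - \<theta>) * ((1 - \<rho>\<^sup>2) * P2))"
      "R * ln 2 - C2 * ln 2 < 1/2 * ln (1 + (1 - \<theta>) * ((1 - \<rho>\<^sup>2) * P1))" "0 < \<theta>" "\<theta> < 1"
    using eventually_happens'[OF trivial_limit_at_right_real] by (metis (no_types, lifting) greaterThanLessThan_iff)
  define s1 where "s1 = (1 - \<theta>) * P1"
  define s2 where "s2 = (1 - \<theta>) * P2"
  define r where "r = (1 - \<theta>) * (\<rho> * sqrt (P1 * P2))"
  have s: "0 < s1" "0 < s2" "s1 < P1" "s2 < P2" using P \<theta> by (auto simp: s1_def s2_def)
  have r2: "r\<^sup>2 = \<rho>\<^sup>2 * (s1 * s2)"
    using P by (simp add: r_def s1_def s2_def power_mult_distrib) (simp add: power2_eq_square)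
  also have "\<dots> < 1 * (s1 * s2)" using s \<rho>2 by (intro mult_strict_right_mono) auto
  finally have r_less: "r\<^sup>2 < s1 * s2" by simp
  interpret one: gaussian_pair 1 s1 s2 r 1 using s r_less by unfold_locales auto
  have S_eq: "one.S = (1 - \<theta>) * ?S"
    unfolding one.S_def by (simp add: s1_def s2_def r_def sum_power_def algebra_simps)
  have \<tau>_eq: "one.\<tau> = (1 - \<theta>) * ((1 - \<rho>\<^sup>2) * P2)" and \<tau>'_eq: "one.\<tau>' = (1 - \<theta>) * ((1 - \<rho>\<^sup>2) * P1)"
  proof -
    have "one.\<tau> = (1 - \<rho>\<^sup>2) * s2" "one.\<tau>' = (1 - \<rho>\<^sup>2) * s1"
      unfolding one.\<tau>_def one.\<tau>'_def r2 using s(1,2) by (simp_all add: left_diff_distrib)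
    then show "one.\<tau> = (1 - \<theta>) * ((1 - \<rho>\<^sup>2) * P2)" "one.\<tau>' = (1 - \<theta>) * ((1 - \<rho>\<^sup>2) * P1)"
      by (simp_all add: s1_def s2_def)
  qed
  have I0_eq: "one.I0 = 1/2 * log 2 (1 / (1 - \<rho>\<^sup>2)) * ln 2"
  proof -
    have "s2 / one.\<tau> = 1 / (1 - \<rho>\<^sup>2)" by (subst \<tau>_eq) (use P \<theta> \<rho>2 in \<open>simp add: s2_def\<close>)
    then show ?thesis by (simp add: one.I0_def log_def)
  qed
  show ?thesis
  proof (rule achievable_partial[OF s(1,2) r_less s(3,4) g C _ f5 R'])
    show "0 \<le> R" using R by simp
    show "1/2 * ln (1 + g * one.S) \<le> f5 P1 P2 g \<rho> * ln 2"
      unfolding f5_ln S_eq by (rule leak_shrink) (use S g \<theta> in auto)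
    show "(R + f5 P1 P2 g \<rho>) * ln 2 < 1/2 * ln (1 + one.S)" using \<theta>(1) by (simp add: S_eq)
    show "one.I0 < C2 * ln 2" unfolding I0_eq by (rule scale[OF C2])
    show "R * ln 2 < C1 * ln 2 + 1/2 * ln (1 + one.\<tau>)" using \<theta>(2) by (simp add: \<tau>_eq)
    show "R * ln 2 < C2 * ln 2 + 1/2 * ln (1 + one.\<tau>')" using \<theta>(3) by (simp add: \<tau>'_eq)
    show "R * ln 2 < (C1 + C2) * ln 2 - one.I0" unfolding I0_eq
      using scale[OF R3] by (simp only: left_diff_distrib)
  qed
qed

text \<open>Only the position of the Marton index breaks the symmetry between the relays, so it is
  enough that one of the links has room for it; exchanging the relays swaps f1 and f2.\<close>

lemma achievable_PDF:
  assumes P: "0 < P1" "0 < P2" and C: "0 \<le> C1" "0 \<le> C2" and g: "0 \<le> g" "g < 1" and \<rho>: "\<bar>\<rho>\<bar> < 1"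
    and R': "f5 P1 P2 g \<rho> \<le> R'" and R: "0 < R"
    and rate: "R < f4 P1 P2 \<rho> - f5 P1 P2 g \<rho>" and R1: "R < f1 P2 C1 \<rho>" and R2: "R < f2 P1 C2 \<rho>"
    and R3: "R < C1 + C2 - 1/2 * log 2 (1 / (1 - \<rho>\<^sup>2))"
  shows "achievable_secrecy_rate P1 P2 C1 C2 g R' R"
proof -
  let ?I = "1/2 * log 2 (1 / (1 - \<rho>\<^sup>2))"
  consider "?I < C2" | "?I < C1" | "C1 \<le> ?I" "C2 \<le> ?I" by linarith
  then show ?thesis
  proof cases
    case 1
    with assms show ?thesis by (intro achievable_PDF_large_C2)
  next
    case 2
    have "achievable_secrecy_rate P2 P1 C2 C1 g R' R"
      using assms 2 by (intro achievable_PDF_large_C2)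
        (auto simp: f1_def f2_def f4_commute[of P2] f5_commute[of P2])
    then show ?thesis by (rule achievable_swap)
  next
    case 3
    \<comment> \<open>No link has room for the Marton index, but then \<open>f3 \<rho> \<le> C1\<close> and \<open>f3 \<rho> \<le> C2\<close>.\<close>
    with assms show ?thesis by (intro achievable_DF[of P1 P2 g \<rho>]) auto
  qed
qed

theorem theorem2:
  fixes P1 P2 C1 C2 g \<rho> R' :: real
  assumes "P1 > 0" and "P2 > 0"
    and "C1 \<ge> 0" and "C2 \<ge> 0"
    and "0 \<le> g" and "g < 1"
    and "-1 \<le> \<rho>" and "\<rho> \<le> 1"
    and "R' \<ge> f5 P1 P2 g \<rho>"
  shows "secrecy_capacity P1 P2 C1 C2 g R'
           \<ge> max (ereal (R_DF P1 P2 C1 C2 g \<rho>)) (R_PDF_M P1 P2 C1 C2 g \<rho>)"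
proof (rule dense_le)
  \<comment> \<open>Approaching the bound from strictly below provides all the margins that the
    constructions consume.\<close>
  fix x assume x: "x < max (ereal (R_DF P1 P2 C1 C2 g \<rho>)) (R_PDF_M P1 P2 C1 C2 g \<rho>)"
  have cap: "ereal R \<le> secrecy_capacity P1 P2 C1 C2 g R'"
    if "achievable_secrecy_rate P1 P2 C1 C2 g R' R" for R
    unfolding secrecy_capacity_def using that by (intro Sup_upper) auto
  have "0 \<le> f5 P1 P2 g \<rho>" using f5_nonneg assms by blast
  then have "achievable_secrecy_rate P1 P2 C1 C2 g R' 0"
    using assms by (intro achievable_zero) auto
  note cap0 = cap[OF this]
  show "x \<le> secrecy_capacity P1 P2 C1 C2 g R'"
  proof (cases "x \<le> 0")
    case True
    with cap0 show ?thesis by (auto simp: zero_ereal_def intro: order_trans)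
  next
    case False
    moreover from ereal_dense2[OF x] obtain R
      where R: "x < ereal R" "ereal R < max (ereal (R_DF P1 P2 C1 C2 g \<rho>)) (R_PDF_M P1 P2 C1 C2 g \<rho>)"
      by blast
    ultimately have "0 < ereal R" by (meson not_le order.strict_trans)
    then have R0: "0 < R" by simp
    have "achievable_secrecy_rate P1 P2 C1 C2 g R' R"
    proof (cases "R < R_DF P1 P2 C1 C2 g \<rho>")
      case True
      then show ?thesis using assms R0 by (intro achievable_DF[of P1 P2 g \<rho>]) (auto simp: R_DF_def)
    next
      case False
      then have *: "ereal R < R_PDF_M P1 P2 C1 C2 g \<rho>" using R(2) by (simp add: less_max_iff_disj)
      \<comment> \<open>At |\<rho>| = 1 the value of \<open>f3\<close> is -\<infinity>, so no real
        rate lies below the minimum.\<close>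
      then have "\<bar>\<rho>\<bar> \<noteq> 1" by (auto simp: R_PDF_M_def f3_def)
      then have "\<bar>\<rho>\<bar> < 1" using assms by auto
      then show ?thesis using * assms R0 by (intro achievable_PDF[of P1 P2 C1 C2 g \<rho>]) (auto simp: R_PDF_M_def f3_def)
    qed
    from cap[OF this] R(1) show ?thesis by auto
  qed
qed

end
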